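(* Let $(X,S)$ be a templicial object in $\mathcal{V}$ with non-degenerate simplices. For all $n\ge0$ and $a,b\in S$, there is an isomorphism in $\mathcal{V}$: $$\mathfrak{C}_{\mathcal{V}}[X]_n(a,b)\simeq\coprod_{\substack{T\in\mathcal{N}ec\\ \vec T\text{ flanked flag of length }n\text{ on }T}}X^{nd}_T(a,b).$$
   Context: Base category. Fix a complete and cocomplete, symmetric monoidal closed category $(\mathcal{V},\otimes,I)$. $F:\mathrm{Set}\to\mathcal{V}$ is the colimit-preserving functor with $F(\{*\})=I$ (unique up to natural isomorphism), applied levelwise also as $F:\mathrm{SSet}\to S\mathcal{V}$. Quivers. For a set $S$, $\mathcal{V}\mathrm{Quiv}_S$ is the category of families $Q=(Q(a,b))_{a,b\in S}$ of objects of $\mathcal{V}$. It is monoidal with $(Q\otimes_S P)(a,b)=\coprod_{c\in S}Q(a,c)\otimes P(c,b)$ and unit $I_S$, where $I_S(a,b)=I$ if $a=b$ and $I_S(a,b)=0$ (initial object) otherwise. Intervals. $\mathbf{\Delta}_f$ is the category with objects $[n]=\{0,\dots,n\}$, $n\ge 0$, and order-preserving maps $f:[m]\to[n]$ with $f(0)=0$, $f(m)=n$ as morphisms. It is monoidal with $[m]+[n]=[m+n]$, where for $f:[m]\to[m']$, $g:[n]\to[n']$ one has $(f+g)(i)=f(i)$ for $i\le m$ and $(f+g)(i)=m'+g(i-m)$ for $i\ge m$. $\mathbf{\Delta}_{surj}\subseteq\mathbf{\Delta}_f$ is the subcategory of surjective maps. Templicial objects. A templicial object in $\mathcal{V}$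 is a pair $(X,S)$ with $S$ a set and $X:\mathbf{\Delta}_f^{op}\to\mathcal{V}\mathrm{Quiv}_S$ a colax monoidal functor which is strongly unital (the counit $\epsilon:X_0\to I_S$ is an isomorphism). Here $X_n=X([n])$, with comultiplications $\mu_{k,l}:X_{k+l}\to X_k\otimes_S X_l$. Non-degenerate simplices. For $n\ge0$ let $X^{deg}_n=\mathrm{colim}_{\sigma:[n]\twoheadrightarrow[k],\,0\le k<n}X_k$, the colimit of $\sigma\mapsto X_k$ on the opposite of the category of surjections $\sigma:[n]\twoheadrightarrow[k]$ in $\mathbf{\Delta}_{surj}$ with $k<n$ (morphisms $\sigma\to\sigma'$ being surjections $\tau$ with $\tau\sigma=\sigma'$), with its canonical morphism to $X_n$. $(X,S)$ has non-degenerate simplices if for every $n$ the morphism $X^{deg}_n\to X_n$ is isomorphic to a coprojection $X^{deg}_n\to X^{deg}_n\amalg N$ with $N\in\mathcal{V}\mathrm{Quiv}_S$; one fixes a choice and writes $N=X^{nd}_n$. Necklaces. $\mathcal{N}ec$ is the category with objects pairs $(T,p)$ with $p\ge 0$ and $\{0,p\}\subseteq T\subseteq[p]$, and morphisms $(T,p)\to(U,q)$ the morphisms $f:[p]\to[q]$ of $\mathbf{\Delta}_f$ with $U\subseteq f(T)$; $(T,p)\vee(U,q)=(T\cup(p+U),p+q)$. A map is inert if $p=q$ and $f=\mathrm{id}_{[p]}$, active if $f(T)=U$; each map factors uniquely as active followed by inert. For $T=\{0=t_0<\dots<t_k=p\}$ put $X_T=X_{t_1}\otimes_S\dots\otimes_S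 X_{p-t_{k-1}}$ and $X^{nd}_T=X^{nd}_{t_1}\otimes_S X^{nd}_{t_2-t_1}\otimes_S\dots\otimes_S X^{nd}_{p-t_{k-1}}$ (both equal to $I_S$ for $T=\{0\}$), and let $\mu_T:X_p\to X_T$ be the iterated comultiplication. $T\mapsto X_T$ extends to $X_\bullet:\mathcal{N}ec^{op}\to\mathcal{V}\mathrm{Quiv}_S$: for inert $(T,p)\to(U,p)$ with $U=\{0=u_0<\dots<u_l=p\}$ write $T=T_1\vee\dots\vee T_l$ with $T_i$ on $[u_i-u_{i-1}]$ and use $\mu_{T_1}\otimes\dots\otimes\mu_{T_l}$; for active $f$ write $f=f_1+\dots+f_k$ with $f_i:[t_i-t_{i-1}]\to[f(t_i)-f(t_{i-1})]$ and use $X(f_1)\otimes\dots\otimes X(f_k)$ (together with $X_0\simeq I_S$). Categorification. For a necklace $(T,p)$ let $\mathcal{P}_T=\{V\subseteq[p]\mid T\subseteq V\}$, ordered by inclusion, functorial via $V\mapsto f(V)$, and let $N$ be the classical nerve. $\mathfrak{C}_{\mathcal{V}}[X]$ is the $S\mathcal{V}$-enriched category ($S\mathcal{V}$ being simplicial objects in $\mathcal{V}$) with object set $S$ and hom-objects the weighted colimits (coends) $\mathfrak{C}_{\mathcal{V}}[X](a,b)=\int^{T\in\mathcal{N}ec}X_T(a,b)\otimes FN(\mathcal{P}_T)\in S\mathcal{V}$; $\mathfrak{C}_{\mathcal{V}}[X]_n(a,b)\in\mathcal{V}$ is its object of $n$-simplices. Flags. A flag of length $n$ on a necklace $(T,p)$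 is a sequence $\vec T=(T_0\subseteq\dots\subseteq T_n)$ with $T\subseteq T_0$ and $T_n\subseteq[p]$. It is flanked if $T=T_0$ and $T_n=[p]$. *)

theory Defs
  imports "HOL-Library.FuncSet"
begin

section \<open>Categories, functors, (co)limits\<close>

record ('o, 'm) cat =
  Obj :: "'o set"
  Arr :: "'m set"
  Dom :: "'m \<Rightarrow> 'o"
  Cod :: "'m \<Rightarrow> 'o"
  Idn :: "'o \<Rightarrow> 'm"
  Comp :: "'m \<Rightarrow> 'm \<Rightarrow> 'm"  (infixr "\<cdot>\<index>" 75)

definition hom :: "('o, 'm, 'z) cat_scheme \<Rightarrow> 'o \<Rightarrow> 'o \<Rightarrow> 'm set" where
  "hom C x y = {f \<in> Arr C. Dom C f = x \<and> Cod C f = y}"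

locale category =
  fixes C :: "('o, 'm, 'z) cat_scheme" (structure)
  assumes Dom_Obj: "f \<in> Arr C \<Longrightarrow> Dom C f \<in> Obj C"
    and Cod_Obj: "f \<in> Arr C \<Longrightarrow> Cod C f \<in> Obj C"
    and Idn_hom: "x \<in> Obj C \<Longrightarrow> Idn C x \<in> hom C x x"
    and Comp_hom: "f \<in> hom C x y \<Longrightarrow> g \<in> hom C y z \<Longrightarrow> g \<cdot> f \<in> hom C x z"
    and Comp_Idn: "f \<in> hom C x y \<Longrightarrow> f \<cdot> Idn C x = f"
    and Idn_Comp: "f \<in> hom C x y \<Longrightarrow> Idn C y \<cdot> f = f"
    and Comp_assoc: "f \<in> hom C w x \<Longrightarrow> g \<in> hom C x y \<Longrightarrow> h \<in> hom C y z \<Longrightarrow>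
      (h \<cdot> g) \<cdot> f = h \<cdot> (g \<cdot> f)"

definition inverse_arrows :: "('o, 'm, 'z) cat_scheme \<Rightarrow> 'm \<Rightarrow> 'm \<Rightarrow> bool" where
  "inverse_arrows C f g \<longleftrightarrow>
     f \<in> Arr C \<and> g \<in> hom C (Cod C f) (Dom C f) \<and>
     g \<cdot>\<^bsub>C\<^esub> f = Idn C (Dom C f) \<and> f \<cdot>\<^bsub>C\<^esub> g = Idn C (Cod C f)"

definition iso :: "('o, 'm, 'z) cat_scheme \<Rightarrow> 'm \<Rightarrow> bool" where
  "iso C f \<longleftrightarrow> (\<exists>g. inverse_arrows C f g)"

definition inv_arr :: "('o, 'm, 'z) cat_scheme \<Rightarrow> 'm \<Rightarrow> 'm" where
  "inv_arr C f = (THE g. inverse_arrows C f g)"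

definition isomorphic :: "('o, 'm, 'z) cat_scheme \<Rightarrow> 'o \<Rightarrow> 'o \<Rightarrow> bool" where
  "isomorphic C x y \<longleftrightarrow> x \<in> Obj C \<and> y \<in> Obj C \<and> (\<exists>f \<in> hom C x y. iso C f)"

definition op_cat :: "('o, 'm, 'z) cat_scheme \<Rightarrow> ('o, 'm) cat" where
  "op_cat C = \<lparr>Obj = Obj C, Arr = Arr C, Dom = Cod C, Cod = Dom C, Idn = Idn C,
     Comp = (\<lambda>g f. f \<cdot>\<^bsub>C\<^esub> g)\<rparr>"

definition prod_cat :: "('o, 'm, 'z) cat_scheme \<Rightarrow> ('p, 'n, 'y) cat_scheme \<Rightarrow>
    ('o \<times> 'p, 'm \<times> 'n) cat" where
  "prod_cat C D = \<lparr>Obj = Obj C \<times> Obj D, Arr = Arr C \<times> Arr D,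
     Dom = map_prod (Dom C) (Dom D), Cod = map_prod (Cod C) (Cod D),
     Idn = map_prod (Idn C) (Idn D),
     Comp = (\<lambda>(g, g') (f, f'). (g \<cdot>\<^bsub>C\<^esub> f, g' \<cdot>\<^bsub>D\<^esub> f'))\<rparr>"

record ('o, 'm, 'p, 'n) functr =
  fob :: "'o \<Rightarrow> 'p"
  far :: "'m \<Rightarrow> 'n"

definition is_functor :: "('o, 'm, 'z) cat_scheme \<Rightarrow> ('p, 'n, 'y) cat_scheme \<Rightarrow>
    ('o, 'm, 'p, 'n, 'x) functr_scheme \<Rightarrow> bool" where
  "is_functor C D F \<longleftrightarrow> category C \<and> category D \<and>
     (\<forall>x \<in> Obj C. fob F x \<in> Obj D) \<and>
     (\<forall>f \<in> Arr C. far F f \<in> hom D (fob F (Dom C f)) (fob F (Cod C f))) \<and>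
     (\<forall>x \<in> Obj C. far F (Idn C x) = Idn D (fob F x)) \<and>
     (\<forall>f \<in> Arr C. \<forall>g \<in> Arr C. Cod C f = Dom C g \<longrightarrow>
        far F (g \<cdot>\<^bsub>C\<^esub> f) = far F g \<cdot>\<^bsub>D\<^esub> far F f)"

definition comp_functr :: "('p, 'n, 'q, 'l) functr \<Rightarrow> ('o, 'm, 'p, 'n) functr \<Rightarrow>
    ('o, 'm, 'q, 'l) functr" where
  "comp_functr G F = \<lparr>fob = fob G \<circ> fob F, far = far G \<circ> far F\<rparr>"

text \<open>An arrow of the functor category is a triple (source, target, components).\<close>

definition fun_cat :: "('o, 'm, 'z) cat_scheme \<Rightarrow> ('p, 'n, 'y) cat_scheme \<Rightarrow>
    (('o, 'm, 'p, 'n) functr,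
     ('o, 'm, 'p, 'n) functr \<times> ('o, 'm, 'p, 'n) functr \<times> ('o \<Rightarrow> 'n)) cat" where
  "fun_cat C D = \<lparr>Obj = {F. is_functor C D F},
     Arr = {(F, G, \<eta>). is_functor C D F \<and> is_functor C D G \<and>
       \<eta> \<in> (\<Pi>\<^sub>E x \<in> Obj C. hom D (fob F x) (fob G x)) \<and>
       (\<forall>f \<in> Arr C. far G f \<cdot>\<^bsub>D\<^esub> \<eta> (Dom C f) = \<eta> (Cod C f) \<cdot>\<^bsub>D\<^esub> far F f)},
     Dom = (\<lambda>(F, G, \<eta>). F), Cod = (\<lambda>(F, G, \<eta>). G),
     Idn = (\<lambda>F. (F, F, \<lambda>x \<in> Obj C. Idn D (fob F x))),
     Comp = (\<lambda>(G, H, \<theta>) (F, G', \<eta>). (F, H, \<lambda>x \<in> Obj C. \<theta> x \<cdot>\<^bsub>D\<^esub> \<eta> x))\<rparr>"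

definition is_cocone :: "('j, 'k, 'y) cat_scheme \<Rightarrow> ('o, 'm, 'z) cat_scheme \<Rightarrow>
    ('j, 'k, 'o, 'm) functr \<Rightarrow> 'o \<Rightarrow> ('j \<Rightarrow> 'm) \<Rightarrow> bool" where
  "is_cocone J C D c \<iota> \<longleftrightarrow> c \<in> Obj C \<and>
     (\<forall>j \<in> Obj J. \<iota> j \<in> hom C (fob D j) c) \<and>
     (\<forall>f \<in> Arr J. \<iota> (Cod J f) \<cdot>\<^bsub>C\<^esub> far D f = \<iota> (Dom J f))"

definition is_colimit :: "('j, 'k, 'y) cat_scheme \<Rightarrow> ('o, 'm, 'z) cat_scheme \<Rightarrow>
    ('j, 'k, 'o, 'm) functr \<Rightarrow> 'o \<Rightarrow> ('j \<Rightarrow> 'm) \<Rightarrow> bool" where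
  "is_colimit J C D c \<iota> \<longleftrightarrow> is_cocone J C D c \<iota> \<and>
     (\<forall>x \<phi>. is_cocone J C D x \<phi> \<longrightarrow> (\<exists>!h. h \<in> hom C c x \<and> (\<forall>j \<in> Obj J. h \<cdot>\<^bsub>C\<^esub> \<iota> j = \<phi> j)))"

definition is_limit :: "('j, 'k, 'y) cat_scheme \<Rightarrow> ('o, 'm, 'z) cat_scheme \<Rightarrow>
    ('j, 'k, 'o, 'm) functr \<Rightarrow> 'o \<Rightarrow> ('j \<Rightarrow> 'm) \<Rightarrow> bool" where
  "is_limit J C D c \<pi> \<longleftrightarrow> is_colimit (op_cat J) (op_cat C) D c \<pi>"

text \<open>The type \<open>'u\<close> (assumed infinite where it is used) plays the role of the universe:
  a set is small if it is a subset of \<open>'u\<close>, and a category is small if its objects and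
  arrows form subsets of \<open>'u\<close>.\<close>

definition cocomplete :: "'u itself \<Rightarrow> ('o, 'm, 'z) cat_scheme \<Rightarrow> bool" where
  "cocomplete _ C \<longleftrightarrow> (\<forall>(J :: ('u, 'u) cat) D. is_functor J C D \<longrightarrow> (\<exists>c \<iota>. is_colimit J C D c \<iota>))"

definition complete_cat :: "'u itself \<Rightarrow> ('o, 'm, 'z) cat_scheme \<Rightarrow> bool" where
  "complete_cat _ C \<longleftrightarrow> (\<forall>(J :: ('u, 'u) cat) D. is_functor J C D \<longrightarrow> (\<exists>c \<pi>. is_limit J C D c \<pi>))"

definition preserves_colimits :: "'u itself \<Rightarrow> ('o, 'm, 'z) cat_scheme \<Rightarrow>
    ('p, 'n, 'y) cat_scheme \<Rightarrow> ('o, 'm, 'p, 'n) functr \<Rightarrow> bool" where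
  "preserves_colimits _ C D F \<longleftrightarrow> (\<forall>(J :: ('u, 'u) cat) K c \<iota>.
     is_functor J C K \<longrightarrow> is_colimit J C K c \<iota> \<longrightarrow>
     is_colimit J D (comp_functr F K) (fob F c) (far F \<circ> \<iota>))"

text \<open>Colimits, coproducts and coends are fixed once and for all by choice.\<close>

definition colim :: "('j, 'k, 'y) cat_scheme \<Rightarrow> ('o, 'm, 'z) cat_scheme \<Rightarrow>
    ('j, 'k, 'o, 'm) functr \<Rightarrow> 'o \<times> ('j \<Rightarrow> 'm)" where
  "colim J C D = (SOME p. is_colimit J C D (fst p) (snd p))"

definition is_coproduct :: "('o, 'm, 'z) cat_scheme \<Rightarrow> 'i set \<Rightarrow> ('i \<Rightarrow> 'o) \<Rightarrow> 'o \<Rightarrow>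
    ('i \<Rightarrow> 'm) \<Rightarrow> bool" where
  "is_coproduct C I A c \<iota> \<longleftrightarrow> c \<in> Obj C \<and> (\<forall>i \<in> I. \<iota> i \<in> hom C (A i) c) \<and>
     (\<forall>x \<in> Obj C. \<forall>\<phi>. (\<forall>i \<in> I. \<phi> i \<in> hom C (A i) x) \<longrightarrow>
        (\<exists>!h. h \<in> hom C c x \<and> (\<forall>i \<in> I. h \<cdot>\<^bsub>C\<^esub> \<iota> i = \<phi> i)))"

definition chosen_coproduct :: "('o, 'm, 'z) cat_scheme \<Rightarrow> 'i set \<Rightarrow> ('i \<Rightarrow> 'o) \<Rightarrow>
    'o \<times> ('i \<Rightarrow> 'm)" where
  "chosen_coproduct C I A = (SOME p. is_coproduct C I A (fst p) (snd p))"

definition coprod :: "('o, 'm, 'z) cat_scheme \<Rightarrow> 'i set \<Rightarrow> ('i \<Rightarrow> 'o) \<Rightarrow> 'o" where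
  "coprod C I A = fst (chosen_coproduct C I A)"

definition coproj :: "('o, 'm, 'z) cat_scheme \<Rightarrow> 'i set \<Rightarrow> ('i \<Rightarrow> 'o) \<Rightarrow> 'i \<Rightarrow> 'm" where
  "coproj C I A = snd (chosen_coproduct C I A)"

definition is_initial :: "('o, 'm, 'z) cat_scheme \<Rightarrow> 'o \<Rightarrow> bool" where
  "is_initial C x \<longleftrightarrow> x \<in> Obj C \<and> (\<forall>y \<in> Obj C. \<exists>!f. f \<in> hom C x y)"

definition initial :: "('o, 'm, 'z) cat_scheme \<Rightarrow> 'o" where
  "initial C = (SOME x. is_initial C x)"

definition iso_to_coprojection :: "('o, 'm, 'z) cat_scheme \<Rightarrow> 'm \<Rightarrow> 'o \<Rightarrow> bool" where
  "iso_to_coprojection C f N \<longleftrightarrow> f \<in> Arr C \<and> N \<in> Obj C \<and>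
     (\<exists>P \<iota>. is_coproduct C (UNIV :: bool set) (\<lambda>i. if i then Dom C f else N) P \<iota> \<and>
        (\<exists>\<phi> \<in> hom C (Dom C f) (Dom C f). \<exists>\<psi> \<in> hom C (Cod C f) P.
           iso C \<phi> \<and> iso C \<psi> \<and> \<psi> \<cdot>\<^bsub>C\<^esub> f = \<iota> True \<cdot>\<^bsub>C\<^esub> \<phi>))"

definition is_cowedge :: "('j, 'k, 'y) cat_scheme \<Rightarrow> ('o, 'm, 'z) cat_scheme \<Rightarrow>
    ('j \<times> 'j, 'k \<times> 'k, 'o, 'm) functr \<Rightarrow> 'o \<Rightarrow> ('j \<Rightarrow> 'm) \<Rightarrow> bool" where
  "is_cowedge J C H c \<kappa> \<longleftrightarrow> c \<in> Obj C \<and>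
     (\<forall>j \<in> Obj J. \<kappa> j \<in> hom C (fob H (j, j)) c) \<and>
     (\<forall>f \<in> Arr J. \<kappa> (Dom J f) \<cdot>\<^bsub>C\<^esub> far H (f, Idn J (Dom J f)) =
                  \<kappa> (Cod J f) \<cdot>\<^bsub>C\<^esub> far H (Idn J (Cod J f), f))"

definition is_coend :: "('j, 'k, 'y) cat_scheme \<Rightarrow> ('o, 'm, 'z) cat_scheme \<Rightarrow>
    ('j \<times> 'j, 'k \<times> 'k, 'o, 'm) functr \<Rightarrow> 'o \<Rightarrow> ('j \<Rightarrow> 'm) \<Rightarrow> bool" where
  "is_coend J C H c \<kappa> \<longleftrightarrow> is_functor (prod_cat (op_cat J) J) C H \<and> is_cowedge J C H c \<kappa> \<and>
     (\<forall>x \<phi>. is_cowedge J C H x \<phi> \<longrightarrow> (\<exists>!h. h \<in> hom C c x \<and> (\<forall>j \<in> Obj J. h \<cdot>\<^bsub>C\<^esub> \<kappa> j = \<phi> j)))"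

definition coend :: "('j, 'k, 'y) cat_scheme \<Rightarrow> ('o, 'm, 'z) cat_scheme \<Rightarrow>
    ('j \<times> 'j, 'k \<times> 'k, 'o, 'm) functr \<Rightarrow> 'o" where
  "coend J C H = (SOME c. \<exists>\<kappa>. is_coend J C H c \<kappa>)"

definition set_cat :: "('u set, 'u set \<times> 'u set \<times> ('u \<Rightarrow> 'u)) cat" where
  "set_cat = \<lparr>Obj = UNIV, Arr = {(A, B, f). f \<in> A \<rightarrow>\<^sub>E B},
     Dom = (\<lambda>(A, B, f). A), Cod = (\<lambda>(A, B, f). B),
     Idn = (\<lambda>A. (A, A, \<lambda>x \<in> A. x)),
     Comp = (\<lambda>(B, C, g) (A, B', f). (A, C, \<lambda>x \<in> A. g (f x)))\<rparr>"


section \<open>Monoidal categories\<close>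

record ('o, 'm) mon_cat = "('o, 'm) cat" +
  Tensor :: "'o \<Rightarrow> 'o \<Rightarrow> 'o"  (infixr "\<otimes>\<index>" 80)
  TensorArr :: "'m \<Rightarrow> 'm \<Rightarrow> 'm"  (infixr "\<odot>\<index>" 80)
  Unit :: 'o
  Assoc :: "'o \<Rightarrow> 'o \<Rightarrow> 'o \<Rightarrow> 'm"
  LUnit :: "'o \<Rightarrow> 'm"
  RUnit :: "'o \<Rightarrow> 'm"

locale monoidal_category = category M for M :: "('o, 'm, 'z) mon_cat_scheme" (structure) +
  assumes Tensor_Obj: "x \<in> Obj M \<Longrightarrow> y \<in> Obj M \<Longrightarrow> x \<otimes> y \<in> Obj M"
    and TensorArr_hom: "f \<in> hom M x x' \<Longrightarrow> g \<in> hom M y y' \<Longrightarrow> f \<odot> g \<in> hom M (x \<otimes> y) (x' \<otimes> y')"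
    and TensorArr_Idn: "x \<in> Obj M \<Longrightarrow> y \<in> Obj M \<Longrightarrow> Idn M x \<odot> Idn M y = Idn M (x \<otimes> y)"
    and TensorArr_Comp: "f \<in> hom M x x' \<Longrightarrow> f' \<in> hom M x' x'' \<Longrightarrow> g \<in> hom M y y' \<Longrightarrow>
      g' \<in> hom M y' y'' \<Longrightarrow> (f' \<cdot> f) \<odot> (g' \<cdot> g) = (f' \<odot> g') \<cdot> (f \<odot> g)"
    and Unit_Obj: "Unit M \<in> Obj M"
    and Assoc_hom: "x \<in> Obj M \<Longrightarrow> y \<in> Obj M \<Longrightarrow> z \<in> Obj M \<Longrightarrow>
      Assoc M x y z \<in> hom M ((x \<otimes> y) \<otimes> z) (x \<otimes> (y \<otimes> z))"
    and Assoc_iso: "x \<in> Obj M \<Longrightarrow> y \<in> Obj M \<Longrightarrow> z \<in> Obj M \<Longrightarrow> iso M (Assoc M x y z)"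
    and Assoc_natural: "f \<in> hom M x x' \<Longrightarrow> g \<in> hom M y y' \<Longrightarrow> h \<in> hom M z z' \<Longrightarrow>
      Assoc M x' y' z' \<cdot> ((f \<odot> g) \<odot> h) = (f \<odot> (g \<odot> h)) \<cdot> Assoc M x y z"
    and LUnit_hom: "x \<in> Obj M \<Longrightarrow> LUnit M x \<in> hom M (Unit M \<otimes> x) x"
    and LUnit_iso: "x \<in> Obj M \<Longrightarrow> iso M (LUnit M x)"
    and LUnit_natural: "f \<in> hom M x y \<Longrightarrow> LUnit M y \<cdot> (Idn M (Unit M) \<odot> f) = f \<cdot> LUnit M x"
    and RUnit_hom: "x \<in> Obj M \<Longrightarrow> RUnit M x \<in> hom M (x \<otimes> Unit M) x"
    and RUnit_iso: "x \<in> Obj M \<Longrightarrow> iso M (RUnit M x)"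
    and RUnit_natural: "f \<in> hom M x y \<Longrightarrow> RUnit M y \<cdot> (f \<odot> Idn M (Unit M)) = f \<cdot> RUnit M x"
    and pentagon: "w \<in> Obj M \<Longrightarrow> x \<in> Obj M \<Longrightarrow> y \<in> Obj M \<Longrightarrow> z \<in> Obj M \<Longrightarrow>
      Assoc M w x (y \<otimes> z) \<cdot> Assoc M (w \<otimes> x) y z =
      (Idn M w \<odot> Assoc M x y z) \<cdot> Assoc M w (x \<otimes> y) z \<cdot> (Assoc M w x y \<odot> Idn M z)"
    and triangle: "x \<in> Obj M \<Longrightarrow> y \<in> Obj M \<Longrightarrow>
      (Idn M x \<odot> LUnit M y) \<cdot> Assoc M x (Unit M) y = RUnit M x \<odot> Idn M y"

record ('o, 'm) sym_mon_cat = "('o, 'm) mon_cat" +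
  Braid :: "'o \<Rightarrow> 'o \<Rightarrow> 'm"

locale symmetric_monoidal_closed_category = monoidal_category V
  for V :: "('o, 'm, 'z) sym_mon_cat_scheme" (structure) +
  assumes Braid_hom: "x \<in> Obj V \<Longrightarrow> y \<in> Obj V \<Longrightarrow> Braid V x y \<in> hom V (x \<otimes> y) (y \<otimes> x)"
    and Braid_natural: "f \<in> hom V x x' \<Longrightarrow> g \<in> hom V y y' \<Longrightarrow>
      Braid V x' y' \<cdot> (f \<odot> g) = (g \<odot> f) \<cdot> Braid V x y"
    and Braid_symmetric: "x \<in> Obj V \<Longrightarrow> y \<in> Obj V \<Longrightarrow> Braid V y x \<cdot> Braid V x y = Idn V (x \<otimes> y)"
    and hexagon: "x \<in> Obj V \<Longrightarrow> y \<in> Obj V \<Longrightarrow> z \<in> Obj V \<Longrightarrow>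
      Assoc V y z x \<cdot> Braid V x (y \<otimes> z) \<cdot> Assoc V x y z =
      (Idn V y \<odot> Braid V x z) \<cdot> Assoc V y x z \<cdot> (Braid V x y \<odot> Idn V z)"
    and closed: "y \<in> Obj V \<Longrightarrow> z \<in> Obj V \<Longrightarrow>
      \<exists>e \<in> Obj V. \<exists>ev \<in> hom V (e \<otimes> y) z. \<forall>x \<in> Obj V. \<forall>f \<in> hom V (x \<otimes> y) z.
        \<exists>!g. g \<in> hom V x e \<and> ev \<cdot> (g \<odot> Idn V y) = f"

definition op_mon_cat :: "('o, 'm, 'z) mon_cat_scheme \<Rightarrow> ('o, 'm) mon_cat" where
  "op_mon_cat M = cat.extend (op_cat M)
     (mon_cat.fields (Tensor M) (TensorArr M) (Unit M)
       (\<lambda>x y z. inv_arr M (Assoc M x y z))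
       (\<lambda>x. inv_arr M (LUnit M x)) (\<lambda>x. inv_arr M (RUnit M x)))"

record ('o, 'm, 'p, 'n) colax = "('o, 'm, 'p, 'n) functr" +
  comult :: "'o \<Rightarrow> 'o \<Rightarrow> 'n"
  counit :: 'n

definition colax_monoidal :: "('o, 'm, 'z) mon_cat_scheme \<Rightarrow> ('p, 'n, 'y) mon_cat_scheme \<Rightarrow>
    ('o, 'm, 'p, 'n, 'x) colax_scheme \<Rightarrow> bool" where
  "colax_monoidal M N X \<longleftrightarrow>
     monoidal_category M \<and> monoidal_category N \<and> is_functor M N X \<and>
     (\<forall>x \<in> Obj M. \<forall>y \<in> Obj M.
        comult X x y \<in> hom N (fob X (x \<otimes>\<^bsub>M\<^esub> y)) (fob X x \<otimes>\<^bsub>N\<^esub> fob X y)) \<and>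
     (\<forall>f \<in> Arr M. \<forall>g \<in> Arr M.
        (far X f \<odot>\<^bsub>N\<^esub> far X g) \<cdot>\<^bsub>N\<^esub> comult X (Dom M f) (Dom M g) =
        comult X (Cod M f) (Cod M g) \<cdot>\<^bsub>N\<^esub> far X (f \<odot>\<^bsub>M\<^esub> g)) \<and>
     counit X \<in> hom N (fob X (Unit M)) (Unit N) \<and>
     (\<forall>x \<in> Obj M. \<forall>y \<in> Obj M. \<forall>z \<in> Obj M.
        Assoc N (fob X x) (fob X y) (fob X z) \<cdot>\<^bsub>N\<^esub>
          (comult X x y \<odot>\<^bsub>N\<^esub> Idn N (fob X z)) \<cdot>\<^bsub>N\<^esub> comult X (x \<otimes>\<^bsub>M\<^esub> y) z =
        (Idn N (fob X x) \<odot>\<^bsub>N\<^esub> comult X y z) \<cdot>\<^bsub>N\<^esub> comult X x (y \<otimes>\<^bsub>M\<^esub> z) \<cdot>\<^bsub>N\<^esub>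
          far X (Assoc M x y z)) \<and>
     (\<forall>x \<in> Obj M.
        LUnit N (fob X x) \<cdot>\<^bsub>N\<^esub> (counit X \<odot>\<^bsub>N\<^esub> Idn N (fob X x)) \<cdot>\<^bsub>N\<^esub> comult X (Unit M) x =
          far X (LUnit M x) \<and>
        RUnit N (fob X x) \<cdot>\<^bsub>N\<^esub> (Idn N (fob X x) \<odot>\<^bsub>N\<^esub> counit X) \<cdot>\<^bsub>N\<^esub> comult X x (Unit M) =
          far X (RUnit M x))"

text \<open>Iterated tensor products are bracketed to the right; the empty one is the unit and a
  one-element list gives its element itself.\<close>

fun tens :: "('o, 'm, 'z) mon_cat_scheme \<Rightarrow> 'o list \<Rightarrow> 'o" where
  "tens M [] = Unit M"
| "tens M [x] = x"
| "tens M (x # y # xs) = x \<otimes>\<^bsub>M\<^esub> tens M (y # xs)"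

fun tens_arr :: "('o, 'm, 'z) mon_cat_scheme \<Rightarrow> 'm list \<Rightarrow> 'm" where
  "tens_arr M [] = Idn M (Unit M)"
| "tens_arr M [f] = f"
| "tens_arr M (f # g # fs) = f \<odot>\<^bsub>M\<^esub> tens_arr M (g # fs)"

text \<open>The coherence isomorphisms
  \<open>tens xs \<otimes> tens ys \<rightarrow> tens (xs @ ys)\<close> and
  \<open>tens (map tens xss) \<rightarrow> tens (concat xss)\<close>.\<close>

fun tens_append :: "('o, 'm, 'z) mon_cat_scheme \<Rightarrow> 'o list \<Rightarrow> 'o list \<Rightarrow> 'm" where
  "tens_append M [] ys = LUnit M (tens M ys)"
| "tens_append M (x # xs) [] = RUnit M (tens M (x # xs))"
| "tens_append M [x] (y # ys) = Idn M (tens M (x # y # ys))"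
| "tens_append M (x # x' # xs) (y # ys) =
     (Idn M x \<odot>\<^bsub>M\<^esub> tens_append M (x' # xs) (y # ys)) \<cdot>\<^bsub>M\<^esub>
       Assoc M x (tens M (x' # xs)) (tens M (y # ys))"

fun tens_concat :: "('o, 'm, 'z) mon_cat_scheme \<Rightarrow> 'o list list \<Rightarrow> 'm" where
  "tens_concat M [] = Idn M (Unit M)"
| "tens_concat M [xs] = Idn M (tens M xs)"
| "tens_concat M (xs # ys # xss) =
     tens_append M xs (concat (ys # xss)) \<cdot>\<^bsub>M\<^esub> (Idn M (tens M xs) \<odot>\<^bsub>M\<^esub> tens_concat M (ys # xss))"


section \<open>Quivers\<close>

type_synonym ('u, 'o) quiver = "'u \<times> 'u \<Rightarrow> 'o"
type_synonym ('u, 'o, 'm) quiver_arr = "('u, 'o) quiver \<times> ('u, 'o) quiver \<times> ('u \<times> 'u \<Rightarrow> 'm)"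

definition quiv_tensor :: "('o, 'm, 'z) mon_cat_scheme \<Rightarrow> 'u set \<Rightarrow>
    ('u, 'o) quiver \<Rightarrow> ('u, 'o) quiver \<Rightarrow> ('u, 'o) quiver" where
  "quiv_tensor V S Q P = (\<lambda>ab \<in> S \<times> S. coprod V S (\<lambda>c. Q (fst ab, c) \<otimes>\<^bsub>V\<^esub> P (c, snd ab)))"

definition quiv_in :: "('o, 'm, 'z) mon_cat_scheme \<Rightarrow> 'u set \<Rightarrow>
    ('u, 'o) quiver \<Rightarrow> ('u, 'o) quiver \<Rightarrow> 'u \<Rightarrow> 'u \<Rightarrow> 'u \<Rightarrow> 'm" where
  "quiv_in V S Q P a b c = coproj V S (\<lambda>c. Q (a, c) \<otimes>\<^bsub>V\<^esub> P (c, b)) c"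

definition quiv_unit :: "('o, 'm, 'z) mon_cat_scheme \<Rightarrow> 'u set \<Rightarrow> ('u, 'o) quiver" where
  "quiv_unit V S = (\<lambda>ab \<in> S \<times> S. if fst ab = snd ab then Unit V else initial V)"

text \<open>Each structure map out of a coproduct is the unique arrow with the displayed restrictions to
  the summands. For the unitors only one summand need be prescribed: the remaining ones,
  \<open>0 \<otimes> Q\<close> and \<open>Q \<otimes> 0\<close>, are initial because the monoidal structure is closed.\<close>

definition quiv_tensor_arr :: "('o, 'm, 'z) mon_cat_scheme \<Rightarrow> 'u set \<Rightarrow>
    ('u, 'o, 'm) quiver_arr \<Rightarrow> ('u, 'o, 'm) quiver_arr \<Rightarrow> ('u, 'o, 'm) quiver_arr" where
  "quiv_tensor_arr V S = (\<lambda>(Q, Q', f) (P, P', g).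
     (quiv_tensor V S Q P, quiv_tensor V S Q' P',
      restrict (\<lambda>(a, b). THE h. h \<in> hom V (quiv_tensor V S Q P (a, b)) (quiv_tensor V S Q' P' (a, b)) \<and>
        (\<forall>c \<in> S. h \<cdot>\<^bsub>V\<^esub> quiv_in V S Q P a b c = quiv_in V S Q' P' a b c \<cdot>\<^bsub>V\<^esub> (f (a, c) \<odot>\<^bsub>V\<^esub> g (c, b))))
      (S \<times> S)))"

definition quiv_assoc :: "('o, 'm, 'z) mon_cat_scheme \<Rightarrow> 'u set \<Rightarrow>
    ('u, 'o) quiver \<Rightarrow> ('u, 'o) quiver \<Rightarrow> ('u, 'o) quiver \<Rightarrow> ('u, 'o, 'm) quiver_arr" where
  "quiv_assoc V S Q P R =
     (let QP = quiv_tensor V S Q P; PR = quiv_tensor V S P R;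
          s = quiv_tensor V S QP R; t = quiv_tensor V S Q PR
      in (s, t, restrict (\<lambda>(a, b). THE h. h \<in> hom V (s (a, b)) (t (a, b)) \<and>
        (\<forall>c \<in> S. \<forall>d \<in> S.
           h \<cdot>\<^bsub>V\<^esub> quiv_in V S QP R a b d \<cdot>\<^bsub>V\<^esub> (quiv_in V S Q P a d c \<odot>\<^bsub>V\<^esub> Idn V (R (d, b))) =
           quiv_in V S Q PR a b c \<cdot>\<^bsub>V\<^esub> (Idn V (Q (a, c)) \<odot>\<^bsub>V\<^esub> quiv_in V S P R c b d) \<cdot>\<^bsub>V\<^esub>
             Assoc V (Q (a, c)) (P (c, d)) (R (d, b))))
      (S \<times> S)))"

definition quiv_lunit :: "('o, 'm, 'z) mon_cat_scheme \<Rightarrow> 'u set \<Rightarrow>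
    ('u, 'o) quiver \<Rightarrow> ('u, 'o, 'm) quiver_arr" where
  "quiv_lunit V S Q =
     (let s = quiv_tensor V S (quiv_unit V S) Q
      in (s, Q, restrict (\<lambda>(a, b). THE h. h \<in> hom V (s (a, b)) (Q (a, b)) \<and>
           h \<cdot>\<^bsub>V\<^esub> quiv_in V S (quiv_unit V S) Q a b a = LUnit V (Q (a, b))) (S \<times> S)))"

definition quiv_runit :: "('o, 'm, 'z) mon_cat_scheme \<Rightarrow> 'u set \<Rightarrow>
    ('u, 'o) quiver \<Rightarrow> ('u, 'o, 'm) quiver_arr" where
  "quiv_runit V S Q =
     (let s = quiv_tensor V S Q (quiv_unit V S)
      in (s, Q, restrict (\<lambda>(a, b). THE h. h \<in> hom V (s (a, b)) (Q (a, b)) \<and>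
           h \<cdot>\<^bsub>V\<^esub> quiv_in V S Q (quiv_unit V S) a b b = RUnit V (Q (a, b))) (S \<times> S)))"

definition Quiv :: "('o, 'm, 'z) mon_cat_scheme \<Rightarrow> 'u set \<Rightarrow>
    (('u, 'o) quiver, ('u, 'o, 'm) quiver_arr) mon_cat" where
  "Quiv V S = \<lparr>Obj = (S \<times> S \<rightarrow>\<^sub>E Obj V),
     Arr = {(Q, P, f). Q \<in> (S \<times> S \<rightarrow>\<^sub>E Obj V) \<and> P \<in> (S \<times> S \<rightarrow>\<^sub>E Obj V) \<and>
       f \<in> (\<Pi>\<^sub>E ab \<in> S \<times> S. hom V (Q ab) (P ab))},
     Dom = (\<lambda>(Q, P, f). Q), Cod = (\<lambda>(Q, P, f). P),
     Idn = (\<lambda>Q. (Q, Q, \<lambda>ab \<in> S \<times> S. Idn V (Q ab))),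
     Comp = (\<lambda>(P, R, g) (Q, P', f). (Q, R, \<lambda>ab \<in> S \<times> S. g ab \<cdot>\<^bsub>V\<^esub> f ab)),
     Tensor = quiv_tensor V S, TensorArr = quiv_tensor_arr V S, Unit = quiv_unit V S,
     Assoc = quiv_assoc V S, LUnit = quiv_lunit V S, RUnit = quiv_runit V S\<rparr>"

definition quiv_comp :: "('u, 'o, 'm) quiver_arr \<Rightarrow> 'u \<times> 'u \<Rightarrow> 'm" where
  "quiv_comp f ab = snd (snd f) ab"


section \<open>Finite intervals and simplices\<close>

text \<open>The object \<open>[n]\<close> is encoded as \<open>n\<close>, and a map \<open>f : [m] \<rightarrow> [n]\<close> of finite
  intervals as its list of values \<open>[f 0, \<dots>, f m]\<close>; its codomain is recovered as
  \<open>f m = n\<close>.\<close>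

definition Delta_f :: "(nat, nat list) mon_cat" where
  "Delta_f = \<lparr>Obj = UNIV, Arr = {f. f \<noteq> [] \<and> sorted f \<and> hd f = 0},
     Dom = (\<lambda>f. length f - 1), Cod = last,
     Idn = (\<lambda>n. [0..<Suc n]), Comp = (\<lambda>g f. map ((!) g) f),
     Tensor = (+), TensorArr = (\<lambda>f g. f @ map ((+) (last f)) (tl g)), Unit = 0,
     Assoc = (\<lambda>k l m. [0..<Suc (k + l + m)]),
     LUnit = (\<lambda>n. [0..<Suc n]), RUnit = (\<lambda>n. [0..<Suc n])\<rparr>"

definition surj_interval_maps :: "nat list set" where
  "surj_interval_maps = {f \<in> Arr Delta_f. set f = {..last f}}"

text \<open>The simplex category; here the codomain has to be recorded, \<open>(f, n)\<close> being the
  map into \<open>[n]\<close> with list of values \<open>f\<close>.\<close>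

definition Delta :: "(nat, nat list \<times> nat) cat" where
  "Delta = \<lparr>Obj = UNIV, Arr = {(f, n). f \<noteq> [] \<and> sorted f \<and> set f \<subseteq> {..n}},
     Dom = (\<lambda>(f, n). length f - 1), Cod = snd,
     Idn = (\<lambda>n. ([0..<Suc n], n)), Comp = (\<lambda>(g, n) (f, m). (map ((!) g) f, n))\<rparr>"

abbreviation Simp :: "('o, 'm, 'z) cat_scheme \<Rightarrow> _" where
  "Simp C \<equiv> fun_cat (op_cat Delta) C"


section \<open>Templicial objects and their non-degenerate simplices\<close>

type_synonym ('u, 'o, 'm) templicial =
  "(nat, nat list, ('u, 'o) quiver, ('u, 'o, 'm) quiver_arr) colax"

definition is_templicial :: "('o, 'm, 'z) mon_cat_scheme \<Rightarrow> 'u set \<Rightarrow>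
    ('u, 'o, 'm) templicial \<Rightarrow> bool" where
  "is_templicial V S X \<longleftrightarrow>
     colax_monoidal (op_mon_cat Delta_f) (Quiv V S) X \<and> iso (Quiv V S) (counit X)"

definition deg_cat :: "nat \<Rightarrow> (nat list, nat list \<times> nat list \<times> nat list) cat" where
  "deg_cat n =
     (let Obs = {\<sigma> \<in> surj_interval_maps. Dom Delta_f \<sigma> = n \<and> Cod Delta_f \<sigma> < n}
      in \<lparr>Obj = Obs,
       Arr = {(\<sigma>, \<sigma>', \<tau>). \<sigma> \<in> Obs \<and> \<sigma>' \<in> Obs \<and> \<tau> \<in> surj_interval_maps \<and>
         \<tau> \<in> hom Delta_f (Cod Delta_f \<sigma>) (Cod Delta_f \<sigma>') \<and> \<tau> \<cdot>\<^bsub>Delta_f\<^esub> \<sigma> = \<sigma>'},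
       Dom = (\<lambda>(\<sigma>, \<sigma>', \<tau>). \<sigma>), Cod = (\<lambda>(\<sigma>, \<sigma>', \<tau>). \<sigma>'),
       Idn = (\<lambda>\<sigma>. (\<sigma>, \<sigma>, Idn Delta_f (Cod Delta_f \<sigma>))),
       Comp = (\<lambda>(\<sigma>', \<sigma>'', \<tau>') (\<sigma>, \<rho>, \<tau>). (\<sigma>, \<sigma>'', \<tau>' \<cdot>\<^bsub>Delta_f\<^esub> \<tau>))\<rparr>)"

definition deg_diagram :: "('u, 'o, 'm) templicial \<Rightarrow>
    (nat list, nat list \<times> nat list \<times> nat list, ('u, 'o) quiver, ('u, 'o, 'm) quiver_arr) functr" where
  "deg_diagram X = \<lparr>fob = (\<lambda>\<sigma>. fob X (Cod Delta_f \<sigma>)), far = (\<lambda>(\<sigma>, \<sigma>', \<tau>). far X \<tau>)\<rparr>"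

definition deg_colim :: "('o, 'm, 'z) mon_cat_scheme \<Rightarrow> 'u set \<Rightarrow> ('u, 'o, 'm) templicial \<Rightarrow> nat \<Rightarrow>
    ('u, 'o) quiver \<times> (nat list \<Rightarrow> ('u, 'o, 'm) quiver_arr)" where
  "deg_colim V S X n = colim (op_cat (deg_cat n)) (Quiv V S) (deg_diagram X)"

definition Xdeg :: "('o, 'm, 'z) mon_cat_scheme \<Rightarrow> 'u set \<Rightarrow> ('u, 'o, 'm) templicial \<Rightarrow> nat \<Rightarrow>
    ('u, 'o) quiver" where
  "Xdeg V S X n = fst (deg_colim V S X n)"

definition deg_map :: "('o, 'm, 'z) mon_cat_scheme \<Rightarrow> 'u set \<Rightarrow> ('u, 'o, 'm) templicial \<Rightarrow> nat \<Rightarrow>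
    ('u, 'o, 'm) quiver_arr" where
  "deg_map V S X n = (THE h. h \<in> hom (Quiv V S) (Xdeg V S X n) (fob X n) \<and>
     (\<forall>\<sigma> \<in> Obj (deg_cat n). h \<cdot>\<^bsub>Quiv V S\<^esub> snd (deg_colim V S X n) \<sigma> = far X \<sigma>))"

definition is_nondeg_choice :: "('o, 'm, 'z) mon_cat_scheme \<Rightarrow> 'u set \<Rightarrow> ('u, 'o, 'm) templicial \<Rightarrow>
    (nat \<Rightarrow> ('u, 'o) quiver) \<Rightarrow> bool" where
  "is_nondeg_choice V S X Xnd \<longleftrightarrow>
     (\<forall>n. iso_to_coprojection (Quiv V S) (deg_map V S X n) (Xnd n))"


section \<open>Necklaces\<close>

type_synonym necklace = "nat set \<times> nat"
type_synonym nec_arr = "necklace \<times> necklace \<times> nat list"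

definition Nec :: "(necklace, nec_arr) cat" where
  "Nec = (let Obs = {(T, p). {0, p} \<subseteq> T \<and> T \<subseteq> {..p}}
     in \<lparr>Obj = Obs,
       Arr = {((T, p), (U, q), f). (T, p) \<in> Obs \<and> (U, q) \<in> Obs \<and>
         f \<in> hom Delta_f p q \<and> U \<subseteq> (!) f ` T},
       Dom = (\<lambda>(T, U, f). T), Cod = (\<lambda>(T, U, f). U),
       Idn = (\<lambda>(T, p). ((T, p), (T, p), Idn Delta_f p)),
       Comp = (\<lambda>(U, W, g) (T, U', f). (T, W, g \<cdot>\<^bsub>Delta_f\<^esub> f))\<rparr>)"

text \<open>For \<open>T = {t\<^sub>0 < \<dots> < t\<^sub>k}\<close> the list of pairs \<open>(t\<^sub>i\<^sub>-\<^sub>1, t\<^sub>i)\<close>, and of differences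
  \<open>t\<^sub>i - t\<^sub>i\<^sub>-\<^sub>1\<close>.\<close>

definition beads :: "nat set \<Rightarrow> (nat \<times> nat) list" where
  "beads T = (let ts = sorted_list_of_set T in zip ts (tl ts))"

definition gaps :: "nat set \<Rightarrow> nat list" where
  "gaps T = map (\<lambda>(s, t). t - s) (beads T)"

definition nec_prod :: "('o, 'm, 'z) mon_cat_scheme \<Rightarrow> (nat \<Rightarrow> 'o) \<Rightarrow> nat set \<Rightarrow> 'o" where
  "nec_prod M Y T = tens M (map Y (gaps T))"

text \<open>The iterated comultiplication \<open>X\<^sub>p \<rightarrow> X\<^sub>k\<^sub>1 \<otimes> \<dots> \<otimes> X\<^sub>k\<^sub>r\<close> with
  \<open>p = k\<^sub>1 + \<dots> + k\<^sub>r\<close>.\<close>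

fun comult_list :: "('o, 'm, 'z) mon_cat_scheme \<Rightarrow> (nat, 'k, 'o, 'm) colax \<Rightarrow> nat list \<Rightarrow> 'm" where
  "comult_list M X [] = counit X"
| "comult_list M X [k] = Idn M (fob X k)"
| "comult_list M X (k # l # ks) =
     (Idn M (fob X k) \<odot>\<^bsub>M\<^esub> comult_list M X (l # ks)) \<cdot>\<^bsub>M\<^esub> comult X k (sum_list (l # ks))"

text \<open>The action \<open>X\<^sub>U \<rightarrow> X\<^sub>T\<close> of an inert map, for \<open>U \<subseteq> T\<close>.\<close>

definition nec_inert :: "('o, 'm, 'z) mon_cat_scheme \<Rightarrow> (nat, 'k, 'o, 'm) colax \<Rightarrow>
    nat set \<Rightarrow> nat set \<Rightarrow> 'm" where
  "nec_inert M X T U =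
     (let kss = map (\<lambda>(u, v). gaps ((\<lambda>t. t - u) ` (T \<inter> {u..v}))) (beads U)
      in tens_concat M (map (map (fob X)) kss) \<cdot>\<^bsub>M\<^esub> tens_arr M (map (comult_list M X) kss))"

text \<open>The isomorphism which inserts a factor \<open>X\<^sub>0 \<simeq> I\<close> for each zero in \<open>ks\<close>.\<close>

definition insert_units :: "('o, 'm, 'z) mon_cat_scheme \<Rightarrow> (nat, 'k, 'o, 'm) colax \<Rightarrow>
    nat list \<Rightarrow> 'm" where
  "insert_units M X ks =
     tens_arr M (map (\<lambda>k. if k = 0 then inv_arr M (counit X) else Idn M (fob X k)) ks) \<cdot>\<^bsub>M\<^esub>
     inv_arr M (tens_concat M (map (\<lambda>k. if k = 0 then [] else [fob X k]) ks))"

text \<open>The action \<open>X\<^bsub>f T\<^esub> \<rightarrow> X\<^sub>T\<close> of an active map \<open>T \<rightarrow> f T\<close>; a bead of \<open>T\<close>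
  collapsed by \<open>f\<close> does not contribute a bead to \<open>f T\<close>.\<close>

definition bead_map :: "nat list \<Rightarrow> nat \<times> nat \<Rightarrow> nat list" where
  "bead_map f = (\<lambda>(s, t). map (\<lambda>j. f ! (s + j) - f ! s) [0..<Suc (t - s)])"

definition nec_active :: "('o, 'm, 'z) mon_cat_scheme \<Rightarrow> (nat, nat list, 'o, 'm) colax \<Rightarrow>
    nat set \<Rightarrow> nat list \<Rightarrow> 'm" where
  "nec_active M X T f =
     tens_arr M (map (\<lambda>b. far X (bead_map f b)) (beads T)) \<cdot>\<^bsub>M\<^esub>
     insert_units M X (map (\<lambda>(s, t). f ! t - f ! s) (beads T))"

definition nec_functor :: "('o, 'm, 'z) mon_cat_scheme \<Rightarrow> (nat, nat list, 'o, 'm) colax \<Rightarrow>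
    (necklace, nec_arr, 'o, 'm) functr" where
  "nec_functor M X = \<lparr>fob = (\<lambda>(T, p). nec_prod M (fob X) T),
     far = (\<lambda>((T, p), (U, q), f). nec_active M X T f \<cdot>\<^bsub>M\<^esub> nec_inert M X ((!) f ` T) U)\<rparr>"


section \<open>Categorification\<close>

definition nec_poset :: "necklace \<Rightarrow> nat set set" where
  "nec_poset = (\<lambda>(T, p). {W. T \<subseteq> W \<and> W \<subseteq> {..p}})"

definition chains :: "nat set set \<Rightarrow> nat \<Rightarrow> nat set list set" where
  "chains P n = {c. length c = Suc n \<and> sorted_wrt (\<subseteq>) c \<and> set c \<subseteq> P}"

text \<open>Simplices of the nerves \<open>N(P\<^sub>T)\<close> are lists of finite sets of natural numbers. They
  are transported into the universe \<open>'u\<close> along some injection, which exists as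
  \<open>'u\<close> is infinite.\<close>

definition code :: "nat set list \<Rightarrow> 'u" where
  "code = (SOME e. inj_on e {c. \<forall>W \<in> set c. finite W})"

definition small_map :: "nat set list set \<Rightarrow> nat set list set \<Rightarrow> (nat set list \<Rightarrow> nat set list) \<Rightarrow>
    'u set \<times> 'u set \<times> ('u \<Rightarrow> 'u)" where
  "small_map A B h = (code ` A, code ` B, \<lambda>x \<in> code ` A. code (h (inv_into A code x)))"

definition nerve :: "nat set set \<Rightarrow>
    (nat, nat list \<times> nat, 'u set, 'u set \<times> 'u set \<times> ('u \<Rightarrow> 'u)) functr" where
  "nerve P = \<lparr>fob = (\<lambda>n. code ` chains P n),
     far = (\<lambda>(f, n). small_map (chains P n) (chains P (length f - 1)) (\<lambda>c. map ((!) c) f))\<rparr>"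

definition nerve_map :: "nec_arr \<Rightarrow> nat \<Rightarrow> 'u set \<times> 'u set \<times> ('u \<Rightarrow> 'u)" where
  "nerve_map = (\<lambda>(T, U, f) n.
     small_map (chains (nec_poset T) n) (chains (nec_poset U) n) (map ((`) ((!) f))))"

definition act_obj :: "('o, 'm, 'z) mon_cat_scheme \<Rightarrow> 'o \<Rightarrow> (nat, 'k, 'o, 'm) functr \<Rightarrow>
    (nat, 'k, 'o, 'm) functr" where
  "act_obj V v K = \<lparr>fob = (\<lambda>n. v \<otimes>\<^bsub>V\<^esub> fob K n), far = (\<lambda>\<theta>. Idn V v \<odot>\<^bsub>V\<^esub> far K \<theta>)\<rparr>"

text \<open>The functor \<open>((T, p), (U, q)) \<mapsto> X\<^sub>T(a, b) \<otimes> F N(P\<^sub>U)\<close> on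
  \<open>Nec\<^sup>o\<^sup>p \<times> Nec\<close>.\<close>

definition hom_integrand_obj :: "('o, 'm, 'z) mon_cat_scheme \<Rightarrow> 'u set \<Rightarrow>
    ('u set, 'u set \<times> 'u set \<times> ('u \<Rightarrow> 'u), 'o, 'm) functr \<Rightarrow> ('u, 'o, 'm) templicial \<Rightarrow>
    'u \<Rightarrow> 'u \<Rightarrow> necklace \<times> necklace \<Rightarrow> (nat, nat list \<times> nat, 'o, 'm) functr" where
  "hom_integrand_obj V S F X a b = (\<lambda>(T, U).
     act_obj V (fob (nec_functor (Quiv V S) X) T (a, b)) (comp_functr F (nerve (nec_poset U))))"

definition hom_integrand :: "('o, 'm, 'z) mon_cat_scheme \<Rightarrow> 'u set \<Rightarrow>
    ('u set, 'u set \<times> 'u set \<times> ('u \<Rightarrow> 'u), 'o, 'm) functr \<Rightarrow> ('u, 'o, 'm) templicial \<Rightarrow>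
    'u \<Rightarrow> 'u \<Rightarrow> (necklace \<times> necklace, nec_arr \<times> nec_arr, (nat, nat list \<times> nat, 'o, 'm) functr,
      (nat, nat list \<times> nat, 'o, 'm) functr \<times> (nat, nat list \<times> nat, 'o, 'm) functr \<times> (nat \<Rightarrow> 'm)) functr" where
  "hom_integrand V S F X a b = \<lparr>fob = hom_integrand_obj V S F X a b,
     far = (\<lambda>(f, g).
       (hom_integrand_obj V S F X a b (Cod Nec f, Dom Nec g),
        hom_integrand_obj V S F X a b (Dom Nec f, Cod Nec g),
        \<lambda>n. quiv_comp (far (nec_functor (Quiv V S) X) f) (a, b) \<odot>\<^bsub>V\<^esub> far F (nerve_map g n)))\<rparr>"

definition categorification_hom :: "('o, 'm, 'z) mon_cat_scheme \<Rightarrow> 'u set \<Rightarrow>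
    ('u set, 'u set \<times> 'u set \<times> ('u \<Rightarrow> 'u), 'o, 'm) functr \<Rightarrow> ('u, 'o, 'm) templicial \<Rightarrow>
    'u \<Rightarrow> 'u \<Rightarrow> (nat, nat list \<times> nat, 'o, 'm) functr" where
  "categorification_hom V S F X a b = coend Nec (Simp V) (hom_integrand V S F X a b)"


section \<open>Flags\<close>

definition is_flag :: "nat \<Rightarrow> necklace \<Rightarrow> nat set list \<Rightarrow> bool" where
  "is_flag n = (\<lambda>(T, p) Ts. length Ts = Suc n \<and> sorted_wrt (\<subseteq>) Ts \<and> T \<subseteq> hd Ts \<and> last Ts \<subseteq> {..p})"

definition is_flanked_flag :: "nat \<Rightarrow> necklace \<Rightarrow> nat set list \<Rightarrow> bool" where
  "is_flanked_flag n = (\<lambda>(T, p) Ts. is_flag n (T, p) Ts \<and> T = hd Ts \<and> last Ts = {..p})"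

definition flanked_flags :: "nat \<Rightarrow> (necklace \<times> nat set list) set" where
  "flanked_flags n = {(T, Ts). T \<in> Obj Nec \<and> is_flanked_flag n T Ts}"

end

theory Submission
  imports Defs "HOL-Library.Countable_Set"
begin

text \<open>
  Colimits in a functor category are pointwise, so the coend may be computed at a fixed simplicial
  level \<open>n\<close>. There \<open>FN(\<P>\<^sub>T)\<close> is a copower of the unit indexed by the flags \<open>c\<close> on \<open>T\<close>, so a cowedge
  amounts to a family of arrows out of the \<open>X\<^sub>T\<close>, one for each flag on \<open>T\<close>, natural in \<open>(T, c)\<close>.

  The Eilenberg--Zilber argument exhibits \<open>X\<^sub>n\<close> as the coproduct of the \<open>X\<^sup>n\<^sup>d\<^sub>k\<close> over all surjections
  \<open>[n] \<rightarrow> [k]\<close>. As the tensor product preserves coproducts, \<open>X\<^sub>T\<close> is the coproduct of the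
  \<open>X\<^sup>n\<^sup>d\<close> at the images of \<open>T\<close> under all surjections out of \<open>[p]\<close>. Moreover every flag \<open>c\<close> is the image,
  under a necklace map determined by \<open>c\<close>, of a flanked flag. Therefore a natural family is determined by
  its restrictions to the summand \<open>X\<^sup>n\<^sup>d\<^sub>T\<close> (the one of the identity) for flanked flags on \<open>T\<close>,
  and these restrictions are arbitrary because surjections preserve flanked flags.

  Functoriality of \<open>T \<mapsto> X\<^sub>T\<close> involves bracketings and the insertion of \<open>X\<^sub>0 \<simeq> I\<^sub>S\<close>; it is checked in a
  strictification, where objects are lists and \<open>X\<^sub>0\<close> is replaced by the empty list.
\<close>

section \<open>Categories and coproducts\<close>

text \<open>Consider pairs of a necklace T and a flag c on it, a map to (U, d) being a necklace map
  that carries c to d. The flanked pairs are coreflective, with counit \<open>span c\<close>, and a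
  map between flanked pairs is automatically active and surjective on vertices. Along such maps X_T
  is free on X^nd, so the colimit of X_T over all pairs is the plain coproduct over the flanked
  ones. Two obstacles shape the rest. Composing necklace maps requires an inert map to be moved past
  an active one; this is naturality of iterated comultiplications, some of whose blocks may be
  collapsed. Moreover X^deg, the coend and the coproducts are fixed by choice, and nothing is known
  of them before some such object has been constructed. Hence the explicit existence proofs, the one
  for X^deg being part of the induction that decomposes X_n, and the care for countable index sets:
  coproducts are available for families that embed into \<open>'u\<close>.\<close>

definition discrete :: "'i set \<Rightarrow> ('i, 'i) cat" where
  "discrete A = \<lparr>Obj = A, Arr = A, Dom = id, Cod = id, Idn = id, Comp = (\<lambda>g f. g)\<rparr>"

lemma homD:
  assumes "f \<in> hom C x y"
  shows "f \<in> Arr C" "Dom C f = x" "Cod C f = y"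
  using assms by (auto simp: hom_def)

lemma homI: "f \<in> Arr C \<Longrightarrow> Dom C f = x \<Longrightarrow> Cod C f = y \<Longrightarrow> f \<in> hom C x y"
  by (simp add: hom_def)

lemma category_discrete: "category (discrete A)"
  by unfold_locales (auto simp: discrete_def hom_def)

section \<open>Composites and isomorphisms\<close>

context category
begin

lemma Arr_hom: "f \<in> Arr C \<Longrightarrow> f \<in> hom C (Dom C f) (Cod C f)"
  by (simp add: hom_def)

lemma Comp_Arr [simp]: "f \<in> Arr C \<Longrightarrow> g \<in> Arr C \<Longrightarrow> Cod C f = Dom C g \<Longrightarrow> g \<cdot> f \<in> Arr C"
  and Dom_Comp [simp]: "f \<in> Arr C \<Longrightarrow> g \<in> Arr C \<Longrightarrow> Cod C f = Dom C g \<Longrightarrow> Dom C (g \<cdot> f) = Dom C f"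
  and Cod_Comp [simp]: "f \<in> Arr C \<Longrightarrow> g \<in> Arr C \<Longrightarrow> Cod C f = Dom C g \<Longrightarrow> Cod C (g \<cdot> f) = Cod C g"
  using Comp_hom[OF Arr_hom, of f g "Cod C g"] by (auto simp: hom_def)

lemma Idn_Arr [simp]: "x \<in> Obj C \<Longrightarrow> Idn C x \<in> Arr C"
  and Dom_Idn [simp]: "x \<in> Obj C \<Longrightarrow> Dom C (Idn C x) = x"
  and Cod_Idn [simp]: "x \<in> Obj C \<Longrightarrow> Cod C (Idn C x) = x"
  using Idn_hom by (auto simp: hom_def)

lemma Comp_Idn' [simp]: "f \<in> Arr C \<Longrightarrow> Dom C f = x \<Longrightarrow> f \<cdot> Idn C x = f"
  and Idn_Comp' [simp]: "f \<in> Arr C \<Longrightarrow> Cod C f = x \<Longrightarrow> Idn C x \<cdot> f = f"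
  using Comp_Idn[OF Arr_hom] Idn_Comp[OF Arr_hom] by auto

text \<open>As a simplification rule this brackets every composite to the right. An equation
  \<open>g \<cdot> f = h\<close> then no longer matches inside a longer composite, which is why such
  equations recur below in a form with a tail (names ending in \<open>_assoc\<close>, and
  \<open>Comp_rewrite\<close>).\<close>

lemma Comp_assoc' [simp]:
  "f \<in> Arr C \<Longrightarrow> g \<in> Arr C \<Longrightarrow> h \<in> Arr C \<Longrightarrow> Cod C f = Dom C g \<Longrightarrow> Cod C g = Dom C h \<Longrightarrow>
   (h \<cdot> g) \<cdot> f = h \<cdot> (g \<cdot> f)"
  by (metis Arr_hom Comp_assoc)

declare Dom_Obj [simp] Cod_Obj [simp]

lemma hom_Obj: assumes "f \<in> hom C x y" shows "x \<in> Obj C" "y \<in> Obj C"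
  using assms Dom_Obj Cod_Obj by (auto simp: hom_def)

lemma Idn_Comp_left: "f \<in> Arr C \<Longrightarrow> g \<in> Arr C \<Longrightarrow> Cod C f = Dom C g \<Longrightarrow> g \<cdot> f = Idn C x \<Longrightarrow>
    k \<in> Arr C \<Longrightarrow> Cod C k = Dom C f \<Longrightarrow> x = Dom C f \<Longrightarrow> g \<cdot> (f \<cdot> k) = k"
  by (metis Comp_assoc' Idn_Comp')

lemma inverse_arrows_unique:
  assumes "inverse_arrows C f g" "inverse_arrows C f h" shows "g = h"
proof -
  have *: "f \<in> Arr C" "g \<in> Arr C" "h \<in> Arr C" "Dom C g = Cod C f" "Cod C g = Dom C f"
    "Dom C h = Cod C f" "Cod C h = Dom C f" "g \<cdot> f = Idn C (Dom C f)" "f \<cdot> h = Idn C (Cod C f)"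
    using assms by (auto simp: inverse_arrows_def hom_def)
  have "g = g \<cdot> (f \<cdot> h)" using * by simp
  also have "\<dots> = (g \<cdot> f) \<cdot> h" using *(1-7) by (simp del: *)
  also have "\<dots> = h" unfolding *(8) using * by simp
  finally show ?thesis .
qed

lemma inv_arr_eq: "inverse_arrows C f g \<Longrightarrow> inv_arr C f = g"
  unfolding inv_arr_def using inverse_arrows_unique by blast

lemma inverse_arrows_inv_arr: "iso C f \<Longrightarrow> inverse_arrows C f (inv_arr C f)"
  unfolding iso_def using inv_arr_eq by blast

lemma iso_Arr: "iso C f \<Longrightarrow> f \<in> Arr C"
  by (auto simp: iso_def inverse_arrows_def)

lemma inv_arr_Arr [simp]: "iso C f \<Longrightarrow> inv_arr C f \<in> Arr C"
  and Dom_inv_arr [simp]: "iso C f \<Longrightarrow> Dom C (inv_arr C f) = Cod C f"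
  and Cod_inv_arr [simp]: "iso C f \<Longrightarrow> Cod C (inv_arr C f) = Dom C f"
  and inv_arr_Comp [simp]: "iso C f \<Longrightarrow> inv_arr C f \<cdot> f = Idn C (Dom C f)"
  and Comp_inv_arr [simp]: "iso C f \<Longrightarrow> f \<cdot> inv_arr C f = Idn C (Cod C f)"
  using inverse_arrows_inv_arr[of f] by (auto simp: inverse_arrows_def hom_def)

lemma inv_arr_Comp_assoc [simp]:
  "iso C f \<Longrightarrow> g \<in> Arr C \<Longrightarrow> Cod C g = Dom C f \<Longrightarrow> inv_arr C f \<cdot> (f \<cdot> g) = g"
  by (subst Comp_assoc'[symmetric]) (auto simp: iso_Arr)

lemma Comp_inv_arr_assoc [simp]:
  "iso C f \<Longrightarrow> g \<in> Arr C \<Longrightarrow> Cod C g = Cod C f \<Longrightarrow> f \<cdot> (inv_arr C f \<cdot> g) = g"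
  by (subst Comp_assoc'[symmetric]) (auto simp: iso_Arr)

lemma inverse_arrowsI:
  "f \<in> Arr C \<Longrightarrow> g \<in> Arr C \<Longrightarrow> Dom C g = Cod C f \<Longrightarrow> Cod C g = Dom C f \<Longrightarrow>
   g \<cdot> f = Idn C (Dom C f) \<Longrightarrow> f \<cdot> g = Idn C (Cod C f) \<Longrightarrow> inverse_arrows C f g"
  by (auto simp: inverse_arrows_def hom_def)

lemma iso_Idn [simp]: "x \<in> Obj C \<Longrightarrow> iso C (Idn C x)"
  unfolding iso_def by (rule exI[of _ "Idn C x"], rule inverse_arrowsI) auto

lemma inverse_arrows_Comp:
  assumes "inverse_arrows C f f'" "inverse_arrows C g g'" "Cod C f = Dom C g"
  shows "inverse_arrows C (g \<cdot> f) (f' \<cdot> g')"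
proof (rule inverse_arrowsI)
  have *: "f \<in> Arr C" "f' \<in> Arr C" "g \<in> Arr C" "g' \<in> Arr C" "Dom C f' = Cod C f" "Cod C f' = Dom C f"
    "Dom C g' = Cod C g" "Cod C g' = Dom C g" "f' \<cdot> f = Idn C (Dom C f)" "f \<cdot> f' = Idn C (Cod C f)"
    "g' \<cdot> g = Idn C (Dom C g)" "g \<cdot> g' = Idn C (Cod C g)"
    using assms by (auto simp: inverse_arrows_def hom_def)
  have "g' \<cdot> (g \<cdot> f) = f" "f \<cdot> (f' \<cdot> g') = g'"
    using * assms(3) by (auto intro: Idn_Comp_left)
  then show "(f' \<cdot> g') \<cdot> (g \<cdot> f) = Idn C (Dom C (g \<cdot> f))" "(g \<cdot> f) \<cdot> (f' \<cdot> g') = Idn C (Cod C (g \<cdot> f))"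
    using * assms(3) by auto
qed (use assms in \<open>auto simp: inverse_arrows_def hom_def\<close>)

lemma iso_Comp [simp]: "iso C f \<Longrightarrow> iso C g \<Longrightarrow> Cod C f = Dom C g \<Longrightarrow> iso C (g \<cdot> f)"
  using inverse_arrows_Comp unfolding iso_def by blast

lemma iso_inv_arr [simp]: "iso C f \<Longrightarrow> iso C (inv_arr C f)"
  using inverse_arrowsI[of "inv_arr C f" f] iso_Arr unfolding iso_def[of C "inv_arr C f"] by auto

lemma inv_arr_Idn [simp]: "x \<in> Obj C \<Longrightarrow> inv_arr C (Idn C x) = Idn C x"
  by (intro inv_arr_eq inverse_arrowsI) auto

lemma iso_cancel_left:
  assumes "iso C f" "f \<cdot> g = f \<cdot> h" "g \<in> Arr C" "h \<in> Arr C" "Cod C g = Dom C f" "Cod C h = Dom C f"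
  shows "g = h"
  by (metis assms inv_arr_Comp_assoc)

lemma iso_cancel_right:
  assumes "iso C f" "g \<cdot> f = h \<cdot> f" "g \<in> Arr C" "h \<in> Arr C" "Dom C g = Cod C f" "Dom C h = Cod C f"
  shows "g = h"
proof -
  have "g = (g \<cdot> f) \<cdot> inv_arr C f" using assms(1,3,5) by (simp add: iso_Arr)
  also have "\<dots> = h" unfolding assms(2) using assms(1,4,6) by (simp add: iso_Arr)
  finally show ?thesis .
qed

lemma isomorphic_iso: "iso C f \<Longrightarrow> isomorphic C (Dom C f) (Cod C f)"
  unfolding isomorphic_def by (intro conjI bexI[of _ f]) (auto simp: hom_def dest: iso_Arr)

section \<open>Coproducts and their stability\<close>

lemma coproductI:
  assumes "c \<in> Obj C" "\<And>i. i \<in> I \<Longrightarrow> \<iota> i \<in> hom C (A i) c"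
    and "\<And>x \<phi>. x \<in> Obj C \<Longrightarrow> (\<And>i. i \<in> I \<Longrightarrow> \<phi> i \<in> hom C (A i) x) \<Longrightarrow>
      \<exists>h \<in> hom C c x. \<forall>i \<in> I. h \<cdot> \<iota> i = \<phi> i"
    and "\<And>x h h'. h \<in> hom C c x \<Longrightarrow> h' \<in> hom C c x \<Longrightarrow> (\<And>i. i \<in> I \<Longrightarrow> h \<cdot> \<iota> i = h' \<cdot> \<iota> i) \<Longrightarrow> h = h'"
  shows "is_coproduct C I A c \<iota>"
  unfolding is_coproduct_def
proof (intro conjI ballI allI impI)
  fix x \<phi> assume "x \<in> Obj C" "\<forall>i\<in>I. \<phi> i \<in> hom C (A i) x"
  then obtain h where "h \<in> hom C c x" "\<forall>i \<in> I. h \<cdot> \<iota> i = \<phi> i" using assms(3) by blast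
  then show "\<exists>!h. h \<in> hom C c x \<and> (\<forall>i\<in>I. h \<cdot> \<iota> i = \<phi> i)"
    using assms(4) by (intro ex1I[of _ h]) auto
qed (use assms in auto)

lemma coproduct_hom: "is_coproduct C I A c \<iota> \<Longrightarrow> i \<in> I \<Longrightarrow> \<iota> i \<in> hom C (A i) c"
  and coproduct_Obj: "is_coproduct C I A c \<iota> \<Longrightarrow> c \<in> Obj C"
  by (auto simp: is_coproduct_def)

lemma coproduct_ex1:
  assumes "is_coproduct C I A c \<iota>" "x \<in> Obj C" "\<forall>i\<in>I. \<phi> i \<in> hom C (A i) x"
  shows "\<exists>!h. h \<in> hom C c x \<and> (\<forall>i \<in> I. h \<cdot> \<iota> i = \<phi> i)"
proof -
  have "\<forall>x \<in> Obj C. \<forall>\<phi>. (\<forall>i \<in> I. \<phi> i \<in> hom C (A i) x) \<longrightarrow>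
      (\<exists>!h. h \<in> hom C c x \<and> (\<forall>i \<in> I. h \<cdot> \<iota> i = \<phi> i))"
    using assms(1) unfolding is_coproduct_def by (elim conjE)
  from mp[OF spec[OF bspec[OF this assms(2)]] assms(3)] show ?thesis .
qed

lemma coproduct_ex:
  assumes "is_coproduct C I A c \<iota>" "x \<in> Obj C" "\<And>i. i \<in> I \<Longrightarrow> \<phi> i \<in> hom C (A i) x"
  obtains h where "h \<in> hom C c x" "\<And>i. i \<in> I \<Longrightarrow> h \<cdot> \<iota> i = \<phi> i"
  using coproduct_ex1[OF assms(1,2), of \<phi>] assms(3) by blast

lemma coproduct_eqI:
  assumes "is_coproduct C I A c \<iota>" "h \<in> hom C c x" "h' \<in> hom C c x"
    "\<And>i. i \<in> I \<Longrightarrow> h \<cdot> \<iota> i = h' \<cdot> \<iota> i"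
  shows "h = h'"
proof -
  have x: "x \<in> Obj C" using assms(2) hom_Obj by blast
  have "\<forall>i\<in>I. h \<cdot> \<iota> i \<in> hom C (A i) x"
    using coproduct_hom[OF assms(1)] assms(2) Comp_hom by blast
  then have "\<exists>!k. k \<in> hom C c x \<and> (\<forall>i\<in>I. k \<cdot> \<iota> i = h \<cdot> \<iota> i)"
    by (rule coproduct_ex1[OF assms(1) x])
  then show ?thesis using assms(2-4) by (elim ex1E) (metis (no_types))
qed

lemma coproduct_cong:
  assumes "is_coproduct C I A c \<iota>" "\<And>i. i \<in> I \<Longrightarrow> A i = A' i" "\<And>i. i \<in> I \<Longrightarrow> \<iota> i = \<iota>' i"
  shows "is_coproduct C I A' c \<iota>'"
  using assms unfolding is_coproduct_def by auto

lemma coproduct_reindex: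
  assumes "bij_betw e J I" "is_coproduct C I A c \<iota>"
  shows "is_coproduct C J (\<lambda>j. A (e j)) c (\<lambda>j. \<iota> (e j))"
proof (rule coproductI)
  fix x \<phi> assume x: "x \<in> Obj C" and \<phi>: "\<And>j. j \<in> J \<Longrightarrow> \<phi> j \<in> hom C (A (e j)) x"
  define d where "d = inv_into J e"
  have "\<And>i. i \<in> I \<Longrightarrow> \<phi> (d i) \<in> hom C (A i) x"
    using \<phi> bij_betw_inv_into_right[OF assms(1)] bij_betwE[OF bij_betw_inv_into[OF assms(1)]] unfolding d_def by metis
  then obtain h where "h \<in> hom C c x" "\<And>i. i \<in> I \<Longrightarrow> h \<cdot> \<iota> i = \<phi> (d i)"
    using coproduct_ex[OF assms(2) x, of "\<lambda>i. \<phi> (d i)"] by blast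
  then show "\<exists>h\<in>hom C c x. \<forall>j\<in>J. h \<cdot> \<iota> (e j) = \<phi> j"
    using bij_betw_inv_into_left[OF assms(1)] bij_betwE[OF assms(1)] unfolding d_def by metis
next
  fix x h h' assume "h \<in> hom C c x" "h' \<in> hom C c x" "\<And>j. j \<in> J \<Longrightarrow> h \<cdot> \<iota> (e j) = h' \<cdot> \<iota> (e j)"
  then show "h = h'"
    using coproduct_eqI[OF assms(2)] bij_betw_imp_surj_on[OF assms(1)] by (metis (no_types, lifting) imageE)
qed (use assms bij_betwE[OF assms(1)] in \<open>auto simp: is_coproduct_def\<close>)

text \<open>Lets coherence isomorphisms be absorbed at both ends of a coproduct: the inverses of the
  \<open>\<alpha> i\<close> translate the prescribed components into components on the old summands,
  and the inverse of \<open>\<beta>\<close> carries the induced arrow to the new object.\<close>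

lemma coproduct_iso:
  assumes "is_coproduct C I A c \<iota>"
    and \<alpha>: "\<And>i. i \<in> I \<Longrightarrow> \<alpha> i \<in> hom C (A' i) (A i)" "\<And>i. i \<in> I \<Longrightarrow> iso C (\<alpha> i)"
    and \<beta>: "\<beta> \<in> hom C c c'" "iso C \<beta>"
  shows "is_coproduct C I A' c' (\<lambda>i. \<beta> \<cdot> (\<iota> i \<cdot> \<alpha> i))"
proof (rule coproductI)
  show "c' \<in> Obj C" using \<beta> hom_Obj by blast
  show "\<beta> \<cdot> \<iota> i \<cdot> \<alpha> i \<in> hom C (A' i) c'" if "i \<in> I" for i
    using \<alpha>[OF that] \<beta> coproduct_hom[OF assms(1) that] Comp_hom by blast
  fix x \<phi> assume x: "x \<in> Obj C" and \<phi>: "\<And>i. i \<in> I \<Longrightarrow> \<phi> i \<in> hom C (A' i) x"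
  have "\<And>i. i \<in> I \<Longrightarrow> \<phi> i \<cdot> inv_arr C (\<alpha> i) \<in> hom C (A i) x"
    using \<phi> \<alpha> by (auto simp: hom_def)
  then obtain h where h: "h \<in> hom C c x" "\<And>i. i \<in> I \<Longrightarrow> h \<cdot> \<iota> i = \<phi> i \<cdot> inv_arr C (\<alpha> i)"
    using coproduct_ex[OF assms(1) x, of "\<lambda>i. \<phi> i \<cdot> inv_arr C (\<alpha> i)"] by blast
  show "\<exists>h\<in>hom C c' x. \<forall>i\<in>I. h \<cdot> \<beta> \<cdot> \<iota> i \<cdot> \<alpha> i = \<phi> i"
  proof (intro bexI ballI)
    show "h \<cdot> inv_arr C \<beta> \<in> hom C c' x" using h \<beta> by (auto simp: hom_def)
    fix i assume i: "i \<in> I"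
    have "(h \<cdot> inv_arr C \<beta>) \<cdot> \<beta> \<cdot> \<iota> i \<cdot> \<alpha> i = (h \<cdot> \<iota> i) \<cdot> \<alpha> i"
      using homD[OF h(1)] homD[OF \<beta>(1)] \<beta>(2) homD[OF coproduct_hom[OF assms(1) i]] homD[OF \<alpha>(1)[OF i]] by auto
    also have "\<dots> = \<phi> i"
      using homD[OF \<alpha>(1)[OF i]] \<alpha>(2)[OF i] homD[OF \<phi>[OF i]] by (simp add: h(2)[OF i])
    finally show "(h \<cdot> inv_arr C \<beta>) \<cdot> \<beta> \<cdot> \<iota> i \<cdot> \<alpha> i = \<phi> i" .
  qed
next
  fix x h h' assume h: "h \<in> hom C c' x" "h' \<in> hom C c' x"
    and eq: "\<And>i. i \<in> I \<Longrightarrow> h \<cdot> \<beta> \<cdot> \<iota> i \<cdot> \<alpha> i = h' \<cdot> \<beta> \<cdot> \<iota> i \<cdot> \<alpha> i"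
  have "h \<cdot> \<beta> = h' \<cdot> \<beta>"
  proof (rule coproduct_eqI[OF assms(1)])
    fix i assume i: "i \<in> I"
    show "(h \<cdot> \<beta>) \<cdot> \<iota> i = (h' \<cdot> \<beta>) \<cdot> \<iota> i"
      by (rule iso_cancel_right[OF \<alpha>(2)[OF i]])
        (use eq[OF i] homD[OF h(1)] homD[OF h(2)] homD[OF \<beta>(1)] homD[OF coproduct_hom[OF assms(1) i]] homD[OF \<alpha>(1)[OF i]] in auto)
  qed (use h \<beta> in \<open>auto simp: hom_def\<close>)
  then show "h = h'"
    by (rule iso_cancel_right[OF \<beta>(2)]) (use homD[OF h(1)] homD[OF h(2)] homD[OF \<beta>(1)] in simp_all)
qed

text \<open>Serves degree zero: the only surjection out of [0] is the identity, so there the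
  decomposition has a single summand, whose coprojection must be invertible. The inverse is the
  arrow induced by the identity of that summand.\<close>

lemma coproduct_singleton_iso:
  assumes "is_coproduct C {i} A c \<iota>"
  shows "iso C (\<iota> i)"
proof -
  have \<iota>: "\<iota> i \<in> hom C (A i) c" by (rule coproduct_hom[OF assms]) simp
  note i = homD[OF this]
  have c: "c \<in> Obj C" and A: "A i \<in> Obj C" using hom_Obj[OF \<iota>] by auto
  obtain k where k: "k \<in> hom C c (A i)" "\<And>j. j \<in> {i} \<Longrightarrow> k \<cdot> \<iota> j = Idn C (A j)"
    using coproduct_ex[OF assms A, of "\<lambda>j. Idn C (A j)"] Idn_hom[OF A] by blast
  note k' = homD[OF k(1)]
  have "\<iota> i \<cdot> k = Idn C c"
  proof (rule coproduct_eqI[OF assms])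
    fix j assume "j \<in> {i}"
    then show "(\<iota> i \<cdot> k) \<cdot> \<iota> j = Idn C c \<cdot> \<iota> j" using i k k' by simp
  qed (use \<iota> k(1) Comp_hom Idn_hom[OF c] in blast)+
  then have "inverse_arrows C (\<iota> i) k" using i k' k(2)[of i] by (intro inverse_arrowsI) simp_all
  then show ?thesis unfolding iso_def by (rule exI)
qed

lemma coproduct_singleton:
  assumes "iso C (\<iota> i)"
  shows "is_coproduct C {i} (\<lambda>i. Dom C (\<iota> i)) (Cod C (\<iota> i)) \<iota>"
proof (rule coproductI)
  fix x \<phi> assume "\<And>j. j \<in> {i} \<Longrightarrow> \<phi> j \<in> hom C (Dom C (\<iota> j)) x"
  then have "\<phi> i \<in> hom C (Dom C (\<iota> i)) x" by simp
  then show "\<exists>h\<in>hom C (Cod C (\<iota> i)) x. \<forall>j\<in>{i}. h \<cdot> \<iota> j = \<phi> j"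
    using assms by (intro bexI[of _ "\<phi> i \<cdot> inv_arr C (\<iota> i)"]) (auto simp: hom_def iso_Arr)
next
  fix x h h' assume "h \<in> hom C (Cod C (\<iota> i)) x" "h' \<in> hom C (Cod C (\<iota> i)) x" "\<And>j. j \<in> {i} \<Longrightarrow> h \<cdot> \<iota> j = h' \<cdot> \<iota> j"
  then show "h = h'" using iso_cancel_right[OF assms, of h h'] by (auto simp: hom_def)
qed (use iso_Arr[OF assms] in \<open>auto simp: hom_def\<close>)

lemma coproduct_Sigma:
  assumes "is_coproduct C I A c \<iota>" "\<And>i. i \<in> I \<Longrightarrow> is_coproduct C (J i) (B i) (A i) (\<kappa> i)"
  shows "is_coproduct C (Sigma I J) (\<lambda>(i, j). B i j) c (\<lambda>(i, j). \<iota> i \<cdot> \<kappa> i j)"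
proof (rule coproductI)
  fix x \<phi> assume x: "x \<in> Obj C" and \<phi>: "\<And>ij. ij \<in> Sigma I J \<Longrightarrow> \<phi> ij \<in> hom C (case ij of (i, j) \<Rightarrow> B i j) x"
  have "\<exists>h \<in> hom C (A i) x. \<forall>j \<in> J i. h \<cdot> \<kappa> i j = \<phi> (i, j)" if "i \<in> I" for i
    using coproduct_ex[OF assms(2)[OF that] x, of "\<lambda>j. \<phi> (i, j)"] \<phi> that by (metis SigmaI case_prod_conv)
  then obtain h where h: "\<And>i. i \<in> I \<Longrightarrow> h i \<in> hom C (A i) x" "\<And>i j. i \<in> I \<Longrightarrow> j \<in> J i \<Longrightarrow> h i \<cdot> \<kappa> i j = \<phi> (i, j)"
    by metis
  obtain k where k: "k \<in> hom C c x" "\<And>i. i \<in> I \<Longrightarrow> k \<cdot> \<iota> i = h i"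
    using coproduct_ex[OF assms(1) x h(1)] by blast
  have "k \<cdot> \<iota> i \<cdot> \<kappa> i j = \<phi> (i, j)" if "i \<in> I" "j \<in> J i" for i j
    using Comp_assoc[OF coproduct_hom[OF assms(2) that(2)] coproduct_hom[OF assms(1)] k(1)] that h k by simp
  then show "\<exists>h\<in>hom C c x. \<forall>ij\<in>Sigma I J. h \<cdot> (case ij of (i, j) \<Rightarrow> \<iota> i \<cdot> \<kappa> i j) = \<phi> ij"
    using k by auto
next
  fix x h h' assume h: "h \<in> hom C c x" "h' \<in> hom C c x"
    and eq: "\<And>ij. ij \<in> Sigma I J \<Longrightarrow> h \<cdot> (case ij of (i, j) \<Rightarrow> \<iota> i \<cdot> \<kappa> i j) = h' \<cdot> (case ij of (i, j) \<Rightarrow> \<iota> i \<cdot> \<kappa> i j)"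
  show "h = h'"
  proof (rule coproduct_eqI[OF assms(1) h])
    fix i assume i: "i \<in> I"
    show "h \<cdot> \<iota> i = h' \<cdot> \<iota> i"
    proof (rule coproduct_eqI[OF assms(2)[OF i]])
      show "h \<cdot> \<iota> i \<in> hom C (A i) x" "h' \<cdot> \<iota> i \<in> hom C (A i) x"
        using h coproduct_hom[OF assms(1) i] Comp_hom by blast+
      fix j assume j: "j \<in> J i"
      show "(h \<cdot> \<iota> i) \<cdot> \<kappa> i j = (h' \<cdot> \<iota> i) \<cdot> \<kappa> i j"
        using Comp_assoc[OF coproduct_hom[OF assms(2)[OF i] j] coproduct_hom[OF assms(1) i]] h eq[of "(i, j)"] i j by simp
    qed
  qed
qed (auto simp: coproduct_Obj[OF assms(1)] intro: Comp_hom coproduct_hom[OF assms(1)] coproduct_hom[OF assms(2)])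

text \<open>Converse of \<open>coproduct_Sigma\<close>: arrows out of \<open>A i\<close> are the
  same as families on its parts, so a double coproduct with known inner coproducts determines the
  outer one. It permits the exchange of two coproducts in tensor products of quivers.\<close>

lemma coproduct_cancel:
  assumes "is_coproduct C (Sigma I J) (\<lambda>(i, j). B i j) c (\<lambda>(i, j). \<iota> i \<cdot> \<kappa> i j)"
    and "\<And>i. i \<in> I \<Longrightarrow> is_coproduct C (J i) (B i) (A i) (\<kappa> i)"
    and \<iota>: "\<And>i. i \<in> I \<Longrightarrow> \<iota> i \<in> hom C (A i) c"
  shows "is_coproduct C I A c \<iota>"
proof (rule coproductI)
  fix x \<phi> assume x: "x \<in> Obj C" and \<phi>: "\<And>i. i \<in> I \<Longrightarrow> \<phi> i \<in> hom C (A i) x"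
  have "(case ij of (i, j) \<Rightarrow> \<phi> i \<cdot> \<kappa> i j) \<in> hom C (case ij of (i, j) \<Rightarrow> B i j) x" if "ij \<in> Sigma I J" for ij
    using that by (auto intro: Comp_hom \<phi> coproduct_hom[OF assms(2)])
  then obtain k where k: "k \<in> hom C c x" "\<And>ij. ij \<in> Sigma I J \<Longrightarrow>
      k \<cdot> (case ij of (i, j) \<Rightarrow> \<iota> i \<cdot> \<kappa> i j) = (case ij of (i, j) \<Rightarrow> \<phi> i \<cdot> \<kappa> i j)"
    using coproduct_ex[OF assms(1) x, of "\<lambda>(i, j). \<phi> i \<cdot> \<kappa> i j"] by blast
  have "k \<cdot> \<iota> i = \<phi> i" if i: "i \<in> I" for i
  proof (rule coproduct_eqI[OF assms(2)[OF i]])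
    fix j assume "j \<in> J i"
    then show "(k \<cdot> \<iota> i) \<cdot> \<kappa> i j = \<phi> i \<cdot> \<kappa> i j"
      using Comp_assoc[OF coproduct_hom[OF assms(2)[OF i]] \<iota>[OF i] k(1)] k(2)[of "(i, j)"] i by simp
  qed (use \<phi>[OF i] \<iota>[OF i] k(1) Comp_hom in blast)+
  then show "\<exists>h\<in>hom C c x. \<forall>i\<in>I. h \<cdot> \<iota> i = \<phi> i" using k by auto
next
  fix x h h' assume h: "h \<in> hom C c x" "h' \<in> hom C c x" and eq: "\<And>i. i \<in> I \<Longrightarrow> h \<cdot> \<iota> i = h' \<cdot> \<iota> i"
  show "h = h'"
  proof (rule coproduct_eqI[OF assms(1) h])
    fix ij assume "ij \<in> Sigma I J"
    then obtain i j where ij: "i \<in> I" "j \<in> J i" "ij = (i, j)" by (rule SigmaE)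
    show "h \<cdot> (case ij of (i, j) \<Rightarrow> \<iota> i \<cdot> \<kappa> i j) = h' \<cdot> (case ij of (i, j) \<Rightarrow> \<iota> i \<cdot> \<kappa> i j)"
      unfolding ij(3) case_prod_conv
      using Comp_assoc[OF coproduct_hom[OF assms(2)[OF ij(1)] ij(2)] \<iota>[OF ij(1)] h(1)]
        Comp_assoc[OF coproduct_hom[OF assms(2)[OF ij(1)] ij(2)] \<iota>[OF ij(1)] h(2)] eq[OF ij(1)] by simp
  qed
qed (use coproduct_Obj[OF assms(1)] \<iota> in auto)

text \<open>\<open>coprod\<close> and \<open>coproj\<close> are picked by choice; they mean
  something only once some coproduct is known to exist.\<close>

lemma chosen_coproductI:
  assumes "is_coproduct C I A c \<iota>"
  shows "is_coproduct C I A (coprod C I A) (coproj C I A)"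
  unfolding coprod_def coproj_def chosen_coproduct_def
  by (rule someI2[of _ "(c, \<iota>)"]) (use assms in auto)

lemma discrete_colimit_coproduct:
  assumes colim: "is_colimit (discrete A) C D c \<iota>"
    and D: "\<And>i. i \<in> A \<Longrightarrow> fob D i \<in> Obj C" "\<And>i. i \<in> A \<Longrightarrow> far D i = Idn C (fob D i)"
  shows "is_coproduct C A (fob D) c \<iota>"
proof -
  have cocone: "is_cocone (discrete A) C D x \<phi> \<longleftrightarrow> x \<in> Obj C \<and> (\<forall>i\<in>A. \<phi> i \<in> hom C (fob D i) x)" for x \<phi>
    using D by (auto simp: is_cocone_def discrete_def hom_def)
  have O: "Obj (discrete A) = A" by (simp add: discrete_def)
  have cc: "c \<in> Obj C" "\<And>i. i \<in> A \<Longrightarrow> \<iota> i \<in> hom C (fob D i) c" using colim by (auto simp: is_colimit_def cocone)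
  have univ: "\<exists>!h. h \<in> hom C c x \<and> (\<forall>i\<in>A. h \<cdot> \<iota> i = \<phi> i)"
    if "x \<in> Obj C" "\<forall>i\<in>A. \<phi> i \<in> hom C (fob D i) x" for x \<phi>
    using colim that unfolding is_colimit_def cocone O by blast
  then show ?thesis unfolding is_coproduct_def using cc by blast
qed

text \<open>\<open>cocomplete\<close> quantifies over diagrams on the type \<open>'u\<close> only. A
  family over another index type is therefore carried along an injection \<open>e\<close> into a
  discrete category on \<open>'u\<close> and brought back afterwards.\<close>

lemma cocomplete_coproduct:
  fixes e :: "'i \<Rightarrow> 'u"
  assumes "cocomplete TYPE('u) C" and e: "inj_on e I" and A: "\<And>i. i \<in> I \<Longrightarrow> A i \<in> Obj C"
  shows "is_coproduct C I A (coprod C I A) (coproj C I A)"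
proof -
  define D where "D = \<lparr>fob = \<lambda>j. A (inv_into I e j), far = \<lambda>j. Idn C (A (inv_into I e j))\<rparr>"
  have inv: "inv_into I e (e i) = i" if "i \<in> I" for i using e that by simp
  have "is_functor (discrete (e ` I)) C D"
    using A by (auto simp: is_functor_def D_def discrete_def hom_def inv category_axioms category_discrete[unfolded discrete_def])
  then obtain c \<iota> where c: "is_colimit (discrete (e ` I)) C D c \<iota>" using assms(1) unfolding cocomplete_def by blast
  have "is_coproduct C (e ` I) (fob D) c \<iota>"
    by (rule discrete_colimit_coproduct[OF c]) (use A in \<open>auto simp: D_def inv\<close>)
  from coproduct_reindex[OF inj_on_imp_bij_betw[OF e] this]
  have "is_coproduct C I A c (\<lambda>i. \<iota> (e i))"
    by (rule coproduct_cong) (auto simp: D_def inv)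
  then show ?thesis by (rule chosen_coproductI)
qed

end

section \<open>Strictification of monoidal categories\<close>

context category
begin

lemma Comp_rewrite:
  "a \<cdot> b = c \<Longrightarrow> a \<in> Arr C \<Longrightarrow> b \<in> Arr C \<Longrightarrow> k \<in> Arr C \<Longrightarrow> Cod C b = Dom C a \<Longrightarrow> Cod C k = Dom C b \<Longrightarrow>
   a \<cdot> (b \<cdot> k) = c \<cdot> k"
  by (metis Comp_assoc')

end

context monoidal_category
begin

declare Tensor_Obj [simp] Unit_Obj [simp]

lemma TensorArr_Arr [simp]: "f \<in> Arr M \<Longrightarrow> g \<in> Arr M \<Longrightarrow> f \<odot> g \<in> Arr M"
  and Dom_TensorArr [simp]: "f \<in> Arr M \<Longrightarrow> g \<in> Arr M \<Longrightarrow> Dom M (f \<odot> g) = Dom M f \<otimes> Dom M g"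
  and Cod_TensorArr [simp]: "f \<in> Arr M \<Longrightarrow> g \<in> Arr M \<Longrightarrow> Cod M (f \<odot> g) = Cod M f \<otimes> Cod M g"
  using TensorArr_hom[OF Arr_hom Arr_hom, of f g] by (auto simp: hom_def)

lemmas TensorArr_Idn' [simp] = TensorArr_Idn

lemma interchange:
  "f \<in> Arr M \<Longrightarrow> f' \<in> Arr M \<Longrightarrow> g \<in> Arr M \<Longrightarrow> g' \<in> Arr M \<Longrightarrow> Cod M f = Dom M f' \<Longrightarrow> Cod M g = Dom M g' \<Longrightarrow>
   (f' \<odot> g') \<cdot> (f \<odot> g) = (f' \<cdot> f) \<odot> (g' \<cdot> g)"
  by (rule TensorArr_Comp[symmetric]) (auto simp: hom_def)

lemma interchange_assoc:
  "f \<in> Arr M \<Longrightarrow> f' \<in> Arr M \<Longrightarrow> g \<in> Arr M \<Longrightarrow> g' \<in> Arr M \<Longrightarrow> Cod M f = Dom M f' \<Longrightarrow> Cod M g = Dom M g' \<Longrightarrow>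
   k \<in> Arr M \<Longrightarrow> Cod M k = Dom M f \<otimes> Dom M g \<Longrightarrow>
   (f' \<odot> g') \<cdot> ((f \<odot> g) \<cdot> k) = ((f' \<cdot> f) \<odot> (g' \<cdot> g)) \<cdot> k"
  by (intro Comp_rewrite interchange) auto

lemma Assoc_Arr [simp]: "x \<in> Obj M \<Longrightarrow> y \<in> Obj M \<Longrightarrow> z \<in> Obj M \<Longrightarrow> Assoc M x y z \<in> Arr M"
  and Dom_Assoc [simp]: "x \<in> Obj M \<Longrightarrow> y \<in> Obj M \<Longrightarrow> z \<in> Obj M \<Longrightarrow> Dom M (Assoc M x y z) = (x \<otimes> y) \<otimes> z"
  and Cod_Assoc [simp]: "x \<in> Obj M \<Longrightarrow> y \<in> Obj M \<Longrightarrow> z \<in> Obj M \<Longrightarrow> Cod M (Assoc M x y z) = x \<otimes> (y \<otimes> z)"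
  and LUnit_Arr [simp]: "x \<in> Obj M \<Longrightarrow> LUnit M x \<in> Arr M"
  and Dom_LUnit [simp]: "x \<in> Obj M \<Longrightarrow> Dom M (LUnit M x) = Unit M \<otimes> x"
  and Cod_LUnit [simp]: "x \<in> Obj M \<Longrightarrow> Cod M (LUnit M x) = x"
  and RUnit_Arr [simp]: "x \<in> Obj M \<Longrightarrow> RUnit M x \<in> Arr M"
  and Dom_RUnit [simp]: "x \<in> Obj M \<Longrightarrow> Dom M (RUnit M x) = x \<otimes> Unit M"
  and Cod_RUnit [simp]: "x \<in> Obj M \<Longrightarrow> Cod M (RUnit M x) = x"
  using Assoc_hom LUnit_hom RUnit_hom by (auto simp: hom_def)

declare Assoc_iso [simp] LUnit_iso [simp] RUnit_iso [simp]

lemma Assoc_natural': "f \<in> Arr M \<Longrightarrow> g \<in> Arr M \<Longrightarrow> h \<in> Arr M \<Longrightarrow>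
    Assoc M (Cod M f) (Cod M g) (Cod M h) \<cdot> ((f \<odot> g) \<odot> h) = (f \<odot> (g \<odot> h)) \<cdot> Assoc M (Dom M f) (Dom M g) (Dom M h)"
  by (intro Assoc_natural Arr_hom)

lemma LUnit_natural': "f \<in> Arr M \<Longrightarrow> LUnit M (Cod M f) \<cdot> (Idn M (Unit M) \<odot> f) = f \<cdot> LUnit M (Dom M f)"
  and RUnit_natural': "f \<in> Arr M \<Longrightarrow> RUnit M (Cod M f) \<cdot> (f \<odot> Idn M (Unit M)) = f \<cdot> RUnit M (Dom M f)"
  by (intro LUnit_natural RUnit_natural Arr_hom; assumption)+

lemma inverse_arrows_TensorArr:
  assumes "inverse_arrows M f f'" "inverse_arrows M g g'"
  shows "inverse_arrows M (f \<odot> g) (f' \<odot> g')"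
proof -
  have "f \<in> Arr M" "f' \<in> Arr M" "g \<in> Arr M" "g' \<in> Arr M" "Dom M f' = Cod M f" "Cod M f' = Dom M f"
    "Dom M g' = Cod M g" "Cod M g' = Dom M g" "f' \<cdot> f = Idn M (Dom M f)" "f \<cdot> f' = Idn M (Cod M f)"
    "g' \<cdot> g = Idn M (Dom M g)" "g \<cdot> g' = Idn M (Cod M g)"
    using assms by (auto simp: inverse_arrows_def hom_def)
  then show ?thesis by (intro inverse_arrowsI) (auto simp: interchange)
qed

lemma iso_TensorArr [simp]: "iso M f \<Longrightarrow> iso M g \<Longrightarrow> iso M (f \<odot> g)"
  using inverse_arrows_TensorArr unfolding iso_def by blast

text \<open>Tensoring with the unit is faithful, being naturally isomorphic to the identity through
  the left unitor; an equation of arrows may thus be checked after tensoring.\<close>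

lemma Unit_TensorArr_cancel:
  assumes "Idn M (Unit M) \<odot> f = Idn M (Unit M) \<odot> g" "f \<in> Arr M" "g \<in> Arr M" "Dom M f = Dom M g" "Cod M f = Cod M g"
  shows "f = g"
proof -
  have "f \<cdot> LUnit M (Dom M f) = g \<cdot> LUnit M (Dom M f)"
    using LUnit_natural'[of f] LUnit_natural'[of g] assms by simp
  then show ?thesis by (rule iso_cancel_right[rotated]) (use assms in auto)
qed

lemma TensorArr_Unit_cancel:
  assumes "f \<odot> Idn M (Unit M) = g \<odot> Idn M (Unit M)" "f \<in> Arr M" "g \<in> Arr M" "Dom M f = Dom M g" "Cod M f = Cod M g"
  shows "f = g"
proof -
  have "f \<cdot> RUnit M (Dom M f) = g \<cdot> RUnit M (Dom M f)"
    using RUnit_natural'[of f] RUnit_natural'[of g] assms by simp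
  then show ?thesis by (rule iso_cancel_right[rotated]) (use assms in auto)
qed

text \<open>The next three lemmas are Kelly's: the remaining unit coherences follow from pentagon and
  triangle.\<close>

lemma LUnit_Tensor:
  assumes [simp]: "x \<in> Obj M" "y \<in> Obj M"
  shows "LUnit M (x \<otimes> y) \<cdot> Assoc M (Unit M) x y = LUnit M x \<odot> Idn M y"
proof -
  let ?I = "Unit M" and ?i = "Idn M (Unit M)"
  let ?K = "Assoc M ?I (?I \<otimes> x) y \<cdot> (Assoc M ?I ?I x \<odot> Idn M y)"
  have "(?i \<odot> (LUnit M (x \<otimes> y) \<cdot> Assoc M ?I x y)) \<cdot> ?K =
      (?i \<odot> LUnit M (x \<otimes> y)) \<cdot> ((?i \<odot> Assoc M ?I x y) \<cdot> ?K)"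
    by (subst interchange_assoc) auto
  also have "(?i \<odot> Assoc M ?I x y) \<cdot> ?K = Assoc M ?I ?I (x \<otimes> y) \<cdot> Assoc M (?I \<otimes> ?I) x y"
    by (rule pentagon[symmetric]) auto
  also have "(?i \<odot> LUnit M (x \<otimes> y)) \<cdot> (Assoc M ?I ?I (x \<otimes> y) \<cdot> Assoc M (?I \<otimes> ?I) x y) =
      (RUnit M ?I \<odot> Idn M (x \<otimes> y)) \<cdot> Assoc M (?I \<otimes> ?I) x y"
    by (rule Comp_rewrite) (auto intro: triangle)
  also have "\<dots> = Assoc M ?I x y \<cdot> ((RUnit M ?I \<odot> Idn M x) \<odot> Idn M y)"
    using Assoc_natural'[of "RUnit M ?I" "Idn M x" "Idn M y"] by simp
  also have "(RUnit M ?I \<odot> Idn M x) \<odot> Idn M y =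
      ((?i \<odot> LUnit M x) \<odot> Idn M y) \<cdot> (Assoc M ?I ?I x \<odot> Idn M y)"
    by (simp add: interchange triangle)
  also have "Assoc M ?I x y \<cdot> (((?i \<odot> LUnit M x) \<odot> Idn M y) \<cdot> (Assoc M ?I ?I x \<odot> Idn M y)) =
      ((?i \<odot> (LUnit M x \<odot> Idn M y)) \<cdot> Assoc M ?I (?I \<otimes> x) y) \<cdot> (Assoc M ?I ?I x \<odot> Idn M y)"
    by (rule Comp_rewrite) (use Assoc_natural'[of ?i "LUnit M x" "Idn M y"] in auto)
  also have "\<dots> = (?i \<odot> (LUnit M x \<odot> Idn M y)) \<cdot> ?K" by simp
  finally have "?i \<odot> (LUnit M (x \<otimes> y) \<cdot> Assoc M ?I x y) = ?i \<odot> (LUnit M x \<odot> Idn M y)"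
    by (rule iso_cancel_right[rotated]) auto
  then show ?thesis by (rule Unit_TensorArr_cancel) auto
qed

lemma RUnit_Tensor:
  assumes [simp]: "x \<in> Obj M" "y \<in> Obj M"
  shows "(Idn M x \<odot> RUnit M y) \<cdot> Assoc M x y (Unit M) = RUnit M (x \<otimes> y)"
proof -
  let ?I = "Unit M" and ?i = "Idn M (Unit M)"
  have "Assoc M x y ?I \<cdot> (RUnit M (x \<otimes> y) \<odot> ?i) =
      Assoc M x y ?I \<cdot> (((Idn M x \<odot> Idn M y) \<odot> LUnit M ?I) \<cdot> Assoc M (x \<otimes> y) ?I ?I)"
    by (simp add: triangle)
  also have "\<dots> = ((Idn M x \<odot> (Idn M y \<odot> LUnit M ?I)) \<cdot> Assoc M x y (?I \<otimes> ?I)) \<cdot> Assoc M (x \<otimes> y) ?I ?I"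
    by (rule Comp_rewrite) (use Assoc_natural'[of "Idn M x" "Idn M y" "LUnit M ?I"] in auto)
  also have "\<dots> = (Idn M x \<odot> (Idn M y \<odot> LUnit M ?I)) \<cdot>
      (Idn M x \<odot> Assoc M y ?I ?I) \<cdot> Assoc M x (y \<otimes> ?I) ?I \<cdot> (Assoc M x y ?I \<odot> ?i)"
    using pentagon[of x y ?I ?I] by simp
  also have "\<dots> = (Idn M x \<odot> (RUnit M y \<odot> ?i)) \<cdot> Assoc M x (y \<otimes> ?I) ?I \<cdot> (Assoc M x y ?I \<odot> ?i)"
    by (subst interchange_assoc) (auto simp: triangle)
  also have "\<dots> = (Assoc M x y ?I \<cdot> ((Idn M x \<odot> RUnit M y) \<odot> ?i)) \<cdot> (Assoc M x y ?I \<odot> ?i)"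
    by (rule Comp_rewrite) (use Assoc_natural'[of "Idn M x" "RUnit M y" ?i] in auto)
  also have "\<dots> = Assoc M x y ?I \<cdot> (((Idn M x \<odot> RUnit M y) \<cdot> Assoc M x y ?I) \<odot> ?i)"
    by (simp add: interchange)
  finally have "RUnit M (x \<otimes> y) \<odot> ?i = ((Idn M x \<odot> RUnit M y) \<cdot> Assoc M x y ?I) \<odot> ?i"
    by (rule iso_cancel_left[rotated]) auto
  then have "RUnit M (x \<otimes> y) = (Idn M x \<odot> RUnit M y) \<cdot> Assoc M x y ?I"
    by (rule TensorArr_Unit_cancel) auto
  then show ?thesis ..
qed

lemma LUnit_Unit: "LUnit M (Unit M) = RUnit M (Unit M)"
proof -
  let ?I = "Unit M" and ?i = "Idn M (Unit M)"
  have "LUnit M (?I \<otimes> ?I) = ?i \<odot> LUnit M ?I"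
    by (rule iso_cancel_left[of "LUnit M ?I"]) (use LUnit_natural'[of "LUnit M ?I"] in auto)
  then have "LUnit M ?I \<odot> ?i = RUnit M ?I \<odot> ?i"
    using LUnit_Tensor[of ?I ?I] triangle[of ?I ?I] by simp
  then show ?thesis by (rule TensorArr_Unit_cancel) auto
qed

section \<open>Coherence of iterated tensor products\<close>

lemma tens_Cons: "xs \<noteq> [] \<Longrightarrow> tens M (x # xs) = x \<otimes> tens M xs"
  by (cases xs) auto

lemma tens_Obj [simp]: "set xs \<subseteq> Obj M \<Longrightarrow> tens M xs \<in> Obj M"
  by (induction xs rule: induct_list012) auto

lemma tens_append_hom_iso:
  "set xs \<subseteq> Obj M \<Longrightarrow> set ys \<subseteq> Obj M \<Longrightarrow>
   tens_append M xs ys \<in> hom M (tens M xs \<otimes> tens M ys) (tens M (xs @ ys)) \<and> iso M (tens_append M xs ys)"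
proof (induction xs rule: induct_list012)
  case 1
  then show ?case using LUnit_hom by simp
next
  case (2 x)
  then show ?case by (cases ys) (auto simp: hom_def)
next
  case (3 x x' xs)
  then show ?case by (cases ys) (auto simp: hom_def tens_Cons)
qed

lemma tens_append_Arr [simp]: "set xs \<subseteq> Obj M \<Longrightarrow> set ys \<subseteq> Obj M \<Longrightarrow> tens_append M xs ys \<in> Arr M"
  and Dom_tens_append [simp]: "set xs \<subseteq> Obj M \<Longrightarrow> set ys \<subseteq> Obj M \<Longrightarrow>
    Dom M (tens_append M xs ys) = tens M xs \<otimes> tens M ys"
  and Cod_tens_append [simp]: "set xs \<subseteq> Obj M \<Longrightarrow> set ys \<subseteq> Obj M \<Longrightarrow>
    Cod M (tens_append M xs ys) = tens M (xs @ ys)"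
  and iso_tens_append [simp]: "set xs \<subseteq> Obj M \<Longrightarrow> set ys \<subseteq> Obj M \<Longrightarrow> iso M (tens_append M xs ys)"
  using tens_append_hom_iso[of xs ys] by (auto simp: hom_def)

text \<open>\<open>tens_append\<close> uses the left unitor when its first list is empty. For two
  empty lists the claim is therefore that both unitors of the unit object agree, which is
  \<open>LUnit_Unit\<close>.\<close>

lemma tens_append_Nil2: "set xs \<subseteq> Obj M \<Longrightarrow> tens_append M xs [] = RUnit M (tens M xs)"
  by (cases xs) (auto simp: LUnit_Unit)

lemma tens_append_Cons:
  "set xs \<subseteq> Obj M \<Longrightarrow> set ys \<subseteq> Obj M \<Longrightarrow> x \<in> Obj M \<Longrightarrow> xs \<noteq> [] \<Longrightarrow> ys \<noteq> [] \<Longrightarrow>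
   tens_append M (x # xs) ys = (Idn M x \<odot> tens_append M xs ys) \<cdot> Assoc M x (tens M xs) (tens M ys)"
  by (cases xs; cases ys) auto

lemma tens_append_singleton: "ys \<noteq> [] \<Longrightarrow> tens_append M [x] ys = Idn M (x \<otimes> tens M ys)"
  by (cases ys) auto

text \<open>This makes \<open>strict_box\<close> associative on the nose. An empty list reduces the
  claim to one of the unit coherences, since \<open>tens_append\<close> switches to unitors there.
  Otherwise induction on \<open>xs\<close>, each step being a pentagon between two naturality
  squares of the associator.\<close>

lemma tens_append_coherence:
  assumes [simp]: "set xs \<subseteq> Obj M" "set ys \<subseteq> Obj M" "set zs \<subseteq> Obj M"
  shows "tens_append M xs (ys @ zs) \<cdot> ((Idn M (tens M xs) \<odot> tens_append M ys zs) \<cdot>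
      Assoc M (tens M xs) (tens M ys) (tens M zs)) =
    tens_append M (xs @ ys) zs \<cdot> (tens_append M xs ys \<odot> Idn M (tens M zs))"
proof -
  consider "xs = []" | "ys = []" | "zs = []" | "xs \<noteq> []" "ys \<noteq> []" "zs \<noteq> []" by blast
  then show ?thesis
  proof cases
    case 1
    have "LUnit M (tens M (ys @ zs)) \<cdot> ((Idn M (Unit M) \<odot> tens_append M ys zs) \<cdot>
        Assoc M (Unit M) (tens M ys) (tens M zs)) =
      (tens_append M ys zs \<cdot> LUnit M (tens M ys \<otimes> tens M zs)) \<cdot> Assoc M (Unit M) (tens M ys) (tens M zs)"
      by (rule Comp_rewrite) (use LUnit_natural'[of "tens_append M ys zs"] in auto)
    then show ?thesis using 1 by (simp add: LUnit_Tensor)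
  next
    case 2
    then show ?thesis by (simp add: tens_append_Nil2 triangle)
  next
    case 3
    have "tens_append M xs ys \<cdot> ((Idn M (tens M xs) \<odot> RUnit M (tens M ys)) \<cdot>
        Assoc M (tens M xs) (tens M ys) (Unit M)) =
      RUnit M (tens M (xs @ ys)) \<cdot> (tens_append M xs ys \<odot> Idn M (Unit M))"
      using RUnit_natural'[of "tens_append M xs ys"] by (simp add: RUnit_Tensor)
    then show ?thesis using 3 by (simp add: tens_append_Nil2)
  next
    case 4
    from \<open>xs \<noteq> []\<close> \<open>set xs \<subseteq> Obj M\<close> show ?thesis
    proof (induction xs rule: list_nonempty_induct)
      case (single x)
      then show ?case using 4 by (simp add: tens_append_singleton tens_append_Cons tens_Cons)
    next
      case (cons x xs)
      let ?x = "tens M xs" and ?y = "tens M ys" and ?z = "tens M zs"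
      have [simp]: "x \<in> Obj M" "set xs \<subseteq> Obj M" using cons by auto
      have "tens_append M (x # xs) (ys @ zs) \<cdot> ((Idn M (tens M (x # xs)) \<odot> tens_append M ys zs) \<cdot>
          Assoc M (tens M (x # xs)) ?y ?z) =
        (Idn M x \<odot> tens_append M xs (ys @ zs)) \<cdot> (Assoc M x ?x (tens M (ys @ zs)) \<cdot>
          (((Idn M x \<odot> Idn M ?x) \<odot> tens_append M ys zs) \<cdot> Assoc M (x \<otimes> ?x) ?y ?z))"
        using cons 4 by (simp add: tens_append_Cons tens_Cons)
      also have "Assoc M x ?x (tens M (ys @ zs)) \<cdot>
          (((Idn M x \<odot> Idn M ?x) \<odot> tens_append M ys zs) \<cdot> Assoc M (x \<otimes> ?x) ?y ?z) =
          ((Idn M x \<odot> (Idn M ?x \<odot> tens_append M ys zs)) \<cdot> Assoc M x ?x (?y \<otimes> ?z)) \<cdot> Assoc M (x \<otimes> ?x) ?y ?z"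
        by (rule Comp_rewrite) (use Assoc_natural'[of "Idn M x" "Idn M ?x" "tens_append M ys zs"] in auto)
      also have "\<dots> = (Idn M x \<odot> (Idn M ?x \<odot> tens_append M ys zs)) \<cdot>
          (Idn M x \<odot> Assoc M ?x ?y ?z) \<cdot> Assoc M x (?x \<otimes> ?y) ?z \<cdot> (Assoc M x ?x ?y \<odot> Idn M ?z)"
        using pentagon[of x ?x ?y ?z] by simp
      also have "(Idn M x \<odot> tens_append M xs (ys @ zs)) \<cdot> \<dots> =
          (Idn M x \<odot> (tens_append M xs (ys @ zs) \<cdot> ((Idn M ?x \<odot> tens_append M ys zs) \<cdot> Assoc M ?x ?y ?z))) \<cdot>
            Assoc M x (?x \<otimes> ?y) ?z \<cdot> (Assoc M x ?x ?y \<odot> Idn M ?z)"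
        by (simp add: interchange_assoc)
      also have "\<dots> = (Idn M x \<odot> tens_append M (xs @ ys) zs) \<cdot>
          (Idn M x \<odot> (tens_append M xs ys \<odot> Idn M ?z)) \<cdot> Assoc M x (?x \<otimes> ?y) ?z \<cdot> (Assoc M x ?x ?y \<odot> Idn M ?z)"
        using cons by (simp add: interchange_assoc)
      also have "(Idn M x \<odot> (tens_append M xs ys \<odot> Idn M ?z)) \<cdot> Assoc M x (?x \<otimes> ?y) ?z \<cdot> (Assoc M x ?x ?y \<odot> Idn M ?z) =
          (Assoc M x (tens M (xs @ ys)) ?z \<cdot> ((Idn M x \<odot> tens_append M xs ys) \<odot> Idn M ?z)) \<cdot> (Assoc M x ?x ?y \<odot> Idn M ?z)"
        by (rule Comp_rewrite) (use Assoc_natural'[of "Idn M x" "tens_append M xs ys" "Idn M ?z"] in auto)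
      also have "\<dots> = Assoc M x (tens M (xs @ ys)) ?z \<cdot> (tens_append M (x # xs) ys \<odot> Idn M ?z)"
        using cons 4 by (simp add: tens_append_Cons interchange)
      also have "(Idn M x \<odot> tens_append M (xs @ ys) zs) \<cdot> \<dots> =
          tens_append M (x # xs @ ys) zs \<cdot> (tens_append M (x # xs) ys \<odot> Idn M ?z)"
        using cons 4 by (simp add: tens_append_Cons tens_Cons)
      finally show ?case by simp
    qed
  qed
qed

end

text \<open>Objects are lists, with concatenation as tensor product, so that the associativity and
  unit laws hold as equations. Source and target are stored in an arrow because different lists may
  have the same tensor product.\<close>

definition strictify :: "('o, 'm, 'z) mon_cat_scheme \<Rightarrow> ('o list, 'o list \<times> 'o list \<times> 'm) cat" where
  "strictify M = \<lparr>Obj = {xs. set xs \<subseteq> Obj M},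
     Arr = {(xs, ys, f). set xs \<subseteq> Obj M \<and> set ys \<subseteq> Obj M \<and> f \<in> hom M (tens M xs) (tens M ys)},
     Dom = (\<lambda>(xs, ys, f). xs), Cod = (\<lambda>(xs, ys, f). ys), Idn = (\<lambda>xs. (xs, xs, Idn M (tens M xs))),
     Comp = (\<lambda>(ys, zs, g) (xs, ys', f). (xs, zs, g \<cdot>\<^bsub>M\<^esub> f))\<rparr>"

definition strict_box :: "('o, 'm, 'z) mon_cat_scheme \<Rightarrow> 'o list \<times> 'o list \<times> 'm \<Rightarrow>
    'o list \<times> 'o list \<times> 'm \<Rightarrow> 'o list \<times> 'o list \<times> 'm" where
  "strict_box M = (\<lambda>(xs, ys, f) (xs', ys', g). (xs @ xs', ys @ ys',
     tens_append M ys ys' \<cdot>\<^bsub>M\<^esub> ((f \<odot>\<^bsub>M\<^esub> g) \<cdot>\<^bsub>M\<^esub> inv_arr M (tens_append M xs xs'))))"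

locale strict_monoidal = category C for C :: "('x list, 'a, 'z) cat_scheme" (structure) +
  fixes box :: "'a \<Rightarrow> 'a \<Rightarrow> 'a"  (infixr "\<boxtimes>" 80)
  assumes Nil_Obj [simp]: "[] \<in> Obj C"
    and append_Obj [simp]: "x \<in> Obj C \<Longrightarrow> y \<in> Obj C \<Longrightarrow> x @ y \<in> Obj C"
    and box_hom: "f \<in> hom C x x' \<Longrightarrow> g \<in> hom C y y' \<Longrightarrow> f \<boxtimes> g \<in> hom C (x @ y) (x' @ y')"
    and box_Idn: "x \<in> Obj C \<Longrightarrow> y \<in> Obj C \<Longrightarrow> Idn C x \<boxtimes> Idn C y = Idn C (x @ y)"
    and box_Comp: "f \<in> hom C x x' \<Longrightarrow> f' \<in> hom C x' x'' \<Longrightarrow> g \<in> hom C y y' \<Longrightarrow> g' \<in> hom C y' y'' \<Longrightarrow>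
      (f' \<cdot> f) \<boxtimes> (g' \<cdot> g) = (f' \<boxtimes> g') \<cdot> (f \<boxtimes> g)"
    and box_assoc: "f \<in> Arr C \<Longrightarrow> g \<in> Arr C \<Longrightarrow> h \<in> Arr C \<Longrightarrow> (f \<boxtimes> g) \<boxtimes> h = f \<boxtimes> (g \<boxtimes> h)"
    and Idn_Nil_box [simp]: "f \<in> Arr C \<Longrightarrow> Idn C [] \<boxtimes> f = f"
    and box_Idn_Nil [simp]: "f \<in> Arr C \<Longrightarrow> f \<boxtimes> Idn C [] = f"

context monoidal_category
begin

lemma category_strictify: "category (strictify M)"
  by unfold_locales (auto simp: strictify_def hom_def)

lemma strict_box_tens_append:
  assumes "f \<in> hom M (tens M xs) (tens M ys)" "g \<in> hom M (tens M xs') (tens M ys')"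
    and "set xs \<subseteq> Obj M" "set ys \<subseteq> Obj M" "set xs' \<subseteq> Obj M" "set ys' \<subseteq> Obj M"
  shows "snd (snd (strict_box M (xs, ys, f) (xs', ys', g))) \<cdot> tens_append M xs xs' =
    tens_append M ys ys' \<cdot> (f \<odot> g)"
  using assms by (auto simp: strict_box_def hom_def)

lemma strict_monoidal_strictify: "strict_monoidal (strictify M) (strict_box M)"
proof -
  interpret S: category "strictify M" by (rule category_strictify)
  show ?thesis
  proof
    show "strict_box M f g \<in> hom (strictify M) (x @ y) (x' @ y')"
      if "f \<in> hom (strictify M) x x'" "g \<in> hom (strictify M) y y'" for f g x y x' y'
      using that by (auto simp: strictify_def strict_box_def hom_def)
    show "strict_box M (Idn (strictify M) x) (Idn (strictify M) y) = Idn (strictify M) (x @ y)"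
      if "x \<in> Obj (strictify M)" "y \<in> Obj (strictify M)" for x y
      using that by (auto simp: strictify_def strict_box_def)
    show "strict_box M (f' \<cdot>\<^bsub>strictify M\<^esub> f) (g' \<cdot>\<^bsub>strictify M\<^esub> g) =
        strict_box M f' g' \<cdot>\<^bsub>strictify M\<^esub> strict_box M f g"
      if "f \<in> hom (strictify M) x x'" "f' \<in> hom (strictify M) x' x''"
        "g \<in> hom (strictify M) y y'" "g' \<in> hom (strictify M) y' y''" for f f' g g' x x' x'' y y' y''
      using that by (auto simp: strictify_def strict_box_def hom_def interchange_assoc)
    show "strict_box M (Idn (strictify M) []) f = f" if "f \<in> Arr (strictify M)" for f
    proof -
      obtain xs ys h where f: "f = (xs, ys, h)" by (cases f)
      then show ?thesis using that LUnit_natural'[of h]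
        by (auto simp: strictify_def strict_box_def hom_def Comp_rewrite[of "LUnit M (tens M ys)" "Idn M (Unit M) \<odot> h" "h \<cdot> LUnit M (tens M xs)"])
    qed
    show "strict_box M f (Idn (strictify M) []) = f" if "f \<in> Arr (strictify M)" for f
    proof -
      obtain xs ys h where f: "f = (xs, ys, h)" by (cases f)
      then show ?thesis using that RUnit_natural'[of h]
        by (auto simp: strictify_def strict_box_def hom_def tens_append_Nil2 Comp_rewrite[of "RUnit M (tens M ys)" "h \<odot> Idn M (Unit M)" "h \<cdot> RUnit M (tens M xs)"])
    qed
    show "strict_box M (strict_box M F G) H = strict_box M F (strict_box M G H)"
      if FGH: "F \<in> Arr (strictify M)" "G \<in> Arr (strictify M)" "H \<in> Arr (strictify M)" for F G H
    proof -
      obtain xs ys f xs' ys' g xs'' ys'' h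
        where F: "F = (xs, ys, f)" "G = (xs', ys', g)" "H = (xs'', ys'', h)" by (metis prod_cases3)
      have [simp]: "set xs \<subseteq> Obj M" "set ys \<subseteq> Obj M" "set xs' \<subseteq> Obj M" "set ys' \<subseteq> Obj M" "set xs'' \<subseteq> Obj M" "set ys'' \<subseteq> Obj M"
        "f \<in> Arr M" "Dom M f = tens M xs" "Cod M f = tens M ys" "g \<in> Arr M" "Dom M g = tens M xs'" "Cod M g = tens M ys'"
        "h \<in> Arr M" "Dom M h = tens M xs''" "Cod M h = tens M ys''"
        using FGH F by (auto simp: strictify_def hom_def)
      define fg where "fg = tens_append M ys ys' \<cdot> ((f \<odot> g) \<cdot> inv_arr M (tens_append M xs xs'))"
      define gh where "gh = tens_append M ys' ys'' \<cdot> ((g \<odot> h) \<cdot> inv_arr M (tens_append M xs' xs''))"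
      define l where "l = tens_append M (ys @ ys') ys'' \<cdot> ((fg \<odot> h) \<cdot> inv_arr M (tens_append M (xs @ xs') xs''))"
      define r where "r = tens_append M ys (ys' @ ys'') \<cdot> ((f \<odot> gh) \<cdot> inv_arr M (tens_append M xs (xs' @ xs'')))"
      let ?a = "Assoc M (tens M xs) (tens M xs') (tens M xs'')"
      let ?b = "Assoc M (tens M ys) (tens M ys') (tens M ys'')"
      \<comment> \<open>\<open>?k\<close> is the isomorphism from the left-bracketed triple tensor
        product to the tensor product of the concatenation. \<open>tens_append_coherence\<close>
        gives its other form through the associator, so \<open>l\<close> and \<open>r\<close> become
        comparable after precomposition with \<open>?k\<close>.\<close>
      let ?k = "tens_append M (xs @ xs') xs'' \<cdot> (tens_append M xs xs' \<odot> Idn M (tens M xs''))"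
      have [simp]: "fg \<in> Arr M" "Dom M fg = tens M (xs @ xs')" "Cod M fg = tens M (ys @ ys')"
        "gh \<in> Arr M" "Dom M gh = tens M (xs' @ xs'')" "Cod M gh = tens M (ys' @ ys'')"
        by (simp_all add: fg_def gh_def)
      have lr: "l \<in> Arr M" "Dom M l = tens M (xs @ xs' @ xs'')" "r \<in> Arr M" "Dom M r = tens M (xs @ xs' @ xs'')"
        by (simp_all add: l_def r_def)
      have "l \<cdot> ?k = tens_append M (ys @ ys') ys'' \<cdot> ((fg \<odot> h) \<cdot> (tens_append M xs xs' \<odot> Idn M (tens M xs'')))"
        by (simp add: l_def)
      also have "\<dots> = (tens_append M (ys @ ys') ys'' \<cdot> (tens_append M ys ys' \<odot> Idn M (tens M ys''))) \<cdot> ((f \<odot> g) \<odot> h)"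
        by (simp add: interchange fg_def)
      also have "\<dots> = tens_append M ys (ys' @ ys'') \<cdot> ((Idn M (tens M ys) \<odot> tens_append M ys' ys'') \<cdot> (?b \<cdot> ((f \<odot> g) \<odot> h)))"
        using tens_append_coherence[of ys ys' ys'', symmetric] by simp
      also have "?b \<cdot> ((f \<odot> g) \<odot> h) = (f \<odot> (g \<odot> h)) \<cdot> ?a"
        using Assoc_natural'[of f g h] by simp
      also have "(Idn M (tens M ys) \<odot> tens_append M ys' ys'') \<cdot> ((f \<odot> (g \<odot> h)) \<cdot> ?a) =
          (f \<odot> gh) \<cdot> ((Idn M (tens M xs) \<odot> tens_append M xs' xs'') \<cdot> ?a)"
        by (simp add: interchange_assoc gh_def)
      also have "tens_append M ys (ys' @ ys'') \<cdot> \<dots> =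
          r \<cdot> (tens_append M xs (xs' @ xs'') \<cdot> ((Idn M (tens M xs) \<odot> tens_append M xs' xs'') \<cdot> ?a))"
        by (simp add: r_def)
      also have "\<dots> = r \<cdot> ?k"
        using tens_append_coherence[of xs xs' xs''] by simp
      finally have "l = r" by (rule iso_cancel_right[rotated]) (use lr in auto)
      then show ?thesis by (simp add: F strict_box_def l_def r_def fg_def gh_def)
    qed
  qed (auto simp: strictify_def)
qed

end

context strict_monoidal
begin

lemma box_Arr [simp]: "f \<in> Arr C \<Longrightarrow> g \<in> Arr C \<Longrightarrow> f \<boxtimes> g \<in> Arr C"
  and Dom_box [simp]: "f \<in> Arr C \<Longrightarrow> g \<in> Arr C \<Longrightarrow> Dom C (f \<boxtimes> g) = Dom C f @ Dom C g"
  and Cod_box [simp]: "f \<in> Arr C \<Longrightarrow> g \<in> Arr C \<Longrightarrow> Cod C (f \<boxtimes> g) = Cod C f @ Cod C g"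
  using box_hom[OF Arr_hom Arr_hom, of f g] by (auto simp: hom_def)

lemma box_interchange:
  "f \<in> Arr C \<Longrightarrow> f' \<in> Arr C \<Longrightarrow> g \<in> Arr C \<Longrightarrow> g' \<in> Arr C \<Longrightarrow> Cod C f = Dom C f' \<Longrightarrow> Cod C g = Dom C g' \<Longrightarrow>
   (f' \<boxtimes> g') \<cdot> (f \<boxtimes> g) = (f' \<cdot> f) \<boxtimes> (g' \<cdot> g)"
  by (rule box_Comp[symmetric]) (auto simp: hom_def)

lemma box_interchange_assoc:
  "f \<in> Arr C \<Longrightarrow> f' \<in> Arr C \<Longrightarrow> g \<in> Arr C \<Longrightarrow> g' \<in> Arr C \<Longrightarrow> Cod C f = Dom C f' \<Longrightarrow> Cod C g = Dom C g' \<Longrightarrow>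
   k \<in> Arr C \<Longrightarrow> Cod C k = Dom C f @ Dom C g \<Longrightarrow>
   (f' \<boxtimes> g') \<cdot> ((f \<boxtimes> g) \<cdot> k) = ((f' \<cdot> f) \<boxtimes> (g' \<cdot> g)) \<cdot> k"
  by (intro Comp_rewrite box_interchange) auto

definition boxes :: "'a list \<Rightarrow> 'a" where
  "boxes fs = foldr (\<boxtimes>) fs (Idn C [])"

lemma boxes_Nil [simp]: "boxes [] = Idn C []"
  and boxes_Cons [simp]: "boxes (f # fs) = f \<boxtimes> boxes fs"
  by (simp_all add: boxes_def)

lemma boxes_Arr [simp]: "set fs \<subseteq> Arr C \<Longrightarrow> boxes fs \<in> Arr C"
  and Dom_boxes [simp]: "set fs \<subseteq> Arr C \<Longrightarrow> Dom C (boxes fs) = concat (map (Dom C) fs)"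
  and Cod_boxes [simp]: "set fs \<subseteq> Arr C \<Longrightarrow> Cod C (boxes fs) = concat (map (Cod C) fs)"
  by (induction fs) auto

lemma boxes_hom:
  assumes "\<And>i. i \<in> set is \<Longrightarrow> f i \<in> hom C (A i) (B i)"
  shows "boxes (map f is) \<in> hom C (concat (map A is)) (concat (map B is))"
proof -
  have "\<And>i. i \<in> set is \<Longrightarrow> f i \<in> Arr C \<and> Dom C (f i) = A i \<and> Cod C (f i) = B i"
    using assms by (auto simp: hom_def)
  then have "set (map f is) \<subseteq> Arr C" "map (\<lambda>i. Dom C (f i)) is = map A is" "map (\<lambda>i. Cod C (f i)) is = map B is"
    by auto
  then show ?thesis by (intro homI) (simp_all add: o_def del: map_eq_conv)
qed

lemma boxes_append: "set fs \<subseteq> Arr C \<Longrightarrow> set gs \<subseteq> Arr C \<Longrightarrow> boxes (fs @ gs) = boxes fs \<boxtimes> boxes gs"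
  by (induction fs) (auto simp: box_assoc)

lemma boxes_concat: "(\<And>fs. fs \<in> set fss \<Longrightarrow> set fs \<subseteq> Arr C) \<Longrightarrow> boxes (concat fss) = boxes (map boxes fss)"
proof (induction fss)
  case (Cons fs fss)
  have "set (concat fss) \<subseteq> Arr C" using Cons.prems by auto
  then show ?case using Cons by (simp add: boxes_append)
qed simp

lemma boxes_Comp:
  assumes "\<And>i. i \<in> set is \<Longrightarrow> f i \<in> hom C (x i) (y i)" "\<And>i. i \<in> set is \<Longrightarrow> g i \<in> hom C (y i) (z i)"
  shows "boxes (map g is) \<cdot> boxes (map f is) = boxes (map (\<lambda>i. g i \<cdot> f i) is)"
  using assms
proof (induction "is")
  case (Cons i "is")
  have "\<And>j. j \<in> set is \<Longrightarrow> f j \<in> hom C (x j) (y j)" "\<And>j. j \<in> set is \<Longrightarrow> g j \<in> hom C (y j) (z j)"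
    using Cons.prems by auto
  note homD[OF boxes_hom[of "is" f, OF this(1)]] homD[OF boxes_hom[of "is" g, OF this(2)]]
    and Cons.IH[OF this]
  moreover have "f i \<in> hom C (x i) (y i)" "g i \<in> hom C (y i) (z i)" using Cons.prems by auto
  ultimately show ?case by (auto simp: box_interchange hom_def)
qed simp

lemma concat_Obj [simp]: "(\<And>i. i \<in> set is \<Longrightarrow> A i \<in> Obj C) \<Longrightarrow> concat (map A is) \<in> Obj C"
  by (induction "is") auto

lemma boxes_Idn: "(\<And>i. i \<in> set is \<Longrightarrow> A i \<in> Obj C) \<Longrightarrow> boxes (map (\<lambda>i. Idn C (A i)) is) = Idn C (concat (map A is))"
proof (induction "is")
  case (Cons i "is")
  then show ?case by (simp add: box_Idn)
qed simp

text \<open>Identities of the empty list are invisible in a product. Collapsed beads give such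
  factors, so a product over all beads of T and one over the beads of an image of T
  coincide.\<close>

lemma boxes_filter:
  assumes "\<And>i. i \<in> set is \<Longrightarrow> f i \<in> Arr C" "\<And>i. i \<in> set is \<Longrightarrow> \<not> P i \<Longrightarrow> f i = Idn C []"
  shows "boxes (map f (filter P is)) = boxes (map f is)"
  using assms
proof (induction "is")
  case (Cons i "is")
  have "boxes (map f is) \<in> Arr C" using Cons.prems by (intro boxes_Arr) auto
  then show ?case using Cons by auto
qed simp

end

section \<open>Beads, gaps and interval maps\<close>

definition steps :: "'b list \<Rightarrow> ('b \<times> 'b) list" where
  "steps xs = zip xs (tl xs)"

lemma steps_simps [simp]: "steps [] = []" "steps [x] = []" "steps (x # y # xs) = (x, y) # steps (y # xs)"
  by (simp_all add: steps_def)

lemma steps_append: "steps (xs @ v # ys) = steps (xs @ [v]) @ steps (v # ys)"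
  by (induction xs rule: induct_list012) auto

lemma steps_map: "steps (map f xs) = map (map_prod f f) (steps xs)"
  by (induction xs rule: induct_list012) auto

text \<open>For a monotone map the sorted image of T is the list of values with adjacent repetitions
  removed; the steps that vanish are precisely those between equal values, i.e. the collapsed
  beads.\<close>

lemma steps_remdups_adj: "steps (remdups_adj xs) = filter (\<lambda>(s, t). s \<noteq> t) (steps xs)"
proof (induction xs rule: remdups_adj.induct)
  case (3 x y xs)
  then show ?case
    by (cases "x = y") (auto simp: remdups_adj_Cons split: list.splits)
qed auto

lemma in_steps_decomp: "(s, t) \<in> set (steps xs) \<Longrightarrow> \<exists>ys zs. xs = ys @ s # t # zs"
proof (induction xs rule: induct_list012)
  case (3 x y xs)
  then show ?case by (auto simp: Cons_eq_append_conv)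
qed auto

lemma beads_steps: "beads T = steps (sorted_list_of_set T)"
  by (simp add: beads_def steps_def Let_def)

lemma sorted_imp_distinct_remdups_adj: "sorted (xs :: 'b :: linorder list) \<Longrightarrow> distinct (remdups_adj xs)"
  by (induction xs rule: remdups_adj.induct) fastforce+

lemma hd_last_sorted_list_of_set:
  assumes "u \<in> T" "v \<in> T" "T \<subseteq> {u..v::nat}"
  shows "sorted_list_of_set T \<noteq> []" "hd (sorted_list_of_set T) = u" "last (sorted_list_of_set T) = v"
proof -
  let ?xs = "sorted_list_of_set T"
  have T: "set ?xs = T" using assms finite_subset[of T "{u..v}"] by simp
  show ne: "?xs \<noteq> []" using T assms(1) by auto
  obtain i j where ij: "i < length ?xs" "?xs ! i = u" "j < length ?xs" "?xs ! j = v"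
    using assms(1,2) T by (metis in_set_conv_nth)
  have "hd ?xs \<le> u" "v \<le> last ?xs"
    using ij ne sorted_nth_mono[of ?xs 0 i] sorted_nth_mono[of ?xs j "length ?xs - 1"]
    by (auto simp: hd_conv_nth last_conv_nth)
  moreover have "hd ?xs \<in> T" "last ?xs \<in> T" using ne T hd_in_set last_in_set by metis+
  ultimately show "hd ?xs = u" "last ?xs = v" using assms(3) by force+
qed

lemma sorted_list_of_set_image:
  fixes f :: "nat \<Rightarrow> nat"
  assumes "finite T" "mono_on T f"
  shows "sorted_list_of_set (f ` T) = remdups_adj (map f (sorted_list_of_set T))"
proof -
  have s: "sorted (map f (sorted_list_of_set T))"
    unfolding sorted_map
    by (rule sorted_wrt_mono_rel[OF _ sorted_sorted_list_of_set]) (use assms in \<open>auto simp: mono_on_def\<close>)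
  show ?thesis
  proof (rule sorted_distinct_set_unique)
    show "sorted (remdups_adj (map f (sorted_list_of_set T)))" using s by simp
    show "distinct (remdups_adj (map f (sorted_list_of_set T)))" using s by (rule sorted_imp_distinct_remdups_adj)
  qed (use assms in auto)
qed

lemma beads_image:
  fixes f :: "nat \<Rightarrow> nat"
  assumes "finite T" "mono_on T f"
  shows "beads (f ` T) = filter (\<lambda>(s, t). s \<noteq> t) (map (map_prod f f) (beads T))"
  by (simp add: beads_steps sorted_list_of_set_image[OF assms] steps_remdups_adj steps_map)

lemma beads_glue:
  assumes "finite T" "v \<in> T"
  shows "beads T = beads (T \<inter> {..v}) @ beads (T \<inter> {v..})"
proof -
  let ?x = "sorted_list_of_set (T \<inter> {..<v})" and ?y = "sorted_list_of_set (T \<inter> {v<..})"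
  have "sorted_list_of_set T = ?x @ v # ?y"
    by (rule sorted_distinct_set_unique) (use assms in \<open>auto simp: sorted_append\<close>)
  moreover have "sorted_list_of_set (T \<inter> {..v}) = ?x @ [v]"
    by (rule sorted_distinct_set_unique) (use assms in \<open>auto simp: sorted_append\<close>)
  moreover have "sorted_list_of_set (T \<inter> {v..}) = v # ?y"
    by (rule sorted_distinct_set_unique) (use assms in \<open>auto simp: sorted_append\<close>)
  ultimately show ?thesis unfolding beads_steps by (simp only: steps_append[of ?x v ?y])
qed

lemma beads_mem:
  assumes "(s, t) \<in> set (beads T)"
  shows "s \<in> T" "t \<in> T" "s < t" "T \<inter> {s..t} = {s, t}"
proof -
  have fin: "finite T" using assms by (cases "finite T") (auto simp: beads_steps)
  obtain ys zs where e: "sorted_list_of_set T = ys @ s # t # zs"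
    using assms in_steps_decomp by (metis beads_steps)
  have T: "T = set (ys @ s # t # zs)" using e fin by (metis set_sorted_list_of_set)
  have "sorted_wrt (<) (ys @ s # t # zs)" using e strict_sorted_list_of_set[of T] by simp
  then show "s \<in> T" "t \<in> T" "s < t" "T \<inter> {s..t} = {s, t}"
    unfolding T by (auto simp: sorted_wrt_append)
qed

lemma beads_pair: "s < t \<Longrightarrow> beads {s, t} = [(s, t)]"
proof -
  assume "s < t"
  then have "sorted_list_of_set {s, t} = [s, t]"
    by (intro sorted_distinct_set_unique) auto
  then show ?thesis by (simp add: beads_steps)
qed

lemma beads_singleton [simp]: "beads {s} = []"
  by (simp add: beads_steps)

lemma gaps_singleton [simp]: "gaps {s} = []"
  by (simp add: gaps_def)

lemma gaps_pair: "s < t \<Longrightarrow> gaps {s, t} = [t - s]"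
  by (simp add: gaps_def beads_pair)

lemma gaps_pos: "k \<in> set (gaps T) \<Longrightarrow> 0 < k"
  using beads_mem(3) by (fastforce simp: gaps_def)

text \<open>Groups the beads of T by the beads of a coarser necklace U; both the composition of
  inert maps and their exchange with active ones rest on this regrouping.\<close>

lemma beads_split:
  assumes "finite T" "U \<subseteq> T" "u \<in> U" "v \<in> U" "T \<subseteq> {u..v}"
  shows "beads T = concat (map (\<lambda>(s, t). beads (T \<inter> {s..t})) (beads U))"
proof -
  \<comment> \<open>Stated for an arbitrary strictly increasing list \<open>us\<close> and for all
    T, because the induction cuts off the first step of \<open>us\<close> and replaces T by its part
    from \<open>y\<close> onwards.\<close>
  have *: "beads T = concat (map (\<lambda>(s, t). beads (T \<inter> {s..t})) (steps us))"
    if "finite T" "set us \<subseteq> T" "T \<subseteq> {hd us..last us}" "us \<noteq> []" "sorted_wrt (<) us" for us T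
    using that
  proof (induction us arbitrary: T rule: induct_list012)
    case (2 x)
    then have "T = {x}" by auto
    then show ?case by simp
  next
    case (3 x y us)
    have "beads T = beads (T \<inter> {..y}) @ beads (T \<inter> {y..})"
      by (rule beads_glue) (use "3.prems" in auto)
    also have "T \<inter> {..y} = T \<inter> {x..y}" using "3.prems" by auto
    also have "beads (T \<inter> {y..}) = concat (map (\<lambda>(s, t). beads ((T \<inter> {y..}) \<inter> {s..t})) (steps (y # us)))"
    proof (rule 3(2))
      show "set (y # us) \<subseteq> T \<inter> {y..}" using "3.prems" by auto
      show "T \<inter> {y..} \<subseteq> {hd (y # us)..last (y # us)}" using "3.prems" by auto
    qed (use "3.prems" in auto)
    also have "map (\<lambda>(s, t). beads ((T \<inter> {y..}) \<inter> {s..t})) (steps (y # us)) =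
        map (\<lambda>(s, t). beads (T \<inter> {s..t})) (steps (y # us))"
    proof (rule map_cong[OF refl], clarify)
      fix s t assume "(s, t) \<in> set (steps (y # us))"
      then have "s \<in> set (y # us)" using in_steps_decomp[of s t "y # us"] by (metis in_set_conv_decomp)
      then have "y \<le> s" using "3.prems" by auto
      then have "T \<inter> {y..} \<inter> {s..t} = T \<inter> {s..t}" by auto
      then show "beads (T \<inter> {y..} \<inter> {s..t}) = beads (T \<inter> {s..t})" by simp
    qed
    finally show ?case by simp
  qed auto
  have "finite U" using assms finite_subset by auto
  moreover have "U \<subseteq> {u..v}" using assms by auto
  note hd_last_sorted_list_of_set[OF assms(3,4) this]
  ultimately show ?thesis unfolding beads_steps[of U]
    using assms by (intro *) (simp_all add: strict_sorted_list_of_set)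
qed

text \<open>Recovers the beads from their lengths and the starting point, so that arguments about
  the beads of a set can proceed by induction on the list of gaps.\<close>

fun cuts :: "nat \<Rightarrow> nat list \<Rightarrow> (nat \<times> nat) list" where
  "cuts s [] = []"
| "cuts s (k # ks) = (s, s + k) # cuts (s + k) ks"

lemma steps_cuts: "sorted (x # xs) \<Longrightarrow> steps (x # xs) = cuts x (map (\<lambda>(s, t). t - s) (steps (x # xs))) \<and>
    x + sum_list (map (\<lambda>(s, t). t - s) (steps (x # xs))) = last (x # xs)"
proof (induction xs arbitrary: x)
  case (Cons y xs)
  then show ?case using Cons.IH[of y] by auto
qed simp

lemma
  assumes "u \<in> T" "v \<in> T" "T \<subseteq> {u..v}"
  shows beads_cuts: "beads T = cuts u (gaps T)"
    and sum_list_gaps: "u + sum_list (gaps T) = v"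
proof -
  obtain xs where xs: "sorted_list_of_set T = u # xs" "last (u # xs) = v"
    using hd_last_sorted_list_of_set[OF assms] by (metis list.collapse)
  have "sorted (u # xs)" using xs(1) sorted_sorted_list_of_set[of T] by simp
  from steps_cuts[OF this] xs show "beads T = cuts u (gaps T)" "u + sum_list (gaps T) = v"
    by (simp_all add: gaps_def beads_steps)
qed

text \<open>\<open>nec_inert\<close> moves each bead so that it starts at 0, whereas
  \<open>inert\<close> below leaves it in place; only the gaps enter either of them.\<close>

lemma gaps_shift:
  assumes "finite T" "T \<subseteq> {u..}"
  shows "gaps ((\<lambda>t. t - u) ` T) = gaps T"
proof -
  have "beads ((\<lambda>t. t - u) ` T) = map (map_prod (\<lambda>t. t - u) (\<lambda>t. t - u)) (beads T)"
  proof (subst beads_image)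
    show "mono_on T (\<lambda>t. t - u)" by (auto simp: mono_on_def)
    show "filter (\<lambda>(s, t). s \<noteq> t) (map (map_prod (\<lambda>t. t - u) (\<lambda>t. t - u)) (beads T)) =
        map (map_prod (\<lambda>t. t - u) (\<lambda>t. t - u)) (beads T)"
      by (rule filter_True) (use beads_mem(1-3) assms(2) in fastforce)
  qed (use assms in auto)
  moreover have "t - u - (s - u) = t - s" if "(s, t) \<in> set (beads T)" for s t
    using beads_mem(1,3)[OF that] assms(2) by auto
  ultimately show ?thesis by (auto simp: gaps_def)
qed

section \<open>Maps of finite intervals and their restrictions to beads\<close>

lemma Arr_Delta_f: "f \<in> Arr Delta_f \<longleftrightarrow> f \<noteq> [] \<and> sorted f \<and> f ! 0 = 0"
  by (cases f) (auto simp: Delta_f_def)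

lemma Delta_f_simps [simp]:
  "Obj Delta_f = UNIV" "Dom Delta_f f = length f - 1" "Cod Delta_f f = last f"
  "Idn Delta_f n = [0..<Suc n]" "g \<cdot>\<^bsub>Delta_f\<^esub> f = map ((!) g) f"
  "Tensor Delta_f = (+)" "f \<odot>\<^bsub>Delta_f\<^esub> g = f @ map ((+) (last f)) (tl g)" "Unit Delta_f = 0"
  by (simp_all add: Delta_f_def)

lemma nth_mono: "f \<in> Arr Delta_f \<Longrightarrow> i \<le> j \<Longrightarrow> j < length f \<Longrightarrow> f ! i \<le> f ! j"
  by (simp add: Arr_Delta_f sorted_nth_mono)

lemma last_Delta_f: "f \<in> Arr Delta_f \<Longrightarrow> last f = f ! (length f - 1)"
  by (simp add: Arr_Delta_f last_conv_nth)

lemma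
  assumes "f \<in> Arr Delta_f" "g \<in> Arr Delta_f" "last f = length g - 1"
  shows Comp_Delta_f: "map ((!) g) f \<in> Arr Delta_f"
    and last_Comp_Delta_f: "last (map ((!) g) f) = last g"
proof -
  have "f ! i < length g" if "i < length f" for i
  proof -
    have "f ! i \<le> length g - 1" "g \<noteq> []"
      using nth_mono[OF assms(1), of i "length f - 1"] last_Delta_f[OF assms(1)] assms that
      by (auto simp: Arr_Delta_f)
    then show ?thesis by (cases g) auto
  qed
  then show "map ((!) g) f \<in> Arr Delta_f"
    using assms by (auto simp: Arr_Delta_f sorted_iff_nth_mono)
  show "last (map ((!) g) f) = last g"
    using assms by (simp add: Arr_Delta_f last_map last_conv_nth)
qed

lemma TensorArr_Delta_f:
  assumes "f \<in> Arr Delta_f" "g \<in> Arr Delta_f"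
  shows "f @ map ((+) (last f)) (tl g) \<in> Arr Delta_f"
    "last (f @ map ((+) (last f)) (tl g)) = last f + last g"
    "length (f @ map ((+) (last f)) (tl g)) - 1 = (length f - 1) + (length g - 1)"
proof -
  obtain f' g' where fg: "f = 0 # f'" "g = 0 # g'"
    using assms by (metis Arr_Delta_f list.exhaust nth_Cons_0)
  have s: "sorted f" "sorted g'" using assms fg by (auto simp: Arr_Delta_f)
  have "x \<le> last f" if "x \<in> set f" for x
    using s(1) that by (metis in_set_conv_nth last_conv_nth length_pos_if_in_set
      less_Suc_eq_le Suc_pred' list.size(3) not_less0 sorted_nth_mono diff_less zero_less_one)
  then show "f @ map ((+) (last f)) (tl g) \<in> Arr Delta_f"
    using s fg by (auto simp: Arr_Delta_f sorted_append sorted_map trans_le_add1 simp del: last.simps)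
  show "last (f @ map ((+) (last f)) (tl g)) = last f + last g"
    using fg by (auto simp: last_map)
qed (use assms in \<open>cases f; auto simp: Arr_Delta_f\<close>)

lemma length_bead_map [simp]: "length (bead_map f (s, t)) = Suc (t - s)"
  by (simp add: bead_map_def)

lemma nth_bead_map: "j \<le> t - s \<Longrightarrow> bead_map f (s, t) ! j = f ! (s + j) - f ! s"
  by (simp add: bead_map_def nth_append del: upt_Suc)

lemma
  assumes "f \<in> Arr Delta_f" "s \<le> t" "t < length f"
  shows bead_map_Arr: "bead_map f (s, t) \<in> Arr Delta_f"
    and last_bead_map: "last (bead_map f (s, t)) = f ! t - f ! s"
proof -
  have ne: "bead_map f (s, t) \<noteq> []" by (simp add: bead_map_def)
  have "bead_map f (s, t) ! i \<le> bead_map f (s, t) ! j" if "i \<le> j" "j \<le> t - s" for i j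
    using that assms nth_mono[OF assms(1), of "s + i" "s + j"] by (simp add: nth_bead_map diff_le_mono)
  then show "bead_map f (s, t) \<in> Arr Delta_f"
    using ne by (auto simp: Arr_Delta_f sorted_iff_nth_mono nth_bead_map)
  show "last (bead_map f (s, t)) = f ! t - f ! s"
    using ne assms by (simp add: last_conv_nth nth_bead_map)
qed

lemma bead_map_same [simp]: "bead_map f (s, s) = [0]"
  by (simp add: bead_map_def)

lemma bead_map_Idn: "s \<le> t \<Longrightarrow> t \<le> n \<Longrightarrow> bead_map [0..<Suc n] (s, t) = [0..<Suc (t - s)]"
  by (rule nth_equalityI) (auto simp: nth_bead_map simp del: upt_Suc)

lemma bead_map_Comp:
  assumes "f \<in> Arr Delta_f" "g \<in> Arr Delta_f" "last f = length g - 1" "s \<le> t" "t < length f"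
  shows "bead_map (map ((!) g) f) (s, t) = map ((!) (bead_map g (f ! s, f ! t))) (bead_map f (s, t))"
proof (rule nth_equalityI)
  fix j assume "j < length (bead_map (map ((!) g) f) (s, t))"
  then have j: "j \<le> t - s" by simp
  have "f ! s \<le> f ! (s + j)" "f ! (s + j) \<le> f ! t"
    using assms j by (auto intro!: nth_mono)
  then show "bead_map (map ((!) g) f) (s, t) ! j = map ((!) (bead_map g (f ! s, f ! t))) (bead_map f (s, t)) ! j"
    using j assms by (simp add: nth_bead_map diff_le_mono)
qed simp

text \<open>The iterated monoidal product f_1 + ... + f_k; \<open>[0]\<close> is the identity of the
  unit object.\<close>

definition joins :: "nat list list \<Rightarrow> nat list" where
  "joins fs = foldr (\<lambda>f g. f \<odot>\<^bsub>Delta_f\<^esub> g) fs [0]"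

lemma joins_simps [simp]: "joins [] = [0]" "joins (f # fs) = f @ map ((+) (last f)) (tl (joins fs))"
  by (simp_all add: joins_def)

lemma joins_Arr: "set fs \<subseteq> Arr Delta_f \<Longrightarrow> joins fs \<in> Arr Delta_f"
  and last_joins: "set fs \<subseteq> Arr Delta_f \<Longrightarrow> last (joins fs) = sum_list (map last fs)"
  and length_joins: "set fs \<subseteq> Arr Delta_f \<Longrightarrow> length (joins fs) - 1 = sum_list (map (\<lambda>f. length f - 1) fs)"
proof (induction fs)
  case Nil
  { case 1 show ?case by (simp add: Arr_Delta_f) }
  { case 2 show ?case by simp }
  { case 3 show ?case by simp }
next
  case (Cons f fs)
  note * = TensorArr_Delta_f[of f "joins fs"]
  { case 1 then show ?case using * Cons by simp }
  { case 2 then show ?case using * Cons by simp }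
  { case 3 then show ?case using *(3) Cons by simp }
qed

lemma bead_map_glue:
  assumes "f \<in> Arr Delta_f" "s \<le> t" "t \<le> u" "u < length f"
  shows "bead_map f (s, t) @ map ((+) (last (bead_map f (s, t)))) (tl (bead_map f (t, u))) = bead_map f (s, u)"
proof (rule nth_equalityI)
  show "length (bead_map f (s, t) @ map ((+) (last (bead_map f (s, t)))) (tl (bead_map f (t, u)))) =
      length (bead_map f (s, u))"
    using assms by simp
  fix j assume "j < length (bead_map f (s, t) @ map ((+) (last (bead_map f (s, t)))) (tl (bead_map f (t, u))))"
  then have j: "j \<le> u - s" using assms by simp
  show "(bead_map f (s, t) @ map ((+) (last (bead_map f (s, t)))) (tl (bead_map f (t, u)))) ! j = bead_map f (s, u) ! j"
  proof (cases "j \<le> t - s")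
    case True
    then show ?thesis using j by (simp add: nth_append nth_bead_map)
  next
    case False
    \<comment> \<open>\<open>tl\<close> drops the vertex \<open>t\<close> shared by the two pieces,
      hence the \<open>Suc\<close>.\<close>
    have e: "Suc (t + (j - Suc (t - s))) = s + j" using False assms by auto
    have "f ! s \<le> f ! t" "f ! t \<le> f ! (s + j)"
      using False assms j by (auto intro!: nth_mono)
    then show ?thesis using False j assms e
      by (simp add: nth_append nth_tl nth_bead_map last_bead_map add.commute[of j s])
  qed
qed

text \<open>Together with \<open>bead_map_joins\<close> this makes cutting a map along beads and
  joining the pieces mutually inverse. It is used both for the naturality of iterated
  comultiplications and for the bijection between surjections and families of surjections on
  beads.\<close>

lemma joins_bead_map:
  assumes "f \<in> Arr Delta_f" "s + sum_list ks < length f"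
  shows "joins (map (bead_map f) (cuts s ks)) = bead_map f (s, s + sum_list ks)"
  using assms(2)
proof (induction ks arbitrary: s)
  case (Cons k ks)
  then have "joins (map (bead_map f) (cuts (s + k) ks)) = bead_map f (s + k, s + k + sum_list ks)"
    by (simp add: add.assoc)
  then show ?case
    using bead_map_glue[OF assms(1), of s "s + k" "s + k + sum_list ks"] Cons.prems by (simp add: add.assoc)
qed simp

lemma bead_map_full: "f \<in> Arr Delta_f \<Longrightarrow> length f = Suc p \<Longrightarrow> bead_map f (0, p) = f"
  by (rule nth_equalityI) (auto simp: nth_bead_map Arr_Delta_f)

lemma cuts_shift: "cuts (k + s) ks = map (map_prod ((+) k) ((+) k)) (cuts s ks)"
  by (induction ks arbitrary: s) (auto simp: add.assoc)

lemma cuts_bound: "(s, t) \<in> set (cuts u ks) \<Longrightarrow> u \<le> s \<and> s \<le> t \<and> t \<le> u + sum_list ks"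
  by (induction ks arbitrary: u) fastforce+

lemma bead_map_joins:
  assumes "set fs \<subseteq> Arr Delta_f"
  shows "map (bead_map (joins fs)) (cuts 0 (map (\<lambda>f. length f - 1) fs)) = fs"
  using assms
proof (induction fs)
  case (Cons f fs)
  define g where "g = joins fs"
  define ks where "ks = map (\<lambda>f. length f - 1) fs"
  have f: "f \<in> Arr Delta_f" "f \<noteq> []" and g: "g \<in> Arr Delta_f" "length g - 1 = sum_list ks"
    using Cons.prems joins_Arr length_joins by (auto simp: g_def ks_def Arr_Delta_f)
  define h where "h = f @ map ((+) (last f)) (tl g)"
  have h1: "h ! j = f ! j" if "j < length f" for j using that by (simp add: h_def nth_append)
  \<comment> \<open>The offset is \<open>length f - 1\<close> and not \<open>length f\<close>,
    because the last vertex of \<open>f\<close> is the first one of \<open>g\<close>: for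
    \<open>j = 0\<close> both descriptions give \<open>last f\<close>.\<close>
  have h2: "h ! (length f - 1 + j) = last f + g ! j" if "j < length g" for j
  proof (cases j)
    case 0
    then show ?thesis using f g h1[of "length f - 1"] by (simp add: last_conv_nth Arr_Delta_f)
  next
    case (Suc i)
    then have e: "length f - 1 + j = length f + i" using f by (cases f) auto
    show ?thesis unfolding e using that Suc by (simp add: h_def nth_append nth_tl)
  qed
  have "bead_map h (0, length f - 1) = f"
    by (rule nth_equalityI) (use f in \<open>auto simp: nth_bead_map h1 Arr_Delta_f\<close>)
  moreover have "bead_map h (length f - 1 + s, length f - 1 + t) = bead_map g (s, t)"
    if st: "(s, t) \<in> set (cuts 0 ks)" for s t
  proof (rule nth_equalityI)
    fix j assume "j < length (bead_map h (length f - 1 + s, length f - 1 + t))"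
    then have j: "j \<le> t - s" by simp
    have "length g = Suc (sum_list ks)" using g by (cases g) (auto simp: Arr_Delta_f)
    then have "s + j < length g" "s < length g" using cuts_bound[OF st] j by auto
    then show "bead_map h (length f - 1 + s, length f - 1 + t) ! j = bead_map g (s, t) ! j"
      using j h2[of s] h2[of "s + j"] by (simp add: nth_bead_map add.assoc)
  qed simp
  then have "map (bead_map h) (cuts (length f - 1) ks) = map (bead_map g) (cuts 0 ks)"
    using cuts_shift[of "length f - 1" 0 ks] by auto
  ultimately show ?case using Cons by (simp add: g_def h_def ks_def)
qed simp

section \<open>Normalized colax functors on necklaces\<close>

text \<open>A colax monoidal functor on intervals with strict target, normalized so that degree 0 is
  the unit and \<open>mu\<close> with an index 0 is an identity. A collapsed bead then contributes
  nothing to a product and no unit has to be inserted. \<open>Yar\<close> reverses arrows.\<close>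

locale strict_colax = strict_monoidal C box
  for C :: "('x list, 'a, 'z) cat_scheme" (structure) and box :: "'a \<Rightarrow> 'a \<Rightarrow> 'a"  (infixr "\<boxtimes>" 80) +
  fixes Y :: "nat \<Rightarrow> 'x list" and Yar :: "nat list \<Rightarrow> 'a" and mu :: "nat \<Rightarrow> nat \<Rightarrow> 'a"
  assumes Y_Obj [simp]: "Y k \<in> Obj C"
    and Y_0 [simp]: "Y 0 = []"
    and Yar_hom: "f \<in> Arr Delta_f \<Longrightarrow> Yar f \<in> hom C (Y (last f)) (Y (length f - 1))"
    and Yar_Idn: "Yar [0..<Suc k] = Idn C (Y k)"
    and Yar_Comp: "f \<in> Arr Delta_f \<Longrightarrow> g \<in> Arr Delta_f \<Longrightarrow> last f = length g - 1 \<Longrightarrow>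
      Yar (map ((!) g) f) = Yar f \<cdot> Yar g"
    and mu_hom: "mu k l \<in> hom C (Y (k + l)) (Y k @ Y l)"
    and mu_natural: "f \<in> Arr Delta_f \<Longrightarrow> g \<in> Arr Delta_f \<Longrightarrow>
      (Yar f \<boxtimes> Yar g) \<cdot> mu (last f) (last g) =
      mu (length f - 1) (length g - 1) \<cdot> Yar (f @ map ((+) (last f)) (tl g))"
    and mu_assoc: "(mu k l \<boxtimes> Idn C (Y m)) \<cdot> mu (k + l) m = (Idn C (Y k) \<boxtimes> mu l m) \<cdot> mu k (l + m)"
    and mu_0_left [simp]: "mu 0 k = Idn C (Y k)"
    and mu_0_right [simp]: "mu k 0 = Idn C (Y k)"
begin

lemma Yar_Arr [simp]: "f \<in> Arr Delta_f \<Longrightarrow> Yar f \<in> Arr C"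
  and Dom_Yar [simp]: "f \<in> Arr Delta_f \<Longrightarrow> Dom C (Yar f) = Y (last f)"
  and Cod_Yar [simp]: "f \<in> Arr Delta_f \<Longrightarrow> Cod C (Yar f) = Y (length f - 1)"
  using Yar_hom by (auto simp: hom_def)

lemma mu_Arr [simp]: "mu k l \<in> Arr C"
  and Dom_mu [simp]: "Dom C (mu k l) = Y (k + l)"
  and Cod_mu [simp]: "Cod C (mu k l) = Y k @ Y l"
  using mu_hom by (auto simp: hom_def)

lemma Yar_0 [simp]: "Yar [0] = Idn C []"
  using Yar_Idn[of 0] by simp

definition Ys :: "nat list \<Rightarrow> 'x list" where
  "Ys ks = concat (map Y ks)"

lemma Ys_simps [simp]: "Ys [] = []" "Ys (k # ks) = Y k @ Ys ks" "Ys (ks @ ls) = Ys ks @ Ys ls"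
  by (simp_all add: Ys_def)

lemma Ys_Obj [simp]: "Ys ks \<in> Obj C"
  by (simp add: Ys_def)

lemma Ys_filter: "Ys (filter (\<lambda>k. k \<noteq> 0) ks) = Ys ks"
  by (induction ks) auto

lemma Ys_concat: "Ys (concat kss) = concat (map Ys kss)"
  by (induction kss) auto

text \<open>By normalization the empty list can be the base case, and a one-element list yields an
  identity by itself; \<open>comult_list\<close> has to give the latter a clause of its own.\<close>

fun mus :: "nat list \<Rightarrow> 'a" where
  "mus [] = Idn C []"
| "mus (k # ks) = (Idn C (Y k) \<boxtimes> mus ks) \<cdot> mu k (sum_list ks)"

lemma mus_hom: "mus ks \<in> hom C (Y (sum_list ks)) (Ys ks)"
  by (induction ks) (auto simp: hom_def)

lemma mus_Arr [simp]: "mus ks \<in> Arr C"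
  and Dom_mus [simp]: "Dom C (mus ks) = Y (sum_list ks)"
  and Cod_mus [simp]: "Cod C (mus ks) = Ys ks"
  using mus_hom by (auto simp: hom_def)

lemma mus_append: "mus (ks @ ls) = (mus ks \<boxtimes> mus ls) \<cdot> mu (sum_list ks) (sum_list ls)"
proof (induction ks)
  case (Cons k ks)
  let ?k = "sum_list ks" and ?l = "sum_list ls"
  have "mus ((k # ks) @ ls) = (Idn C (Y k) \<boxtimes> (mus ks \<boxtimes> mus ls)) \<cdot> ((Idn C (Y k) \<boxtimes> mu ?k ?l) \<cdot> mu k (?k + ?l))"
    using Cons by (simp add: box_interchange_assoc)
  also have "\<dots> = ((Idn C (Y k) \<boxtimes> mus ks) \<boxtimes> mus ls) \<cdot> ((mu k ?k \<boxtimes> Idn C (Y ?l)) \<cdot> mu (k + ?k) ?l)"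
    by (simp add: mu_assoc box_assoc)
  also have "\<dots> = (mus (k # ks) \<boxtimes> mus ls) \<cdot> mu (sum_list (k # ks)) ?l"
    by (simp add: box_interchange_assoc)
  finally show ?case .
qed simp

text \<open>Coassociativity, iterated through \<open>mus_append\<close>. With the beads of a coarser
  necklace as blocks it becomes the functoriality of inert maps.\<close>

lemma mus_concat: "mus (concat kss) = boxes (map mus kss) \<cdot> mus (map sum_list kss)"
proof (induction kss)
  case (Cons ks kss)
  have *: "boxes (map mus kss) \<in> Arr C" "Dom C (boxes (map mus kss)) = Ys (map sum_list kss)"
    by (auto simp: Ys_def o_def image_subset_iff)
  have "sum_list (concat kss) = sum_list (map sum_list kss)" by (induction kss) auto
  then show ?case using Cons * by (simp add: mus_append box_interchange_assoc)
qed simp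

text \<open>Zeros arise when a map collapses beads, while \<open>gaps\<close> of the image set omits
  them; by normalization both lists give the same iterated comultiplication.\<close>

lemma mus_filter: "mus (filter (\<lambda>k. k \<noteq> 0) ks) = mus ks"
proof (induction ks)
  case (Cons k ks)
  have "sum_list (filter (\<lambda>k. k \<noteq> 0) ks) = sum_list ks" by (induction ks) auto
  then show ?case using Cons by auto
qed simp

lemma mus_singleton: "mus [k] = Idn C (Y k)"
  by simp

text \<open>Naturality of \<open>mu\<close>, iterated along \<open>joins\<close>. When some of the
  \<open>fs\<close> are constant, entries of \<open>map last fs\<close> are 0; normalization lets
  them pass without a case distinction.\<close>

lemma mus_natural: "set fs \<subseteq> Arr Delta_f \<Longrightarrow>
  boxes (map Yar fs) \<cdot> mus (map last fs) = mus (map (\<lambda>f. length f - 1) fs) \<cdot> Yar (joins fs)"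
proof (induction fs)
  case (Cons f fs)
  let ?l = "map last fs" and ?d = "map (\<lambda>f. length f - 1) fs"
  have f: "f \<in> Arr Delta_f" "set fs \<subseteq> Arr Delta_f" using Cons.prems by auto
  have b: "boxes (map Yar fs) \<in> Arr C" "Dom C (boxes (map Yar fs)) = Ys ?l"
  proof -
    have "set (map Yar fs) \<subseteq> Arr C" using f by auto
    moreover have "map (Dom C) (map Yar fs) = map Y ?l" using f by auto
    ultimately show "boxes (map Yar fs) \<in> Arr C" "Dom C (boxes (map Yar fs)) = Ys ?l"
      by (simp_all add: Ys_def del: map_map map_eq_conv)
  qed
  note j = joins_Arr[OF f(2)] last_joins[OF f(2)] length_joins[OF f(2)]
  have "boxes (map Yar (f # fs)) \<cdot> mus (map last (f # fs)) =
      (Yar f \<boxtimes> (boxes (map Yar fs) \<cdot> mus ?l)) \<cdot> mu (last f) (sum_list ?l)"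
    using f b by (simp add: box_interchange_assoc)
  also have "\<dots> = (Idn C (Y (length f - 1)) \<boxtimes> mus ?d) \<cdot> ((Yar f \<boxtimes> Yar (joins fs)) \<cdot> mu (last f) (last (joins fs)))"
    using Cons f j by (simp add: box_interchange_assoc)
  also have "\<dots> = mus (map (\<lambda>f. length f - 1) (f # fs)) \<cdot> Yar (joins (f # fs))"
    using f j TensorArr_Delta_f[OF f(1) j(1)] unfolding mu_natural[OF f(1) j(1)] by simp
  finally show ?case .
qed simp

text \<open>\<open>act\<close> and \<open>inert\<close> are the normalized counterparts of
  \<open>nec_active\<close> and \<open>nec_inert\<close>, free of rebracketing and of inserted
  units. Both run against the necklace map: \<open>act T f\<close> ends at X_T and starts at the
  image of T, \<open>inert T U\<close> goes from X_U to X_T.\<close>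

definition act :: "nat set \<Rightarrow> nat list \<Rightarrow> 'a" where
  "act T f = boxes (map (\<lambda>b. Yar (bead_map f b)) (beads T))"

definition inert :: "nat set \<Rightarrow> nat set \<Rightarrow> 'a" where
  "inert T U = boxes (map (\<lambda>(s, t). mus (gaps (T \<inter> {s..t}))) (beads U))"

end

lemma gaps_image:
  fixes f :: "nat \<Rightarrow> nat"
  assumes "finite T" "mono_on T f"
  shows "gaps (f ` T) = filter (\<lambda>k. k \<noteq> 0) (map (\<lambda>(s, t). f t - f s) (beads T))"
proof -
  have "f s \<le> f t" if "(s, t) \<in> set (beads T)" for s t
    using beads_mem(1-3)[OF that] assms(2) by (auto simp: mono_on_def)
  then have "map (\<lambda>(s, t). t - s) (filter (\<lambda>(s, t). s \<noteq> t) (map (map_prod f f) bs)) =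
      filter (\<lambda>k. k \<noteq> 0) (map (\<lambda>(s, t). f t - f s) bs)" if "set bs \<subseteq> set (beads T)" for bs
    using that by (induction bs) (auto, fastforce)
  then show ?thesis by (simp add: gaps_def beads_image[OF assms])
qed

lemma gaps_split:
  assumes "U \<subseteq> T" "u \<in> U" "v \<in> U" "T \<subseteq> {u..v}"
  shows "gaps T = concat (map (\<lambda>(s, t). gaps (T \<inter> {s..t})) (beads U))"
  unfolding gaps_def using assms finite_subset[of T "{u..v}"]
  by (subst beads_split[of T U u v]) (auto simp: map_concat intro!: arg_cong[where f = concat])

lemma sum_list_gaps_bead:
  assumes "(s, t) \<in> set (beads U)" "U \<subseteq> T"
  shows "sum_list (gaps (T \<inter> {s..t})) = t - s"
proof -
  have "s + sum_list (gaps (T \<inter> {s..t})) = t"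
    by (rule sum_list_gaps) (use beads_mem(1-3)[OF assms(1)] assms(2) in auto)
  then show ?thesis by simp
qed

lemma mono_on_nth:
  assumes "f \<in> Arr Delta_f" "T \<subseteq> {..<length f}"
  shows "mono_on T ((!) f)"
  using assms nth_mono[OF assms(1)] by (force simp: mono_on_def)

text \<open>A vertex of T outside \<open>{s..t}\<close> whose image falls into the interval has, by
  monotonicity, the image of an endpoint, and the endpoints belong to T. So restricting to a bead
  commutes with taking images.\<close>

lemma nth_image_interval:
  assumes "f \<in> Arr Delta_f" "T \<subseteq> {..<length f}" "s \<in> T" "t \<in> T" "s \<le> t"
  shows "(!) f ` T \<inter> {f ! s..f ! t} = (!) f ` (T \<inter> {s..t})"
proof
  show "(!) f ` (T \<inter> {s..t}) \<subseteq> (!) f ` T \<inter> {f ! s..f ! t}"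
    using assms by (auto intro!: nth_mono[OF assms(1)])
  show "(!) f ` T \<inter> {f ! s..f ! t} \<subseteq> (!) f ` (T \<inter> {s..t})"
  proof clarify
    fix x assume x: "x \<in> T" "f ! x \<in> {f ! s..f ! t}"
    have lt: "x < length f" "s < length f" "t < length f" using assms x by auto
    consider "x < s" | "x \<in> {s..t}" | "t < x" by force
    then show "f ! x \<in> (!) f ` (T \<inter> {s..t})"
    proof cases
      case 1
      then have "f ! x = f ! s" using nth_mono[OF assms(1), of x s] x lt by simp
      then show ?thesis using assms by auto
    next
      case 3
      then have "f ! x = f ! t" using nth_mono[OF assms(1), of t x] x lt by simp
      then show ?thesis using assms by auto
    qed (use x in auto)
  qed
qed

section \<open>Functoriality of the action of necklace maps\<close>

context strict_colax
begin

lemma Ys_map: "Ys (map f xs) = concat (map (\<lambda>x. Y (f x)) xs)"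
  by (simp add: Ys_def o_def)

lemma Ys_gaps_image:
  assumes "f \<in> Arr Delta_f" "T \<subseteq> {..<length f}"
  shows "Ys (gaps ((!) f ` T)) = concat (map (\<lambda>(s, t). Y (f ! t - f ! s)) (beads T))"
proof -
  have "finite T" using assms(2) finite_subset by blast
  then have "Ys (gaps ((!) f ` T)) = Ys (map (\<lambda>(s, t). f ! t - f ! s) (beads T))"
    by (simp only: gaps_image mono_on_nth[OF assms] Ys_filter)
  then show ?thesis by (simp add: Ys_def case_prod_unfold o_def)
qed

lemma act_hom:
  assumes "f \<in> Arr Delta_f" "T \<subseteq> {..<length f}"
  shows "act T f \<in> hom C (Ys (gaps ((!) f ` T))) (Ys (gaps T))"
proof -
  have "act T f \<in> hom C (concat (map (\<lambda>(s, t). Y (f ! t - f ! s)) (beads T))) (concat (map (\<lambda>(s, t). Y (t - s)) (beads T)))"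
    unfolding act_def
  proof (rule boxes_hom, clarify)
    fix s t assume "(s, t) \<in> set (beads T)"
    from beads_mem[OF this] have st: "s < t" "t < length f" using assms by auto
    then show "Yar (bead_map f (s, t)) \<in> hom C (Y (f ! t - f ! s)) (Y (t - s))"
      using Yar_hom[OF bead_map_Arr[OF assms(1), of s t]] assms by (simp add: last_bead_map)
  qed
  then show ?thesis unfolding Ys_gaps_image[OF assms]
    by (simp add: Ys_def gaps_def case_prod_unfold o_def)
qed

lemma inert_hom:
  assumes "U \<subseteq> T" "u \<in> U" "v \<in> U" "T \<subseteq> {u..v}"
  shows "inert T U \<in> hom C (Ys (gaps U)) (Ys (gaps T))"
proof -
  have "inert T U \<in> hom C (concat (map (\<lambda>(s, t). Y (t - s)) (beads U))) (concat (map (\<lambda>(s, t). Ys (gaps (T \<inter> {s..t}))) (beads U)))"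
    unfolding inert_def
  proof (rule boxes_hom, clarify)
    fix s t assume "(s, t) \<in> set (beads U)"
    then show "mus (gaps (T \<inter> {s..t})) \<in> hom C (Y (t - s)) (Ys (gaps (T \<inter> {s..t})))"
      using mus_hom[of "gaps (T \<inter> {s..t})"] sum_list_gaps_bead assms(1) by metis
  qed
  moreover have "concat (map (\<lambda>(s, t). Y (t - s)) (beads U)) = Ys (gaps U)"
    by (simp add: Ys_def gaps_def case_prod_unfold o_def)
  moreover have "concat (map (\<lambda>(s, t). Ys (gaps (T \<inter> {s..t}))) (beads U)) = Ys (gaps T)"
    by (subst gaps_split[OF assms]) (simp add: Ys_concat case_prod_unfold o_def)
  ultimately show ?thesis by simp
qed

lemma act_Idn: "T \<subseteq> {..n} \<Longrightarrow> act T [0..<Suc n] = Idn C (Ys (gaps T))"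
proof -
  assume T: "T \<subseteq> {..n}"
  have "map (\<lambda>b. Yar (bead_map [0..<Suc n] b)) (beads T) = map (\<lambda>b. Idn C (Y (snd b - fst b))) (beads T)"
  proof (rule map_cong[OF refl], clarify)
    fix s t assume "(s, t) \<in> set (beads T)"
    then have "s \<le> t" "t \<le> n" using beads_mem[of s t T] T by auto
    then show "Yar (bead_map [0..<Suc n] (s, t)) = Idn C (Y (snd (s, t) - fst (s, t)))"
      unfolding bead_map_Idn[OF \<open>s \<le> t\<close> \<open>t \<le> n\<close>] by (simp add: Yar_Idn del: upt_Suc)
  qed
  then have "act T [0..<Suc n] = boxes (map (\<lambda>b. Idn C (Y (snd b - fst b))) (beads T))"
    unfolding act_def by (rule arg_cong)
  then show ?thesis by (simp add: boxes_Idn Ys_def gaps_def case_prod_unfold o_def)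
qed

lemma inert_refl: "inert T T = Idn C (Ys (gaps T))"
proof -
  have "map (\<lambda>(s, t). mus (gaps (T \<inter> {s..t}))) (beads T) = map (\<lambda>b. Idn C (Y (snd b - fst b))) (beads T)"
    using beads_mem by (intro map_cong[OF refl]) (auto simp: gaps_pair)
  then have "inert T T = boxes (map (\<lambda>b. Idn C (Y (snd b - fst b))) (beads T))"
    unfolding inert_def by (rule arg_cong)
  then show ?thesis by (simp add: boxes_Idn Ys_def gaps_def case_prod_unfold o_def)
qed

text \<open>A bead of T collapsed by \<open>f\<close> adds only an identity, so the product over the
  beads of the image may run over all beads of T. Now \<open>act_Comp\<close> can compare factors
  bead by bead.\<close>

lemma act_image:
  assumes f: "f \<in> Arr Delta_f" "T \<subseteq> {..<length f}" and g: "g \<in> Arr Delta_f" "last f = length g - 1"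
  shows "act ((!) f ` T) g = boxes (map (\<lambda>(s, t). Yar (bead_map g (f ! s, f ! t))) (beads T))"
proof -
  have fin: "finite T" using f(2) finite_subset by blast
  have "act ((!) f ` T) g = boxes (map (\<lambda>b. Yar (bead_map g b)) (map (map_prod ((!) f) ((!) f)) (beads T)))"
    unfolding act_def beads_image[OF fin mono_on_nth[OF f]]
  proof (rule boxes_filter)
    fix b assume "b \<in> set (map (map_prod ((!) f) ((!) f)) (beads T))"
    then obtain s t where st: "(s, t) \<in> set (beads T)" "b = (f ! s, f ! t)" by auto
    have "s < t" "t < length f" using beads_mem[OF st(1)] f by auto
    then have "f ! s \<le> f ! t" "f ! t \<le> last f"
      using f by (auto intro!: nth_mono[OF f(1)] simp: last_Delta_f[OF f(1)])
    moreover have "f ! t < length g" using calculation(2) g by (cases g) (auto simp: Arr_Delta_f)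
    ultimately show "Yar (bead_map g b) \<in> Arr C" using st bead_map_Arr[OF g(1)] by simp
    show "Yar (bead_map g b) = Idn C []" if "\<not> (case b of (s, t) \<Rightarrow> s \<noteq> t)" using that by auto
  qed
  then show ?thesis by (simp add: case_prod_unfold o_def map_prod_def)
qed

lemma act_Comp:
  assumes f: "f \<in> Arr Delta_f" "T \<subseteq> {..<length f}" and g: "g \<in> Arr Delta_f" "last f = length g - 1"
  shows "act T (map ((!) g) f) = act T f \<cdot> act ((!) f ` T) g"
proof -
  have lt: "s < t \<and> t < length f \<and> f ! s \<le> f ! t \<and> f ! t < length g" if "(s, t) \<in> set (beads T)" for s t
  proof -
    have "s < t" "t < length f" using beads_mem[OF that] f by auto
    moreover from this have "f ! s \<le> f ! t" "f ! t \<le> last f"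
      using f by (auto intro!: nth_mono[OF f(1)] simp: last_Delta_f[OF f(1)])
    moreover have "f ! t < length g" using calculation(4) g by (cases g) (auto simp: Arr_Delta_f)
    ultimately show ?thesis by blast
  qed
  have "act T f \<cdot> act ((!) f ` T) g =
      boxes (map (\<lambda>b. Yar (bead_map f b) \<cdot> (case b of (s, t) \<Rightarrow> Yar (bead_map g (f ! s, f ! t)))) (beads T))"
    unfolding act_image[OF assms] act_def[of T f]
  proof (rule boxes_Comp)
    fix b assume b: "b \<in> set (beads T)"
    obtain s t where st: "b = (s, t)" by (cases b)
    note l = lt[OF b[unfolded st]]
    show "(case b of (s, t) \<Rightarrow> Yar (bead_map g (f ! s, f ! t))) \<in>
        hom C (case b of (s, t) \<Rightarrow> Y (g ! (f ! t) - g ! (f ! s))) (case b of (s, t) \<Rightarrow> Y (f ! t - f ! s))"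
      using Yar_hom[OF bead_map_Arr[OF g(1), of "f ! s" "f ! t"]] l g st by (simp add: last_bead_map)
    show "Yar (bead_map f b) \<in> hom C (case b of (s, t) \<Rightarrow> Y (f ! t - f ! s)) (case b of (s, t) \<Rightarrow> Y (t - s))"
      using Yar_hom[OF bead_map_Arr[OF f(1), of s t]] l f st by (simp add: last_bead_map)
  qed
  also have "\<dots> = act T (map ((!) g) f)"
    unfolding act_def
  proof (rule arg_cong[where f = boxes], rule map_cong[OF refl], clarify)
    fix s t assume "(s, t) \<in> set (beads T)"
    note l = lt[OF this]
    have "Yar (map ((!) (bead_map g (f ! s, f ! t))) (bead_map f (s, t))) =
        Yar (bead_map f (s, t)) \<cdot> Yar (bead_map g (f ! s, f ! t))"
      by (rule Yar_Comp) (use l f g in \<open>auto simp: last_bead_map intro!: bead_map_Arr\<close>)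
    then show "Yar (bead_map f (s, t)) \<cdot> Yar (bead_map g (f ! s, f ! t)) = Yar (bead_map (map ((!) g) f) (s, t))"
      using bead_map_Comp[OF f(1) g, of s t] l by simp
  qed
  finally show ?thesis ..
qed

text \<open>On each bead of W this is coassociativity in the form \<open>mus_concat\<close>, with
  the beads of U inside it as blocks; \<open>beads_split\<close> assembles the pieces.\<close>

lemma inert_Comp:
  assumes "W \<subseteq> U" "U \<subseteq> T" "u \<in> W" "v \<in> W" "T \<subseteq> {u..v}"
  shows "inert T W = inert T U \<cdot> inert U W"
proof -
  have U: "u \<in> U" "v \<in> U" "U \<subseteq> {u..v}" using assms by auto
  have fin: "finite U" using U finite_subset by blast
  have "inert T U = boxes (concat (map (\<lambda>(s, t). map (\<lambda>(s', t'). mus (gaps (T \<inter> {s'..t'}))) (beads (U \<inter> {s..t}))) (beads W)))"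
    unfolding inert_def using assms U fin
    by (subst beads_split[of U W u v]) (auto simp: map_concat intro!: arg_cong[where f = boxes] arg_cong[where f = concat])
  also have "\<dots> = boxes (map boxes (map (\<lambda>(s, t). map (\<lambda>(s', t'). mus (gaps (T \<inter> {s'..t'}))) (beads (U \<inter> {s..t}))) (beads W)))"
    by (rule boxes_concat) auto
  also have "\<dots> = boxes (map (\<lambda>(s, t). boxes (map (\<lambda>(s', t'). mus (gaps (T \<inter> {s'..t'}))) (beads (U \<inter> {s..t})))) (beads W))"
    by (simp add: case_prod_unfold o_def)
  finally have TU: "inert T U = \<dots>" .
  have gs: "gaps (T \<inter> {s..t}) = concat (map (\<lambda>(s', t'). gaps (T \<inter> {s'..t'})) (beads (U \<inter> {s..t})))"
    and ms: "mus (gaps (T \<inter> {s..t})) = boxes (map (\<lambda>(s', t'). mus (gaps (T \<inter> {s'..t'}))) (beads (U \<inter> {s..t}))) \<cdot> mus (gaps (U \<inter> {s..t}))"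
    if st: "(s, t) \<in> set (beads W)" for s t
  proof -
    have m: "s \<in> W" "t \<in> W" "s < t" using beads_mem[OF st] by auto
    have "gaps (T \<inter> {s..t}) = concat (map (\<lambda>(s', t'). gaps (T \<inter> {s..t} \<inter> {s'..t'})) (beads (U \<inter> {s..t})))"
      by (rule gaps_split[of _ _ s t]) (use m assms in auto)
    also have "map (\<lambda>(s', t'). gaps (T \<inter> {s..t} \<inter> {s'..t'})) (beads (U \<inter> {s..t})) =
        map (\<lambda>(s', t'). gaps (T \<inter> {s'..t'})) (beads (U \<inter> {s..t}))"
    proof (rule map_cong[OF refl], clarify)
      fix s' t' assume "(s', t') \<in> set (beads (U \<inter> {s..t}))"
      then have "T \<inter> {s..t} \<inter> {s'..t'} = T \<inter> {s'..t'}" using beads_mem by fastforce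
      then show "gaps (T \<inter> {s..t} \<inter> {s'..t'}) = gaps (T \<inter> {s'..t'})" by simp
    qed
    finally show g: "gaps (T \<inter> {s..t}) = concat (map (\<lambda>(s', t'). gaps (T \<inter> {s'..t'})) (beads (U \<inter> {s..t})))" .
    have "map sum_list (map (\<lambda>(s', t'). gaps (T \<inter> {s'..t'})) (beads (U \<inter> {s..t}))) = gaps (U \<inter> {s..t})"
      unfolding gaps_def[of "U \<inter> {s..t}"] map_map
      by (rule map_cong[OF refl]) (use sum_list_gaps_bead[of _ _ "U \<inter> {s..t}" T] assms in auto)
    then show "mus (gaps (T \<inter> {s..t})) = boxes (map (\<lambda>(s', t'). mus (gaps (T \<inter> {s'..t'}))) (beads (U \<inter> {s..t}))) \<cdot> mus (gaps (U \<inter> {s..t}))"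
      unfolding g mus_concat by (simp add: case_prod_unfold o_def)
  qed
  have "inert T U \<cdot> inert U W = boxes (map (\<lambda>b. (case b of (s, t) \<Rightarrow> boxes (map (\<lambda>(s', t'). mus (gaps (T \<inter> {s'..t'}))) (beads (U \<inter> {s..t})))) \<cdot>
      (case b of (s, t) \<Rightarrow> mus (gaps (U \<inter> {s..t})))) (beads W))"
    unfolding TU unfolding inert_def
  proof (rule boxes_Comp)
    fix b assume b: "b \<in> set (beads W)"
    obtain s t where st: "b = (s, t)" by (cases b)
    show "(case b of (s, t) \<Rightarrow> mus (gaps (U \<inter> {s..t}))) \<in>
        hom C (case b of (s, t) \<Rightarrow> Y (t - s)) (case b of (s, t) \<Rightarrow> Ys (gaps (U \<inter> {s..t})))"
      using mus_hom[of "gaps (U \<inter> {s..t})"] sum_list_gaps_bead[of s t W U] b st assms by simp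
    have "boxes (map (\<lambda>(s', t'). mus (gaps (T \<inter> {s'..t'}))) (beads (U \<inter> {s..t}))) \<in>
      hom C (concat (map (\<lambda>(s', t'). Y (t' - s')) (beads (U \<inter> {s..t})))) (concat (map (\<lambda>(s', t'). Ys (gaps (T \<inter> {s'..t'}))) (beads (U \<inter> {s..t}))))"
    proof (rule boxes_hom, clarify)
      fix s' t' assume "(s', t') \<in> set (beads (U \<inter> {s..t}))"
      then have "sum_list (gaps (T \<inter> {s'..t'})) = t' - s'" using assms by (intro sum_list_gaps_bead[of _ _ "U \<inter> {s..t}"]) auto
      then show "mus (gaps (T \<inter> {s'..t'})) \<in> hom C (Y (t' - s')) (Ys (gaps (T \<inter> {s'..t'})))"
        using mus_hom[of "gaps (T \<inter> {s'..t'})"] by simp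
    qed
    then show "(case b of (s, t) \<Rightarrow> boxes (map (\<lambda>(s', t'). mus (gaps (T \<inter> {s'..t'}))) (beads (U \<inter> {s..t})))) \<in>
        hom C (case b of (s, t) \<Rightarrow> Ys (gaps (U \<inter> {s..t}))) (case b of (s, t) \<Rightarrow> Ys (gaps (T \<inter> {s..t})))"
      using b st gs by (simp add: Ys_concat Ys_map gaps_def[of "U \<inter> _"] case_prod_unfold o_def)
  qed
  also have "\<dots> = inert T W"
    unfolding inert_def by (rule arg_cong[where f = boxes], rule map_cong[OF refl]) (auto simp: ms)
  finally show ?thesis ..
qed

text \<open>The exchange needed for composites: an inert necklace map followed by an active one is
  rewritten as an active map followed by an inert one. On each bead of U it is naturality of the
  iterated comultiplication, applied to \<open>g\<close> cut at the vertices of T.\<close>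

lemma inert_act:
  assumes "U \<subseteq> T" "0 \<in> U" "p \<in> U" "T \<subseteq> {..p}" and g: "g \<in> Arr Delta_f" "length g = Suc p"
  shows "inert T U \<cdot> act U g = act T g \<cdot> inert ((!) g ` T) ((!) g ` U)"
proof -
  have T: "T \<subseteq> {..<length g}" "T \<subseteq> {0..p}" and fin: "finite T" "finite U"
    using assms finite_subset[of T "{..p}"] finite_subset[of U T] by auto
  \<comment> \<open>The lengths of the images of the beads of T inside one bead of U, zeros
    included; the gaps of the image set omit these zeros.\<close>
  define gg where "gg = (\<lambda>(s, t). map (\<lambda>(s, t). g ! t - g ! s) (beads (T \<inter> {s..t})))"
  define ac where "ac = (\<lambda>(s, t). boxes (map (\<lambda>b. Yar (bead_map g b)) (beads (T \<inter> {s..t}))))"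
  have lt: "s \<in> T \<and> t \<in> T \<and> s < t \<and> t < length g" if "(s, t) \<in> set (beads U)" for s t
    using beads_mem[OF that] assms by auto
  have nat: "mus (gaps (T \<inter> {s..t})) \<cdot> Yar (bead_map g (s, t)) = ac (s, t) \<cdot> mus (gg (s, t))"
    and sum: "sum_list (gg (s, t)) = g ! t - g ! s"
    and ac_hom: "ac (s, t) \<in> hom C (Ys (gg (s, t))) (Ys (gaps (T \<inter> {s..t})))"
    if st: "(s, t) \<in> set (beads U)" for s t
  proof -
    note l = lt[OF st]
    let ?B = "beads (T \<inter> {s..t})"
    let ?fs = "map (bead_map g) ?B"
    have lB: "s' < t' \<and> t' < length g" if "(s', t') \<in> set ?B" for s' t'
      using beads_mem[OF that] l by auto
    have fs: "set ?fs \<subseteq> Arr Delta_f" by (auto dest!: lB intro!: bead_map_Arr[OF g(1)])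
    have B: "?B = cuts s (gaps (T \<inter> {s..t}))" "s + sum_list (gaps (T \<inter> {s..t})) = t"
      using beads_cuts[of s "T \<inter> {s..t}" t] sum_list_gaps[of s "T \<inter> {s..t}" t] l by auto
    have j: "joins ?fs = bead_map g (s, t)"
      using joins_bead_map[OF g(1), of s "gaps (T \<inter> {s..t})"] B l by simp
    have d: "map (\<lambda>f. length f - 1) ?fs = gaps (T \<inter> {s..t})" by (auto simp: gaps_def)
    have la: "map last ?fs = gg (s, t)" by (auto dest!: lB simp: gg_def last_bead_map[OF g(1)])
    show "mus (gaps (T \<inter> {s..t})) \<cdot> Yar (bead_map g (s, t)) = ac (s, t) \<cdot> mus (gg (s, t))"
      using mus_natural[OF fs] unfolding j d la by (simp add: ac_def o_def)
    show "sum_list (gg (s, t)) = g ! t - g ! s"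
      using last_joins[OF fs] unfolding j la using last_bead_map[OF g(1), of s t] l by simp
    have "ac (s, t) \<in> hom C (concat (map (\<lambda>(s, t). Y (g ! t - g ! s)) ?B)) (concat (map (\<lambda>(s, t). Y (t - s)) ?B))"
      unfolding ac_def case_prod_conv
    proof (rule boxes_hom, clarify)
      fix s' t' assume "(s', t') \<in> set ?B"
      from lB[OF this] have "s' \<le> t'" "t' < length g" by auto
      then show "Yar (bead_map g (s', t')) \<in> hom C (Y (g ! t' - g ! s')) (Y (t' - s'))"
        using Yar_hom[OF bead_map_Arr[OF g(1), of s' t']] by (simp add: last_bead_map[OF g(1)])
    qed
    then show "ac (s, t) \<in> hom C (Ys (gg (s, t))) (Ys (gaps (T \<inter> {s..t})))"
      by (simp add: Ys_def gg_def gaps_def case_prod_unfold o_def)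
  qed
  have "inert T U \<cdot> act U g = boxes (map (\<lambda>b. (case b of (s, t) \<Rightarrow> mus (gaps (T \<inter> {s..t}))) \<cdot> Yar (bead_map g b)) (beads U))"
    unfolding inert_def act_def
  proof (rule boxes_Comp)
    fix b assume b: "b \<in> set (beads U)"
    obtain s t where st: "b = (s, t)" by (cases b)
    note l = lt[OF b[unfolded st]]
    show "Yar (bead_map g b) \<in> hom C (case b of (s, t) \<Rightarrow> Y (g ! t - g ! s)) (case b of (s, t) \<Rightarrow> Y (t - s))"
      using Yar_hom[OF bead_map_Arr[OF g(1), of s t]] l st by (simp add: last_bead_map[OF g(1)])
    show "(case b of (s, t) \<Rightarrow> mus (gaps (T \<inter> {s..t}))) \<in>
        hom C (case b of (s, t) \<Rightarrow> Y (t - s)) (case b of (s, t) \<Rightarrow> Ys (gaps (T \<inter> {s..t})))"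
      using mus_hom[of "gaps (T \<inter> {s..t})"] sum_list_gaps_bead[of s t U T] b st assms by simp
  qed
  also have "\<dots> = boxes (map (\<lambda>b. ac b \<cdot> mus (gg b)) (beads U))"
    by (rule arg_cong[where f = boxes], rule map_cong[OF refl]) (auto simp: nat)
  also have "\<dots> = boxes (map ac (beads U)) \<cdot> boxes (map (\<lambda>b. mus (gg b)) (beads U))"
  proof (rule boxes_Comp[symmetric])
    fix b assume b: "b \<in> set (beads U)"
    obtain s t where st: "b = (s, t)" by (cases b)
    show "mus (gg b) \<in> hom C (Y (sum_list (gg b))) (Ys (gg b))" by (rule mus_hom)
    show "ac b \<in> hom C (Ys (gg b)) (Ys (gaps (T \<inter> {fst b..snd b})))"
      using ac_hom b st by simp
  qed
  also have "boxes (map ac (beads U)) = act T g"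
  proof -
    have "act T g = boxes (concat (map (\<lambda>(s, t). map (\<lambda>b. Yar (bead_map g b)) (beads (T \<inter> {s..t}))) (beads U)))"
      unfolding act_def using fin assms T
      by (subst beads_split[of T U 0 p]) (auto simp: map_concat intro!: arg_cong[where f = boxes] arg_cong[where f = concat])
    also have "\<dots> = boxes (map boxes (map (\<lambda>(s, t). map (\<lambda>b. Yar (bead_map g b)) (beads (T \<inter> {s..t}))) (beads U)))"
    proof (rule boxes_concat, clarsimp)
      fix s t s' t' assume "(s', t') \<in> set (beads (T \<inter> {s..t}))"
      from beads_mem[OF this] have "s' \<le> t'" "t' < length g" using T by auto
      then show "Yar (bead_map g (s', t')) \<in> Arr C" by (simp add: bead_map_Arr[OF g(1)])
    qed
    finally show ?thesis by (simp add: ac_def case_prod_unfold o_def)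
  qed
  \<comment> \<open>Two kinds of collapse have to disappear. Beads of T collapsed inside a bead of U
    give zeros in \<open>gg\<close>, removed by \<open>mus_filter\<close>; whole beads of U
    collapsed to a point give identities, removed by \<open>boxes_filter\<close>.\<close>
  also have "boxes (map (\<lambda>b. mus (gg b)) (beads U)) = inert ((!) g ` T) ((!) g ` U)"
  proof -
    have im: "mus (gaps ((!) g ` T \<inter> {g ! s..g ! t})) = mus (gg (s, t))" if "(s, t) \<in> set (beads U)" for s t
    proof -
      note l = lt[OF that]
      have "mono_on (T \<inter> {s..t}) ((!) g)" using T by (intro mono_on_nth[OF g(1)]) auto
      then show ?thesis using l nth_image_interval[OF g(1) T(1), of s t]
          gaps_image[of "T \<inter> {s..t}" "(!) g"] fin
        by (simp add: gg_def mus_filter[simplified])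
    qed
    have "mono_on U ((!) g)" using assms T by (intro mono_on_nth[OF g(1)]) auto
    then have "inert ((!) g ` T) ((!) g ` U) =
      boxes (map (\<lambda>(s, t). mus (gaps ((!) g ` T \<inter> {s..t}))) (filter (\<lambda>(s, t). s \<noteq> t) (map (map_prod ((!) g) ((!) g)) (beads U))))"
      by (simp add: inert_def beads_image fin)
    also have "\<dots> = boxes (map (\<lambda>(s, t). mus (gaps ((!) g ` T \<inter> {s..t}))) (map (map_prod ((!) g) ((!) g)) (beads U)))"
    proof (rule boxes_filter)
      fix b assume "b \<in> set (map (map_prod ((!) g) ((!) g)) (beads U))" "\<not> (case b of (s, t) \<Rightarrow> s \<noteq> t)"
      then obtain s t where st: "(s, t) \<in> set (beads U)" "b = (g ! s, g ! t)" "g ! s = g ! t" by auto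
      then have "(!) g ` T \<inter> {g ! s..g ! t} = {g ! s}" using lt[OF st(1)] by auto
      then show "(case b of (s, t) \<Rightarrow> mus (gaps ((!) g ` T \<inter> {s..t}))) = Idn C []" using st by simp
    qed auto
    also have "\<dots> = boxes (map (\<lambda>b. mus (gg b)) (beads U))"
      unfolding map_map by (rule arg_cong[where f = boxes], rule map_cong[OF refl]) (auto simp: im)
    finally show ?thesis ..
  qed
  finally show ?thesis .
qed

definition nec_act :: "nat set \<Rightarrow> nat set \<Rightarrow> nat list \<Rightarrow> 'a" where
  "nec_act T U f = act T f \<cdot> inert ((!) f ` T) U"

lemma Nec_Arr_image:
  assumes "((T, p), (U, q), f) \<in> Arr Nec"
  shows "f \<in> Arr Delta_f" "length f = Suc p" "last f = q" "U \<subseteq> (!) f ` T" "(!) f ` T \<subseteq> {0..q}"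
    "0 \<in> U" "q \<in> U" "0 \<in> T" "p \<in> T" "T \<subseteq> {..p}" "T \<subseteq> {..<length f}"
proof -
  show f: "f \<in> Arr Delta_f" "last f = q" "U \<subseteq> (!) f ` T" "0 \<in> U" "q \<in> U" "0 \<in> T" "p \<in> T" "T \<subseteq> {..p}"
    using assms by (auto simp: Nec_def Let_def hom_def)
  show l: "length f = Suc p" using assms by (cases f) (auto simp: Nec_def Let_def hom_def Arr_Delta_f)
  then show "T \<subseteq> {..<length f}" using f by auto
  show "(!) f ` T \<subseteq> {0..q}"
    using f l last_Delta_f[OF f(1)] nth_mono[OF f(1), of _ p] by auto
qed

lemma nec_act_hom:
  assumes "((T, p), (U, q), f) \<in> Arr Nec"
  shows "nec_act T U f \<in> hom C (Ys (gaps U)) (Ys (gaps T))"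
  unfolding nec_act_def
  using Comp_hom[OF inert_hom[of U "(!) f ` T" 0 q] act_hom[of f T]] Nec_Arr_image[OF assms] by blast

lemma nec_act_Idn: "T \<subseteq> {..p} \<Longrightarrow> nec_act T T [0..<Suc p] = Idn C (Ys (gaps T))"
proof -
  assume "T \<subseteq> {..p}"
  then have "(!) [0..<Suc p] ` T = T" by (force simp: nth_append simp del: upt_Suc)
  then show ?thesis using \<open>T \<subseteq> {..p}\<close> by (simp add: nec_act_def act_Idn inert_refl del: upt_Suc)
qed

text \<open>The composite of the two actions reads active, inert, active, inert.
  \<open>inert_act\<close> exchanges the middle two; \<open>act_Comp\<close> and
  \<open>inert_Comp\<close> then merge the neighbours.\<close>

lemma nec_act_Comp:
  assumes "((T, p), (U, q), f) \<in> Arr Nec" "((U, q), (W, r), g) \<in> Arr Nec"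
  shows "nec_act T W (map ((!) g) f) = nec_act T U f \<cdot> nec_act U W g"
proof -
  note f = Nec_Arr_image[OF assms(1)] and g = Nec_Arr_image[OF assms(2)]
  have gf: "last f = length g - 1" "(!) (map ((!) g) f) ` T = (!) g ` ((!) f ` T)"
    using f g by (auto simp: image_image intro!: image_cong)
  have fT: "(!) f ` T \<subseteq> {..<length g}" using f g by auto
  note h = act_hom[OF f(1,11)] inert_hom[OF f(4,6,7,5)] act_hom[OF g(1,11)] inert_hom[OF g(4,6,7,5)]
    act_hom[OF g(1) fT]
  have "(!) g ` ((!) f ` T) \<subseteq> {0..r}"
    using nth_mono[OF g(1), of _ q] last_Delta_f[OF g(1)] g f by auto
  moreover have "(!) g ` U \<subseteq> (!) g ` ((!) f ` T)" using f by blast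
  moreover have "0 \<in> (!) g ` U" "r \<in> (!) g ` U" using g by blast+
  ultimately have i: "inert ((!) g ` ((!) f ` T)) ((!) g ` U) \<in> hom C (Ys (gaps ((!) g ` U))) (Ys (gaps ((!) g ` ((!) f ` T))))"
    "inert ((!) g ` ((!) f ` T)) W = inert ((!) g ` ((!) f ` T)) ((!) g ` U) \<cdot> inert ((!) g ` U) W"
    using inert_hom[of "(!) g ` U" "(!) g ` (!) f ` T" 0 r] inert_Comp[of W "(!) g ` U" "(!) g ` (!) f ` T" 0 r] g
    by simp_all
  have "nec_act T U f \<cdot> nec_act U W g = act T f \<cdot> ((inert ((!) f ` T) U \<cdot> act U g) \<cdot> inert ((!) g ` U) W)"
    unfolding nec_act_def using h by (auto simp: hom_def)
  also have "inert ((!) f ` T) U \<cdot> act U g = act ((!) f ` T) g \<cdot> inert ((!) g ` ((!) f ` T)) ((!) g ` U)"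
    using f g by (intro inert_act[of _ _ q]) auto
  also have "act T f \<cdot> ((act ((!) f ` T) g \<cdot> inert ((!) g ` ((!) f ` T)) ((!) g ` U)) \<cdot> inert ((!) g ` U) W) =
      (act T f \<cdot> act ((!) f ` T) g) \<cdot> inert ((!) g ` ((!) f ` T)) W"
    using h i by (auto simp: hom_def)
  also have "\<dots> = nec_act T W (map ((!) g) f)"
    unfolding nec_act_def act_Comp[OF f(1,11) g(1) gf(1)] gf(2) ..
  finally show ?thesis ..
qed

end

section \<open>Opposites, the category of intervals and the category of necklaces\<close>

lemma op_cat_simps [simp]:
  "Obj (op_cat C) = Obj C" "Arr (op_cat C) = Arr C" "Dom (op_cat C) = Cod C" "Cod (op_cat C) = Dom C"
  "Idn (op_cat C) = Idn C" "g \<cdot>\<^bsub>op_cat C\<^esub> f = f \<cdot>\<^bsub>C\<^esub> g"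
  by (simp_all add: op_cat_def)

lemma hom_op_cat [simp]: "hom (op_cat C) x y = hom C y x"
  by (auto simp: hom_def)

lemma category_op_cat: "category C \<Longrightarrow> category (op_cat C)"
proof -
  assume "category C"
  then interpret category C .
  show ?thesis
  proof
    show "f \<cdot>\<^bsub>op_cat C\<^esub> Idn (op_cat C) x = f" "Idn (op_cat C) y \<cdot>\<^bsub>op_cat C\<^esub> f = f" if "f \<in> hom (op_cat C) x y" for f x y
      using that Idn_Comp Comp_Idn by auto
    show "(h \<cdot>\<^bsub>op_cat C\<^esub> g) \<cdot>\<^bsub>op_cat C\<^esub> f = h \<cdot>\<^bsub>op_cat C\<^esub> (g \<cdot>\<^bsub>op_cat C\<^esub> f)"
      if "f \<in> hom (op_cat C) w x" "g \<in> hom (op_cat C) x y" "h \<in> hom (op_cat C) y z" for f g h w x y z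
      using that Comp_assoc[of h z y g x f w] by simp
    show "g \<cdot>\<^bsub>op_cat C\<^esub> f \<in> hom (op_cat C) x z" if "f \<in> hom (op_cat C) x y" "g \<in> hom (op_cat C) y z" for f g x y z
      using that Comp_hom by auto
  qed (auto intro: Idn_hom)
qed

lemma nth_le_last_Delta_f: "f \<in> Arr Delta_f \<Longrightarrow> i < length f \<Longrightarrow> f ! i \<le> last f"
  using nth_mono[of f i "length f - 1"] last_Delta_f[of f] by auto

lemma Idn_Delta_f_Arr [simp]: "[0..<n] @ [n] \<in> Arr Delta_f"
  using sorted_upt[of 0 "Suc n"] by (cases n) (auto simp: Arr_Delta_f nth_append)

lemma category_Delta_f: "category Delta_f"
proof
  show "f \<cdot>\<^bsub>Delta_f\<^esub> Idn Delta_f x = f" if "f \<in> hom Delta_f x y" for f x y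
  proof -
    have "length f = Suc x" using that by (cases f) (auto simp: hom_def Arr_Delta_f)
    then show ?thesis using map_nth[of f] by (simp del: upt_Suc)
  qed
  show "Idn Delta_f y \<cdot>\<^bsub>Delta_f\<^esub> f = f" if "f \<in> hom Delta_f x y" for f x y
  proof (rule nth_equalityI)
    fix i assume "i < length (Idn Delta_f y \<cdot>\<^bsub>Delta_f\<^esub> f)"
    then have i: "i < length f" by simp
    have "f \<in> Arr Delta_f" "last f = y" using that by (auto simp: hom_def)
    then have "f ! i < Suc y" using nth_le_last_Delta_f[of f i] i by auto
    then show "(Idn Delta_f y \<cdot>\<^bsub>Delta_f\<^esub> f) ! i = f ! i" using i by (simp del: upt_Suc)
  qed simp
  show "(h \<cdot>\<^bsub>Delta_f\<^esub> g) \<cdot>\<^bsub>Delta_f\<^esub> f = h \<cdot>\<^bsub>Delta_f\<^esub> (g \<cdot>\<^bsub>Delta_f\<^esub> f)"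
    if "f \<in> hom Delta_f w x" "g \<in> hom Delta_f x y" "h \<in> hom Delta_f y z" for f g h w x y z
  proof -
    have *: "f \<in> Arr Delta_f" "last f = length g - 1" "g \<noteq> []" using that by (auto simp: hom_def Arr_Delta_f)
    have "f ! i < length g" if "i < length f" for i
      using nth_le_last_Delta_f[OF *(1) that] *(2,3) by (cases g) auto
    then show ?thesis by (intro nth_equalityI) simp_all
  qed
  show "g \<cdot>\<^bsub>Delta_f\<^esub> f \<in> hom Delta_f x z" if "f \<in> hom Delta_f x y" "g \<in> hom Delta_f y z" for f g x y z
  proof -
    have "f \<in> Arr Delta_f" "g \<in> Arr Delta_f" "last f = length g - 1" using that by (simp_all add: hom_def)
    from Comp_Delta_f[OF this] last_Comp_Delta_f[OF this] that show ?thesis by (simp add: hom_def)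
  qed
qed (auto simp: hom_def)

lemma Nec_simps:
  "Obj Nec = {(T, p). {0, p} \<subseteq> T \<and> T \<subseteq> {..p}}"
  "Arr Nec = {((T, p), (U, q), f). (T, p) \<in> Obj Nec \<and> (U, q) \<in> Obj Nec \<and>
     f \<in> hom Delta_f p q \<and> U \<subseteq> (!) f ` T}"
  "Dom Nec (x, y, f) = x" "Cod Nec (x, y, f) = y" "Idn Nec (T, p) = ((T, p), (T, p), [0..<Suc p])"
  "(x', y', g) \<cdot>\<^bsub>Nec\<^esub> (x, y, f) = (x, y', map ((!) g) f)"
  by (auto simp: Nec_def Let_def)

lemma Nec_Comp_Arr:
  assumes "((T, p), (U, q), f) \<in> Arr Nec" "((U, q), (W, r), g) \<in> Arr Nec"
  shows "((T, p), (W, r), map ((!) g) f) \<in> Arr Nec"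
proof -
  have f: "f \<in> hom Delta_f p q" and g: "g \<in> hom Delta_f q r" and s: "U \<subseteq> (!) f ` T" "W \<subseteq> (!) g ` U"
    and o: "(T, p) \<in> Obj Nec" "(W, r) \<in> Obj Nec"
    using assms by (auto simp: Nec_simps)
  interpret D: category Delta_f by (rule category_Delta_f)
  have "length f = Suc p" "T \<subseteq> {..p}" using f o by (cases f; auto simp: hom_def Arr_Delta_f Nec_simps)+
  then have e: "(!) (map ((!) g) f) ` T = (!) g ` ((!) f ` T)"
    by (auto simp: image_image intro!: image_cong)
  have "W \<subseteq> (!) (map ((!) g) f) ` T"
    unfolding e by (rule subset_trans[OF s(2) image_mono[OF s(1)]])
  moreover have "map ((!) g) f \<in> hom Delta_f p r" using D.Comp_hom[OF f g] by simp
  ultimately show ?thesis using o unfolding Nec_simps(2) by blast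
qed

lemma category_Nec: "category Nec"
proof
  interpret D: category Delta_f by (rule category_Delta_f)
  show "Idn Nec x \<in> hom Nec x x" if "x \<in> Obj Nec" for x
  proof -
    obtain T p where x: "x = (T, p)" by (cases x)
    then have "T \<subseteq> (!) [0..<Suc p] ` T" using that by (force simp: Nec_simps nth_append)
    then show ?thesis using that x D.Idn_hom[of p] by (auto simp: hom_def[of Nec] Nec_simps)
  qed
  show "g \<cdot>\<^bsub>Nec\<^esub> f \<in> hom Nec x z" if fg: "f \<in> hom Nec x y" "g \<in> hom Nec y z" for f g x y z
  proof -
    obtain T p U q W r where xyz: "x = (T, p)" "y = (U, q)" "z = (W, r)" by (metis prod.exhaust)
    obtain f' where "f = ((T, p), (U, q), f')"
      using fg(1) xyz by (cases f) (auto simp: hom_def Nec_simps(3,4))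
    moreover obtain g' where "g = ((U, q), (W, r), g')"
      using fg(2) xyz by (cases g) (auto simp: hom_def Nec_simps(3,4))
    ultimately show ?thesis using fg xyz Nec_Comp_Arr[of T p U q f' W r g']
      by (simp add: hom_def[of Nec] Nec_simps(3-6))
  qed
  show "f \<cdot>\<^bsub>Nec\<^esub> Idn Nec x = f" if "f \<in> hom Nec x y" for f x y
    using that D.Comp_Idn by (auto simp: hom_def[of Nec] Nec_simps simp del: upt_Suc)
  show "Idn Nec y \<cdot>\<^bsub>Nec\<^esub> f = f" if "f \<in> hom Nec x y" for f x y
    using that D.Idn_Comp by (auto simp: hom_def[of Nec] Nec_simps simp del: upt_Suc)
  show "(h \<cdot>\<^bsub>Nec\<^esub> g) \<cdot>\<^bsub>Nec\<^esub> f = h \<cdot>\<^bsub>Nec\<^esub> (g \<cdot>\<^bsub>Nec\<^esub> f)"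
    if "f \<in> hom Nec w x" "g \<in> hom Nec x y" "h \<in> hom Nec y z" for f g h w x y z
    using that D.Comp_assoc by (auto simp: hom_def[of Nec] Nec_simps simp del: map_map)
  have "x \<in> Obj Nec \<and> y \<in> Obj Nec" if "(x, y, f) \<in> Arr Nec" for x y f
    using that unfolding Nec_simps(2) by (cases x; cases y) simp
  then show "Dom Nec f \<in> Obj Nec" "Cod Nec f \<in> Obj Nec" if "f \<in> Arr Nec" for f
    using that by (cases f; simp add: Nec_simps(3,4); blast)+
qed

lemma op_mon_cat_Delta_f [simp]:
  "Obj (op_mon_cat Delta_f) = UNIV" "Arr (op_mon_cat Delta_f) = Arr Delta_f"
  "Dom (op_mon_cat Delta_f) f = last f" "Cod (op_mon_cat Delta_f) f = length f - 1"
  "Idn (op_mon_cat Delta_f) n = [0..<Suc n]" "g \<cdot>\<^bsub>op_mon_cat Delta_f\<^esub> f = map ((!) f) g"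
  "Tensor (op_mon_cat Delta_f) = (+)"
  "f \<odot>\<^bsub>op_mon_cat Delta_f\<^esub> g = f @ map ((+) (last f)) (tl g)" "Unit (op_mon_cat Delta_f) = 0"
  by (simp_all add: op_mon_cat_def op_cat_def cat.defs mon_cat.defs)

lemma op_mon_cat_Delta_f_coherence [simp]:
  "Assoc (op_mon_cat Delta_f) k l m = [0..<Suc (k + l + m)]"
  "LUnit (op_mon_cat Delta_f) n = [0..<Suc n]" "RUnit (op_mon_cat Delta_f) n = [0..<Suc n]"
proof -
  interpret D: category Delta_f by (rule category_Delta_f)
  have inv: "inv_arr Delta_f [0..<Suc n] = [0..<Suc n]" for n
    using D.inv_arr_Idn[of n] by (simp del: upt_Suc)
  have "Assoc Delta_f k l m = [0..<Suc (k + l + m)]" "LUnit Delta_f n = [0..<Suc n]" "RUnit Delta_f n = [0..<Suc n]"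
    by (simp_all add: Delta_f_def)
  then show "Assoc (op_mon_cat Delta_f) k l m = [0..<Suc (k + l + m)]"
    "LUnit (op_mon_cat Delta_f) n = [0..<Suc n]" "RUnit (op_mon_cat Delta_f) n = [0..<Suc n]"
    by (simp_all add: op_mon_cat_def op_cat_def cat.defs mon_cat.defs inv del: upt_Suc)
qed

section \<open>Normalizing a strongly unital colax functor\<close>

locale unital_colax = monoidal_category M for M :: "('o, 'm, 'z) mon_cat_scheme" (structure) +
  fixes X :: "(nat, nat list, 'o, 'm) colax"
  assumes colax: "colax_monoidal (op_mon_cat Delta_f) M X" and iso_counit: "iso M (counit X)"
begin

lemma X_functor: "is_functor (op_mon_cat Delta_f) M X"
  using colax by (simp add: colax_monoidal_def)

lemma X_Obj [simp]: "fob X k \<in> Obj M"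
  and X_Arr [simp]: "f \<in> Arr Delta_f \<Longrightarrow> far X f \<in> Arr M"
  and X_Dom [simp]: "f \<in> Arr Delta_f \<Longrightarrow> Dom M (far X f) = fob X (last f)"
  and X_Cod [simp]: "f \<in> Arr Delta_f \<Longrightarrow> Cod M (far X f) = fob X (length f - 1)"
  and X_Idn: "far X [0..<Suc k] = Idn M (fob X k)"
  using X_functor by (auto simp: is_functor_def hom_def simp del: upt_Suc)

lemma X_Comp: "f \<in> Arr Delta_f \<Longrightarrow> g \<in> Arr Delta_f \<Longrightarrow> last f = length g - 1 \<Longrightarrow>
    far X (map ((!) g) f) = far X f \<cdot> far X g"
  using X_functor by (auto simp: is_functor_def)

lemma comult_Arr [simp]: "comult X k l \<in> Arr M"
  and Dom_comult [simp]: "Dom M (comult X k l) = fob X (k + l)"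
  and Cod_comult [simp]: "Cod M (comult X k l) = fob X k \<otimes> fob X l"
  using colax by (auto simp: colax_monoidal_def hom_def)

lemma comult_natural: "f \<in> Arr Delta_f \<Longrightarrow> g \<in> Arr Delta_f \<Longrightarrow>
    (far X f \<odot> far X g) \<cdot> comult X (last f) (last g) =
    comult X (length f - 1) (length g - 1) \<cdot> far X (f @ map ((+) (last f)) (tl g))"
  using colax by (auto simp: colax_monoidal_def)

lemma counit_Arr [simp]: "counit X \<in> Arr M"
  and Dom_counit [simp]: "Dom M (counit X) = fob X 0"
  and Cod_counit [simp]: "Cod M (counit X) = Unit M"
  using colax by (auto simp: colax_monoidal_def hom_def)

lemma comult_assoc: "Assoc M (fob X k) (fob X l) (fob X m) \<cdot> ((comult X k l \<odot> Idn M (fob X m)) \<cdot> comult X (k + l) m) =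
    (Idn M (fob X k) \<odot> comult X l m) \<cdot> comult X k (l + m)"
  using colax by (simp add: colax_monoidal_def X_Idn add.assoc del: upt_Suc)

lemma counit_left: "LUnit M (fob X k) \<cdot> ((counit X \<odot> Idn M (fob X k)) \<cdot> comult X 0 k) = Idn M (fob X k)"
  and counit_right: "RUnit M (fob X k) \<cdot> ((Idn M (fob X k) \<odot> counit X) \<cdot> comult X k 0) = Idn M (fob X k)"
  using colax by (simp_all add: colax_monoidal_def X_Idn del: upt_Suc)

text \<open>Conjugation by \<open>norm\<close> replaces \<open>X\<^sub>0\<close> by the empty list, so that collapsed beads disappear
  from tensor products.\<close>

abbreviation S where "S \<equiv> strictify M"
abbreviation sbox (infixr "\<boxtimes>" 80) where "f \<boxtimes> g \<equiv> strict_box M f g"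

definition Y :: "nat \<Rightarrow> 'o list" where
  "Y k = (if k = 0 then [] else [fob X k])"

definition norm :: "nat \<Rightarrow> 'o list \<times> 'o list \<times> 'm" where
  "norm k = ([fob X k], Y k, if k = 0 then counit X else Idn M (fob X k))"

definition norm' :: "nat \<Rightarrow> 'o list \<times> 'o list \<times> 'm" where
  "norm' k = (Y k, [fob X k], if k = 0 then inv_arr M (counit X) else Idn M (fob X k))"

definition X1 :: "nat list \<Rightarrow> 'o list \<times> 'o list \<times> 'm" where
  "X1 f = ([fob X (last f)], [fob X (length f - 1)], far X f)"

definition comult1 :: "nat \<Rightarrow> nat \<Rightarrow> 'o list \<times> 'o list \<times> 'm" where
  "comult1 k l = ([fob X (k + l)], [fob X k, fob X l], comult X k l)"

definition Yar :: "nat list \<Rightarrow> 'o list \<times> 'o list \<times> 'm" where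
  "Yar f = norm (length f - 1) \<cdot>\<^bsub>S\<^esub> (X1 f \<cdot>\<^bsub>S\<^esub> norm' (last f))"

definition mu :: "nat \<Rightarrow> nat \<Rightarrow> 'o list \<times> 'o list \<times> 'm" where
  "mu k l = (norm k \<boxtimes> norm l) \<cdot>\<^bsub>S\<^esub> (comult1 k l \<cdot>\<^bsub>S\<^esub> norm' (k + l))"

lemma S_simps:
  "Obj S = {xs. set xs \<subseteq> Obj M}"
  "(xs, ys, f) \<in> Arr S \<longleftrightarrow> set xs \<subseteq> Obj M \<and> set ys \<subseteq> Obj M \<and> f \<in> hom M (tens M xs) (tens M ys)"
  "Dom S (xs, ys, f) = xs" "Cod S (xs, ys, f) = ys" "Idn S xs = (xs, xs, Idn M (tens M xs))"
  "(ys, zs, g) \<cdot>\<^bsub>S\<^esub> (xs, ys', f) = (xs, zs, g \<cdot> f)"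
  by (auto simp: strictify_def)

lemma strict_box_simp: "(xs, ys, f) \<boxtimes> (xs', ys', g) = (xs @ xs', ys @ ys',
    tens_append M ys ys' \<cdot> ((f \<odot> g) \<cdot> inv_arr M (tens_append M xs xs')))"
  by (simp add: strict_box_def)

sublocale S: strict_monoidal S "strict_box M"
  by (rule strict_monoidal_strictify)

lemma norm_Arr [simp]: "norm k \<in> Arr S" "Dom S (norm k) = [fob X k]" "Cod S (norm k) = Y k"
  and norm'_Arr [simp]: "norm' k \<in> Arr S" "Dom S (norm' k) = Y k" "Cod S (norm' k) = [fob X k]"
  and X1_Arr [simp]: "f \<in> Arr Delta_f \<Longrightarrow> X1 f \<in> Arr S" "Dom S (X1 f) = [fob X (last f)]"
    "Cod S (X1 f) = [fob X (length f - 1)]"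
  and comult1_Arr [simp]: "comult1 k l \<in> Arr S" "Dom S (comult1 k l) = [fob X (k + l)]"
    "Cod S (comult1 k l) = [fob X k, fob X l]"
  and Y_Obj [simp]: "Y k \<in> Obj S"
  by (auto simp: norm_def norm'_def X1_def comult1_def S_simps hom_def Y_def iso_counit)

lemma X_singleton_Obj [simp]: "[fob X k] \<in> Obj S"
  by (simp add: S_simps)

lemma norm_inverse [simp]: "norm k \<cdot>\<^bsub>S\<^esub> norm' k = Idn S (Y k)" "norm' k \<cdot>\<^bsub>S\<^esub> norm k = Idn S [fob X k]"
  by (auto simp: norm_def norm'_def S_simps Y_def iso_counit)

lemma norm_inverse_assoc [simp]:
  "f \<in> Arr S \<Longrightarrow> Cod S f = Y k \<Longrightarrow> norm k \<cdot>\<^bsub>S\<^esub> (norm' k \<cdot>\<^bsub>S\<^esub> f) = f"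
  "f \<in> Arr S \<Longrightarrow> Cod S f = [fob X k] \<Longrightarrow> norm' k \<cdot>\<^bsub>S\<^esub> (norm k \<cdot>\<^bsub>S\<^esub> f) = f"
  by (simp_all add: S.Comp_assoc'[symmetric] del: S.Comp_assoc')

lemma norm_0: "norm 0 = ([fob X 0], [], counit X)"
  by (simp add: norm_def Y_def)

text \<open>The first of the colax axioms in strict form: associator and unitors disappear into the
  isomorphisms \<open>tens_append\<close> that enter \<open>strict_box\<close>.\<close>

lemma comult1_assoc: "(comult1 k l \<boxtimes> Idn S [fob X m]) \<cdot>\<^bsub>S\<^esub> comult1 (k + l) m =
    (Idn S [fob X k] \<boxtimes> comult1 l m) \<cdot>\<^bsub>S\<^esub> comult1 k (l + m)"
  using comult_assoc by (simp add: comult1_def S_simps strict_box_simp add.assoc)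

lemma comult1_unit: "(norm 0 \<boxtimes> Idn S [fob X k]) \<cdot>\<^bsub>S\<^esub> comult1 0 k = Idn S [fob X k]"
  "(Idn S [fob X k] \<boxtimes> norm 0) \<cdot>\<^bsub>S\<^esub> comult1 k 0 = Idn S [fob X k]"
  using counit_left counit_right by (simp_all add: norm_0 comult1_def S_simps strict_box_simp)

lemma comult1_natural: "f \<in> Arr Delta_f \<Longrightarrow> g \<in> Arr Delta_f \<Longrightarrow>
  (X1 f \<boxtimes> X1 g) \<cdot>\<^bsub>S\<^esub> comult1 (last f) (last g) =
  comult1 (length f - 1) (length g - 1) \<cdot>\<^bsub>S\<^esub> X1 (f @ map ((+) (last f)) (tl g))"
  using comult_natural[of f g] TensorArr_Delta_f[of f g] by (simp add: comult1_def X1_def S_simps strict_box_simp)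

text \<open>In every composite a \<open>norm\<close> is met by the \<open>norm'\<close> that undoes
  it; these cancel, and what remains is a strict axiom of X conjugated by
  \<open>norm\<close>.\<close>

sublocale Y: strict_colax S "strict_box M" Y Yar mu
proof
  show "Y 0 = []" by (simp add: Y_def)
  show "Yar f \<in> hom S (Y (last f)) (Y (length f - 1))" if "f \<in> Arr Delta_f" for f
    using that by (simp add: Yar_def hom_def)
  show "Yar [0..<Suc k] = Idn S (Y k)" for k
  proof -
    have "X1 [0..<Suc k] = Idn S [fob X k]" using X_Idn[of k] by (simp add: X1_def S_simps)
    then show ?thesis by (simp add: Yar_def)
  qed
  show "Yar (map ((!) g) f) = Yar f \<cdot>\<^bsub>S\<^esub> Yar g"
    if "f \<in> Arr Delta_f" "g \<in> Arr Delta_f" "last f = length g - 1" for f g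
  proof -
    have "X1 (map ((!) g) f) = X1 f \<cdot>\<^bsub>S\<^esub> X1 g"
      using that last_Comp_Delta_f[of f g] by (simp add: X1_def S_simps X_Comp)
    then show ?thesis using that last_Comp_Delta_f[of f g] by (simp add: Yar_def)
  qed
  show "mu k l \<in> hom S (Y (k + l)) (Y k @ Y l)" for k l by (simp add: mu_def hom_def)
  show "(Yar f \<boxtimes> Yar g) \<cdot>\<^bsub>S\<^esub> mu (last f) (last g) =
      mu (length f - 1) (length g - 1) \<cdot>\<^bsub>S\<^esub> Yar (f @ map ((+) (last f)) (tl g))"
    if f: "f \<in> Arr Delta_f" "g \<in> Arr Delta_f" for f g
  proof -
    note fg = TensorArr_Delta_f[OF f]
    have "(Yar f \<boxtimes> Yar g) \<cdot>\<^bsub>S\<^esub> mu (last f) (last g) =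
        (norm (length f - 1) \<boxtimes> norm (length g - 1)) \<cdot>\<^bsub>S\<^esub>
          (((X1 f \<boxtimes> X1 g) \<cdot>\<^bsub>S\<^esub> comult1 (last f) (last g)) \<cdot>\<^bsub>S\<^esub> norm' (last f + last g))"
      using f by (simp add: Yar_def mu_def S.box_interchange_assoc)
    then show ?thesis
      unfolding comult1_natural[OF f] using f fg by (simp add: Yar_def mu_def)
  qed
  show "(mu k l \<boxtimes> Idn S (Y m)) \<cdot>\<^bsub>S\<^esub> mu (k + l) m = (Idn S (Y k) \<boxtimes> mu l m) \<cdot>\<^bsub>S\<^esub> mu k (l + m)" for k l m
  proof -
    have "(mu k l \<boxtimes> Idn S (Y m)) \<cdot>\<^bsub>S\<^esub> mu (k + l) m =
        ((norm k \<boxtimes> norm l) \<boxtimes> norm m) \<cdot>\<^bsub>S\<^esub> (((comult1 k l \<boxtimes> Idn S [fob X m]) \<cdot>\<^bsub>S\<^esub> comult1 (k + l) m) \<cdot>\<^bsub>S\<^esub> norm' (k + l + m))"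
      by (simp add: mu_def S.box_interchange_assoc)
    also have "\<dots> = (norm k \<boxtimes> (norm l \<boxtimes> norm m)) \<cdot>\<^bsub>S\<^esub> (((Idn S [fob X k] \<boxtimes> comult1 l m) \<cdot>\<^bsub>S\<^esub> comult1 k (l + m)) \<cdot>\<^bsub>S\<^esub> norm' (k + l + m))"
      by (simp only: comult1_assoc S.box_assoc norm_Arr)
    also have "\<dots> = (Idn S (Y k) \<boxtimes> mu l m) \<cdot>\<^bsub>S\<^esub> mu k (l + m)"
      by (simp add: mu_def S.box_interchange_assoc add.assoc)
    finally show ?thesis .
  qed
  show "mu 0 k = Idn S (Y k)" for k
  proof -
    \<comment> \<open>The factor \<open>norm 0 \<boxtimes> norm k\<close> is split into two stages
      so that the counit law \<open>comult1_unit\<close> applies; simplifying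
      \<open>Idn S [] \<boxtimes> norm k\<close> would undo the splitting.\<close>
    have "mu 0 k = (Idn S [] \<boxtimes> norm k) \<cdot>\<^bsub>S\<^esub> (((norm 0 \<boxtimes> Idn S [fob X k]) \<cdot>\<^bsub>S\<^esub> comult1 0 k) \<cdot>\<^bsub>S\<^esub> norm' k)"
      by (simp add: mu_def S.box_interchange_assoc Y_def del: S.Idn_Nil_box)
    then show ?thesis by (simp add: comult1_unit)
  qed
  show "mu k 0 = Idn S (Y k)" for k
  proof -
    have "mu k 0 = (norm k \<boxtimes> Idn S []) \<cdot>\<^bsub>S\<^esub> (((Idn S [fob X k] \<boxtimes> norm 0) \<cdot>\<^bsub>S\<^esub> comult1 k 0) \<cdot>\<^bsub>S\<^esub> norm' k)"
      by (simp add: mu_def S.box_interchange_assoc Y_def del: S.box_Idn_Nil)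
    then show ?thesis by (simp add: comult1_unit)
  qed
qed simp

end

section \<open>The necklace functor\<close>

context monoidal_category
begin

lemma tens_concat_hom_iso:
  "(\<And>xs. xs \<in> set xss \<Longrightarrow> set xs \<subseteq> Obj M) \<Longrightarrow>
   tens_concat M xss \<in> hom M (tens M (map (tens M) xss)) (tens M (concat xss)) \<and> iso M (tens_concat M xss)"
proof (induction xss rule: induct_list012)
  case (3 xs ys xss)
  let ?zs = "concat (ys # xss)"
  have "set xs \<subseteq> Obj M" "set ys \<subseteq> Obj M" "set ?zs \<subseteq> Obj M" using "3.prems" by auto
  moreover have "tens_concat M (ys # xss) \<in> hom M (tens M (map (tens M) (ys # xss))) (tens M ?zs)"
    "iso M (tens_concat M (ys # xss))"
    using 3(2) "3.prems" by auto
  ultimately show ?case by (simp add: hom_def del: tens_concat.simps(2))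
qed (auto simp: hom_def)

lemma concat_singletons: "concat (map (\<lambda>x. [x]) xs) = xs"
  by (induction xs) auto

lemma tens_concat_singletons:
  "set xs \<subseteq> Obj M \<Longrightarrow> tens_concat M (map (\<lambda>x. [x]) xs) = Idn M (tens M xs)"
proof (induction xs rule: induct_list012)
  case (3 x y xs)
  have "concat (map (\<lambda>x. [x]) xs) = xs" by (induction xs) auto
  then show ?case using 3 by simp
qed auto

end

section \<open>Comparison of the strict action with the bracketed one\<close>

context unital_colax
begin

abbreviation thd where "thd F \<equiv> snd (snd F)"

lemma Arr_S_split: "F \<in> Arr S \<Longrightarrow> F = (Dom S F, Cod S F, thd F)"
  by (cases F) (simp add: S_simps)

lemma thd_hom:
  assumes "F \<in> Arr S"
  shows "thd F \<in> Arr M" "Dom M (thd F) = tens M (Dom S F)" "Cod M (thd F) = tens M (Cod S F)"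
    "set (Dom S F) \<subseteq> Obj M" "set (Cod S F) \<subseteq> Obj M"
  using assms by (cases F; auto simp: S_simps hom_def)+

lemma thd_Comp: "F \<in> Arr S \<Longrightarrow> G \<in> Arr S \<Longrightarrow> thd (F \<cdot>\<^bsub>S\<^esub> G) = thd F \<cdot> thd G"
  by (cases F; cases G) (simp add: S_simps)

lemma thd_box:
  assumes "F \<in> Arr S" "G \<in> Arr S"
  shows "thd (F \<boxtimes> G) \<cdot> tens_append M (Dom S F) (Dom S G) = tens_append M (Cod S F) (Cod S G) \<cdot> (thd F \<odot> thd G)"
proof -
  note F = thd_hom[OF assms(1)] and G = thd_hom[OF assms(2)]
  have "thd ((Dom S F, Cod S F, thd F) \<boxtimes> (Dom S G, Cod S G, thd G)) \<cdot> tens_append M (Dom S F) (Dom S G) =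
      tens_append M (Cod S F) (Cod S G) \<cdot> (thd F \<odot> thd G)"
    by (rule strict_box_tens_append) (use F G in \<open>auto simp: hom_def\<close>)
  then show ?thesis using Arr_S_split assms by metis
qed

lemma tens_arr_thd:
  assumes "set Fs \<subseteq> Arr S"
  shows "tens_arr M (map thd Fs) \<in> hom M (tens M (map (\<lambda>F. tens M (Dom S F)) Fs)) (tens M (map (\<lambda>F. tens M (Cod S F)) Fs))"
  using assms
proof (induction Fs rule: induct_list012)
  case (2 F)
  then show ?case using thd_hom[of F] by (auto simp: hom_def)
next
  case (3 F G Fs)
  then show ?case using thd_hom[of F] by (auto simp: hom_def)
qed (auto simp: hom_def)

lemma tens_concat_Dom_Cod:
  assumes "set Fs \<subseteq> Arr S"
  shows "tens_concat M (map (Dom S) Fs) \<in> hom M (tens M (map (tens M) (map (Dom S) Fs))) (tens M (concat (map (Dom S) Fs)))"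
    "tens_concat M (map (Cod S) Fs) \<in> hom M (tens M (map (tens M) (map (Cod S) Fs))) (tens M (concat (map (Cod S) Fs)))"
    "iso M (tens_concat M (map (Dom S) Fs))"
proof -
  have "set (Dom S F) \<subseteq> Obj M" "set (Cod S F) \<subseteq> Obj M" if "F \<in> set Fs" for F
    using thd_hom(4,5)[of F] that assms by auto
  then have "\<And>xs. xs \<in> set (map (Dom S) Fs) \<Longrightarrow> set xs \<subseteq> Obj M" "\<And>xs. xs \<in> set (map (Cod S) Fs) \<Longrightarrow> set xs \<subseteq> Obj M"
    unfolding set_map by (blast elim!: imageE)+
  from tens_concat_hom_iso[OF this(1)] tens_concat_hom_iso[OF this(2)]
  show "tens_concat M (map (Dom S) Fs) \<in> hom M (tens M (map (tens M) (map (Dom S) Fs))) (tens M (concat (map (Dom S) Fs)))"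
    "tens_concat M (map (Cod S) Fs) \<in> hom M (tens M (map (tens M) (map (Cod S) Fs))) (tens M (concat (map (Cod S) Fs)))"
    "iso M (tens_concat M (map (Dom S) Fs))"
    by blast+
qed

text \<open>The way back from the strictification: a product there differs from the right-bracketed
  tensor product of arrows only by the rebracketing isomorphisms \<open>tens_concat\<close> at both
  ends. \<open>thd\<close> extracts the underlying arrow.\<close>

lemma thd_boxes:
  assumes "set Fs \<subseteq> Arr S"
  shows "thd (S.boxes Fs) \<cdot> tens_concat M (map (Dom S) Fs) = tens_concat M (map (Cod S) Fs) \<cdot> tens_arr M (map thd Fs)"
  using assms
proof (induction Fs rule: induct_list012)
  case 1
  then show ?case by (simp add: S_simps)
next
  case (2 F)
  then show ?case using thd_hom[of F] by simp
next
  case (3 F G Fs)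
  let ?H = "G # Fs"
  have H: "set ?H \<subseteq> Arr S" and F: "F \<in> Arr S" using "3.prems" by auto
  note F' = thd_hom[OF F]
  have B: "S.boxes ?H \<in> Arr S" "Dom S (S.boxes ?H) = concat (map (Dom S) ?H)" "Cod S (S.boxes ?H) = concat (map (Cod S) ?H)"
    using H by (simp_all del: S.boxes_Cons)
  note B' = thd_hom[OF B(1), unfolded B(2,3)]
  have tD: "tens_concat M (map (Dom S) ?H) \<in> hom M (tens M (map (tens M) (map (Dom S) ?H))) (tens M (concat (map (Dom S) ?H)))"
    by (rule tens_concat_Dom_Cod[OF H])
  have tC: "tens_concat M (map (Cod S) ?H) \<in> hom M (tens M (map (tens M) (map (Cod S) ?H))) (tens M (concat (map (Cod S) ?H)))"
    by (rule tens_concat_Dom_Cod[OF H])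
  note tD' = homD[OF tD] and tC' = homD[OF tC] and ta = homD[OF tens_arr_thd[OF H]]
  have mm: "map (tens M) (map (Dom S) ?H) = map (\<lambda>F. tens M (Dom S F)) ?H"
    "map (tens M) (map (Cod S) ?H) = map (\<lambda>F. tens M (Cod S F)) ?H" by simp_all
  have IH: "thd (S.boxes ?H) \<cdot> tens_concat M (map (Dom S) ?H) = tens_concat M (map (Cod S) ?H) \<cdot> tens_arr M (map thd ?H)"
    using 3(2) H by simp
  have c: "tens_concat M (map (Dom S) (F # ?H)) = tens_append M (Dom S F) (concat (map (Dom S) ?H)) \<cdot> (Idn M (tens M (Dom S F)) \<odot> tens_concat M (map (Dom S) ?H))"
    "tens_concat M (map (Cod S) (F # ?H)) = tens_append M (Cod S F) (concat (map (Cod S) ?H)) \<cdot> (Idn M (tens M (Cod S F)) \<odot> tens_concat M (map (Cod S) ?H))"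
    "tens_arr M (map thd (F # ?H)) = thd F \<odot> tens_arr M (map thd ?H)" "S.boxes (F # ?H) = F \<boxtimes> S.boxes ?H"
    by simp_all
  note Fb = thd_hom[OF S.box_Arr[OF F B(1)]]
  have Fb2: "Dom S (F \<boxtimes> S.boxes ?H) = Dom S F @ concat (map (Dom S) ?H)" using F B by (simp del: S.boxes_Cons)
  have "thd (F \<boxtimes> S.boxes ?H) \<cdot> (tens_append M (Dom S F) (concat (map (Dom S) ?H)) \<cdot> (Idn M (tens M (Dom S F)) \<odot> tens_concat M (map (Dom S) ?H))) =
     (tens_append M (Cod S F) (concat (map (Cod S) ?H)) \<cdot> (thd F \<odot> thd (S.boxes ?H))) \<cdot> (Idn M (tens M (Dom S F)) \<odot> tens_concat M (map (Dom S) ?H))"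
    by (rule Comp_rewrite[OF thd_box[OF F B(1), unfolded B(2,3)]])
      (use F' B' tD' Fb Fb2 in \<open>simp_all del: S.boxes_Cons list.map concat.simps\<close>)
  also have "\<dots> = tens_append M (Cod S F) (concat (map (Cod S) ?H)) \<cdot> (thd F \<odot> (thd (S.boxes ?H) \<cdot> tens_concat M (map (Dom S) ?H)))"
    using F' B' tD' by (simp add: interchange del: S.boxes_Cons list.map concat.simps)
  also have "\<dots> = tens_append M (Cod S F) (concat (map (Cod S) ?H)) \<cdot> ((Idn M (tens M (Cod S F)) \<odot> tens_concat M (map (Cod S) ?H)) \<cdot> (thd F \<odot> tens_arr M (map thd ?H)))"
    unfolding IH using F' B' tC' ta mm by (simp add: interchange del: S.boxes_Cons list.map concat.simps map_map)
  also have "\<dots> = (tens_append M (Cod S F) (concat (map (Cod S) ?H)) \<cdot> (Idn M (tens M (Cod S F)) \<odot> tens_concat M (map (Cod S) ?H))) \<cdot> (thd F \<odot> tens_arr M (map thd ?H))"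
    using F' B' tC' ta mm by (simp del: S.boxes_Cons list.map concat.simps map_map)
  finally show ?case unfolding c .
qed

text \<open>For one-object lists both rebracketing isomorphisms are identities.\<close>

lemma thd_boxes_singletons:
  assumes "\<And>i. i \<in> set is \<Longrightarrow> G i \<in> Arr S" "\<And>i. i \<in> set is \<Longrightarrow> Dom S (G i) = [x i]"
    "\<And>i. i \<in> set is \<Longrightarrow> Cod S (G i) = [y i]"
  shows "thd (S.boxes (map G is)) = tens_arr M (map (\<lambda>i. thd (G i)) is)"
proof -
  have x: "set (map x is) \<subseteq> Obj M" "set (map y is) \<subseteq> Obj M"  proof -
    have "x i \<in> Obj M \<and> y i \<in> Obj M" if "i \<in> set is" for i
      using thd_hom(4,5)[OF assms(1)[OF that]] assms(2,3)[OF that] by simp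
    then show "set (map x is) \<subseteq> Obj M" "set (map y is) \<subseteq> Obj M" by auto
  qed
  have G: "set (map G is) \<subseteq> Arr S" using assms by auto
  have m: "map (Dom S) (map G is) = map (\<lambda>x. [x]) (map x is)" "map (Cod S) (map G is) = map (\<lambda>x. [x]) (map y is)"
    using assms by auto
  have c: "concat (map (Dom S) (map G is)) = map x is" unfolding m concat_singletons ..
  have B: "S.boxes (map G is) \<in> Arr S" "Dom S (S.boxes (map G is)) = map x is"
    using S.boxes_Arr[OF G] S.Dom_boxes[OF G] c by (simp_all only:)
  have mm: "map (\<lambda>F. tens M (Cod S F)) (map G is) = map y is" using assms by auto
  have t: "tens_arr M (map thd (map G is)) \<in> Arr M" "Cod M (tens_arr M (map thd (map G is))) = tens M (map y is)"
    using homD(1,3)[OF tens_arr_thd[OF G]] unfolding mm by auto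
  have "thd (S.boxes (map G is)) \<cdot> Idn M (tens M (map x is)) = Idn M (tens M (map y is)) \<cdot> tens_arr M (map thd (map G is))"
    using thd_boxes[OF G] unfolding m tens_concat_singletons[OF x(1)] tens_concat_singletons[OF x(2)] .
  then show ?thesis using thd_hom[OF B(1)] B(2) t by (simp add: o_def)
qed

lemma Y_pos: "0 < k \<Longrightarrow> Y k = [fob X k]"
  by (simp add: Y_def)

lemma Ys_pos: "(\<And>k. k \<in> set ks \<Longrightarrow> 0 < k) \<Longrightarrow> Y.Ys ks = map (fob X) ks"
  by (induction ks) (auto simp: Y_pos)

lemma norm_pos: "0 < k \<Longrightarrow> norm k = Idn S [fob X k]" "0 < k \<Longrightarrow> norm' k = Idn S [fob X k]"
  by (auto simp: norm_def norm'_def Y_def S_simps)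

lemma mu_pos: "0 < k \<Longrightarrow> 0 < l \<Longrightarrow> mu k l = comult1 k l"
  by (simp add: mu_def norm_pos S.box_Idn)

text \<open>Positive indices are untouched by the normalization. The list must be nonempty:
  \<open>comult_list\<close> of \<open>[]\<close> is the counit out of X_0, whereas
  \<open>mus []\<close> is the identity of the empty list.\<close>

lemma thd_mus: "ks \<noteq> [] \<Longrightarrow> (\<And>k. k \<in> set ks \<Longrightarrow> 0 < k) \<Longrightarrow> thd (Y.mus ks) = comult_list M X ks"
proof (induction ks rule: induct_list012)
  case (2 k)
  then have "Y.mus [k] = Idn S [fob X k]" unfolding Y.mus_singleton using Y_pos[of k] by simp
  then show ?case by (simp add: S_simps del: Y.mus.simps)
next
  case (3 k l ks)
  let ?ls = "l # ks"
  have p: "0 < k" "0 < sum_list ?ls" "\<And>k. k \<in> set ?ls \<Longrightarrow> 0 < k" using "3.prems" by auto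
  have IH: "thd (Y.mus ?ls) = comult_list M X ?ls" using 3(2) p(3) by simp
  have D: "Dom S (Y.mus ?ls) = [fob X (sum_list ?ls)]" "Cod S (Y.mus ?ls) = map (fob X) ?ls"
    using Y.Dom_mus[of ?ls] Y.Cod_mus[of ?ls] Y_pos[OF p(2)] Ys_pos[of ?ls] p(3) by (simp_all del: Y.mus.simps)
  have e: "Y.mus ?ls = ([fob X (sum_list ?ls)], map (fob X) ?ls, comult_list M X ?ls)"
    using Arr_S_split[OF Y.mus_Arr[of ?ls]] unfolding D IH .
  have c: "comult_list M X ?ls \<in> Arr M" "Dom M (comult_list M X ?ls) = fob X (sum_list ?ls)"
    "Cod M (comult_list M X ?ls) = tens M (map (fob X) ?ls)"
    using thd_hom[OF Y.mus_Arr[of ?ls]] unfolding D IH by (simp_all del: comult_list.simps)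
  have "Y.mus (k # ?ls) = (Idn S [fob X k] \<boxtimes> Y.mus ?ls) \<cdot>\<^bsub>S\<^esub> comult1 k (sum_list ?ls)"
    using mu_pos[OF p(1,2)] Y_pos[OF p(1)] by simp
  then have "thd (Y.mus (k # ?ls)) = (tens_append M [fob X k] (map (fob X) ?ls) \<cdot>
      ((Idn M (fob X k) \<odot> comult_list M X ?ls) \<cdot> inv_arr M (tens_append M [fob X k] [fob X (sum_list ?ls)]))) \<cdot> comult X k (sum_list ?ls)"
    unfolding e comult1_def by (simp add: S_simps strict_box_simp del: tens_append.simps comult_list.simps list.map sum_list.Cons)
  also have "\<dots> = (Idn M (fob X k) \<odot> comult_list M X ?ls) \<cdot> comult X k (sum_list ?ls)"
    using c by (simp add: tens_append_singleton del: comult_list.simps(3))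
  finally show ?case by simp
qed auto

text \<open>Inside a bead of U all gaps of T are positive, and there is at least one since they add
  up to the positive length of the bead; so \<open>thd_mus\<close> applies to every factor. The
  sources are one-object lists, so no rebracketing occurs at that end.\<close>

lemma nec_inert_eq:
  assumes "U \<subseteq> T" "u \<in> U" "v \<in> U" "T \<subseteq> {u..v}"
  shows "nec_inert M X T U = thd (Y.inert T U)"
proof -
  define g where "g = (\<lambda>(s, t). gaps (T \<inter> {s..t}))"
  have fin: "finite T" using assms finite_subset by blast
  have b: "s < t \<and> sum_list (g (s, t)) = t - s \<and> g (s, t) \<noteq> [] \<and> (\<forall>k \<in> set (g (s, t)). 0 < k)"
    if "(s, t) \<in> set (beads U)" for s t
  proof -
    have "s < t" "sum_list (g (s, t)) = t - s" using beads_mem[OF that] sum_list_gaps_bead[OF that assms(1)] by (auto simp: g_def)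
    moreover then have "g (s, t) \<noteq> []" by auto
    moreover have "\<forall>k \<in> set (g (s, t)). 0 < k" using gaps_pos by (auto simp: g_def)
    ultimately show ?thesis by blast
  qed
  have kss: "map (\<lambda>(u, v). gaps ((\<lambda>t. t - u) ` (T \<inter> {u..v}))) (beads U) = map g (beads U)"
    unfolding g_def by (rule map_cong[OF refl]) (use fin in \<open>auto intro!: gaps_shift\<close>)
  let ?Fs = "map (\<lambda>b. Y.mus (g b)) (beads U)"
  have Fs: "set ?Fs \<subseteq> Arr S" by auto
  have I: "Y.inert T U = S.boxes ?Fs" by (simp add: Y.inert_def g_def case_prod_unfold)
  have m: "map (Dom S) ?Fs = map (\<lambda>x. [x]) (map (\<lambda>(s, t). fob X (t - s)) (beads U))"
    "map (Cod S) ?Fs = map (map (fob X)) (map g (beads U))" "map thd ?Fs = map (comult_list M X) (map g (beads U))"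
    using b by (auto simp: Y_pos Ys_pos thd_mus)
  have x: "set (map (\<lambda>(s, t). fob X (t - s)) (beads U)) \<subseteq> Obj M" by auto
  have "concat (map (Dom S) ?Fs) = map (\<lambda>(s, t). fob X (t - s)) (beads U)" unfolding m concat_singletons ..
  then have D: "S.boxes ?Fs \<in> Arr S" "Dom S (S.boxes ?Fs) = map (\<lambda>(s, t). fob X (t - s)) (beads U)"
    using S.boxes_Arr[OF Fs] S.Dom_boxes[OF Fs] by (simp_all only:)
  have "thd (S.boxes ?Fs) \<cdot> Idn M (tens M (map (\<lambda>(s, t). fob X (t - s)) (beads U))) =
      tens_concat M (map (map (fob X)) (map g (beads U))) \<cdot> tens_arr M (map (comult_list M X) (map g (beads U)))"
    using thd_boxes[OF Fs] unfolding m tens_concat_singletons[OF x] .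
  then show ?thesis unfolding nec_inert_def Let_def kss I using thd_hom[OF D(1)] D(2) by simp
qed

text \<open>A bead of T has positive length, so of the two normalizing arrows in \<open>Yar\<close>
  only \<open>norm'\<close> at the source can differ from an identity. It does so on collapsed
  beads, where it is the inverse counit; the product of these arrows is
  \<open>insert_units\<close>.\<close>

lemma nec_active_eq:
  assumes f: "f \<in> Arr Delta_f" "T \<subseteq> {..<length f}"
  shows "nec_active M X T f = thd (Y.act T f)"
proof -
  define l where "l = (\<lambda>(s, t). f ! t - f ! s)"
  have b: "s < t \<and> bead_map f (s, t) \<in> Arr Delta_f \<and> last (bead_map f (s, t)) = l (s, t)" if "(s, t) \<in> set (beads T)" for s t
  proof -
    have "s < t" "t < length f" using beads_mem[OF that] f by auto
    then show ?thesis using bead_map_Arr[OF f(1), of s t] last_bead_map[OF f(1), of s t] by (simp add: l_def)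
  qed
  let ?N = "map (\<lambda>b. norm' (l b)) (beads T)" and ?X = "map (\<lambda>b. X1 (bead_map f b)) (beads T)"
  have "Y.act T f = S.boxes (map (\<lambda>b. X1 (bead_map f b) \<cdot>\<^bsub>S\<^esub> norm' (l b)) (beads T))"
    unfolding Y.act_def by (rule arg_cong[where f = S.boxes], rule map_cong[OF refl]) (use b in \<open>auto simp: Yar_def norm_pos\<close>)
  also have "\<dots> = S.boxes ?X \<cdot>\<^bsub>S\<^esub> S.boxes ?N"
    by (rule S.boxes_Comp[symmetric, where x = "\<lambda>b. Y (l b)" and y = "\<lambda>b. [fob X (l b)]" and z = "\<lambda>b. [fob X (length (bead_map f b) - 1)]"])
      (use b in \<open>auto simp: hom_def\<close>)
  finally have act: "Y.act T f = S.boxes ?X \<cdot>\<^bsub>S\<^esub> S.boxes ?N" .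
  have Fs: "set ?X \<subseteq> Arr S" "set ?N \<subseteq> Arr S" using b by auto
  have X: "thd (S.boxes ?X) = tens_arr M (map (\<lambda>b. far X (bead_map f b)) (beads T))"
  proof -
    have "thd (S.boxes ?X) = tens_arr M (map (\<lambda>b. thd (X1 (bead_map f b))) (beads T))"
      by (rule thd_boxes_singletons[where x = "\<lambda>b. fob X (l b)" and y = "\<lambda>b. fob X (length (bead_map f b) - 1)"])
        (use b in auto)
    then show ?thesis by (simp add: X1_def)
  qed
  have m: "map (Dom S) ?N = map (\<lambda>k. if k = 0 then [] else [fob X k]) (map l (beads T))"
    "map (Cod S) ?N = map (\<lambda>x. [x]) (map (\<lambda>b. fob X (l b)) (beads T))"
    "map thd ?N = map (\<lambda>k. if k = 0 then inv_arr M (counit X) else Idn M (fob X k)) (map l (beads T))"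
  proof -
    show "map (Dom S) ?N = map (\<lambda>k. if k = 0 then [] else [fob X k]) (map l (beads T))" by (simp add: Y_def)
    show "map (Cod S) ?N = map (\<lambda>x. [x]) (map (\<lambda>b. fob X (l b)) (beads T))" by simp
    show "map thd ?N = map (\<lambda>k. if k = 0 then inv_arr M (counit X) else Idn M (fob X k)) (map l (beads T))"
      by (simp add: norm'_def)
  qed
  have x: "set (map (\<lambda>b. fob X (l b)) (beads T)) \<subseteq> Obj M" by auto
  let ?c = "tens_concat M (map (Dom S) ?N)"
  have c: "?c \<in> hom M (tens M (map (tens M) (map (Dom S) ?N))) (tens M (concat (map (Dom S) ?N)))" "iso M ?c"
    by (rule tens_concat_Dom_Cod[OF Fs(2)])+
  have mm: "map (\<lambda>F. tens M (Cod S F)) ?N = map (\<lambda>b. fob X (l b)) (beads T)" by simp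
  have t: "tens_arr M (map thd ?N) \<in> Arr M" "Cod M (tens_arr M (map thd ?N)) = tens M (map (\<lambda>b. fob X (l b)) (beads T))"
    using homD(1,3)[OF tens_arr_thd[OF Fs(2)]] unfolding mm by auto
  have B: "S.boxes ?N \<in> Arr S" "Dom S (S.boxes ?N) = concat (map (Dom S) ?N)" "S.boxes ?X \<in> Arr S"
    using S.boxes_Arr[OF Fs(1)] S.boxes_Arr[OF Fs(2)] S.Dom_boxes[OF Fs(2)] by (simp_all only:)
  have "thd (S.boxes ?N) \<cdot> ?c = tens_arr M (map thd ?N)"
    using thd_boxes[OF Fs(2)] t unfolding m(2) tens_concat_singletons[OF x] by simp
  then have "(thd (S.boxes ?N) \<cdot> ?c) \<cdot> inv_arr M ?c = tens_arr M (map thd ?N) \<cdot> inv_arr M ?c" by simp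
  then have N: "thd (S.boxes ?N) = tens_arr M (map thd ?N) \<cdot> inv_arr M ?c"
    using c thd_hom[OF B(1)] B(2) homD[OF c(1)] by (simp del: map_map)
  have u: "thd (S.boxes ?N) = insert_units M X (map l (beads T))"
    unfolding insert_units_def N m ..
  show ?thesis
    unfolding act thd_Comp[OF B(3,1)] X u by (simp add: nec_active_def l_def)
qed

lemma far_nec_functor:
  assumes "((T, p), (U, q), f) \<in> Arr Nec"
  shows "far (nec_functor M X) ((T, p), (U, q), f) = thd (Y.nec_act T U f)"
proof -
  note f = Y.Nec_Arr_image[OF assms]
  have "Y.act T f \<in> Arr S" "Y.inert ((!) f ` T) U \<in> Arr S"
    using homD[OF Y.act_hom[OF f(1,11)]] homD[OF Y.inert_hom[OF f(4,6,7,5)]] by auto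
  then show ?thesis
    using nec_inert_eq[OF f(4,6,7,5)] nec_active_eq[OF f(1,11)]
    by (simp add: nec_functor_def Y.nec_act_def thd_Comp)
qed

lemma fob_nec_functor: "fob (nec_functor M X) (T, p) = tens M (Y.Ys (gaps T))"
  using gaps_pos by (simp add: nec_functor_def nec_prod_def Ys_pos)

lemma Arr_NecE:
  assumes "f \<in> Arr Nec"
  obtains T p U q g where "f = ((T, p), (U, q), g)" "((T, p), (U, q), g) \<in> Arr Nec"
  using assms by (metis prod.exhaust)

lemma functor_nec_functor: "is_functor (op_cat Nec) M (nec_functor M X)"
  unfolding is_functor_def
proof (intro conjI ballI impI)
  show "category (op_cat Nec)" by (intro category_op_cat category_Nec)
  show "category M" by (rule category_axioms)
  show "fob (nec_functor M X) x \<in> Obj M" if "x \<in> Obj (op_cat Nec)" for x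
    using Y.Ys_Obj by (cases x) (simp add: fob_nec_functor S_simps(1))
  show "far (nec_functor M X) f \<in> hom M (fob (nec_functor M X) (Dom (op_cat Nec) f)) (fob (nec_functor M X) (Cod (op_cat Nec) f))"
    if "f \<in> Arr (op_cat Nec)" for f
  proof -
    obtain T p U q g where f: "f = ((T, p), (U, q), g)" "((T, p), (U, q), g) \<in> Arr Nec"
      using \<open>f \<in> Arr (op_cat Nec)\<close> by (auto elim: Arr_NecE)
    show ?thesis
      unfolding f(1) far_nec_functor[OF f(2)]
      using thd_hom(1-3)[OF homD(1)[OF Y.nec_act_hom[OF f(2)]]] homD(2,3)[OF Y.nec_act_hom[OF f(2)]]
      by (simp add: hom_def Nec_simps(3,4) fob_nec_functor)
  qed
  show "far (nec_functor M X) (Idn (op_cat Nec) x) = Idn M (fob (nec_functor M X) x)" if "x \<in> Obj (op_cat Nec)" for x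
  proof -
    obtain T p where x: "x = (T, p)" by (cases x)
    have "Idn Nec x \<in> Arr Nec" using that category.Idn_Arr[OF category_Nec] by simp
    moreover have "T \<subseteq> {..p}" using that x by (simp add: Nec_simps(1))
    ultimately show ?thesis
      using far_nec_functor[of T p T p "[0..<Suc p]"] Y.nec_act_Idn[of T p]
      by (simp add: x Nec_simps(5) fob_nec_functor S_simps(5) del: upt_Suc)
  qed
  show "far (nec_functor M X) (g \<cdot>\<^bsub>op_cat Nec\<^esub> f) = far (nec_functor M X) g \<cdot> far (nec_functor M X) f"
    if fg: "f \<in> Arr (op_cat Nec)" "g \<in> Arr (op_cat Nec)" "Cod (op_cat Nec) f = Dom (op_cat Nec) g" for f g
  proof -
    obtain T p U q g' where g: "g = ((T, p), (U, q), g')" "((T, p), (U, q), g') \<in> Arr Nec"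
      using fg(2) by (auto elim: Arr_NecE)
    obtain U' q' W r f' where "f = ((U', q'), (W, r), f')" "((U', q'), (W, r), f') \<in> Arr Nec"
      using fg(1) by (auto elim: Arr_NecE)
    moreover from this have "U' = U" "q' = q" using fg(3) g by (simp_all add: Nec_simps(3,4))
    ultimately have f: "f = ((U, q), (W, r), f')" "((U, q), (W, r), f') \<in> Arr Nec" by auto
    have "far (nec_functor M X) ((T, p), (W, r), map ((!) f') g') = thd (Y.nec_act T U g') \<cdot> thd (Y.nec_act U W f')"
      unfolding far_nec_functor[OF Nec_Comp_Arr[OF g(2) f(2)]] Y.nec_act_Comp[OF g(2) f(2)]
      by (rule thd_Comp) (use homD(1)[OF Y.nec_act_hom[OF g(2)]] homD(1)[OF Y.nec_act_hom[OF f(2)]] in auto)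
    then show ?thesis
      unfolding f(1) g(1) op_cat_simps Nec_simps(6) far_nec_functor[OF g(2)] far_nec_functor[OF f(2)] .
  qed
qed

end

section \<open>Tensor products of coproducts\<close>

lemma infinite_UNIV_inj_countable:
  assumes "infinite (UNIV :: 'u set)" "countable I"
  obtains e :: "'i \<Rightarrow> 'u" where "inj_on e I"
proof -
  obtain g :: "nat \<Rightarrow> 'u" where "inj g"
    using infinite_countable_subset[OF assms(1)] by blast
  moreover obtain f :: "'i \<Rightarrow> nat" where "inj_on f I"
    using assms(2) by (auto simp: countable_def)
  ultimately have "inj_on (g \<circ> f) I" by (meson comp_inj_on inj_on_subset subset_UNIV)
  then show thesis by (rule that)
qed

context symmetric_monoidal_closed_category
begin

lemma Braid_iso:
  assumes "x \<in> Obj V" "y \<in> Obj V"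
  shows "iso V (Braid V x y)"
proof -
  have "inverse_arrows V (Braid V x y) (Braid V y x)"
    using Braid_hom[OF assms] Braid_hom[OF assms(2,1)] Braid_symmetric[OF assms] Braid_symmetric[OF assms(2,1)]
    by (intro inverse_arrowsI) (auto simp: hom_def)
  then show ?thesis by (auto simp: iso_def)
qed

text \<open>Tensoring with \<open>y\<close> has a right adjoint by \<open>closed\<close>, hence
  preserves coproducts: arrows out of \<open>c \<otimes> y\<close> correspond to arrows from
  \<open>c\<close> to an internal hom, and there the universal property of \<open>c\<close> gives
  existence and uniqueness.\<close>

lemma coproduct_TensorArr_right:
  assumes c: "is_coproduct V I A c \<iota>" and y: "y \<in> Obj V"
  shows "is_coproduct V I (\<lambda>i. A i \<otimes> y) (c \<otimes> y) (\<lambda>i. \<iota> i \<odot> Idn V y)"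
proof (rule coproductI)
  note cO = coproduct_Obj[OF c] and \<iota> = coproduct_hom[OF c]
  show "c \<otimes> y \<in> Obj V" using cO y by simp
  show "\<iota> i \<odot> Idn V y \<in> hom V (A i \<otimes> y) (c \<otimes> y)" if "i \<in> I" for i
    using \<iota>[OF that] y by (auto simp: hom_def)
  have cl: "\<exists>e \<in> Obj V. \<exists>ev \<in> hom V (e \<otimes> y) z. \<forall>x \<in> Obj V. \<forall>f \<in> hom V (x \<otimes> y) z.
        \<exists>!g. g \<in> hom V x e \<and> ev \<cdot> (g \<odot> Idn V y) = f" if "z \<in> Obj V" for z
    by (rule closed[OF y that])
  fix z \<phi> assume z: "z \<in> Obj V" and \<phi>: "\<And>i. i \<in> I \<Longrightarrow> \<phi> i \<in> hom V (A i \<otimes> y) z"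
  obtain e ev where e: "e \<in> Obj V" "ev \<in> hom V (e \<otimes> y) z" and
    ex: "\<forall>x \<in> Obj V. \<forall>f \<in> hom V (x \<otimes> y) z. \<exists>!g. g \<in> hom V x e \<and> ev \<cdot> (g \<odot> Idn V y) = f"
    using cl[OF z] by blast
  have "\<exists>g \<in> hom V (A i) e. ev \<cdot> (g \<odot> Idn V y) = \<phi> i" if "i \<in> I" for i
    using ex \<phi>[OF that] hom_Obj(1)[OF \<iota>[OF that]] by blast
  then obtain g where g: "\<And>i. i \<in> I \<Longrightarrow> g i \<in> hom V (A i) e" "\<And>i. i \<in> I \<Longrightarrow> ev \<cdot> (g i \<odot> Idn V y) = \<phi> i"
    by metis
  obtain k where k: "k \<in> hom V c e" "\<And>i. i \<in> I \<Longrightarrow> k \<cdot> \<iota> i = g i"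
    using coproduct_ex[OF c e(1) g(1)] by blast
  show "\<exists>h\<in>hom V (c \<otimes> y) z. \<forall>i\<in>I. h \<cdot> (\<iota> i \<odot> Idn V y) = \<phi> i"
  proof (intro bexI ballI)
    show "ev \<cdot> (k \<odot> Idn V y) \<in> hom V (c \<otimes> y) z" using e k y by (auto simp: hom_def)
    fix i assume i: "i \<in> I"
    have "(ev \<cdot> (k \<odot> Idn V y)) \<cdot> (\<iota> i \<odot> Idn V y) = ev \<cdot> ((k \<cdot> \<iota> i) \<odot> Idn V y)"
      using homD[OF e(2)] homD[OF k(1)] homD[OF \<iota>[OF i]] y by (simp add: interchange)
    then show "(ev \<cdot> (k \<odot> Idn V y)) \<cdot> (\<iota> i \<odot> Idn V y) = \<phi> i" using k g i by simp
  qed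
next
  note cO = coproduct_Obj[OF c] and \<iota> = coproduct_hom[OF c]
  fix z h h' assume h: "h \<in> hom V (c \<otimes> y) z" "h' \<in> hom V (c \<otimes> y) z"
    and eq: "\<And>i. i \<in> I \<Longrightarrow> h \<cdot> (\<iota> i \<odot> Idn V y) = h' \<cdot> (\<iota> i \<odot> Idn V y)"
  obtain e ev where e: "e \<in> Obj V" "ev \<in> hom V (e \<otimes> y) z" and
    ex: "\<forall>x \<in> Obj V. \<forall>f \<in> hom V (x \<otimes> y) z. \<exists>!g. g \<in> hom V x e \<and> ev \<cdot> (g \<odot> Idn V y) = f"
    using closed[OF y hom_Obj(2)[OF h(1)]] by blast
  obtain g g' where g: "g \<in> hom V c e" "ev \<cdot> (g \<odot> Idn V y) = h" and g': "g' \<in> hom V c e" "ev \<cdot> (g' \<odot> Idn V y) = h'"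
    using ex cO h by metis
  have "g = g'"
  proof (rule coproduct_eqI[OF c g(1) g'(1)])
    fix i assume i: "i \<in> I"
    have comp: "ev \<cdot> ((k \<cdot> \<iota> i) \<odot> Idn V y) = (ev \<cdot> (k \<odot> Idn V y)) \<cdot> (\<iota> i \<odot> Idn V y)" if "k \<in> hom V c e" for k
      using homD[OF e(2)] homD[OF that] homD[OF \<iota>[OF i]] y by (simp add: interchange)
    have A: "A i \<in> Obj V" using hom_Obj(1)[OF \<iota>[OF i]] .
    have "h \<cdot> (\<iota> i \<odot> Idn V y) \<in> hom V (A i \<otimes> y) z" using h \<iota>[OF i] y by (auto simp: hom_def)
    then have "\<exists>!k. k \<in> hom V (A i) e \<and> ev \<cdot> (k \<odot> Idn V y) = h \<cdot> (\<iota> i \<odot> Idn V y)" using ex A by blast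
    moreover have "g \<cdot> \<iota> i \<in> hom V (A i) e" "g' \<cdot> \<iota> i \<in> hom V (A i) e"
      using g g' \<iota>[OF i] Comp_hom by blast+
    moreover have "ev \<cdot> ((g \<cdot> \<iota> i) \<odot> Idn V y) = h \<cdot> (\<iota> i \<odot> Idn V y)" "ev \<cdot> ((g' \<cdot> \<iota> i) \<odot> Idn V y) = h \<cdot> (\<iota> i \<odot> Idn V y)"
      using comp[OF g(1)] comp[OF g'(1)] g(2) g'(2) eq[OF i] by simp_all
    ultimately show "g \<cdot> \<iota> i = g' \<cdot> \<iota> i" by metis
  qed
  then show "h = h'" using g g' by simp
qed

text \<open>The braiding reduces this to the other side; its naturality and symmetry remove it again
  from the coprojections.\<close>

lemma coproduct_TensorArr_left:
  assumes c: "is_coproduct V I A c \<iota>" and y: "y \<in> Obj V"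
  shows "is_coproduct V I (\<lambda>i. y \<otimes> A i) (y \<otimes> c) (\<lambda>i. Idn V y \<odot> \<iota> i)"
proof -
  note cO = coproduct_Obj[OF c] and \<iota> = coproduct_hom[OF c]
  have A: "A i \<in> Obj V" if "i \<in> I" for i using hom_Obj(1)[OF \<iota>[OF that]] .
  have "is_coproduct V I (\<lambda>i. y \<otimes> A i) (y \<otimes> c) (\<lambda>i. Braid V c y \<cdot> ((\<iota> i \<odot> Idn V y) \<cdot> Braid V y (A i)))"
    by (rule coproduct_iso[OF coproduct_TensorArr_right[OF c y]]) (use A y cO Braid_hom Braid_iso in auto)
  then show ?thesis
  proof (rule coproduct_cong)
    fix i assume i: "i \<in> I"
    note b = homD[OF Braid_hom[OF A[OF i] y]] homD[OF Braid_hom[OF y A[OF i]]] homD[OF Braid_hom[OF cO y]] homD[OF \<iota>[OF i]]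
    have "Braid V c y \<cdot> ((\<iota> i \<odot> Idn V y) \<cdot> Braid V y (A i)) = ((Idn V y \<odot> \<iota> i) \<cdot> Braid V (A i) y) \<cdot> Braid V y (A i)"
      by (rule Comp_rewrite[OF Braid_natural[OF \<iota>[OF i] Idn_hom[OF y]]]) (use b y in auto)
    also have "\<dots> = Idn V y \<odot> \<iota> i"
      using b y A[OF i] Braid_symmetric[OF y A[OF i]] by simp
    finally show "Braid V c y \<cdot> ((\<iota> i \<odot> Idn V y) \<cdot> Braid V y (A i)) = Idn V y \<odot> \<iota> i" .
  qed simp
qed

lemma coproduct_TensorArr:
  assumes c: "is_coproduct V I A c \<iota>" and d: "is_coproduct V J B d \<kappa>"
  shows "is_coproduct V (I \<times> J) (\<lambda>(i, j). A i \<otimes> B j) (c \<otimes> d) (\<lambda>(i, j). \<iota> i \<odot> \<kappa> j)"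
proof -
  note dO = coproduct_Obj[OF d] and \<iota> = coproduct_hom[OF c] and \<kappa> = coproduct_hom[OF d]
  have A: "A i \<in> Obj V" if "i \<in> I" for i using hom_Obj(1)[OF \<iota>[OF that]] .
  have "is_coproduct V (I \<times> J) (\<lambda>(i, j). A i \<otimes> B j) (c \<otimes> d) (\<lambda>(i, j). (\<iota> i \<odot> Idn V d) \<cdot> (Idn V (A i) \<odot> \<kappa> j))"
    by (rule coproduct_Sigma[OF coproduct_TensorArr_right[OF c dO]]) (use A coproduct_TensorArr_left[OF d] in auto)
  then show ?thesis
    by (rule coproduct_cong) (use homD[OF \<iota>] homD[OF \<kappa>] A dO in \<open>auto simp: interchange\<close>)
qed

end

section \<open>Coproducts of quivers\<close>

text \<open>That quivers form a monoidal category is part of \<open>colax_monoidal\<close>, hence of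
  the notion of a templicial object; it enters here as an assumption, to be discharged from
  there.\<close>

locale quivers = symmetric_monoidal_closed_category V
  for V :: "('o, 'm, 'z) sym_mon_cat_scheme" (structure) +
  fixes S :: "'u set"
  assumes small_coproducts: "cocomplete TYPE('u) V" and infinite_universe: "infinite (UNIV :: 'u set)"
    and monoidal_Quiv: "monoidal_category (Quiv V S)"
begin

abbreviation Q where "Q \<equiv> Quiv V S"

sublocale Q: monoidal_category Q by (rule monoidal_Quiv)

lemma coproduct_over_S:
  fixes A :: "'u \<Rightarrow> 'o"
  assumes "\<And>c. c \<in> S \<Longrightarrow> A c \<in> Obj V"
  shows "is_coproduct V S A (coprod V S A) (coproj V S A)"
  by (rule cocomplete_coproduct[OF small_coproducts, where e = id]) (use assms in auto)

lemma countable_coproduct: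
  assumes "countable I" "\<And>i. i \<in> I \<Longrightarrow> A i \<in> Obj V"
  shows "is_coproduct V I A (coprod V I A) (coproj V I A)"
proof -
  obtain e :: "'a \<Rightarrow> 'u" where "inj_on e I"
    using infinite_UNIV_inj_countable[OF infinite_universe assms(1)] by blast
  then show ?thesis by (rule cocomplete_coproduct[OF small_coproducts _ assms(2)])
qed

lemma Quiv_simps:
  "Obj Q = (S \<times> S \<rightarrow>\<^sub>E Obj V)" "Unit Q = quiv_unit V S" "A \<otimes>\<^bsub>Q\<^esub> B = quiv_tensor V S A B"
  by (simp_all add: Quiv_def)

lemma Obj_Quiv: "A \<in> Obj Q \<Longrightarrow> ab \<in> S \<times> S \<Longrightarrow> A ab \<in> Obj V"
  by (auto simp: Quiv_def PiE_def Pi_def)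

lemma Quiv_Arr:
  "Arr Q = {(A, B, f). A \<in> Obj Q \<and> B \<in> Obj Q \<and> f \<in> (\<Pi>\<^sub>E ab \<in> S \<times> S. hom V (A ab) (B ab))}"
  "Dom Q f = fst f" "Cod Q f = fst (snd f)"
  by (auto simp: Quiv_def split: prod.splits)

lemma hom_Quiv: "f \<in> hom Q A B \<longleftrightarrow> fst f = A \<and> fst (snd f) = B \<and> A \<in> Obj Q \<and> B \<in> Obj Q \<and>
    snd (snd f) \<in> (\<Pi>\<^sub>E ab \<in> S \<times> S. hom V (A ab) (B ab))"
  by (cases f) (auto simp: hom_def[of Q] Quiv_Arr)

lemma quiv_comp_hom: "f \<in> hom Q A B \<Longrightarrow> ab \<in> S \<times> S \<Longrightarrow> quiv_comp f ab \<in> hom V (A ab) (B ab)"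
  unfolding hom_Quiv quiv_comp_def by (auto simp: PiE_def Pi_def)

lemma quiv_comp_Idn: "ab \<in> S \<times> S \<Longrightarrow> quiv_comp (Idn Q A) ab = Idn V (A ab)"
  by (simp add: Quiv_def quiv_comp_def)

lemma quiv_comp_Comp: "ab \<in> S \<times> S \<Longrightarrow> quiv_comp (g \<cdot>\<^bsub>Q\<^esub> f) ab = quiv_comp g ab \<cdot> quiv_comp f ab"
  by (cases f; cases g) (simp add: Quiv_def quiv_comp_def)

lemma quiv_arr_eqI:
  assumes "f \<in> hom Q A B" "g \<in> hom Q A B" "\<And>ab. ab \<in> S \<times> S \<Longrightarrow> quiv_comp f ab = quiv_comp g ab"
  shows "f = g"
proof -
  have "snd (snd f) \<in> extensional (S \<times> S)" "snd (snd g) \<in> extensional (S \<times> S)"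
    using assms(1,2) unfolding hom_Quiv by (auto simp: PiE_def)
  then have "snd (snd f) = snd (snd g)"
    by (rule extensionalityI) (use assms(3) in \<open>auto simp: quiv_comp_def\<close>)
  then show ?thesis using assms(1,2) unfolding hom_Quiv by (simp add: prod_eq_iff)
qed

definition mk_arr :: "('u, 'o) quiver \<Rightarrow> ('u, 'o) quiver \<Rightarrow> ('u \<times> 'u \<Rightarrow> 'm) \<Rightarrow> ('u, 'o, 'm) quiver_arr" where
  "mk_arr A B \<phi> = (A, B, restrict \<phi> (S \<times> S))"

lemma mk_arr_hom: "A \<in> Obj Q \<Longrightarrow> B \<in> Obj Q \<Longrightarrow> (\<And>ab. ab \<in> S \<times> S \<Longrightarrow> \<phi> ab \<in> hom V (A ab) (B ab)) \<Longrightarrow>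
    mk_arr A B \<phi> \<in> hom Q A B"
  unfolding hom_Quiv mk_arr_def by auto

lemma quiv_comp_mk_arr: "ab \<in> S \<times> S \<Longrightarrow> quiv_comp (mk_arr A B \<phi>) ab = \<phi> ab"
  by (simp add: quiv_comp_def mk_arr_def)

lemma coproduct_Quiv:
  assumes A: "\<And>i. i \<in> I \<Longrightarrow> A i \<in> Obj Q" and c: "c \<in> Obj Q" and \<iota>: "\<And>i. i \<in> I \<Longrightarrow> \<iota> i \<in> hom Q (A i) c"
    and p: "\<And>ab. ab \<in> S \<times> S \<Longrightarrow> is_coproduct V I (\<lambda>i. A i ab) (c ab) (\<lambda>i. quiv_comp (\<iota> i) ab)"
  shows "is_coproduct Q I A c \<iota>"
proof (rule Q.coproductI[OF c \<iota>])
  fix x \<phi> assume x: "x \<in> Obj Q" and \<phi>: "\<And>i. i \<in> I \<Longrightarrow> \<phi> i \<in> hom Q (A i) x"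
  have "\<exists>h \<in> hom V (c ab) (x ab). \<forall>i \<in> I. h \<cdot> quiv_comp (\<iota> i) ab = quiv_comp (\<phi> i) ab" if ab: "ab \<in> S \<times> S" for ab
    using coproduct_ex[OF p[OF ab] Obj_Quiv[OF x ab], of "\<lambda>i. quiv_comp (\<phi> i) ab"] quiv_comp_hom[OF \<phi> ab] by metis
  then obtain h where h: "\<And>ab. ab \<in> S \<times> S \<Longrightarrow> h ab \<in> hom V (c ab) (x ab)"
    "\<And>ab i. ab \<in> S \<times> S \<Longrightarrow> i \<in> I \<Longrightarrow> h ab \<cdot> quiv_comp (\<iota> i) ab = quiv_comp (\<phi> i) ab" by metis
  have m: "mk_arr c x h \<in> hom Q c x" by (rule mk_arr_hom[OF c x h(1)])
  show "\<exists>h\<in>hom Q c x. \<forall>i\<in>I. h \<cdot>\<^bsub>Q\<^esub> \<iota> i = \<phi> i"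
  proof (intro bexI[OF _ m] ballI)
    fix i assume i: "i \<in> I"
    show "mk_arr c x h \<cdot>\<^bsub>Q\<^esub> \<iota> i = \<phi> i"
      by (rule quiv_arr_eqI[OF Q.Comp_hom[OF \<iota>[OF i] m] \<phi>[OF i]]) (simp add: quiv_comp_Comp quiv_comp_mk_arr h(2) i)
  qed
next
  fix x h h' assume h: "h \<in> hom Q c x" "h' \<in> hom Q c x" and eq: "\<And>i. i \<in> I \<Longrightarrow> h \<cdot>\<^bsub>Q\<^esub> \<iota> i = h' \<cdot>\<^bsub>Q\<^esub> \<iota> i"
  show "h = h'"
  proof (rule quiv_arr_eqI[OF h])
    fix ab assume ab: "ab \<in> S \<times> S"
    show "quiv_comp h ab = quiv_comp h' ab"
      by (rule coproduct_eqI[OF p[OF ab] quiv_comp_hom[OF h(1) ab] quiv_comp_hom[OF h(2) ab]])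
        (use eq ab in \<open>simp add: quiv_comp_Comp[symmetric]\<close>)
  qed
qed

text \<open>A cocone under the values at \<open>ab\<close> extends to a cocone of quivers: change the colimiting
  quiver only at \<open>ab\<close> and use the given arrows elsewhere.\<close>

lemma coproduct_Quiv_pointwise:
  assumes cp: "is_coproduct Q I A c \<iota>" and ab: "ab \<in> S \<times> S"
  shows "is_coproduct V I (\<lambda>i. A i ab) (c ab) (\<lambda>i. quiv_comp (\<iota> i) ab)"
proof -
  note c = Q.coproduct_Obj[OF cp] and \<iota> = Q.coproduct_hom[OF cp]
  have A: "A i \<in> Obj Q" if "i \<in> I" for i using Q.hom_Obj(1)[OF \<iota>[OF that]] .
  have Z: "c(ab := z) \<in> Obj Q" if "z \<in> Obj V" for z
    using c ab that by (auto simp: Quiv_simps PiE_def Pi_def extensional_def)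
  show ?thesis
  proof (rule coproductI)
    show "c ab \<in> Obj V" by (rule Obj_Quiv[OF c ab])
    show "quiv_comp (\<iota> i) ab \<in> hom V (A i ab) (c ab)" if "i \<in> I" for i by (rule quiv_comp_hom[OF \<iota>[OF that] ab])
  next
    fix x \<phi> assume x: "x \<in> Obj V" and \<phi>: "\<And>i. i \<in> I \<Longrightarrow> \<phi> i \<in> hom V (A i ab) x"
    define \<psi> where "\<psi> i = mk_arr (A i) (c(ab := x)) (\<lambda>xy. if xy = ab then \<phi> i else quiv_comp (\<iota> i) xy)" for i
    have \<psi>: "\<psi> i \<in> hom Q (A i) (c(ab := x))" if "i \<in> I" for i
      unfolding \<psi>_def by (rule mk_arr_hom[OF A[OF that] Z[OF x]]) (use \<phi>[OF that] quiv_comp_hom[OF \<iota>[OF that]] in auto)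
    obtain h where h: "h \<in> hom Q c (c(ab := x))" "\<And>i. i \<in> I \<Longrightarrow> h \<cdot>\<^bsub>Q\<^esub> \<iota> i = \<psi> i"
      using Q.coproduct_ex[OF cp Z[OF x] \<psi>] by blast
    have "quiv_comp h ab \<cdot> quiv_comp (\<iota> i) ab = \<phi> i" if "i \<in> I" for i
      using arg_cong[OF h(2)[OF that], of "\<lambda>f. quiv_comp f ab"] ab by (simp add: quiv_comp_Comp \<psi>_def quiv_comp_mk_arr)
    moreover have "quiv_comp h ab \<in> hom V (c ab) x" using quiv_comp_hom[OF h(1) ab] by simp
    ultimately show "\<exists>h\<in>hom V (c ab) x. \<forall>i\<in>I. h \<cdot> quiv_comp (\<iota> i) ab = \<phi> i" by blast
  next
    fix x h h' assume h: "h \<in> hom V (c ab) x" "h' \<in> hom V (c ab) x"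
      and eq: "\<And>i. i \<in> I \<Longrightarrow> h \<cdot> quiv_comp (\<iota> i) ab = h' \<cdot> quiv_comp (\<iota> i) ab"
    have x: "x \<in> Obj V" using hom_Obj(2)[OF h(1)] .
    define m where "m k = mk_arr c (c(ab := x)) (\<lambda>xy. if xy = ab then k else Idn V (c xy))" for k
    have m: "m k \<in> hom Q c (c(ab := x))" if "k \<in> hom V (c ab) x" for k
      unfolding m_def by (rule mk_arr_hom[OF c Z[OF x]]) (use that Idn_hom Obj_Quiv[OF c] in auto)
    have "m h = m h'"
    proof (rule Q.coproduct_eqI[OF cp m[OF h(1)] m[OF h(2)]])
      fix i assume i: "i \<in> I"
      show "m h \<cdot>\<^bsub>Q\<^esub> \<iota> i = m h' \<cdot>\<^bsub>Q\<^esub> \<iota> i"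
        by (rule quiv_arr_eqI[OF Q.Comp_hom[OF \<iota>[OF i] m[OF h(1)]] Q.Comp_hom[OF \<iota>[OF i] m[OF h(2)]]])
          (use eq[OF i] in \<open>auto simp: quiv_comp_Comp m_def quiv_comp_mk_arr\<close>)
    qed
    from arg_cong[OF this, of "\<lambda>f. quiv_comp f ab"] show "h = h'" using ab by (simp add: m_def quiv_comp_mk_arr)
  qed
qed

lemma countable_coproduct_Quiv:
  assumes "countable I" "\<And>i. i \<in> I \<Longrightarrow> A i \<in> Obj Q"
  shows "\<exists>c \<iota>. is_coproduct Q I A c \<iota>"
proof -
  have p: "is_coproduct V I (\<lambda>i. A i ab) (coprod V I (\<lambda>i. A i ab)) (coproj V I (\<lambda>i. A i ab))" if "ab \<in> S \<times> S" for ab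
    by (rule countable_coproduct[OF assms(1)]) (use Obj_Quiv[OF assms(2) that] in auto)
  let ?c = "restrict (\<lambda>ab. coprod V I (\<lambda>i. A i ab)) (S \<times> S)"
  have c: "?c \<in> Obj Q" using coproduct_Obj[OF p] by (auto simp: Quiv_simps)
  have m: "mk_arr (A i) ?c (\<lambda>ab. coproj V I (\<lambda>i. A i ab) i) \<in> hom Q (A i) ?c" if "i \<in> I" for i
    by (rule mk_arr_hom[OF assms(2)[OF that] c]) (use coproduct_hom[OF p that] in auto)
  have "is_coproduct Q I A ?c (\<lambda>i. mk_arr (A i) ?c (\<lambda>ab. coproj V I (\<lambda>i. A i ab) i))"
  proof (rule coproduct_Quiv[OF assms(2) c m])
    fix ab assume ab: "ab \<in> S \<times> S"
    show "is_coproduct V I (\<lambda>i. A i ab) (?c ab) (\<lambda>i. quiv_comp (mk_arr (A i) ?c (\<lambda>ab. coproj V I (\<lambda>i. A i ab) i)) ab)"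
      using p[OF ab] ab by (simp add: quiv_comp_mk_arr)
  qed
  then show ?thesis by blast
qed

lemma quiv_tensor_coproduct:
  assumes "A \<in> Obj Q" "B \<in> Obj Q" "a \<in> S" "b \<in> S"
  shows "is_coproduct V S (\<lambda>c. A (a, c) \<otimes> B (c, b)) ((A \<otimes>\<^bsub>Q\<^esub> B) (a, b)) (\<lambda>c. quiv_in V S A B a b c)"
proof -
  have "is_coproduct V S (\<lambda>c. A (a, c) \<otimes> B (c, b)) (coprod V S (\<lambda>c. A (a, c) \<otimes> B (c, b))) (coproj V S (\<lambda>c. A (a, c) \<otimes> B (c, b)))"
    by (rule coproduct_over_S) (use Obj_Quiv[OF assms(1)] Obj_Quiv[OF assms(2)] assms in auto)
  then show ?thesis using assms by (simp add: Quiv_simps quiv_tensor_def quiv_in_def)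
qed

text \<open>The coproduct over the middle vertex justifies the definite description in
  \<open>quiv_tensor_arr\<close>; afterwards only this defining equation is used.\<close>

lemma quiv_tensor_arr_in:
  assumes f: "f \<in> hom Q A A'" and g: "g \<in> hom Q B B'" and ab: "a \<in> S" "b \<in> S" and c: "c \<in> S"
  shows "quiv_comp (f \<odot>\<^bsub>Q\<^esub> g) (a, b) \<cdot> quiv_in V S A B a b c =
    quiv_in V S A' B' a b c \<cdot> (quiv_comp f (a, c) \<odot> quiv_comp g (c, b))"
proof -
  let ?P = "\<lambda>h. h \<in> hom V (quiv_tensor V S A B (a, b)) (quiv_tensor V S A' B' (a, b)) \<and>
        (\<forall>c \<in> S. h \<cdot> quiv_in V S A B a b c = quiv_in V S A' B' a b c \<cdot> (quiv_comp f (a, c) \<odot> quiv_comp g (c, b)))"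
  note O = Q.hom_Obj[OF f] Q.hom_Obj[OF g]
  note p = quiv_tensor_coproduct[OF O(1,3) ab] and p' = quiv_tensor_coproduct[OF O(2,4) ab]
  have "\<forall>c\<in>S. quiv_in V S A' B' a b c \<cdot> (quiv_comp f (a, c) \<odot> quiv_comp g (c, b)) \<in>
      hom V (A (a, c) \<otimes> B (c, b)) ((A' \<otimes>\<^bsub>Q\<^esub> B') (a, b))"
  proof
    fix c assume c: "c \<in> S"
    show "quiv_in V S A' B' a b c \<cdot> (quiv_comp f (a, c) \<odot> quiv_comp g (c, b)) \<in>
      hom V (A (a, c) \<otimes> B (c, b)) ((A' \<otimes>\<^bsub>Q\<^esub> B') (a, b))"
      by (rule Comp_hom[OF TensorArr_hom coproduct_hom[OF p' c]]) (use quiv_comp_hom[OF f] quiv_comp_hom[OF g] ab c in auto)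
  qed
  from coproduct_ex1[OF p coproduct_Obj[OF p'] this] have "\<exists>!h. ?P h" by (simp add: Quiv_simps)
  from theI'[OF this] have "?P (THE h. ?P h)" .
  moreover have "quiv_comp (f \<odot>\<^bsub>Q\<^esub> g) (a, b) = (THE h. ?P h)"
  proof -
    obtain f' g' where "f = (A, A', f')" "g = (B, B', g')"
      using f g unfolding hom_Quiv by (metis prod.collapse)
    then show ?thesis using ab by (simp add: Quiv_def quiv_tensor_arr_def quiv_comp_def)
  qed
  ultimately show ?thesis using c by simp
qed

text \<open>At (a, b) a tensor product of quivers is itself a coproduct over the middle vertex, so
  everything is a coproduct over \<open>S \<times> (I \<times> J)\<close>. Exchanging the order and
  cancelling the inner coproduct over S leaves the one over \<open>I \<times> J\<close>.\<close>

lemma coproduct_TensorArr_Quiv: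
  assumes c: "is_coproduct Q I A c \<iota>" and d: "is_coproduct Q J B d \<kappa>"
  shows "is_coproduct Q (I \<times> J) (\<lambda>(i, j). A i \<otimes>\<^bsub>Q\<^esub> B j) (c \<otimes>\<^bsub>Q\<^esub> d) (\<lambda>(i, j). \<iota> i \<odot>\<^bsub>Q\<^esub> \<kappa> j)"
proof (rule coproduct_Quiv)
  note cO = Q.coproduct_Obj[OF c] and \<iota> = Q.coproduct_hom[OF c]
    and dO = Q.coproduct_Obj[OF d] and \<kappa> = Q.coproduct_hom[OF d]
  have A: "A i \<in> Obj Q" if "i \<in> I" for i using Q.hom_Obj(1)[OF \<iota>[OF that]] .
  have B: "B i \<in> Obj Q" if "i \<in> J" for i using Q.hom_Obj(1)[OF \<kappa>[OF that]] .
  show "c \<otimes>\<^bsub>Q\<^esub> d \<in> Obj Q" using cO dO by simp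
  show "(case ij of (i, j) \<Rightarrow> A i \<otimes>\<^bsub>Q\<^esub> B j) \<in> Obj Q" if "ij \<in> I \<times> J" for ij using that A B by auto
  show hom: "(case ij of (i, j) \<Rightarrow> \<iota> i \<odot>\<^bsub>Q\<^esub> \<kappa> j) \<in> hom Q (case ij of (i, j) \<Rightarrow> A i \<otimes>\<^bsub>Q\<^esub> B j) (c \<otimes>\<^bsub>Q\<^esub> d)" if "ij \<in> I \<times> J" for ij
    using that Q.TensorArr_hom[OF \<iota> \<kappa>] by auto
  fix ab assume "ab \<in> S \<times> S"
  then obtain a b where ab: "ab = (a, b)" "a \<in> S" "b \<in> S" by auto
  let ?B = "\<lambda>x ij. case ij of (i, j) \<Rightarrow> A i (a, x) \<otimes> B j (x, b)"
  let ?k = "\<lambda>x ij. case ij of (i, j) \<Rightarrow> quiv_comp (\<iota> i) (a, x) \<odot> quiv_comp (\<kappa> j) (x, b)"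
  have sig: "is_coproduct V (S \<times> (I \<times> J)) (\<lambda>(x, ij). ?B x ij) ((c \<otimes>\<^bsub>Q\<^esub> d) (a, b)) (\<lambda>(x, ij). quiv_in V S c d a b x \<cdot> ?k x ij)"
    by (rule coproduct_Sigma[OF quiv_tensor_coproduct[OF cO dO ab(2,3)]], rule coproduct_TensorArr)
      (use coproduct_Quiv_pointwise[OF c] coproduct_Quiv_pointwise[OF d] ab in auto)
  have bij: "bij_betw (\<lambda>(ij, x). (x, ij)) ((I \<times> J) \<times> S) (S \<times> (I \<times> J))"
    by (rule bij_betwI[where g = "\<lambda>(x, ij). (ij, x)"]) auto
  have "is_coproduct V ((I \<times> J) \<times> S) (\<lambda>(ij, x). ?B x ij) ((c \<otimes>\<^bsub>Q\<^esub> d) (a, b)) (\<lambda>(ij, x). quiv_in V S c d a b x \<cdot> ?k x ij)"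
    by (rule coproduct_cong[OF coproduct_reindex[OF bij sig]]) auto
  then have "is_coproduct V (Sigma (I \<times> J) (\<lambda>_. S)) (\<lambda>(ij, x). ?B x ij) ((c \<otimes>\<^bsub>Q\<^esub> d) (a, b))
      (\<lambda>(ij, x). quiv_comp (case ij of (i, j) \<Rightarrow> \<iota> i \<odot>\<^bsub>Q\<^esub> \<kappa> j) (a, b) \<cdot> (case ij of (i, j) \<Rightarrow> quiv_in V S (A i) (B j) a b x))"
    by (rule coproduct_cong) (use quiv_tensor_arr_in[OF \<iota> \<kappa> ab(2,3)] in auto)
  then show "is_coproduct V (I \<times> J) (\<lambda>ij. (case ij of (i, j) \<Rightarrow> A i \<otimes>\<^bsub>Q\<^esub> B j) ab) ((c \<otimes>\<^bsub>Q\<^esub> d) ab) (\<lambda>ij. quiv_comp (case ij of (i, j) \<Rightarrow> \<iota> i \<odot>\<^bsub>Q\<^esub> \<kappa> j) ab)"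
    unfolding ab(1)
  proof (rule coproduct_cancel)
    fix ij assume ij: "ij \<in> I \<times> J"
    then show "is_coproduct V S (\<lambda>x. ?B x ij) ((case ij of (i, j) \<Rightarrow> A i \<otimes>\<^bsub>Q\<^esub> B j) (a, b)) (\<lambda>x. case ij of (i, j) \<Rightarrow> quiv_in V S (A i) (B j) a b x)"
      using quiv_tensor_coproduct[OF A B ab(2,3)] by auto
    show "quiv_comp (case ij of (i, j) \<Rightarrow> \<iota> i \<odot>\<^bsub>Q\<^esub> \<kappa> j) (a, b) \<in> hom V ((case ij of (i, j) \<Rightarrow> A i \<otimes>\<^bsub>Q\<^esub> B j) (a, b)) ((c \<otimes>\<^bsub>Q\<^esub> d) (a, b))"
      by (rule quiv_comp_hom[OF hom[OF ij]]) (use ab in simp)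
  qed
qed

end

section \<open>Decomposition into non-degenerate simplices\<close>

text \<open>\<open>iso_to_coprojection\<close> allows an auxiliary coproduct object and an
  automorphism of the source. Transporting the coproduct along the two isomorphisms makes
  \<open>f\<close> itself one of the coprojections.\<close>

lemma (in category) coproduct_of_coprojection:
  assumes "iso_to_coprojection C f N"
  shows "\<exists>e. is_coproduct C UNIV (\<lambda>i. if i then Dom C f else N) (Cod C f) (\<lambda>i. if i then f else e)"
proof -
  obtain P \<iota> \<phi> \<psi> where P: "is_coproduct C (UNIV :: bool set) (\<lambda>i. if i then Dom C f else N) P \<iota>"
    and \<phi>: "\<phi> \<in> hom C (Dom C f) (Dom C f)" "iso C \<phi>" and \<psi>: "\<psi> \<in> hom C (Cod C f) P" "iso C \<psi>"
    and eq: "\<psi> \<cdot> f = \<iota> True \<cdot> \<phi>" and f: "f \<in> Arr C" and N: "N \<in> Obj C"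
    using assms unfolding iso_to_coprojection_def by blast
  let ?\<alpha> = "\<lambda>i. if i then \<phi> else Idn C N"
  have "is_coproduct C UNIV (\<lambda>i. if i then Dom C f else N) (Cod C f) (\<lambda>i. inv_arr C \<psi> \<cdot> (\<iota> i \<cdot> ?\<alpha> i))"
    by (rule coproduct_iso[OF P]) (use \<phi> N Idn_hom homD[OF \<psi>(1)] \<psi>(2) in \<open>auto simp: hom_def\<close>)
  moreover have "inv_arr C \<psi> \<cdot> (\<iota> True \<cdot> \<phi>) = f"
    unfolding eq[symmetric] using f homD[OF \<psi>(1)] \<psi>(2) by simp
  ultimately have "is_coproduct C UNIV (\<lambda>i. if i then Dom C f else N) (Cod C f)
      (\<lambda>i. if i then f else inv_arr C \<psi> \<cdot> (\<iota> False \<cdot> Idn C N))"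
    by (elim coproduct_cong) auto
  then show ?thesis by blast
qed

section \<open>Surjections of intervals and the degeneracy diagram\<close>

definition surjs :: "nat \<Rightarrow> nat list set" where
  "surjs n = {\<sigma> \<in> surj_interval_maps. length \<sigma> = Suc n}"

lemma surjs_iff: "\<sigma> \<in> surjs n \<longleftrightarrow> \<sigma> \<in> Arr Delta_f \<and> set \<sigma> = {..last \<sigma>} \<and> length \<sigma> = Suc n"
  by (auto simp: surjs_def surj_interval_maps_def)

lemma surjs_0: "surjs 0 = {[0]}"
  by (auto simp: surjs_iff length_Suc_conv Arr_Delta_f)

lemma Idn_surjs: "[0..<Suc n] \<in> surjs n"
  using category.Idn_Arr[OF category_Delta_f, of n] by (auto simp: surjs_iff)

lemma surjs_last_le: "\<sigma> \<in> surjs n \<Longrightarrow> last \<sigma> \<le> n"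
  using card_length[of \<sigma>] by (simp add: surjs_iff)

lemma surjs_eq_Idn: "\<sigma> \<in> surjs n \<Longrightarrow> last \<sigma> = n \<Longrightarrow> \<sigma> = [0..<Suc n]"
proof -
  assume s: "\<sigma> \<in> surjs n" "last \<sigma> = n"
  then have "distinct \<sigma>" by (intro card_distinct) (simp add: surjs_iff)
  then show ?thesis
    using s by (intro sorted_distinct_set_unique) (auto simp: surjs_iff Arr_Delta_f simp del: upt_Suc)
qed

lemma Comp_surjs:
  assumes "\<sigma> \<in> surjs n" "\<rho> \<in> surjs (last \<sigma>)"
  shows "map ((!) \<rho>) \<sigma> \<in> surjs n" "last (map ((!) \<rho>) \<sigma>) = last \<rho>"
proof -
  have *: "\<sigma> \<in> Arr Delta_f" "\<rho> \<in> Arr Delta_f" "last \<sigma> = length \<rho> - 1" using assms by (auto simp: surjs_iff)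
  have "set \<sigma> = {..<length \<rho>}" using assms by (auto simp: surjs_iff)
  then have "set (map ((!) \<rho>) \<sigma>) = (!) \<rho> ` {..<length \<rho>}" by (simp only: set_map)
  also have "\<dots> = set \<rho>" by (auto simp: set_conv_nth)
  finally have "set (map ((!) \<rho>) \<sigma>) = set \<rho>" .
  then show "map ((!) \<rho>) \<sigma> \<in> surjs n" "last (map ((!) \<rho>) \<sigma>) = last \<rho>"
    using Comp_Delta_f[OF *] last_Comp_Delta_f[OF *] assms by (auto simp: surjs_iff)
qed

lemma surjs_Arr_Nec:
  assumes "(T, p) \<in> Obj Nec" "f \<in> surjs p"
  shows "((T, p), ((!) f ` T, last f), f) \<in> Arr Nec"
proof -
  have f: "f \<in> Arr Delta_f" "length f = Suc p" using assms(2) by (auto simp: surjs_iff)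
  have "f ! p = last f" "f ! 0 = 0" using last_Delta_f[OF f(1)] f by (auto simp: Arr_Delta_f)
  then have "{0, last f} \<subseteq> (!) f ` T" using assms(1) by (force simp: Nec_simps)
  moreover have "(!) f ` T \<subseteq> {..last f}"
    using assms(1) f nth_le_last_Delta_f[OF f(1)] by (auto simp: Nec_simps)
  ultimately show ?thesis using assms(1) f by (auto simp: Nec_simps hom_def)
qed

lemma countable_lists_nat: "countable (A :: nat list set)"
  by (rule countable_subset[OF subset_UNIV]) simp

lemma Obj_deg_cat: "Obj (deg_cat n) = {\<sigma> \<in> surjs n. last \<sigma> < n}"
  by (auto simp: deg_cat_def Let_def surjs_def surj_interval_maps_def Arr_Delta_f)

lemma Arr_deg_cat: "Arr (deg_cat n) = {(\<sigma>, \<sigma>', \<tau>). \<sigma> \<in> Obj (deg_cat n) \<and> \<sigma>' \<in> Obj (deg_cat n) \<and>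
    \<tau> \<in> surjs (last \<sigma>) \<and> last \<tau> = last \<sigma>' \<and> map ((!) \<tau>) \<sigma> = \<sigma>'}"
proof -
  have "\<tau> \<in> surj_interval_maps \<and> \<tau> \<in> hom Delta_f k l \<longleftrightarrow> \<tau> \<in> surjs k \<and> last \<tau> = l" for \<tau> k l
    by (cases \<tau>) (auto simp: surjs_def surj_interval_maps_def hom_def Arr_Delta_f)
  then show ?thesis by (auto simp: deg_cat_def Let_def)
qed

lemma deg_cat_Dom_Cod: "Dom (deg_cat n) (\<sigma>, \<sigma>', \<tau>) = \<sigma>" "Cod (deg_cat n) (\<sigma>, \<sigma>', \<tau>) = \<sigma>'"
  by (auto simp: deg_cat_def Let_def)

locale nondeg_templicial = quivers V S
  for V :: "('o, 'm, 'z) sym_mon_cat_scheme" (structure) and S :: "'u set" +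
  fixes X :: "('u, 'o, 'm) templicial" and Xnd :: "nat \<Rightarrow> ('u, 'o) quiver"
  assumes templicial: "is_templicial V S X"
    and nondeg: "is_nondeg_choice V S X Xnd"
begin

sublocale X: unital_colax Q X
  by unfold_locales (use templicial in \<open>auto simp: is_templicial_def\<close>)

text \<open>The coprojection of X^nd_n into X_n, picked by choice because \<open>Xnd\<close> records
  the object alone. The ends are written as \<open>Dom\<close> and \<open>Cod\<close> of
  \<open>deg_map\<close>: the latter is a definite description, known to be an arrow from
  \<open>Xdeg\<close> to X_n only after the colimit has been shown to exist.\<close>

definition nd :: "nat \<Rightarrow> ('u, 'o, 'm) quiver_arr" where
  "nd n = (SOME e. is_coproduct Q UNIV (\<lambda>i. if i then Dom Q (deg_map V S X n) else Xnd n)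
     (Cod Q (deg_map V S X n)) (\<lambda>i. if i then deg_map V S X n else e))"

lemma coproduct_nd: "is_coproduct Q UNIV (\<lambda>i. if i then Dom Q (deg_map V S X n) else Xnd n)
     (Cod Q (deg_map V S X n)) (\<lambda>i. if i then deg_map V S X n else nd n)"
  unfolding nd_def
  by (rule someI_ex, rule Q.coproduct_of_coprojection) (use nondeg in \<open>simp add: is_nondeg_choice_def\<close>)

lemma Xnd_Obj [simp]: "Xnd n \<in> Obj Q"
  using nondeg by (simp add: is_nondeg_choice_def iso_to_coprojection_def)

text \<open>Cocones on the degeneracy diagram below \<open>n\<close> are families of arrows out of the
  \<open>Xnd (last \<sigma>)\<close>, \<open>\<sigma> \<noteq> id\<close>, once the smaller \<open>X\<^sub>k\<close> are known to decompose.\<close>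

lemma
  assumes IH: "\<And>k. k < n \<Longrightarrow> nd k \<in> hom Q (Xnd k) (fob X k)"
      "\<And>k. k < n \<Longrightarrow> is_coproduct Q (surjs k) (\<lambda>\<sigma>. Xnd (last \<sigma>)) (fob X k) (\<lambda>\<sigma>. far X \<sigma> \<cdot>\<^bsub>Q\<^esub> nd (last \<sigma>))"
  shows deg_coproduct: "is_colimit (op_cat (deg_cat n)) Q (deg_diagram X) d \<kappa> \<Longrightarrow>
      is_coproduct Q (Obj (deg_cat n)) (\<lambda>\<sigma>. Xnd (last \<sigma>)) d (\<lambda>\<sigma>. \<kappa> \<sigma> \<cdot>\<^bsub>Q\<^esub> nd (last \<sigma>))"
    and deg_colimit: "\<exists>d \<kappa>. is_colimit (op_cat (deg_cat n)) Q (deg_diagram X) d \<kappa>"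
proof -
  let ?D = "Obj (deg_cat n)"
  have cocone: "is_cocone (op_cat (deg_cat n)) Q (deg_diagram X) x \<phi> \<longleftrightarrow> x \<in> Obj Q \<and>
      (\<forall>\<sigma> \<in> ?D. \<phi> \<sigma> \<in> hom Q (fob X (last \<sigma>)) x) \<and>
      (\<forall>\<sigma> \<in> ?D. \<forall>\<tau> \<in> surjs (last \<sigma>). \<phi> \<sigma> \<cdot>\<^bsub>Q\<^esub> far X \<tau> = \<phi> (map ((!) \<tau>) \<sigma>))" for x \<phi>
  proof -
    have "(\<forall>f \<in> Arr (deg_cat n). \<phi> (Dom (deg_cat n) f) \<cdot>\<^bsub>Q\<^esub> far (deg_diagram X) f = \<phi> (Cod (deg_cat n) f)) \<longleftrightarrow>
      (\<forall>\<sigma> \<in> ?D. \<forall>\<tau> \<in> surjs (last \<sigma>). \<phi> \<sigma> \<cdot>\<^bsub>Q\<^esub> far X \<tau> = \<phi> (map ((!) \<tau>) \<sigma>))"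
    proof safe
      fix \<sigma> \<tau> assume a: "\<forall>f \<in> Arr (deg_cat n). \<phi> (Dom (deg_cat n) f) \<cdot>\<^bsub>Q\<^esub> far (deg_diagram X) f = \<phi> (Cod (deg_cat n) f)"
        and s: "\<sigma> \<in> ?D" "\<tau> \<in> surjs (last \<sigma>)"
      have "(\<sigma>, map ((!) \<tau>) \<sigma>, \<tau>) \<in> Arr (deg_cat n)"
        using s Comp_surjs[of \<sigma> n \<tau>] surjs_last_le[OF s(2)] by (auto simp: Arr_deg_cat Obj_deg_cat)
      from a[rule_format, OF this] show "\<phi> \<sigma> \<cdot>\<^bsub>Q\<^esub> far X \<tau> = \<phi> (map ((!) \<tau>) \<sigma>)"
        by (simp add: deg_cat_Dom_Cod deg_diagram_def)
    next
      fix \<sigma> \<sigma>' \<tau> assume a: "\<forall>\<sigma> \<in> ?D. \<forall>\<tau> \<in> surjs (last \<sigma>). \<phi> \<sigma> \<cdot>\<^bsub>Q\<^esub> far X \<tau> = \<phi> (map ((!) \<tau>) \<sigma>)"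
        and f: "(\<sigma>, \<sigma>', \<tau>) \<in> Arr (deg_cat n)"
      then show "\<phi> (Dom (deg_cat n) (\<sigma>, \<sigma>', \<tau>)) \<cdot>\<^bsub>Q\<^esub> far (deg_diagram X) (\<sigma>, \<sigma>', \<tau>) = \<phi> (Cod (deg_cat n) (\<sigma>, \<sigma>', \<tau>))"
        by (auto simp: deg_cat_Dom_Cod deg_diagram_def Arr_deg_cat)
    qed
    then show ?thesis by (simp add: is_cocone_def) (simp add: deg_diagram_def)
  qed
  have D: "\<sigma> \<in> surjs n" "last \<sigma> < n" if "\<sigma> \<in> ?D" for \<sigma> using that by (auto simp: Obj_deg_cat)
  have Dcomp: "map ((!) \<tau>) \<sigma> \<in> ?D" "last (map ((!) \<tau>) \<sigma>) = last \<tau>" if "\<sigma> \<in> ?D" "\<tau> \<in> surjs (last \<sigma>)" for \<sigma> \<tau>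
    using Comp_surjs[OF D(1)[OF that(1)] that(2)] surjs_last_le[OF that(2)] D(2)[OF that(1)] by (auto simp: Obj_deg_cat)
  have lt: "last \<rho> < n" if "\<sigma> \<in> ?D" "\<rho> \<in> surjs (last \<sigma>)" for \<sigma> \<rho>
    using D(2)[OF that(1)] surjs_last_le[OF that(2)] by simp
  have Xa: "\<rho> \<in> Arr Delta_f" "far X \<rho> \<in> hom Q (fob X (last \<rho>)) (fob X k)" if "\<rho> \<in> surjs k" for \<rho> k
    using that by (auto simp: hom_def[of Q] surjs_iff)
  have XC: "far X \<tau> \<cdot>\<^bsub>Q\<^esub> far X \<rho> = far X (map ((!) \<rho>) \<tau>)" if "\<tau> \<in> surjs k" "\<rho> \<in> surjs (last \<tau>)" for \<tau> \<rho> k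
    using X.X_Comp[of \<tau> \<rho>] that by (auto simp: surjs_iff)
  have agree: "t = t'" if \<sigma>: "\<sigma> \<in> ?D" and t: "t \<in> hom Q (fob X (last \<sigma>)) x" "t' \<in> hom Q (fob X (last \<sigma>)) x"
    and eq: "\<And>\<rho>. \<rho> \<in> surjs (last \<sigma>) \<Longrightarrow> t \<cdot>\<^bsub>Q\<^esub> (far X \<rho> \<cdot>\<^bsub>Q\<^esub> nd (last \<rho>)) = t' \<cdot>\<^bsub>Q\<^esub> (far X \<rho> \<cdot>\<^bsub>Q\<^esub> nd (last \<rho>))" for \<sigma> t t' x
    by (rule Q.coproduct_eqI[OF IH(2)[OF D(2)[OF \<sigma>]] t eq])
  have pre: "\<exists>t \<in> hom Q (fob X (last \<sigma>)) x. \<forall>\<rho> \<in> surjs (last \<sigma>). t \<cdot>\<^bsub>Q\<^esub> (far X \<rho> \<cdot>\<^bsub>Q\<^esub> nd (last \<rho>)) = \<phi> (map ((!) \<rho>) \<sigma>)"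
    if \<sigma>: "\<sigma> \<in> ?D" and \<phi>: "\<And>\<sigma>. \<sigma> \<in> ?D \<Longrightarrow> \<phi> \<sigma> \<in> hom Q (Xnd (last \<sigma>)) x" for \<sigma> \<phi> x
  proof -
    have x: "x \<in> Obj Q" using Q.hom_Obj(2)[OF \<phi>[OF \<sigma>]] .
    have "\<phi> (map ((!) \<rho>) \<sigma>) \<in> hom Q (Xnd (last \<rho>)) x" if "\<rho> \<in> surjs (last \<sigma>)" for \<rho>
      using \<phi>[OF Dcomp(1)[OF \<sigma> that]] unfolding Dcomp(2)[OF \<sigma> that] .
    then show ?thesis using Q.coproduct_ex[OF IH(2)[OF D(2)[OF \<sigma>]] x, of "\<lambda>\<rho>. \<phi> (map ((!) \<rho>) \<sigma>)"] by metis
  qed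
  \<comment> \<open>Extends \<open>\<phi>\<close> from the summands to the whole of X_k at
    \<open>\<sigma>\<close>, where \<open>k = last \<sigma>\<close>. By induction hypothesis an
    arrow out of X_k is given by its components along the surjections \<open>\<rho>\<close> out of
    [k]; in a cocone the component at \<open>\<rho>\<close> has to be \<open>\<phi>\<close> at the
    composite of \<open>\<sigma>\<close> and \<open>\<rho>\<close>, which lowers the degree as
    well.\<close>
  define ext where "ext \<phi> x = (SOME t. \<forall>\<sigma> \<in> ?D. t \<sigma> \<in> hom Q (fob X (last \<sigma>)) x \<and>
      (\<forall>\<rho> \<in> surjs (last \<sigma>). t \<sigma> \<cdot>\<^bsub>Q\<^esub> (far X \<rho> \<cdot>\<^bsub>Q\<^esub> nd (last \<rho>)) = \<phi> (map ((!) \<rho>) \<sigma>)))" for \<phi> x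
  have ext_all: "\<forall>\<sigma> \<in> ?D. ext \<phi> x \<sigma> \<in> hom Q (fob X (last \<sigma>)) x \<and>
      (\<forall>\<rho> \<in> surjs (last \<sigma>). ext \<phi> x \<sigma> \<cdot>\<^bsub>Q\<^esub> (far X \<rho> \<cdot>\<^bsub>Q\<^esub> nd (last \<rho>)) = \<phi> (map ((!) \<rho>) \<sigma>))"
    if \<phi>: "\<And>\<sigma>. \<sigma> \<in> ?D \<Longrightarrow> \<phi> \<sigma> \<in> hom Q (Xnd (last \<sigma>)) x" for \<phi> x
  proof -
    have "\<forall>\<sigma> \<in> ?D. \<exists>t. t \<in> hom Q (fob X (last \<sigma>)) x \<and>
      (\<forall>\<rho> \<in> surjs (last \<sigma>). t \<cdot>\<^bsub>Q\<^esub> (far X \<rho> \<cdot>\<^bsub>Q\<^esub> nd (last \<rho>)) = \<phi> (map ((!) \<rho>) \<sigma>))"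
      using pre[OF _ \<phi>] by blast
    from bchoice[OF this] have "\<exists>t. \<forall>\<sigma> \<in> ?D. t \<sigma> \<in> hom Q (fob X (last \<sigma>)) x \<and>
      (\<forall>\<rho> \<in> surjs (last \<sigma>). t \<sigma> \<cdot>\<^bsub>Q\<^esub> (far X \<rho> \<cdot>\<^bsub>Q\<^esub> nd (last \<rho>)) = \<phi> (map ((!) \<rho>) \<sigma>))" .
    then show ?thesis unfolding ext_def by (rule someI_ex)
  qed
  have ext: "\<And>\<phi> x \<sigma>. (\<And>\<sigma>. \<sigma> \<in> ?D \<Longrightarrow> \<phi> \<sigma> \<in> hom Q (Xnd (last \<sigma>)) x) \<Longrightarrow> \<sigma> \<in> ?D \<Longrightarrow>
        ext \<phi> x \<sigma> \<in> hom Q (fob X (last \<sigma>)) x"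
      "\<And>\<phi> x \<sigma> \<rho>. (\<And>\<sigma>. \<sigma> \<in> ?D \<Longrightarrow> \<phi> \<sigma> \<in> hom Q (Xnd (last \<sigma>)) x) \<Longrightarrow> \<sigma> \<in> ?D \<Longrightarrow> \<rho> \<in> surjs (last \<sigma>) \<Longrightarrow>
        ext \<phi> x \<sigma> \<cdot>\<^bsub>Q\<^esub> (far X \<rho> \<cdot>\<^bsub>Q\<^esub> nd (last \<rho>)) = \<phi> (map ((!) \<rho>) \<sigma>)"
    using ext_all by blast+
  have ext_nd: "ext \<phi> x \<sigma> \<cdot>\<^bsub>Q\<^esub> nd (last \<sigma>) = \<phi> \<sigma>" if \<phi>: "\<And>\<sigma>. \<sigma> \<in> ?D \<Longrightarrow> \<phi> \<sigma> \<in> hom Q (Xnd (last \<sigma>)) x" and \<sigma>: "\<sigma> \<in> ?D" for \<phi> x \<sigma>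
  proof -
    have "map ((!) [0..<Suc (last \<sigma>)]) \<sigma> = \<sigma>"
      using category.Idn_Comp[OF category_Delta_f, of \<sigma> n "last \<sigma>"] D[OF \<sigma>] by (auto simp: surjs_iff hom_def)
    then show ?thesis
      using ext(2)[of \<phi> x \<sigma> "[0..<Suc (last \<sigma>)]", OF \<phi> \<sigma> Idn_surjs] homD[OF IH(1)[OF D(2)[OF \<sigma>]]]
      by (simp add: X.X_Idn del: upt_Suc)
  qed
  have ext_cocone: "is_cocone (op_cat (deg_cat n)) Q (deg_diagram X) x (ext \<phi> x)"
    if x: "x \<in> Obj Q" and \<phi>: "\<And>\<sigma>. \<sigma> \<in> ?D \<Longrightarrow> \<phi> \<sigma> \<in> hom Q (Xnd (last \<sigma>)) x" for \<phi> x
    unfolding cocone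
  proof (intro conjI ballI x)
    show "ext \<phi> x \<sigma> \<in> hom Q (fob X (last \<sigma>)) x" if "\<sigma> \<in> ?D" for \<sigma> by (rule ext(1)[OF \<phi> that])
    fix \<sigma> \<tau> assume s: "\<sigma> \<in> ?D" "\<tau> \<in> surjs (last \<sigma>)"
    have e: "ext \<phi> x \<sigma> \<in> hom Q (fob X (last \<sigma>)) x" by (rule ext(1)[OF \<phi> s(1)])
    show "ext \<phi> x \<sigma> \<cdot>\<^bsub>Q\<^esub> far X \<tau> = ext \<phi> x (map ((!) \<tau>) \<sigma>)"
    proof (rule agree[OF Dcomp(1)[OF s]])
      show "ext \<phi> x \<sigma> \<cdot>\<^bsub>Q\<^esub> far X \<tau> \<in> hom Q (fob X (last (map ((!) \<tau>) \<sigma>))) x"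
        unfolding Dcomp(2)[OF s] by (rule Q.Comp_hom[OF Xa(2)[OF s(2)] e])
      show "ext \<phi> x (map ((!) \<tau>) \<sigma>) \<in> hom Q (fob X (last (map ((!) \<tau>) \<sigma>))) x" by (rule ext(1)[OF \<phi> Dcomp(1)[OF s]])
      fix \<rho> assume r': "\<rho> \<in> surjs (last (map ((!) \<tau>) \<sigma>))"
      then have r: "\<rho> \<in> surjs (last \<tau>)" unfolding Dcomp(2)[OF s] .
      have n: "nd (last \<rho>) \<in> hom Q (Xnd (last \<rho>)) (fob X (last \<rho>))" by (rule IH(1)[OF lt[OF Dcomp(1)[OF s] r']])
      have c: "map ((!) \<rho>) \<tau> \<in> surjs (last \<sigma>)" "last (map ((!) \<rho>) \<tau>) = last \<rho>" using Comp_surjs[OF s(2) r] by auto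
      have "(ext \<phi> x \<sigma> \<cdot>\<^bsub>Q\<^esub> far X \<tau>) \<cdot>\<^bsub>Q\<^esub> (far X \<rho> \<cdot>\<^bsub>Q\<^esub> nd (last \<rho>)) =
          ext \<phi> x \<sigma> \<cdot>\<^bsub>Q\<^esub> ((far X \<tau> \<cdot>\<^bsub>Q\<^esub> far X \<rho>) \<cdot>\<^bsub>Q\<^esub> nd (last \<rho>))"
        using homD[OF e] homD[OF n] homD[OF Xa(2)[OF s(2)]] homD[OF Xa(2)[OF r]] by simp
      also have "\<dots> = \<phi> (map ((!) (map ((!) \<rho>) \<tau>)) \<sigma>)"
        unfolding XC[OF s(2) r] using ext(2)[of \<phi> x \<sigma>, OF \<phi> s(1) c(1)] unfolding c(2) .
      also have "map ((!) (map ((!) \<rho>) \<tau>)) \<sigma> = map ((!) \<rho>) (map ((!) \<tau>) \<sigma>)"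
        using s D(1)[OF s(1)] by (auto simp: surjs_iff)
      also have "\<phi> \<dots> = ext \<phi> x (map ((!) \<tau>) \<sigma>) \<cdot>\<^bsub>Q\<^esub> (far X \<rho> \<cdot>\<^bsub>Q\<^esub> nd (last \<rho>))"
        by (rule ext(2)[OF \<phi> Dcomp(1)[OF s] r', symmetric])
      finally show "(ext \<phi> x \<sigma> \<cdot>\<^bsub>Q\<^esub> far X \<tau>) \<cdot>\<^bsub>Q\<^esub> (far X \<rho> \<cdot>\<^bsub>Q\<^esub> nd (last \<rho>)) =
          ext \<phi> x (map ((!) \<tau>) \<sigma>) \<cdot>\<^bsub>Q\<^esub> (far X \<rho> \<cdot>\<^bsub>Q\<^esub> nd (last \<rho>))" .
    qed
  qed
  have cocone_agree: "\<phi> \<sigma> \<cdot>\<^bsub>Q\<^esub> (far X \<rho> \<cdot>\<^bsub>Q\<^esub> nd (last \<rho>)) = \<phi> (map ((!) \<rho>) \<sigma>) \<cdot>\<^bsub>Q\<^esub> nd (last (map ((!) \<rho>) \<sigma>))"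
    if \<phi>: "is_cocone (op_cat (deg_cat n)) Q (deg_diagram X) x \<phi>" and s: "\<sigma> \<in> ?D" "\<rho> \<in> surjs (last \<sigma>)" for x \<phi> \<sigma> \<rho>
  proof -
    have p: "\<phi> \<sigma> \<in> hom Q (fob X (last \<sigma>)) x" "\<phi> \<sigma> \<cdot>\<^bsub>Q\<^esub> far X \<rho> = \<phi> (map ((!) \<rho>) \<sigma>)" using \<phi> s unfolding cocone by auto
    show ?thesis unfolding Dcomp(2)[OF s] p(2)[symmetric]
      by (rule Q.Comp_assoc[OF IH(1)[OF lt[OF s]] Xa(2)[OF s(2)] p(1), symmetric])
  qed
  show "is_coproduct Q ?D (\<lambda>\<sigma>. Xnd (last \<sigma>)) d (\<lambda>\<sigma>. \<kappa> \<sigma> \<cdot>\<^bsub>Q\<^esub> nd (last \<sigma>))"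
    if colim: "is_colimit (op_cat (deg_cat n)) Q (deg_diagram X) d \<kappa>" for d \<kappa>
  proof (rule Q.coproductI)
    have cc: "is_cocone (op_cat (deg_cat n)) Q (deg_diagram X) d \<kappa>" using colim by (simp add: is_colimit_def)
    show "d \<in> Obj Q" using cc by (simp add: cocone)
    have \<kappa>: "\<kappa> \<sigma> \<in> hom Q (fob X (last \<sigma>)) d" if "\<sigma> \<in> ?D" for \<sigma> using cc that by (simp add: cocone)
    show "\<kappa> \<sigma> \<cdot>\<^bsub>Q\<^esub> nd (last \<sigma>) \<in> hom Q (Xnd (last \<sigma>)) d" if "\<sigma> \<in> ?D" for \<sigma>
      by (rule Q.Comp_hom[OF IH(1)[OF D(2)[OF that]] \<kappa>[OF that]])
    { fix x \<phi> assume x: "x \<in> Obj Q" and \<phi>: "\<And>\<sigma>. \<sigma> \<in> ?D \<Longrightarrow> \<phi> \<sigma> \<in> hom Q (Xnd (last \<sigma>)) x"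
      obtain h where h: "h \<in> hom Q d x" "\<forall>\<sigma> \<in> ?D. h \<cdot>\<^bsub>Q\<^esub> \<kappa> \<sigma> = ext \<phi> x \<sigma>"
        using colim ext_cocone[OF x \<phi>] unfolding is_colimit_def op_cat_simps by metis
      have "h \<cdot>\<^bsub>Q\<^esub> (\<kappa> \<sigma> \<cdot>\<^bsub>Q\<^esub> nd (last \<sigma>)) = \<phi> \<sigma>" if "\<sigma> \<in> ?D" for \<sigma>
        using Q.Comp_assoc[OF IH(1)[OF D(2)[OF that]] \<kappa>[OF that] h(1)] h(2) that ext_nd[OF \<phi> that] by simp
      then show "\<exists>h\<in>hom Q d x. \<forall>\<sigma>\<in>?D. h \<cdot>\<^bsub>Q\<^esub> (\<kappa> \<sigma> \<cdot>\<^bsub>Q\<^esub> nd (last \<sigma>)) = \<phi> \<sigma>" using h(1) by blast }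
    { fix x h h' assume h: "h \<in> hom Q d x" "h' \<in> hom Q d x"
        and eq: "\<And>\<sigma>. \<sigma> \<in> ?D \<Longrightarrow> h \<cdot>\<^bsub>Q\<^esub> (\<kappa> \<sigma> \<cdot>\<^bsub>Q\<^esub> nd (last \<sigma>)) = h' \<cdot>\<^bsub>Q\<^esub> (\<kappa> \<sigma> \<cdot>\<^bsub>Q\<^esub> nd (last \<sigma>))"
      have x: "x \<in> Obj Q" using Q.hom_Obj(2)[OF h(1)] .
      have assoc: "(k \<cdot>\<^bsub>Q\<^esub> \<kappa> \<sigma>) \<cdot>\<^bsub>Q\<^esub> (far X \<rho> \<cdot>\<^bsub>Q\<^esub> nd (last \<rho>)) =
          k \<cdot>\<^bsub>Q\<^esub> (\<kappa> (map ((!) \<rho>) \<sigma>) \<cdot>\<^bsub>Q\<^esub> nd (last (map ((!) \<rho>) \<sigma>)))"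
        if k: "k \<in> hom Q d x" and s: "\<sigma> \<in> ?D" "\<rho> \<in> surjs (last \<sigma>)" for k \<sigma> \<rho>
        unfolding cocone_agree[OF cc s, symmetric]
        by (rule Q.Comp_assoc[OF Q.Comp_hom[OF IH(1)[OF lt[OF s]] Xa(2)[OF s(2)]] \<kappa>[OF s(1)] k])
      have hk: "h \<cdot>\<^bsub>Q\<^esub> \<kappa> \<sigma> = h' \<cdot>\<^bsub>Q\<^esub> \<kappa> \<sigma>" if s: "\<sigma> \<in> ?D" for \<sigma>
        by (rule agree[OF s Q.Comp_hom[OF \<kappa>[OF s] h(1)] Q.Comp_hom[OF \<kappa>[OF s] h(2)]])
          (simp only: assoc[OF h(1) s] assoc[OF h(2) s] eq[OF Dcomp(1)[OF s]])
      have "is_cocone (op_cat (deg_cat n)) Q (deg_diagram X) x (\<lambda>\<sigma>. h \<cdot>\<^bsub>Q\<^esub> \<kappa> \<sigma>)"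
        unfolding cocone
      proof (intro conjI ballI x)
        show "h \<cdot>\<^bsub>Q\<^esub> \<kappa> \<sigma> \<in> hom Q (fob X (last \<sigma>)) x" if "\<sigma> \<in> ?D" for \<sigma> by (rule Q.Comp_hom[OF \<kappa>[OF that] h(1)])
        show "(h \<cdot>\<^bsub>Q\<^esub> \<kappa> \<sigma>) \<cdot>\<^bsub>Q\<^esub> far X \<tau> = h \<cdot>\<^bsub>Q\<^esub> \<kappa> (map ((!) \<tau>) \<sigma>)" if s: "\<sigma> \<in> ?D" "\<tau> \<in> surjs (last \<sigma>)" for \<sigma> \<tau>
          using Q.Comp_assoc[OF Xa(2)[OF s(2)] \<kappa>[OF s(1)] h(1)] cc s by (simp add: cocone)
      qed
      then have "\<exists>!k. k \<in> hom Q d x \<and> (\<forall>\<sigma>\<in>?D. k \<cdot>\<^bsub>Q\<^esub> \<kappa> \<sigma> = h \<cdot>\<^bsub>Q\<^esub> \<kappa> \<sigma>)"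
        using colim[unfolded is_colimit_def op_cat_simps] by blast
      then show "h = h'" using h hk by metis }
  qed
  show "\<exists>d \<kappa>. is_colimit (op_cat (deg_cat n)) Q (deg_diagram X) d \<kappa>"
  proof -
    \<comment> \<open>The coproduct of the summands is made into a colimit: its coprojections extend
      to a cocone, and restricting a cocone along \<open>nd\<close> is inverse to extending.\<close>
    obtain d j where d: "is_coproduct Q ?D (\<lambda>\<sigma>. Xnd (last \<sigma>)) d j"
      using countable_coproduct_Quiv[OF countable_lists_nat, of ?D "\<lambda>\<sigma>. Xnd (last \<sigma>)"] by auto
    note dO = Q.coproduct_Obj[OF d] and j = Q.coproduct_hom[OF d]
    have e: "ext j d \<sigma> \<in> hom Q (fob X (last \<sigma>)) d" if "\<sigma> \<in> ?D" for \<sigma> by (rule ext(1)[OF j that])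
    have "is_colimit (op_cat (deg_cat n)) Q (deg_diagram X) d (ext j d)"
      unfolding is_colimit_def
    proof (intro conjI allI impI ext_cocone[OF dO j])
      fix x \<phi> assume c: "is_cocone (op_cat (deg_cat n)) Q (deg_diagram X) x \<phi>"
      then have x: "x \<in> Obj Q" and \<phi>: "\<And>\<sigma>. \<sigma> \<in> ?D \<Longrightarrow> \<phi> \<sigma> \<in> hom Q (fob X (last \<sigma>)) x" by (auto simp: cocone)
      have p: "\<phi> \<sigma> \<cdot>\<^bsub>Q\<^esub> nd (last \<sigma>) \<in> hom Q (Xnd (last \<sigma>)) x" if "\<sigma> \<in> ?D" for \<sigma>
        by (rule Q.Comp_hom[OF IH(1)[OF D(2)[OF that]] \<phi>[OF that]])
      obtain h where h: "h \<in> hom Q d x" "\<And>\<sigma>. \<sigma> \<in> ?D \<Longrightarrow> h \<cdot>\<^bsub>Q\<^esub> j \<sigma> = \<phi> \<sigma> \<cdot>\<^bsub>Q\<^esub> nd (last \<sigma>)"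
        using Q.coproduct_ex[OF d x, of "\<lambda>\<sigma>. \<phi> \<sigma> \<cdot>\<^bsub>Q\<^esub> nd (last \<sigma>)"] p by blast
      have he: "h \<cdot>\<^bsub>Q\<^esub> ext j d \<sigma> = \<phi> \<sigma>" if s: "\<sigma> \<in> ?D" for \<sigma>
      proof (rule agree[OF s Q.Comp_hom[OF e[OF s] h(1)] \<phi>[OF s]])
        fix \<rho> assume r: "\<rho> \<in> surjs (last \<sigma>)"
        have ejr: "ext j d \<sigma> \<cdot>\<^bsub>Q\<^esub> (far X \<rho> \<cdot>\<^bsub>Q\<^esub> nd (last \<rho>)) = j (map ((!) \<rho>) \<sigma>)"
          by (rule ext(2)[OF j s r])
        have "(h \<cdot>\<^bsub>Q\<^esub> ext j d \<sigma>) \<cdot>\<^bsub>Q\<^esub> (far X \<rho> \<cdot>\<^bsub>Q\<^esub> nd (last \<rho>)) = h \<cdot>\<^bsub>Q\<^esub> j (map ((!) \<rho>) \<sigma>)"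
          using Q.Comp_assoc[OF Q.Comp_hom[OF IH(1)[OF lt[OF s r]] Xa(2)[OF r]] e[OF s] h(1)]
          unfolding ejr .
        then show "(h \<cdot>\<^bsub>Q\<^esub> ext j d \<sigma>) \<cdot>\<^bsub>Q\<^esub> (far X \<rho> \<cdot>\<^bsub>Q\<^esub> nd (last \<rho>)) = \<phi> \<sigma> \<cdot>\<^bsub>Q\<^esub> (far X \<rho> \<cdot>\<^bsub>Q\<^esub> nd (last \<rho>))"
          unfolding cocone_agree[OF c s r] h(2)[OF Dcomp(1)[OF s r]] .
      qed
      show "\<exists>!h. h \<in> hom Q d x \<and> (\<forall>\<sigma>\<in>Obj (op_cat (deg_cat n)). h \<cdot>\<^bsub>Q\<^esub> ext j d \<sigma> = \<phi> \<sigma>)"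
      proof (rule ex1I[of _ h])
        show "h \<in> hom Q d x \<and> (\<forall>\<sigma>\<in>Obj (op_cat (deg_cat n)). h \<cdot>\<^bsub>Q\<^esub> ext j d \<sigma> = \<phi> \<sigma>)" using h he by simp
        fix h' assume h': "h' \<in> hom Q d x \<and> (\<forall>\<sigma>\<in>Obj (op_cat (deg_cat n)). h' \<cdot>\<^bsub>Q\<^esub> ext j d \<sigma> = \<phi> \<sigma>)"
        have "k \<cdot>\<^bsub>Q\<^esub> j \<sigma> = \<phi> \<sigma> \<cdot>\<^bsub>Q\<^esub> nd (last \<sigma>)"
          if k: "k \<in> hom Q d x" "\<forall>\<sigma>\<in>?D. k \<cdot>\<^bsub>Q\<^esub> ext j d \<sigma> = \<phi> \<sigma>" and s: "\<sigma> \<in> ?D" for k \<sigma>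
        proof -
          have ej: "ext j d \<sigma> \<cdot>\<^bsub>Q\<^esub> nd (last \<sigma>) = j \<sigma>" by (rule ext_nd[OF j s])
          have "k \<cdot>\<^bsub>Q\<^esub> ext j d \<sigma> = \<phi> \<sigma>" using k(2) s by blast
          then show ?thesis using Q.Comp_assoc[OF IH(1)[OF D(2)[OF s]] e[OF s] k(1)] unfolding ej by simp
        qed
        note kj = this
        show "h' = h"
        proof (rule Q.coproduct_eqI[OF d])
          show "h' \<in> hom Q d x" "h \<in> hom Q d x" using h' h(1) by blast+
          fix \<sigma> assume s: "\<sigma> \<in> ?D"
          have "h' \<cdot>\<^bsub>Q\<^esub> j \<sigma> = \<phi> \<sigma> \<cdot>\<^bsub>Q\<^esub> nd (last \<sigma>)" by (rule kj) (use h' s in simp_all)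
          then show "h' \<cdot>\<^bsub>Q\<^esub> j \<sigma> = h \<cdot>\<^bsub>Q\<^esub> j \<sigma>" using h(2)[OF s] by simp
        qed
      qed
    qed
    then show ?thesis by blast
  qed
qed

text \<open>Strong induction. By assumption X_n is the coproduct of X^deg_n and X^nd_n. The
  decompositions below n turn X^deg_n into the coproduct over the surjections that lower the degree;
  the one remaining surjection, the identity, indexes X^nd_n.\<close>

lemma nd_hom_coproduct:
  "nd n \<in> hom Q (Xnd n) (fob X n) \<and>
   is_coproduct Q (surjs n) (\<lambda>\<sigma>. Xnd (last \<sigma>)) (fob X n) (\<lambda>\<sigma>. far X \<sigma> \<cdot>\<^bsub>Q\<^esub> nd (last \<sigma>))"
proof (induction n rule: less_induct)
  case (less n)
  then have IH: "\<And>k. k < n \<Longrightarrow> nd k \<in> hom Q (Xnd k) (fob X k)"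
      "\<And>k. k < n \<Longrightarrow> is_coproduct Q (surjs k) (\<lambda>\<sigma>. Xnd (last \<sigma>)) (fob X k) (\<lambda>\<sigma>. far X \<sigma> \<cdot>\<^bsub>Q\<^esub> nd (last \<sigma>))"
    by auto
  let ?D = "Obj (deg_cat n)" and ?d = "Xdeg V S X n" and ?\<kappa> = "snd (deg_colim V S X n)"
  have colim: "is_colimit (op_cat (deg_cat n)) Q (deg_diagram X) ?d ?\<kappa>"
    using someI_ex[of "\<lambda>p. is_colimit (op_cat (deg_cat n)) Q (deg_diagram X) (fst p) (snd p)"] deg_colimit[of n, OF IH]
    unfolding Xdeg_def deg_colim_def colim_def by auto
  have D: "\<sigma> \<in> surjs n" "last \<sigma> < n" if "\<sigma> \<in> ?D" for \<sigma> using that by (auto simp: Obj_deg_cat)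
  have "is_cocone (op_cat (deg_cat n)) Q (deg_diagram X) (fob X n) (far X)"
    unfolding is_cocone_def op_cat_simps
  proof (intro conjI ballI)
    show "far X \<sigma> \<in> hom Q (fob (deg_diagram X) \<sigma>) (fob X n)" if "\<sigma> \<in> ?D" for \<sigma>
      using D[OF that] by (simp add: deg_diagram_def hom_def[of Q] surjs_iff)
    fix f assume "f \<in> Arr (deg_cat n)"
    then obtain \<sigma> \<tau> where f: "f = (\<sigma>, map ((!) \<tau>) \<sigma>, \<tau>)" "\<sigma> \<in> ?D" "\<tau> \<in> surjs (last \<sigma>)" by (auto simp: Arr_deg_cat)
    then show "far X (Dom (deg_cat n) f) \<cdot>\<^bsub>Q\<^esub> far (deg_diagram X) f = far X (Cod (deg_cat n) f)"
      using X.X_Comp[of \<sigma> \<tau>] D[OF f(2)] by (simp add: deg_cat_Dom_Cod deg_diagram_def surjs_iff)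
  qed simp
  then have "\<exists>!h. h \<in> hom Q ?d (fob X n) \<and> (\<forall>\<sigma> \<in> ?D. h \<cdot>\<^bsub>Q\<^esub> ?\<kappa> \<sigma> = far X \<sigma>)"
    using colim[unfolded is_colimit_def op_cat_simps] by blast
  from theI'[OF this] have dm: "deg_map V S X n \<in> hom Q ?d (fob X n)"
    "\<And>\<sigma>. \<sigma> \<in> ?D \<Longrightarrow> deg_map V S X n \<cdot>\<^bsub>Q\<^esub> ?\<kappa> \<sigma> = far X \<sigma>"
    unfolding deg_map_def by auto
  have split: "is_coproduct Q UNIV (\<lambda>i. if i then ?d else Xnd n) (fob X n) (\<lambda>i. if i then deg_map V S X n else nd n)"
    using coproduct_nd[of n] unfolding homD(2,3)[OF dm(1)] .
  have nd: "nd n \<in> hom Q (Xnd n) (fob X n)"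
    using Q.coproduct_hom[OF split, of False] by simp
  \<comment> \<open>\<open>True\<close> stands for the degenerate part, indexed by the surjections
    that lower the degree, \<open>False\<close> for the nondegenerate part, indexed by the
    identity.\<close>
  let ?J = "\<lambda>i. if i then ?D else {[0..<Suc n]}"
  let ?k = "\<lambda>i \<sigma>. if i then ?\<kappa> \<sigma> \<cdot>\<^bsub>Q\<^esub> nd (last \<sigma>) else Idn Q (Xnd n)"
  have "is_coproduct Q (Sigma UNIV ?J) (\<lambda>(i, \<sigma>). Xnd (last \<sigma>)) (fob X n) (\<lambda>(i, \<sigma>). (if i then deg_map V S X n else nd n) \<cdot>\<^bsub>Q\<^esub> ?k i \<sigma>)"
  proof (rule Q.coproduct_Sigma[OF split])
    fix i :: bool
    have "is_coproduct Q {[0..<Suc n]} (\<lambda>_. Xnd n) (Xnd n) (\<lambda>_. Idn Q (Xnd n))"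
      using Q.coproduct_singleton[of "\<lambda>_. Idn Q (Xnd n)" "[0..<Suc n]"] by (simp del: upt_Suc)
    then have "is_coproduct Q {[0..<Suc n]} (\<lambda>\<sigma>. Xnd (last \<sigma>)) (Xnd n) (\<lambda>_. Idn Q (Xnd n))"
      by (rule Q.coproduct_cong) auto
    then show "is_coproduct Q (?J i) (\<lambda>\<sigma>. Xnd (last \<sigma>)) (if i then ?d else Xnd n) (?k i)"
      using deg_coproduct[of n, OF IH colim] by simp
  qed
  moreover have "bij_betw (\<lambda>\<sigma>. (\<sigma> \<noteq> [0..<Suc n], \<sigma>)) (surjs n) (Sigma UNIV ?J)"
  proof (rule bij_betwI[where g = snd])
    show "(\<lambda>\<sigma>. (\<sigma> \<noteq> [0..<Suc n], \<sigma>)) \<in> surjs n \<rightarrow> Sigma UNIV ?J"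
      using surjs_eq_Idn surjs_last_le by (fastforce simp: Obj_deg_cat simp del: upt_Suc)
    show "snd \<in> Sigma UNIV ?J \<rightarrow> surjs n" using Idn_surjs by (auto simp: Obj_deg_cat split: if_splits simp del: upt_Suc)
    show "(snd x \<noteq> [0..<Suc n], snd x) = x" if "x \<in> Sigma UNIV ?J" for x
      using that by (auto simp: Obj_deg_cat split: if_splits)
  qed simp
  ultimately have "is_coproduct Q (surjs n) (\<lambda>\<sigma>. case (\<sigma> \<noteq> [0..<Suc n], \<sigma>) of (i, \<sigma>) \<Rightarrow> Xnd (last \<sigma>)) (fob X n)
      (\<lambda>\<sigma>. case (\<sigma> \<noteq> [0..<Suc n], \<sigma>) of (i, \<sigma>) \<Rightarrow> (if i then deg_map V S X n else nd n) \<cdot>\<^bsub>Q\<^esub> ?k i \<sigma>)"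
    using Q.coproduct_reindex[of "\<lambda>\<sigma>. (\<sigma> \<noteq> [0..<Suc n], \<sigma>)" "surjs n" "Sigma UNIV ?J"] by blast
  then have "is_coproduct Q (surjs n) (\<lambda>\<sigma>. Xnd (last \<sigma>)) (fob X n) (\<lambda>\<sigma>. far X \<sigma> \<cdot>\<^bsub>Q\<^esub> nd (last \<sigma>))"
  proof (rule Q.coproduct_cong)
    fix \<sigma> assume s: "\<sigma> \<in> surjs n"
    show "(case (\<sigma> \<noteq> [0..<Suc n], \<sigma>) of (i, \<sigma>) \<Rightarrow> (if i then deg_map V S X n else nd n) \<cdot>\<^bsub>Q\<^esub> ?k i \<sigma>) = far X \<sigma> \<cdot>\<^bsub>Q\<^esub> nd (last \<sigma>)"
    proof (cases "\<sigma> = [0..<Suc n]")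
      case True
      then show ?thesis using homD[OF nd] by (simp add: X.X_Idn del: upt_Suc)
    next
      case False
      then have "last \<sigma> \<noteq> n" "last \<sigma> \<le> n" using surjs_eq_Idn[OF s] surjs_last_le[OF s] by blast+
      then have "\<sigma> \<in> ?D" using s by (simp add: Obj_deg_cat)
      moreover have "is_cocone (op_cat (deg_cat n)) Q (deg_diagram X) ?d ?\<kappa>" using colim by (simp add: is_colimit_def)
      ultimately have "?\<kappa> \<sigma> \<in> hom Q (fob X (last \<sigma>)) ?d" by (simp add: is_cocone_def) (simp add: deg_diagram_def)
      from Q.Comp_assoc[OF IH(1)[OF D(2)] this dm(1)] show ?thesis using False \<open>\<sigma> \<in> ?D\<close> dm(2) by (simp del: upt_Suc)
    qed
  qed simp
  then show ?case using nd by blast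
qed

end

section \<open>Surjections of an interval and of its beads\<close>

lemma in_listset: "xs \<in> listset As \<longleftrightarrow> list_all2 (\<in>) xs As"
  by (induction As arbitrary: xs) (auto simp: set_Cons_def list_all2_Cons2)

text \<open>A discrete intermediate value argument: when a value between those at \<open>s\<close>
  and \<open>t\<close> has a preimage outside the bead, monotonicity forces it to be attained at an
  endpoint of the bead.\<close>

lemma bead_map_surjs:
  assumes f: "f \<in> surjs p" and st: "s \<le> t" "t \<le> p"
  shows "bead_map f (s, t) \<in> surjs (t - s)"
proof -
  have f': "f \<in> Arr Delta_f" "t < length f" "set f = {..last f}" using assms by (auto simp: surjs_iff)
  note l = last_bead_map[OF f'(1) st(1) f'(2)] and a = bead_map_Arr[OF f'(1) st(1) f'(2)]
  have "set (bead_map f (s, t)) = {..f ! t - f ! s}"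
  proof
    show "set (bead_map f (s, t)) \<subseteq> {..f ! t - f ! s}"
      using nth_le_last_Delta_f[OF a] l by (auto simp: set_conv_nth)
    show "{..f ! t - f ! s} \<subseteq> set (bead_map f (s, t))"
    proof
      fix v assume "v \<in> {..f ! t - f ! s}"
      then have v: "v + f ! s \<le> f ! t" using nth_mono[OF f'(1) st(1) f'(2)] by simp
      then have "v + f ! s \<in> set f" using nth_le_last_Delta_f[OF f'(1,2)] unfolding f'(3) by simp
      then obtain i where i: "i < length f" "f ! i = v + f ! s" by (auto simp: in_set_conv_nth)
      have "\<exists>j \<le> t - s. f ! (s + j) = v + f ! s"
      proof -
        consider "i < s" | "s \<le> i" "i \<le> t" | "t < i" by linarith
        then show ?thesis
        proof cases
          case 1
          then have "f ! i \<le> f ! s" using nth_mono[OF f'(1), of i s] st f'(2) by simp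
          then show ?thesis using i by (intro exI[of _ 0]) simp
        next
          case 2
          then show ?thesis using i by (intro exI[of _ "i - s"]) simp
        next
          case 3
          then have "f ! t \<le> f ! i" using nth_mono[OF f'(1), of t i] i by simp
          then show ?thesis using i v st by (intro exI[of _ "t - s"]) simp
        qed
      qed
      then obtain j where "j \<le> t - s" "f ! (s + j) = v + f ! s" by blast
      then show "v \<in> set (bead_map f (s, t))" by (auto simp: in_set_conv_nth nth_bead_map intro!: exI[of _ j])
    qed
  qed
  then show ?thesis using a l by (simp add: surjs_iff)
qed

lemma joins_surjs: "list_all2 (\<in>) \<sigma>s (map surjs ks) \<Longrightarrow> joins \<sigma>s \<in> surjs (sum_list ks)"
proof (induction \<sigma>s arbitrary: ks)
  case (Cons \<sigma> \<sigma>s)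
  then obtain k ls where ks: "ks = k # ls" "\<sigma> \<in> surjs k" "list_all2 (\<in>) \<sigma>s (map surjs ls)"
    by (auto simp: list_all2_Cons1)
  define g where "g = joins \<sigma>s"
  have g: "g \<in> surjs (sum_list ls)" using Cons.IH[OF ks(3)] by (simp add: g_def)
  have A: "\<sigma> \<in> Arr Delta_f" "g \<in> Arr Delta_f" using g ks by (auto simp: surjs_iff)
  obtain g' where g': "g = 0 # g'" using A(2) by (cases g) (auto simp: Arr_Delta_f)
  have "set (\<sigma> @ map ((+) (last \<sigma>)) (tl g)) = {..last \<sigma>} \<union> (+) (last \<sigma>) ` set g'"
    using ks(2) g' by (simp add: surjs_iff)
  also have "\<dots> = {..last \<sigma>} \<union> (+) (last \<sigma>) ` set g"
    using g' by auto
  also have "\<dots> = {..last \<sigma> + last g}"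
  proof -
    have "x \<in> (+) (last \<sigma>) ` {..last g}" if "last \<sigma> < x" "x \<le> last \<sigma> + last g" for x
      using that by (intro image_eqI[of _ _ "x - last \<sigma>"]) auto
    moreover have "set g = {..last g}" using g by (simp add: surjs_iff)
    ultimately show ?thesis by auto (meson leI)
  qed
  finally show ?case
    using TensorArr_Delta_f[OF A] g ks by (simp add: surjs_iff g_def)
qed (auto simp: surjs_iff Arr_Delta_f)

text \<open>A tensor product of decompositions is indexed by one surjection per bead;
  \<open>joins\<close> combines these into a single surjection out of [p], which is the index wanted
  for X_T.\<close>

lemma bij_betw_bead_maps:
  assumes "(T, p) \<in> Obj Nec"
  shows "bij_betw (\<lambda>f. map (bead_map f) (beads T)) (surjs p) (listset (map surjs (gaps T)))"
proof -
  have T: "0 \<in> T" "p \<in> T" "T \<subseteq> {0..p}" using assms by (auto simp: Nec_simps)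
  note c = beads_cuts[OF T] sum_list_gaps[OF T]
  show ?thesis
  proof (rule bij_betwI[where g = joins])
    show "(\<lambda>f. map (bead_map f) (beads T)) \<in> surjs p \<rightarrow> listset (map surjs (gaps T))"
    proof
      fix f assume f: "f \<in> surjs p"
      have "bead_map f (s, t) \<in> surjs (t - s)" if "(s, t) \<in> set (beads T)" for s t
        using bead_map_surjs[OF f, of s t] beads_mem[OF that] T by auto
      then show "map (bead_map f) (beads T) \<in> listset (map surjs (gaps T))"
        by (auto simp: in_listset gaps_def list_all2_map1 list_all2_map2 intro!: list_all2_same[THEN iffD2])
    qed
    show "joins \<in> listset (map surjs (gaps T)) \<rightarrow> surjs p"
      using joins_surjs[of _ "gaps T"] c by (auto simp: in_listset)
    show "joins (map (bead_map f) (beads T)) = f" if "f \<in> surjs p" for f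
      using joins_bead_map[of f 0 "gaps T"] bead_map_full[of f p] that c by (simp add: surjs_iff)
    show "map (bead_map (joins \<sigma>s)) (beads T) = \<sigma>s" if "\<sigma>s \<in> listset (map surjs (gaps T))" for \<sigma>s
    proof -
      have l: "list_all2 (\<lambda>\<sigma> k. \<sigma> \<in> surjs k) \<sigma>s (gaps T)" using that by (simp add: in_listset list_all2_map2)
      then have "map (\<lambda>f. length f - 1) \<sigma>s = gaps T" "set \<sigma>s \<subseteq> Arr Delta_f"
        by (induction rule: list_all2_induct) (auto simp: surjs_iff)
      then show ?thesis using bead_map_joins[of \<sigma>s] c(1) by simp
    qed
  qed
qed

section \<open>The decomposition of X_T\<close>

context nondeg_templicial
begin

abbreviation thd where "thd F \<equiv> snd (snd F)"

lemma nd_hom: "nd n \<in> hom Q (Xnd n) (fob X n)"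
  and simplex_coproduct: "is_coproduct Q (surjs n) (\<lambda>\<sigma>. Xnd (last \<sigma>)) (fob X n) (\<lambda>\<sigma>. far X \<sigma> \<cdot>\<^bsub>Q\<^esub> nd (last \<sigma>))"
  using nd_hom_coproduct by auto

lemma nd_Arr [simp]: "nd n \<in> Arr Q" "Dom Q (nd n) = Xnd n" "Cod Q (nd n) = fob X n"
  using homD[OF nd_hom] by auto

text \<open>The identity is the only surjection out of [0], so X_0 has a single summand. Together
  with the counit this identifies X^nd_0 with the unit.\<close>

lemma iso_nd_0: "iso Q (nd 0)"
proof -
  have "far X [0] = Idn Q (fob X 0)" using X.X_Idn[of 0] by simp
  then show ?thesis
    using Q.coproduct_singleton_iso[OF simplex_coproduct[of 0, unfolded surjs_0]] by simp
qed

text \<open>Normalized in the manner of \<open>X.Y\<close>: the empty list replaces X^nd_0, so that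
  a product over the images of all beads of T is the product over the beads of the image necklace.
  \<open>E\<close> is the corresponding form of \<open>nd\<close>.\<close>

definition Z :: "nat \<Rightarrow> ('u, 'o) quiver list" where
  "Z k = (if k = 0 then [] else [Xnd k])"

definition E :: "nat \<Rightarrow> ('u, 'o) quiver list \<times> ('u, 'o) quiver list \<times> ('u, 'o, 'm) quiver_arr" where
  "E k = (Z k, X.Y k, if k = 0 then Idn Q (Unit Q) else nd k)"

lemma E_0: "E 0 = Idn X.S []"
  by (simp add: E_def Z_def X.Y_def X.S_simps)

lemma E_Arr [simp]: "E k \<in> Arr X.S" "Dom X.S (E k) = Z k" "Cod X.S (E k) = X.Y k"
  by (auto simp: E_def Z_def X.Y_def X.S_simps hom_def[of Q])

definition nd_bead :: "nat list \<Rightarrow> ('u, 'o) quiver list \<times> ('u, 'o) quiver list \<times> ('u, 'o, 'm) quiver_arr" where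
  "nd_bead \<sigma> = X.Yar \<sigma> \<cdot>\<^bsub>X.S\<^esub> E (last \<sigma>)"

lemma nd_bead_Arr [simp]:
  assumes "\<sigma> \<in> surjs k"
  shows "nd_bead \<sigma> \<in> Arr X.S" "Dom X.S (nd_bead \<sigma>) = Z (last \<sigma>)" "Cod X.S (nd_bead \<sigma>) = X.Y k"
  using assms by (auto simp: nd_bead_def surjs_iff)

text \<open>This is \<open>simplex_coproduct\<close>, except that the summand of the surjection onto
  [0] is X^nd_0 there and the unit here. The comparison \<open>?\<alpha>\<close> goes from the unit
  through X_0 to X^nd_0.\<close>

lemma bead_coproduct:
  assumes "0 < k"
  shows "is_coproduct Q (surjs k) (\<lambda>\<sigma>. tens Q (Z (last \<sigma>))) (tens Q (X.Y k)) (\<lambda>\<sigma>. thd (nd_bead \<sigma>))"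
proof -
  let ?\<alpha> = "\<lambda>\<sigma>. if last \<sigma> = 0 then inv_arr Q (nd 0) \<cdot>\<^bsub>Q\<^esub> inv_arr Q (counit X) else Idn Q (Xnd (last \<sigma>))"
  have i: "Idn Q (fob X k) \<in> hom Q (fob X k) (tens Q (X.Y k))"
    using assms Q.Idn_hom[OF X.X_Obj] by (simp add: X.Y_pos)
  have "is_coproduct Q (surjs k) (\<lambda>\<sigma>. tens Q (Z (last \<sigma>))) (tens Q (X.Y k))
      (\<lambda>\<sigma>. Idn Q (fob X k) \<cdot>\<^bsub>Q\<^esub> ((far X \<sigma> \<cdot>\<^bsub>Q\<^esub> nd (last \<sigma>)) \<cdot>\<^bsub>Q\<^esub> ?\<alpha> \<sigma>))"
    by (rule Q.coproduct_iso[OF simplex_coproduct _ _ i]) (auto simp: iso_nd_0 X.iso_counit Z_def hom_def[of Q])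
  then show ?thesis
  proof (rule Q.coproduct_cong)
    fix \<sigma> assume "\<sigma> \<in> surjs k"
    then have s: "\<sigma> \<in> Arr Delta_f" "length \<sigma> - 1 = k" by (auto simp: surjs_iff)
    have "nd_bead \<sigma> = X.X1 \<sigma> \<cdot>\<^bsub>X.S\<^esub> (X.norm' (last \<sigma>) \<cdot>\<^bsub>X.S\<^esub> E (last \<sigma>))"
      using s assms by (simp add: nd_bead_def X.Yar_def X.norm_pos)
    then have "thd (nd_bead \<sigma>) = far X \<sigma> \<cdot>\<^bsub>Q\<^esub> (thd (X.norm' (last \<sigma>)) \<cdot>\<^bsub>Q\<^esub> thd (E (last \<sigma>)))"
      using s by (simp add: X.thd_Comp X.X1_def[of \<sigma>] X.norm'_def E_def X.S_simps)
    then show "Idn Q (fob X k) \<cdot>\<^bsub>Q\<^esub> ((far X \<sigma> \<cdot>\<^bsub>Q\<^esub> nd (last \<sigma>)) \<cdot>\<^bsub>Q\<^esub> ?\<alpha> \<sigma>) = thd (nd_bead \<sigma>)"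
      using s by (simp add: X.norm'_def E_def iso_nd_0 X.iso_counit)
  qed simp
qed

text \<open>Beads are added one at a time: \<open>coproduct_TensorArr_Quiv\<close> multiplies the
  index sets, and \<open>coproduct_iso\<close> absorbs the rebracketing.\<close>

lemma boxes_coproduct:
  assumes "\<And>k. k \<in> set ks \<Longrightarrow> 0 < k"
  shows "is_coproduct Q (listset (map surjs ks)) (\<lambda>\<sigma>s. tens Q (concat (map (\<lambda>\<sigma>. Z (last \<sigma>)) \<sigma>s)))
    (tens Q (X.Y.Ys ks)) (\<lambda>\<sigma>s. thd (X.S.boxes (map nd_bead \<sigma>s)))"
  using assms
proof (induction ks)
  case Nil
  have "is_coproduct Q {[]::nat list list} (\<lambda>_. Unit Q) (Unit Q) (\<lambda>_. Idn Q (Unit Q))"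
    using Q.coproduct_singleton[of "\<lambda>_. Idn Q (Unit Q)" "[]"] by simp
  then show ?case by simp (erule Q.coproduct_cong; simp add: X.S_simps)
next
  case (Cons k ks)
  let ?c = "\<lambda>\<sigma>s. concat (map (\<lambda>\<sigma>. Z (last \<sigma>)) \<sigma>s)"
  let ?B = "\<lambda>\<sigma>s. X.S.boxes (map nd_bead \<sigma>s)"
  have k: "0 < k" and ks: "\<And>k. k \<in> set ks \<Longrightarrow> 0 < k" using Cons.prems by auto
  have Zs: "set (Z j) \<subseteq> Obj Q" for j by (simp add: Z_def)
  have cs: "set (?c \<sigma>s) \<subseteq> Obj Q" for \<sigma>s using Zs by auto
  have Ys: "set (X.Y j) \<subseteq> Obj Q" "set (X.Y.Ys ls) \<subseteq> Obj Q" for j ls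
    using X.Y_Obj[of j] X.Y.Ys_Obj[of ls] unfolding X.S_simps(1) by auto
  have B: "?B \<sigma>s \<in> Arr X.S" "Dom X.S (?B \<sigma>s) = ?c \<sigma>s" "Cod X.S (?B \<sigma>s) = X.Y.Ys ks"
    if "\<sigma>s \<in> listset (map surjs ks)" for \<sigma>s
  proof -
    have "list_all2 (\<lambda>\<sigma> k. \<sigma> \<in> surjs k) \<sigma>s ks" using that by (simp add: in_listset list_all2_map2)
    then have "?B \<sigma>s \<in> Arr X.S \<and> Dom X.S (?B \<sigma>s) = ?c \<sigma>s \<and> Cod X.S (?B \<sigma>s) = X.Y.Ys ks"
      by (induction rule: list_all2_induct) auto
    then show "?B \<sigma>s \<in> Arr X.S" "Dom X.S (?B \<sigma>s) = ?c \<sigma>s" "Cod X.S (?B \<sigma>s) = X.Y.Ys ks" by auto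
  qed
  let ?\<alpha> = "\<lambda>(\<sigma>, \<sigma>s). inv_arr Q (tens_append Q (Z (last \<sigma>)) (?c \<sigma>s))"
  have "is_coproduct Q (surjs k \<times> listset (map surjs ks)) (\<lambda>(\<sigma>, \<sigma>s). tens Q (Z (last \<sigma>) @ ?c \<sigma>s)) (tens Q (X.Y k @ X.Y.Ys ks))
      (\<lambda>x. tens_append Q (X.Y k) (X.Y.Ys ks) \<cdot>\<^bsub>Q\<^esub> ((case x of (\<sigma>, \<sigma>s) \<Rightarrow> thd (nd_bead \<sigma>) \<odot>\<^bsub>Q\<^esub> thd (?B \<sigma>s)) \<cdot>\<^bsub>Q\<^esub> ?\<alpha> x))"
    by (rule Q.coproduct_iso[OF coproduct_TensorArr_Quiv[OF bead_coproduct[OF k] Cons.IH[OF ks]]])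
      (use Ys Zs cs in \<open>auto simp: hom_def[of Q] simp del: set_concat\<close>)
  moreover have "bij_betw (\<lambda>\<sigma>s. (hd \<sigma>s, tl \<sigma>s)) (listset (map surjs (k # ks))) (surjs k \<times> listset (map surjs ks))"
    by (rule bij_betwI[where g = "\<lambda>(\<sigma>, \<sigma>s). \<sigma> # \<sigma>s"]) (auto simp: set_Cons_def)
  ultimately have "is_coproduct Q (listset (map surjs (k # ks))) (\<lambda>\<sigma>s. case (hd \<sigma>s, tl \<sigma>s) of (\<sigma>, \<sigma>s) \<Rightarrow> tens Q (Z (last \<sigma>) @ ?c \<sigma>s)) (tens Q (X.Y k @ X.Y.Ys ks))
      (\<lambda>\<sigma>s. tens_append Q (X.Y k) (X.Y.Ys ks) \<cdot>\<^bsub>Q\<^esub> ((case (hd \<sigma>s, tl \<sigma>s) of (\<sigma>, \<sigma>s) \<Rightarrow> thd (nd_bead \<sigma>) \<odot>\<^bsub>Q\<^esub> thd (?B \<sigma>s)) \<cdot>\<^bsub>Q\<^esub> ?\<alpha> (hd \<sigma>s, tl \<sigma>s)))"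
    by (rule Q.coproduct_reindex[rotated])
  then have "is_coproduct Q (listset (map surjs (k # ks))) (\<lambda>\<sigma>s. tens Q (?c \<sigma>s)) (tens Q (X.Y k @ X.Y.Ys ks)) (\<lambda>\<sigma>s. thd (?B \<sigma>s))"
  proof (rule Q.coproduct_cong)
    fix \<sigma>s assume "\<sigma>s \<in> listset (map surjs (k # ks))"
    then obtain \<sigma> \<tau>s where s: "\<sigma>s = \<sigma> # \<tau>s" "\<sigma> \<in> surjs k" "\<tau>s \<in> listset (map surjs ks)" by (auto simp: set_Cons_def)
    then show "(case (hd \<sigma>s, tl \<sigma>s) of (\<sigma>, \<sigma>s) \<Rightarrow> tens Q (Z (last \<sigma>) @ ?c \<sigma>s)) = tens Q (?c \<sigma>s)" by simp
    have "strict_box Q (nd_bead \<sigma>) (?B \<tau>s) = strict_box Q (Z (last \<sigma>), X.Y k, thd (nd_bead \<sigma>)) (?c \<tau>s, X.Y.Ys ks, thd (?B \<tau>s))"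
      using X.Arr_S_split[OF nd_bead_Arr(1)[OF s(2)]] X.Arr_S_split[OF B(1)[OF s(3)]]
      unfolding nd_bead_Arr[OF s(2)] B[OF s(3)] by (rule arg_cong2)
    then show "tens_append Q (X.Y k) (X.Y.Ys ks) \<cdot>\<^bsub>Q\<^esub> ((case (hd \<sigma>s, tl \<sigma>s) of (\<sigma>, \<sigma>s) \<Rightarrow> thd (nd_bead \<sigma>) \<odot>\<^bsub>Q\<^esub> thd (?B \<sigma>s)) \<cdot>\<^bsub>Q\<^esub> ?\<alpha> (hd \<sigma>s, tl \<sigma>s)) = thd (?B \<sigma>s)"
      by (simp add: s X.strict_box_simp)
  qed
  then show ?case by simp
qed

definition nd_arr :: "nat set \<Rightarrow> ('u, 'o, 'm) quiver_arr" where
  "nd_arr T = tens_arr Q (map nd (gaps T))"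

lemma E_boxes: "X.S.boxes (map E (gaps T)) \<in> Arr X.S" "thd (X.S.boxes (map E (gaps T))) = nd_arr T"
  "Dom X.S (X.S.boxes (map E (gaps T))) = map Xnd (gaps T)" "Cod X.S (X.S.boxes (map E (gaps T))) = map (fob X) (gaps T)"
proof -
  have E: "set (map E (gaps T)) \<subseteq> Arr X.S" by auto
  have p: "Z k = [Xnd k]" "X.Y k = [fob X k]" "thd (E k) = nd k" if "k \<in> set (gaps T)" for k
    using gaps_pos[OF that] by (auto simp: Z_def X.Y_pos E_def)
  have m: "map (Dom X.S) (map E (gaps T)) = map (\<lambda>x. [x]) (map Xnd (gaps T))"
    "map (Cod X.S) (map E (gaps T)) = map (\<lambda>x. [x]) (map (fob X) (gaps T))" using p by auto
  show "X.S.boxes (map E (gaps T)) \<in> Arr X.S" by (rule X.S.boxes_Arr[OF E])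
  show "Dom X.S (X.S.boxes (map E (gaps T))) = map Xnd (gaps T)" unfolding X.S.Dom_boxes[OF E] m Q.concat_singletons ..
  show "Cod X.S (X.S.boxes (map E (gaps T))) = map (fob X) (gaps T)" unfolding X.S.Cod_boxes[OF E] m Q.concat_singletons ..
  have "thd (X.S.boxes (map E (gaps T))) = tens_arr Q (map (\<lambda>k. thd (E k)) (gaps T))"
    by (rule X.thd_boxes_singletons[where x = Xnd and y = "fob X"]) (use p in auto)
  also have "map (\<lambda>k. thd (E k)) (gaps T) = map nd (gaps T)" using p by auto
  finally show "thd (X.S.boxes (map E (gaps T))) = nd_arr T" by (simp add: nd_arr_def)
qed

lemma nd_arr_hom: "nd_arr T \<in> hom Q (nec_prod Q Xnd T) (fob (nec_functor Q X) (T, p))"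
  using X.thd_hom(1-3)[OF E_boxes(1)[of T]] E_boxes[of T]
  by (simp add: hom_def[of Q] nec_prod_def nec_functor_def)

text \<open>A reindexing of \<open>boxes_coproduct\<close> by surjections \<open>f\<close> out of
  [p]. In the summand of \<open>f\<close> the collapsed beads vanish, which leaves X^nd at the image
  of T; the coprojection is \<open>nd_arr\<close> there, followed by the action of \<open>f\<close>
  as an active map onto the image necklace.\<close>

lemma necklace_coproduct:
  assumes Tp: "(T, p) \<in> Obj Nec"
  shows "is_coproduct Q (surjs p) (\<lambda>f. nec_prod Q Xnd ((!) f ` T)) (fob (nec_functor Q X) (T, p))
    (\<lambda>f. far (nec_functor Q X) ((T, p), ((!) f ` T, last f), f) \<cdot>\<^bsub>Q\<^esub> nd_arr ((!) f ` T))"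
proof -
  have T: "0 \<in> T" "p \<in> T" "T \<subseteq> {..p}" using Tp by (auto simp: Nec_simps)
  have fin: "finite T" using T finite_subset by blast
  have "is_coproduct Q (surjs p) (\<lambda>f. tens Q (concat (map (\<lambda>\<sigma>. Z (last \<sigma>)) (map (bead_map f) (beads T)))))
      (tens Q (X.Y.Ys (gaps T))) (\<lambda>f. thd (X.S.boxes (map nd_bead (map (bead_map f) (beads T)))))"
    by (rule Q.coproduct_reindex[OF bij_betw_bead_maps[OF Tp] boxes_coproduct]) (rule gaps_pos)
  then show ?thesis
    unfolding X.fob_nec_functor
  proof (rule Q.coproduct_cong)
    fix f assume f: "f \<in> surjs p"
    then have f': "f \<in> Arr Delta_f" "length f = Suc p" "T \<subseteq> {..<length f}" using T by (auto simp: surjs_iff)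
    define l where "l = (\<lambda>(s, t). f ! t - f ! s)"
    have lt: "s < t \<and> t < length f" if "(s, t) \<in> set (beads T)" for s t using beads_mem[OF that] f' by auto
    have b: "bead_map f b \<in> Arr Delta_f \<and> last (bead_map f b) = l b \<and> bead_map f b \<in> surjs (length (bead_map f b) - 1)" if "b \<in> set (beads T)" for b
    proof -
      obtain s t where st: "b = (s, t)" by (cases b)
      have "s \<le> t" "t < length f" using lt[of s t] that st by auto
      then show ?thesis using bead_map_Arr[OF f'(1), of s t] last_bead_map[OF f'(1), of s t] bead_map_surjs[OF f, of s t] f'(2) st
        by (simp add: l_def)
    qed
    have g: "gaps ((!) f ` T) = filter (\<lambda>k. k \<noteq> 0) (map l (beads T))"
      unfolding l_def by (rule gaps_image[OF fin mono_on_nth[OF f'(1,3)]])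
    have "concat (map (\<lambda>\<sigma>. Z (last \<sigma>)) (map (bead_map f) (beads T))) = concat (map Z (map l (beads T)))"
      unfolding map_map by (rule arg_cong[where f = concat], rule map_cong[OF refl]) (use b in auto)
    also have "\<dots> = map Xnd (filter (\<lambda>k. k \<noteq> 0) ks)" if "ks = map l (beads T)" for ks
      unfolding that[symmetric] by (induction ks) (auto simp: Z_def)
    finally show "tens Q (concat (map (\<lambda>\<sigma>. Z (last \<sigma>)) (map (bead_map f) (beads T)))) = nec_prod Q Xnd ((!) f ` T)"
      by (simp add: nec_prod_def g)
    have E0: "X.S.boxes (map E (map l (beads T))) = X.S.boxes (map E (gaps ((!) f ` T)))"
      unfolding g by (rule X.S.boxes_filter[symmetric]) (auto simp: E_0)
    have "X.S.boxes (map nd_bead (map (bead_map f) (beads T))) = X.S.boxes (map (\<lambda>b. X.Yar (bead_map f b) \<cdot>\<^bsub>X.S\<^esub> E (l b)) (beads T))"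
      unfolding map_map by (rule arg_cong[where f = X.S.boxes], rule map_cong[OF refl]) (use b in \<open>auto simp: nd_bead_def\<close>)
    also have "\<dots> = X.Y.act T f \<cdot>\<^bsub>X.S\<^esub> X.S.boxes (map (\<lambda>b. E (l b)) (beads T))"
      unfolding X.Y.act_def
      by (rule X.S.boxes_Comp[symmetric, where x = "\<lambda>b. Z (l b)" and y = "\<lambda>b. X.Y (l b)" and z = "\<lambda>b. X.Y (length (bead_map f b) - 1)"])
        (use b in \<open>auto simp: hom_def[of X.S]\<close>)
    also have "\<dots> = X.Y.act T f \<cdot>\<^bsub>X.S\<^esub> X.S.boxes (map E (gaps ((!) f ` T)))"
      using E0 by (simp add: o_def)
    \<comment> \<open>Onto its own image \<open>f\<close> is active, so the inert factor of
      \<open>nec_act\<close> is an identity.\<close>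
    also have "X.Y.act T f = X.Y.nec_act T ((!) f ` T) f"
      using homD[OF X.Y.act_hom[OF f'(1,3)]] by (simp add: X.Y.nec_act_def X.Y.inert_refl)
    finally have e: "X.S.boxes (map nd_bead (map (bead_map f) (beads T))) = X.Y.nec_act T ((!) f ` T) f \<cdot>\<^bsub>X.S\<^esub> X.S.boxes (map E (gaps ((!) f ` T)))" .
    have a: "((T, p), ((!) f ` T, last f), f) \<in> Arr Nec" by (rule surjs_Arr_Nec[OF Tp f])
    show "thd (X.S.boxes (map nd_bead (map (bead_map f) (beads T)))) =
        far (nec_functor Q X) ((T, p), ((!) f ` T, last f), f) \<cdot>\<^bsub>Q\<^esub> nd_arr ((!) f ` T)"
      unfolding e X.thd_Comp[OF homD(1)[OF X.Y.nec_act_hom[OF a]] E_boxes(1)] X.far_nec_functor[OF a] E_boxes(2) ..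
  qed
qed

end

section \<open>Pointwise coends\<close>

lemma fun_cat_simps:
  "Obj (fun_cat C D) = {F. is_functor C D F}"
  "Dom (fun_cat C D) t = fst t" "Cod (fun_cat C D) t = fst (snd t)"
  "Idn (fun_cat C D) F = (F, F, \<lambda>x \<in> Obj C. Idn D (fob F x))"
  "t \<cdot>\<^bsub>fun_cat C D\<^esub> s = (fst s, fst (snd t), \<lambda>x \<in> Obj C. snd (snd t) x \<cdot>\<^bsub>D\<^esub> snd (snd s) x)"
  by (auto simp: fun_cat_def split: prod.splits)

lemma hom_fun_cat: "t \<in> hom (fun_cat C D) F G \<longleftrightarrow> fst t = F \<and> fst (snd t) = G \<and> is_functor C D F \<and> is_functor C D G \<and>
    snd (snd t) \<in> (\<Pi>\<^sub>E x \<in> Obj C. hom D (fob F x) (fob G x)) \<and>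
    (\<forall>f \<in> Arr C. far G f \<cdot>\<^bsub>D\<^esub> snd (snd t) (Dom C f) = snd (snd t) (Cod C f) \<cdot>\<^bsub>D\<^esub> far F f)"
  unfolding hom_def[of "fun_cat C D"] mem_Collect_eq fun_cat_simps by (cases t) (auto simp: fun_cat_def)

lemma hom_fun_catD:
  assumes "t \<in> hom (fun_cat C D) F G"
  shows "fst t = F" "fst (snd t) = G" "is_functor C D F" "is_functor C D G"
    "\<And>x. x \<in> Obj C \<Longrightarrow> snd (snd t) x \<in> hom D (fob F x) (fob G x)"
    "\<And>f. f \<in> Arr C \<Longrightarrow> far G f \<cdot>\<^bsub>D\<^esub> snd (snd t) (Dom C f) = snd (snd t) (Cod C f) \<cdot>\<^bsub>D\<^esub> far F f"
    "snd (snd t) \<in> extensional (Obj C)"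
  using assms unfolding hom_fun_cat by (auto simp: PiE_def Pi_def)

lemma is_functorD:
  assumes "is_functor C D F"
  shows "category C" "category D" "\<And>x. x \<in> Obj C \<Longrightarrow> fob F x \<in> Obj D"
    "\<And>f. f \<in> Arr C \<Longrightarrow> far F f \<in> hom D (fob F (Dom C f)) (fob F (Cod C f))"
    "\<And>x. x \<in> Obj C \<Longrightarrow> far F (Idn C x) = Idn D (fob F x)"
    "\<And>f g. f \<in> Arr C \<Longrightarrow> g \<in> Arr C \<Longrightarrow> Cod C f = Dom C g \<Longrightarrow> far F (g \<cdot>\<^bsub>C\<^esub> f) = far F g \<cdot>\<^bsub>D\<^esub> far F f"
  using assms unfolding is_functor_def by auto

lemma fun_cat_eqI:
  assumes "t \<in> hom (fun_cat C D) F G" "s \<in> hom (fun_cat C D) F G" "\<And>x. x \<in> Obj C \<Longrightarrow> snd (snd t) x = snd (snd s) x"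
  shows "t = s"
proof -
  have "snd (snd t) = snd (snd s)"
    by (rule extensionalityI[OF hom_fun_catD(7)[OF assms(1)] hom_fun_catD(7)[OF assms(2)] assms(3)])
  then show ?thesis using hom_fun_catD(1,2)[OF assms(1)] hom_fun_catD(1,2)[OF assms(2)] by (simp add: prod_eq_iff)
qed

lemma category_fun_cat:
  assumes "category C" "category D"
  shows "category (fun_cat C D)"
proof -
  interpret C: category C by fact
  interpret D: category D by fact
  let ?F = "fun_cat C D"
  have comp: "t \<cdot>\<^bsub>?F\<^esub> s \<in> hom ?F F H" if s: "s \<in> hom ?F F G" and t: "t \<in> hom ?F G H" for s t F G H
    unfolding hom_fun_cat
  proof (intro conjI ballI)
    note s' = hom_fun_catD[OF s] and t' = hom_fun_catD[OF t]
    show "fst (t \<cdot>\<^bsub>?F\<^esub> s) = F" "fst (snd (t \<cdot>\<^bsub>?F\<^esub> s)) = H" using s' t' by (simp_all add: fun_cat_simps)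
    show "is_functor C D F" "is_functor C D H" by fact+
    show "snd (snd (t \<cdot>\<^bsub>?F\<^esub> s)) \<in> (\<Pi>\<^sub>E x \<in> Obj C. hom D (fob F x) (fob H x))"
      using D.Comp_hom[OF s'(5) t'(5)] by (simp add: fun_cat_simps)
    fix f assume f: "f \<in> Arr C"
    note h = homD[OF s'(5)[OF C.Dom_Obj[OF f]]] homD[OF t'(5)[OF C.Dom_Obj[OF f]]]
      homD[OF s'(5)[OF C.Cod_Obj[OF f]]] homD[OF t'(5)[OF C.Cod_Obj[OF f]]]
      homD[OF is_functorD(4)[OF s'(3) f]] homD[OF is_functorD(4)[OF s'(4) f]] homD[OF is_functorD(4)[OF t'(4) f]]
    have "far H f \<cdot>\<^bsub>D\<^esub> (snd (snd t) (Dom C f) \<cdot>\<^bsub>D\<^esub> snd (snd s) (Dom C f)) =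
        (snd (snd t) (Cod C f) \<cdot>\<^bsub>D\<^esub> far G f) \<cdot>\<^bsub>D\<^esub> snd (snd s) (Dom C f)"
      by (rule D.Comp_rewrite[OF t'(6)[OF f]]) (use h in auto)
    also have "\<dots> = snd (snd t) (Cod C f) \<cdot>\<^bsub>D\<^esub> (snd (snd s) (Cod C f) \<cdot>\<^bsub>D\<^esub> far F f)"
      using h s'(6)[OF f] by simp
    also have "\<dots> = (snd (snd t) (Cod C f) \<cdot>\<^bsub>D\<^esub> snd (snd s) (Cod C f)) \<cdot>\<^bsub>D\<^esub> far F f"
      using h by simp
    finally show "far H f \<cdot>\<^bsub>D\<^esub> snd (snd (t \<cdot>\<^bsub>?F\<^esub> s)) (Dom C f) = snd (snd (t \<cdot>\<^bsub>?F\<^esub> s)) (Cod C f) \<cdot>\<^bsub>D\<^esub> far F f"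
      using f by (simp add: fun_cat_simps)
  qed
  have idn: "Idn ?F F \<in> hom ?F F F" if "is_functor C D F" for F
    unfolding hom_fun_cat
  proof (intro conjI ballI)
    show "snd (snd (Idn ?F F)) \<in> (\<Pi>\<^sub>E x \<in> Obj C. hom D (fob F x) (fob F x))"
      using D.Idn_hom[OF is_functorD(3)[OF that]] by (simp add: fun_cat_simps)
    fix f assume f: "f \<in> Arr C"
    then show "far F f \<cdot>\<^bsub>D\<^esub> snd (snd (Idn ?F F)) (Dom C f) = snd (snd (Idn ?F F)) (Cod C f) \<cdot>\<^bsub>D\<^esub> far F f"
      using homD[OF is_functorD(4)[OF that f]] by (simp add: fun_cat_simps)
  qed (use that in \<open>auto simp: fun_cat_simps\<close>)
  show ?thesis
  proof
    show "Dom ?F f \<in> Obj ?F" "Cod ?F f \<in> Obj ?F" if "f \<in> Arr ?F" for f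
      using that by (auto simp: fun_cat_def)
    show "Idn ?F x \<in> hom ?F x x" if "x \<in> Obj ?F" for x using idn that by (simp add: fun_cat_simps)
    show "t \<cdot>\<^bsub>?F\<^esub> s \<in> hom ?F F H" if "s \<in> hom ?F F G" "t \<in> hom ?F G H" for s t F G H by (rule comp[OF that])
    show "t \<cdot>\<^bsub>?F\<^esub> Idn ?F F = t" if t: "t \<in> hom ?F F G" for t F G
    proof (rule fun_cat_eqI[OF comp[OF idn[OF hom_fun_catD(3)[OF t]] t] t])
      fix x assume x: "x \<in> Obj C"
      then show "snd (snd (t \<cdot>\<^bsub>?F\<^esub> Idn ?F F)) x = snd (snd t) x"
        using homD[OF hom_fun_catD(5)[OF t x]] by (simp add: fun_cat_simps)
    qed
    show "Idn ?F G \<cdot>\<^bsub>?F\<^esub> t = t" if t: "t \<in> hom ?F F G" for t F G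
    proof (rule fun_cat_eqI[OF comp[OF t idn[OF hom_fun_catD(4)[OF t]]] t])
      fix x assume x: "x \<in> Obj C"
      then show "snd (snd (Idn ?F G \<cdot>\<^bsub>?F\<^esub> t)) x = snd (snd t) x"
        using homD[OF hom_fun_catD(5)[OF t x]] by (simp add: fun_cat_simps)
    qed
    show "(u \<cdot>\<^bsub>?F\<^esub> t) \<cdot>\<^bsub>?F\<^esub> s = u \<cdot>\<^bsub>?F\<^esub> (t \<cdot>\<^bsub>?F\<^esub> s)"
      if stu: "s \<in> hom ?F F G" "t \<in> hom ?F G H" "u \<in> hom ?F H I" for s t u F G H I
    proof (rule fun_cat_eqI[OF comp[OF stu(1) comp[OF stu(2,3)]] comp[OF comp[OF stu(1,2)] stu(3)]])
      fix x assume x: "x \<in> Obj C"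
      then show "snd (snd ((u \<cdot>\<^bsub>?F\<^esub> t) \<cdot>\<^bsub>?F\<^esub> s)) x = snd (snd (u \<cdot>\<^bsub>?F\<^esub> (t \<cdot>\<^bsub>?F\<^esub> s))) x"
        using D.Comp_assoc[OF hom_fun_catD(5)[OF stu(1) x] hom_fun_catD(5)[OF stu(2) x] hom_fun_catD(5)[OF stu(3) x]]
        by (simp add: fun_cat_simps)
    qed
  qed
qed

lemma prod_cat_simps [simp]:
  "Obj (prod_cat C D) = Obj C \<times> Obj D" "Arr (prod_cat C D) = Arr C \<times> Arr D"
  "Dom (prod_cat C D) (f, g) = (Dom C f, Dom D g)" "Cod (prod_cat C D) (f, g) = (Cod C f, Cod D g)"
  "Idn (prod_cat C D) (x, y) = (Idn C x, Idn D y)"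
  "(f', g') \<cdot>\<^bsub>prod_cat C D\<^esub> (f, g) = (f' \<cdot>\<^bsub>C\<^esub> f, g' \<cdot>\<^bsub>D\<^esub> g)"
  by (auto simp: prod_cat_def)

lemma category_prod_cat:
  assumes "category C" "category D"
  shows "category (prod_cat C D)"
proof -
  interpret C: category C by fact
  interpret D: category D by fact
  show ?thesis by unfold_locales (auto simp: hom_def)
qed

definition eval_at :: "('j, 'k, ('o, 'm, 'p, 'n) functr, ('o, 'm, 'p, 'n) functr \<times> ('o, 'm, 'p, 'n) functr \<times> ('o \<Rightarrow> 'n)) functr \<Rightarrow>
    'o \<Rightarrow> ('j, 'k, 'p, 'n) functr" where
  "eval_at H k = \<lparr>fob = \<lambda>x. fob (fob H x) k, far = \<lambda>f. snd (snd (far H f)) k\<rparr>"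

lemma eval_at_simps [simp]: "fob (eval_at H k) x = fob (fob H x) k" "far (eval_at H k) f = snd (snd (far H f)) k"
  by (simp_all add: eval_at_def)

lemma is_cowedgeD:
  assumes "is_cowedge J C H c \<kappa>"
  shows "c \<in> Obj C" "\<And>j. j \<in> Obj J \<Longrightarrow> \<kappa> j \<in> hom C (fob H (j, j)) c"
    "\<And>f. f \<in> Arr J \<Longrightarrow> \<kappa> (Dom J f) \<cdot>\<^bsub>C\<^esub> far H (f, Idn J (Dom J f)) = \<kappa> (Cod J f) \<cdot>\<^bsub>C\<^esub> far H (Idn J (Cod J f), f)"
  using assms unfolding is_cowedge_def by auto

text \<open>The cowedges at different \<open>k\<close> are unrelated data, with no naturality
  assumed. The universal property at the source of an arrow \<open>\<theta>\<close> of K produces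
  the action of \<open>\<theta>\<close> on the values \<open>E k\<close>, and its uniqueness half
  yields functoriality and all naturality. The values are recorded in the conclusion because a coend
  is otherwise known only up to isomorphism.\<close>

lemma pointwise_coend:
  assumes H: "is_functor (prod_cat (op_cat J) J) (fun_cat K C) H" and J: "category J" and K: "category K" and C: "category C"
    and cw: "\<And>k. k \<in> Obj K \<Longrightarrow> is_cowedge J C (eval_at H k) (E k) (\<kappa> k)"
    and univ: "\<And>k x \<phi>. k \<in> Obj K \<Longrightarrow> is_cowedge J C (eval_at H k) x \<phi> \<Longrightarrow>
      \<exists>!h. h \<in> hom C (E k) x \<and> (\<forall>j \<in> Obj J. h \<cdot>\<^bsub>C\<^esub> \<kappa> k j = \<phi> j)"
  shows "\<exists>c \<tau>. is_coend J (fun_cat K C) H c \<tau> \<and> (\<forall>k. fob c k = E k)"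
proof -
  interpret J: category J by fact
  interpret K: category K by fact
  interpret C: category C by fact
  interpret F: category "fun_cat K C" by (rule category_fun_cat[OF K C])
  have Hjj: "is_functor K C (fob H (i, j))" if "i \<in> Obj J" "j \<in> Obj J" for i j
    using is_functorD(3)[OF H, of "(i, j)"] that by (simp add: fun_cat_simps)
  have Hl: "far H (f, Idn J (Dom J f)) \<in> hom (fun_cat K C) (fob H (Cod J f, Dom J f)) (fob H (Dom J f, Dom J f))"
    and Hr: "far H (Idn J (Cod J f), f) \<in> hom (fun_cat K C) (fob H (Cod J f, Dom J f)) (fob H (Cod J f, Cod J f))"
    if "f \<in> Arr J" for f
    using is_functorD(4)[OF H, of "(f, Idn J (Dom J f))"] is_functorD(4)[OF H, of "(Idn J (Cod J f), f)"] that by simp_all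
  have \<kappa>: "\<kappa> k j \<in> hom C (fob (fob H (j, j)) k) (E k)" if "k \<in> Obj K" "j \<in> Obj J" for k j
    using is_cowedgeD(2)[OF cw[OF that(1)] that(2)] by simp
  have E: "E k \<in> Obj C" if "k \<in> Obj K" for k by (rule is_cowedgeD(1)[OF cw[OF that]])
  \<comment> \<open>The arrows of a universal cowedge are jointly epic; every equation of arrows out
    of \<open>E k\<close> is tested on them.\<close>
  have agree: "h = h'" if "k \<in> Obj K" "h \<in> hom C (E k) x" "h' \<in> hom C (E k) x" "\<And>j. j \<in> Obj J \<Longrightarrow> h \<cdot>\<^bsub>C\<^esub> \<kappa> k j = h' \<cdot>\<^bsub>C\<^esub> \<kappa> k j"
    for k h h' x
  proof -
    have "is_cowedge J C (eval_at H k) x (\<lambda>j. h \<cdot>\<^bsub>C\<^esub> \<kappa> k j)"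
      unfolding is_cowedge_def
    proof (intro conjI ballI)
      show "x \<in> Obj C" by (rule C.hom_Obj(2)[OF that(2)])
      show "h \<cdot>\<^bsub>C\<^esub> \<kappa> k j \<in> hom C (fob (eval_at H k) (j, j)) x" if "j \<in> Obj J" for j
        using C.Comp_hom[OF \<kappa>[OF \<open>k \<in> Obj K\<close> that] \<open>h \<in> hom C (E k) x\<close>] by simp
      fix f assume f: "f \<in> Arr J"
      note 1 = homD[OF \<kappa>[OF that(1) J.Dom_Obj[OF f]]] homD[OF \<kappa>[OF that(1) J.Cod_Obj[OF f]]] homD[OF that(2)]
        homD[OF hom_fun_catD(5)[OF Hl[OF f] that(1)]] homD[OF hom_fun_catD(5)[OF Hr[OF f] that(1)]]
      show "(h \<cdot>\<^bsub>C\<^esub> \<kappa> k (Dom J f)) \<cdot>\<^bsub>C\<^esub> far (eval_at H k) (f, Idn J (Dom J f)) =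
          (h \<cdot>\<^bsub>C\<^esub> \<kappa> k (Cod J f)) \<cdot>\<^bsub>C\<^esub> far (eval_at H k) (Idn J (Cod J f), f)"
        using 1 is_cowedgeD(3)[OF cw[OF that(1)] f] by simp
    qed
    from univ[OF that(1) this] show ?thesis using that(2-4) by metis
  qed
  define P where "P \<theta> h \<longleftrightarrow> h \<in> hom C (E (Dom K \<theta>)) (E (Cod K \<theta>)) \<and>
      (\<forall>j \<in> Obj J. h \<cdot>\<^bsub>C\<^esub> \<kappa> (Dom K \<theta>) j = \<kappa> (Cod K \<theta>) j \<cdot>\<^bsub>C\<^esub> far (fob H (j, j)) \<theta>)" for \<theta> h
  have exP: "\<exists>!h. P \<theta> h" if \<theta>: "\<theta> \<in> Arr K" for \<theta>
    unfolding P_def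
  proof (rule univ[OF K.Dom_Obj[OF \<theta>]])
    note d = K.Dom_Obj[OF \<theta>] and c = K.Cod_Obj[OF \<theta>]
    have H\<theta>: "far (fob H (i, j)) \<theta> \<in> hom C (fob (fob H (i, j)) (Dom K \<theta>)) (fob (fob H (i, j)) (Cod K \<theta>))" if "i \<in> Obj J" "j \<in> Obj J" for i j
      by (rule is_functorD(4)[OF Hjj[OF that] \<theta>])
    show "is_cowedge J C (eval_at H (Dom K \<theta>)) (E (Cod K \<theta>)) (\<lambda>j. \<kappa> (Cod K \<theta>) j \<cdot>\<^bsub>C\<^esub> far (fob H (j, j)) \<theta>)"
      unfolding is_cowedge_def
    proof (intro conjI ballI)
      show "E (Cod K \<theta>) \<in> Obj C" by (rule E[OF c])
      show "\<kappa> (Cod K \<theta>) j \<cdot>\<^bsub>C\<^esub> far (fob H (j, j)) \<theta> \<in> hom C (fob (eval_at H (Dom K \<theta>)) (j, j)) (E (Cod K \<theta>))" if "j \<in> Obj J" for j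
        using C.Comp_hom[OF H\<theta>[OF that that] \<kappa>[OF c that]] by simp
      fix f assume f: "f \<in> Arr J"
      note i = J.Dom_Obj[OF f] and j = J.Cod_Obj[OF f]
      note 1 = homD[OF \<kappa>[OF c i]] homD[OF \<kappa>[OF c j]] homD[OF H\<theta>[OF i i]] homD[OF H\<theta>[OF j j]] homD[OF H\<theta>[OF j i]]
        homD[OF hom_fun_catD(5)[OF Hl[OF f] d]] homD[OF hom_fun_catD(5)[OF Hr[OF f] d]]
        homD[OF hom_fun_catD(5)[OF Hl[OF f] c]] homD[OF hom_fun_catD(5)[OF Hr[OF f] c]]
      let ?l = "snd (snd (far H (f, Idn J (Dom J f))))" and ?r = "snd (snd (far H (Idn J (Cod J f), f)))"
      let ?\<theta> = "far (fob H (Cod J f, Dom J f)) \<theta>"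
      have "(\<kappa> (Cod K \<theta>) (Dom J f) \<cdot>\<^bsub>C\<^esub> far (fob H (Dom J f, Dom J f)) \<theta>) \<cdot>\<^bsub>C\<^esub> ?l (Dom K \<theta>) =
          \<kappa> (Cod K \<theta>) (Dom J f) \<cdot>\<^bsub>C\<^esub> (?l (Cod K \<theta>) \<cdot>\<^bsub>C\<^esub> ?\<theta>)"
        using 1 hom_fun_catD(6)[OF Hl[OF f] \<theta>] by simp
      also have "\<dots> = (\<kappa> (Cod K \<theta>) (Cod J f) \<cdot>\<^bsub>C\<^esub> ?r (Cod K \<theta>)) \<cdot>\<^bsub>C\<^esub> ?\<theta>"
        by (rule C.Comp_rewrite) (use 1 is_cowedgeD(3)[OF cw[OF c] f] in auto)
      also have "\<dots> = (\<kappa> (Cod K \<theta>) (Cod J f) \<cdot>\<^bsub>C\<^esub> far (fob H (Cod J f, Cod J f)) \<theta>) \<cdot>\<^bsub>C\<^esub> ?r (Dom K \<theta>)"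
        using 1 hom_fun_catD(6)[OF Hr[OF f] \<theta>] by simp
      finally show "(\<kappa> (Cod K \<theta>) (Dom J f) \<cdot>\<^bsub>C\<^esub> far (fob H (Dom J f, Dom J f)) \<theta>) \<cdot>\<^bsub>C\<^esub> far (eval_at H (Dom K \<theta>)) (f, Idn J (Dom J f)) =
          (\<kappa> (Cod K \<theta>) (Cod J f) \<cdot>\<^bsub>C\<^esub> far (fob H (Cod J f, Cod J f)) \<theta>) \<cdot>\<^bsub>C\<^esub> far (eval_at H (Dom K \<theta>)) (Idn J (Cod J f), f)"
        by simp
    qed
  qed
  define c where "c = \<lparr>fob = E, far = \<lambda>\<theta>. THE h. P \<theta> h\<rparr>"
  have cP: "P \<theta> (far c \<theta>)" if "\<theta> \<in> Arr K" for \<theta>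
    using theI'[OF exP[OF that]] by (simp add: c_def)
  have c: "is_functor K C c"
    unfolding is_functor_def
  proof (intro conjI ballI impI K C)
    show "fob c k \<in> Obj C" if "k \<in> Obj K" for k using E[OF that] by (simp add: c_def)
    show "far c \<theta> \<in> hom C (fob c (Dom K \<theta>)) (fob c (Cod K \<theta>))" if "\<theta> \<in> Arr K" for \<theta>
      using cP[OF that] by (simp add: P_def c_def)
    show "far c (Idn K k) = Idn C (fob c k)" if k: "k \<in> Obj K" for k
    proof -
      have "P (Idn K k) (Idn C (E k))"
        unfolding P_def using k E[OF k] homD[OF \<kappa>[OF k]] is_functorD(5)[OF Hjj k] C.Idn_hom by auto
      then show ?thesis using cP[of "Idn K k"] exP[of "Idn K k"] k by (auto simp: c_def)
    qed
    show "far c (\<theta>' \<cdot>\<^bsub>K\<^esub> \<theta>) = far c \<theta>' \<cdot>\<^bsub>C\<^esub> far c \<theta>"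
      if \<theta>: "\<theta> \<in> Arr K" "\<theta>' \<in> Arr K" "Cod K \<theta> = Dom K \<theta>'" for \<theta> \<theta>'
    proof -
      have h: "far c \<theta> \<in> hom C (E (Dom K \<theta>)) (E (Cod K \<theta>))" "far c \<theta>' \<in> hom C (E (Cod K \<theta>)) (E (Cod K \<theta>'))"
        using cP[OF \<theta>(1)] cP[OF \<theta>(2)] \<theta>(3) by (simp_all add: P_def)
      have "P (\<theta>' \<cdot>\<^bsub>K\<^esub> \<theta>) (far c \<theta>' \<cdot>\<^bsub>C\<^esub> far c \<theta>)"
        unfolding P_def
      proof (intro conjI ballI)
        show "far c \<theta>' \<cdot>\<^bsub>C\<^esub> far c \<theta> \<in> hom C (E (Dom K (\<theta>' \<cdot>\<^bsub>K\<^esub> \<theta>))) (E (Cod K (\<theta>' \<cdot>\<^bsub>K\<^esub> \<theta>)))"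
          using C.Comp_hom[OF h] \<theta> by simp
        fix j assume j: "j \<in> Obj J"
        have 1: "far c \<theta> \<cdot>\<^bsub>C\<^esub> \<kappa> (Dom K \<theta>) j = \<kappa> (Cod K \<theta>) j \<cdot>\<^bsub>C\<^esub> far (fob H (j, j)) \<theta>"
          "far c \<theta>' \<cdot>\<^bsub>C\<^esub> \<kappa> (Cod K \<theta>) j = \<kappa> (Cod K \<theta>') j \<cdot>\<^bsub>C\<^esub> far (fob H (j, j)) \<theta>'"
          using cP[OF \<theta>(1)] cP[OF \<theta>(2)] \<theta>(3) j by (simp_all add: P_def)
        have 2: "far (fob H (j, j)) \<theta> \<in> hom C (fob (fob H (j, j)) (Dom K \<theta>)) (fob (fob H (j, j)) (Cod K \<theta>))"
          "far (fob H (j, j)) \<theta>' \<in> hom C (fob (fob H (j, j)) (Cod K \<theta>)) (fob (fob H (j, j)) (Cod K \<theta>'))"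
          using is_functorD(4)[OF Hjj[OF j j] \<theta>(1)] is_functorD(4)[OF Hjj[OF j j] \<theta>(2)] \<theta>(3) by simp_all
        note 3 = \<kappa>[OF K.Dom_Obj[OF \<theta>(1)] j] \<kappa>[OF K.Cod_Obj[OF \<theta>(1)] j] \<kappa>[OF K.Cod_Obj[OF \<theta>(2)] j]
        have "(far c \<theta>' \<cdot>\<^bsub>C\<^esub> far c \<theta>) \<cdot>\<^bsub>C\<^esub> \<kappa> (Dom K \<theta>) j = far c \<theta>' \<cdot>\<^bsub>C\<^esub> (\<kappa> (Cod K \<theta>) j \<cdot>\<^bsub>C\<^esub> far (fob H (j, j)) \<theta>)"
          unfolding C.Comp_assoc[OF 3(1) h] 1 ..
        also have "\<dots> = (\<kappa> (Cod K \<theta>') j \<cdot>\<^bsub>C\<^esub> far (fob H (j, j)) \<theta>') \<cdot>\<^bsub>C\<^esub> far (fob H (j, j)) \<theta>"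
          unfolding C.Comp_assoc[OF 2(1) 3(2) h(2), symmetric] 1 ..
        also have "\<dots> = \<kappa> (Cod K \<theta>') j \<cdot>\<^bsub>C\<^esub> far (fob H (j, j)) (\<theta>' \<cdot>\<^bsub>K\<^esub> \<theta>)"
          unfolding is_functorD(6)[OF Hjj[OF j j] \<theta>] by (rule C.Comp_assoc[OF 2 3(3)])
        finally show "(far c \<theta>' \<cdot>\<^bsub>C\<^esub> far c \<theta>) \<cdot>\<^bsub>C\<^esub> \<kappa> (Dom K (\<theta>' \<cdot>\<^bsub>K\<^esub> \<theta>)) j =
            \<kappa> (Cod K (\<theta>' \<cdot>\<^bsub>K\<^esub> \<theta>)) j \<cdot>\<^bsub>C\<^esub> far (fob H (j, j)) (\<theta>' \<cdot>\<^bsub>K\<^esub> \<theta>)"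
          using \<theta> by simp
      qed
      then show ?thesis using cP[of "\<theta>' \<cdot>\<^bsub>K\<^esub> \<theta>"] exP[of "\<theta>' \<cdot>\<^bsub>K\<^esub> \<theta>"] \<theta> by auto
    qed
  qed
  define \<tau> where "\<tau> j = (fob H (j, j), c, \<lambda>k \<in> Obj K. \<kappa> k j)" for j
  have \<tau>: "\<tau> j \<in> hom (fun_cat K C) (fob H (j, j)) c" if j: "j \<in> Obj J" for j
    unfolding hom_fun_cat
  proof (intro conjI ballI)
    show "snd (snd (\<tau> j)) \<in> (\<Pi>\<^sub>E k \<in> Obj K. hom C (fob (fob H (j, j)) k) (fob c k))"
      using \<kappa>[OF _ j] by (simp add: \<tau>_def c_def)
    fix \<theta> assume "\<theta> \<in> Arr K"
    then show "far c \<theta> \<cdot>\<^bsub>C\<^esub> snd (snd (\<tau> j)) (Dom K \<theta>) = snd (snd (\<tau> j)) (Cod K \<theta>) \<cdot>\<^bsub>C\<^esub> far (fob H (j, j)) \<theta>"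
      using cP[of \<theta>] j by (simp add: \<tau>_def P_def)
  qed (simp_all add: \<tau>_def Hjj[OF j j] c)
  have "is_coend J (fun_cat K C) H c \<tau>"
    unfolding is_coend_def
  proof (intro conjI allI impI H)
    show "is_cowedge J (fun_cat K C) H c \<tau>"
      unfolding is_cowedge_def
    proof (intro conjI ballI \<tau>)
      show "c \<in> Obj (fun_cat K C)" using c by (simp add: fun_cat_simps)
      fix f assume f: "f \<in> Arr J"
      show "\<tau> (Dom J f) \<cdot>\<^bsub>fun_cat K C\<^esub> far H (f, Idn J (Dom J f)) = \<tau> (Cod J f) \<cdot>\<^bsub>fun_cat K C\<^esub> far H (Idn J (Cod J f), f)"
      proof (rule fun_cat_eqI[OF F.Comp_hom[OF Hl[OF f] \<tau>[OF J.Dom_Obj[OF f]]] F.Comp_hom[OF Hr[OF f] \<tau>[OF J.Cod_Obj[OF f]]]])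
        fix k assume k: "k \<in> Obj K"
        then show "snd (snd (\<tau> (Dom J f) \<cdot>\<^bsub>fun_cat K C\<^esub> far H (f, Idn J (Dom J f)))) k =
            snd (snd (\<tau> (Cod J f) \<cdot>\<^bsub>fun_cat K C\<^esub> far H (Idn J (Cod J f), f))) k"
          using is_cowedgeD(3)[OF cw[OF k] f] by (simp add: fun_cat_simps \<tau>_def)
      qed
    qed
    fix x \<phi> assume x: "is_cowedge J (fun_cat K C) H x \<phi>"
    have xF: "is_functor K C x" using is_cowedgeD(1)[OF x] by (simp add: fun_cat_simps)
    note \<phi> = is_cowedgeD(2)[OF x]
    have \<phi>k: "snd (snd (\<phi> j)) k \<in> hom C (fob (fob H (j, j)) k) (fob x k)" if "j \<in> Obj J" "k \<in> Obj K" for j k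
      by (rule hom_fun_catD(5)[OF \<phi>[OF that(1)] that(2)])
    have "\<exists>!h. h \<in> hom C (E k) (fob x k) \<and> (\<forall>j \<in> Obj J. h \<cdot>\<^bsub>C\<^esub> \<kappa> k j = snd (snd (\<phi> j)) k)" if k: "k \<in> Obj K" for k
    proof (rule univ[OF k])
      show "is_cowedge J C (eval_at H k) (fob x k) (\<lambda>j. snd (snd (\<phi> j)) k)"
        unfolding is_cowedge_def
      proof (intro conjI ballI)
        show "fob x k \<in> Obj C" by (rule is_functorD(3)[OF xF k])
        show "snd (snd (\<phi> j)) k \<in> hom C (fob (eval_at H k) (j, j)) (fob x k)" if "j \<in> Obj J" for j
          using \<phi>k[OF that k] by simp
        fix f assume f: "f \<in> Arr J"
        from arg_cong[OF is_cowedgeD(3)[OF x f], of "\<lambda>t. snd (snd t) k"]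
        show "snd (snd (\<phi> (Dom J f))) k \<cdot>\<^bsub>C\<^esub> far (eval_at H k) (f, Idn J (Dom J f)) =
            snd (snd (\<phi> (Cod J f))) k \<cdot>\<^bsub>C\<^esub> far (eval_at H k) (Idn J (Cod J f), f)"
          using k by (simp add: fun_cat_simps)
      qed
    qed
    then obtain h where h: "\<And>k. k \<in> Obj K \<Longrightarrow> h k \<in> hom C (E k) (fob x k)"
      "\<And>k j. k \<in> Obj K \<Longrightarrow> j \<in> Obj J \<Longrightarrow> h k \<cdot>\<^bsub>C\<^esub> \<kappa> k j = snd (snd (\<phi> j)) k" by metis
    define t where "t = (c, x, restrict h (Obj K))"
    have t: "t \<in> hom (fun_cat K C) c x"
      unfolding hom_fun_cat
    proof (intro conjI ballI)
      show "snd (snd t) \<in> (\<Pi>\<^sub>E k \<in> Obj K. hom C (fob c k) (fob x k))" using h(1) by (simp add: t_def c_def)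
      fix \<theta> assume \<theta>: "\<theta> \<in> Arr K"
      note d = K.Dom_Obj[OF \<theta>] and cd = K.Cod_Obj[OF \<theta>]
      have c\<theta>: "far c \<theta> \<in> hom C (E (Dom K \<theta>)) (E (Cod K \<theta>))" using cP[OF \<theta>] by (simp add: P_def)
      note x\<theta> = is_functorD(4)[OF xF \<theta>]
      have "far x \<theta> \<cdot>\<^bsub>C\<^esub> h (Dom K \<theta>) = h (Cod K \<theta>) \<cdot>\<^bsub>C\<^esub> far c \<theta>"
      proof (rule agree[OF d C.Comp_hom[OF h(1)[OF d] x\<theta>] C.Comp_hom[OF c\<theta> h(1)[OF cd]]])
        fix j assume j: "j \<in> Obj J"
        have H\<theta>: "far (fob H (j, j)) \<theta> \<in> hom C (fob (fob H (j, j)) (Dom K \<theta>)) (fob (fob H (j, j)) (Cod K \<theta>))"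
          by (rule is_functorD(4)[OF Hjj[OF j j] \<theta>])
        have "(far x \<theta> \<cdot>\<^bsub>C\<^esub> h (Dom K \<theta>)) \<cdot>\<^bsub>C\<^esub> \<kappa> (Dom K \<theta>) j = snd (snd (\<phi> j)) (Cod K \<theta>) \<cdot>\<^bsub>C\<^esub> far (fob H (j, j)) \<theta>"
          unfolding C.Comp_assoc[OF \<kappa>[OF d j] h(1)[OF d] x\<theta>] h(2)[OF d j] by (rule hom_fun_catD(6)[OF \<phi>[OF j] \<theta>])
        also have "\<dots> = h (Cod K \<theta>) \<cdot>\<^bsub>C\<^esub> (\<kappa> (Cod K \<theta>) j \<cdot>\<^bsub>C\<^esub> far (fob H (j, j)) \<theta>)"
          unfolding h(2)[OF cd j, symmetric] by (rule C.Comp_assoc[OF H\<theta> \<kappa>[OF cd j] h(1)[OF cd]])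
        also have "\<kappa> (Cod K \<theta>) j \<cdot>\<^bsub>C\<^esub> far (fob H (j, j)) \<theta> = far c \<theta> \<cdot>\<^bsub>C\<^esub> \<kappa> (Dom K \<theta>) j"
          using cP[OF \<theta>] j by (simp add: P_def)
        finally show "(far x \<theta> \<cdot>\<^bsub>C\<^esub> h (Dom K \<theta>)) \<cdot>\<^bsub>C\<^esub> \<kappa> (Dom K \<theta>) j = (h (Cod K \<theta>) \<cdot>\<^bsub>C\<^esub> far c \<theta>) \<cdot>\<^bsub>C\<^esub> \<kappa> (Dom K \<theta>) j"
          unfolding C.Comp_assoc[OF \<kappa>[OF d j] c\<theta> h(1)[OF cd]] .
      qed
      then show "far x \<theta> \<cdot>\<^bsub>C\<^esub> snd (snd t) (Dom K \<theta>) = snd (snd t) (Cod K \<theta>) \<cdot>\<^bsub>C\<^esub> far c \<theta>"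
        using d cd by (simp add: t_def)
    qed (simp_all add: t_def c xF)
    show "\<exists>!h. h \<in> hom (fun_cat K C) c x \<and> (\<forall>j\<in>Obj J. h \<cdot>\<^bsub>fun_cat K C\<^esub> \<tau> j = \<phi> j)"
    proof (rule ex1I[of _ t])
      have "t \<cdot>\<^bsub>fun_cat K C\<^esub> \<tau> j = \<phi> j" if j: "j \<in> Obj J" for j
      proof (rule fun_cat_eqI[OF F.Comp_hom[OF \<tau>[OF j] t] \<phi>[OF j]])
        fix k assume k: "k \<in> Obj K"
        then show "snd (snd (t \<cdot>\<^bsub>fun_cat K C\<^esub> \<tau> j)) k = snd (snd (\<phi> j)) k"
          using h(2)[OF k j] by (simp add: fun_cat_simps t_def \<tau>_def)
      qed
      then show "t \<in> hom (fun_cat K C) c x \<and> (\<forall>j\<in>Obj J. t \<cdot>\<^bsub>fun_cat K C\<^esub> \<tau> j = \<phi> j)" using t by blast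
      fix s assume s: "s \<in> hom (fun_cat K C) c x \<and> (\<forall>j\<in>Obj J. s \<cdot>\<^bsub>fun_cat K C\<^esub> \<tau> j = \<phi> j)"
      show "s = t"
      proof (rule fun_cat_eqI[OF conjunct1[OF s] t])
        fix k assume k: "k \<in> Obj K"
        have sk: "snd (snd s) k \<in> hom C (E k) (fob x k)"
          using hom_fun_catD(5)[OF conjunct1[OF s] k] by (simp add: c_def)
        have "snd (snd s) k = h k"
        proof (rule agree[OF k sk h(1)[OF k]])
          fix j assume j: "j \<in> Obj J"
          have "snd (snd (s \<cdot>\<^bsub>fun_cat K C\<^esub> \<tau> j)) k = snd (snd (\<phi> j)) k" using s j by simp
          then show "snd (snd s) k \<cdot>\<^bsub>C\<^esub> \<kappa> k j = h k \<cdot>\<^bsub>C\<^esub> \<kappa> k j"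
            unfolding h(2)[OF k j] using k by (simp add: fun_cat_simps \<tau>_def)
        qed
        then show "snd (snd s) k = snd (snd t) k" using k by (simp add: t_def)
      qed
    qed
  qed
  then show ?thesis by (auto simp: c_def intro!: exI[of _ c] exI[of _ \<tau>])
qed

lemma (in category) coend_unique:
  assumes "is_coend J C H c \<kappa>" "is_coend J C H d \<tau>"
  shows "\<exists>h k. h \<in> hom C c d \<and> k \<in> hom C d c \<and> k \<cdot> h = Idn C c \<and> h \<cdot> k = Idn C d"
proof -
  have univ: "\<exists>!h. h \<in> hom C c x \<and> (\<forall>j \<in> Obj J. h \<cdot> \<kappa> j = \<phi> j)" if "is_coend J C H c \<kappa>" "is_cowedge J C H x \<phi>" for c \<kappa> x \<phi>
    using that unfolding is_coend_def by blast
  have cw: "is_cowedge J C H c \<kappa>" "is_cowedge J C H d \<tau>" using assms unfolding is_coend_def by auto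
  obtain h where h: "h \<in> hom C c d" "\<And>j. j \<in> Obj J \<Longrightarrow> h \<cdot> \<kappa> j = \<tau> j" using univ[OF assms(1) cw(2)] by blast
  obtain k where k: "k \<in> hom C d c" "\<And>j. j \<in> Obj J \<Longrightarrow> k \<cdot> \<tau> j = \<kappa> j" using univ[OF assms(2) cw(1)] by blast
  have O: "c \<in> Obj C" "d \<in> Obj C" using is_cowedgeD(1)[OF cw(1)] is_cowedgeD(1)[OF cw(2)] by auto
  have "(k \<cdot> h) \<cdot> \<kappa> j = \<kappa> j" if "j \<in> Obj J" for j
    using Comp_assoc[OF is_cowedgeD(2)[OF cw(1) that] h(1) k(1)] h(2)[OF that] k(2)[OF that] by simp
  moreover have "Idn C c \<cdot> \<kappa> j = \<kappa> j" if "j \<in> Obj J" for j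
    using Idn_Comp[OF is_cowedgeD(2)[OF cw(1) that]] .
  ultimately have 1: "k \<cdot> h = Idn C c"
    using univ[OF assms(1) cw(1)] Comp_hom[OF h(1) k(1)] Idn_hom[OF O(1)] by blast
  have "(h \<cdot> k) \<cdot> \<tau> j = \<tau> j" if "j \<in> Obj J" for j
    using Comp_assoc[OF is_cowedgeD(2)[OF cw(2) that] k(1) h(1)] h(2)[OF that] k(2)[OF that] by simp
  moreover have "Idn C d \<cdot> \<tau> j = \<tau> j" if "j \<in> Obj J" for j
    using Idn_Comp[OF is_cowedgeD(2)[OF cw(2) that]] .
  ultimately have 2: "h \<cdot> k = Idn C d"
    using univ[OF assms(2) cw(2)] Comp_hom[OF k(1) h(1)] Idn_hom[OF O(2)] by blast
  show ?thesis using h(1) k(1) 1 2 by blast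
qed

text \<open>\<open>coend\<close> is a choice, so any coend that has been constructed is isomorphic
  to it; evaluating at \<open>k\<close> turns this into an isomorphism in C.\<close>

lemma coend_isomorphic_pointwise:
  assumes "is_coend J (fun_cat K C) H c \<kappa>" "category K" "category C" "k \<in> Obj K"
  shows "isomorphic C (fob (coend J (fun_cat K C) H) k) (fob c k)"
proof -
  interpret C: category C by fact
  interpret F: category "fun_cat K C" by (rule category_fun_cat[OF assms(2,3)])
  have "\<exists>\<tau>. is_coend J (fun_cat K C) H (coend J (fun_cat K C) H) \<tau>"
    unfolding coend_def by (rule someI[of _ c]) (use assms(1) in blast)
  then obtain h g where h: "h \<in> hom (fun_cat K C) (coend J (fun_cat K C) H) c" "g \<in> hom (fun_cat K C) c (coend J (fun_cat K C) H)"
    and 1: "g \<cdot>\<^bsub>fun_cat K C\<^esub> h = Idn (fun_cat K C) (coend J (fun_cat K C) H)" "h \<cdot>\<^bsub>fun_cat K C\<^esub> g = Idn (fun_cat K C) c"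
    using F.coend_unique[OF _ assms(1)] by metis
  note hk = homD[OF hom_fun_catD(5)[OF h(1) assms(4)]] homD[OF hom_fun_catD(5)[OF h(2) assms(4)]]
  have "inverse_arrows C (snd (snd h) k) (snd (snd g) k)"
    using hk arg_cong[OF 1(1), of "\<lambda>t. snd (snd t) k"] arg_cong[OF 1(2), of "\<lambda>t. snd (snd t) k"] assms(4)
    by (intro C.inverse_arrowsI) (simp_all add: fun_cat_simps)
  then have "iso C (snd (snd h) k)" by (auto simp: iso_def)
  from C.isomorphic_iso[OF this] show ?thesis using hk by simp
qed

section \<open>Flags\<close>

definition push :: "nat list \<Rightarrow> nat set list \<Rightarrow> nat set list" where
  "push f = map ((`) ((!) f))"

text \<open>These are the n-simplices of the nerve of P_T; unlike flanked flags they need neither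
  start at T nor end at [p].\<close>

definition flag_chains :: "nat \<Rightarrow> necklace \<Rightarrow> nat set list set" where
  "flag_chains n T = chains (nec_poset T) n"

lemma flag_chains_iff: "c \<in> flag_chains n (T, p) \<longleftrightarrow>
    length c = Suc n \<and> sorted_wrt (\<subseteq>) c \<and> (\<forall>W \<in> set c. T \<subseteq> W \<and> W \<subseteq> {..p})"
  by (auto simp: flag_chains_def chains_def nec_poset_def)

lemma sorted_wrt_subset_hd_last:
  assumes "sorted_wrt (\<subseteq>) c" "W \<in> set c"
  shows "hd c \<subseteq> W" "W \<subseteq> last c"
proof -
  show "hd c \<subseteq> W" using assms by (cases c) auto
  show "W \<subseteq> last c" using assms by (induction c) (auto split: if_splits)
qed

lemma flanked_flags_iff: "((T, p), c) \<in> flanked_flags n \<longleftrightarrow>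
    (T, p) \<in> Obj Nec \<and> c \<in> flag_chains n (T, p) \<and> hd c = T \<and> last c = {..p}"
proof -
  have "T \<subseteq> hd c \<and> last c \<subseteq> {..p} \<longleftrightarrow> (\<forall>W \<in> set c. T \<subseteq> W \<and> W \<subseteq> {..p})"
    if "length c = Suc n" "sorted_wrt (\<subseteq>) c"
  proof -
    have "c \<noteq> []" using that by auto
    then have "hd c \<in> set c" "last c \<in> set c" by auto
    then show ?thesis using sorted_wrt_subset_hd_last[OF that(2)] by (meson subset_trans)
  qed
  note * = this
  have u: "((T, p), c) \<in> flanked_flags n \<longleftrightarrow> (T, p) \<in> Obj Nec \<and>
      ((length c = Suc n \<and> sorted_wrt (\<subseteq>) c \<and> T \<subseteq> hd c \<and> last c \<subseteq> {..p}) \<and> T = hd c \<and> last c = {..p})"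
    by (simp only: flanked_flags_def is_flanked_flag_def is_flag_def mem_Collect_eq case_prod_conv)
  show ?thesis
  proof (cases "length c = Suc n \<and> sorted_wrt (\<subseteq>) c")
    case True
    then have "length c = Suc n" "sorted_wrt (\<subseteq>) c" by auto
    note *[OF this, symmetric]
    then show ?thesis unfolding u flag_chains_iff using True by (simp only:) blast
  next
    case False
    then show ?thesis unfolding u flag_chains_iff by blast
  qed
qed

lemma push_chain:
  assumes f: "((T, p), (U, q), f) \<in> Arr Nec" and c: "c \<in> flag_chains n (T, p)"
  shows "push f c \<in> flag_chains n (U, q)"
proof -
  have f': "f \<in> Arr Delta_f" "length f = Suc p" "last f = q" "U \<subseteq> (!) f ` T"
    using f by (cases f; auto simp: Nec_simps hom_def Arr_Delta_f)+
  have c': "length c = Suc n" "sorted_wrt (\<subseteq>) c" "\<And>W. W \<in> set c \<Longrightarrow> T \<subseteq> W \<and> W \<subseteq> {..p}"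
    using c by (auto simp: flag_chains_iff)
  have "sorted_wrt (\<subseteq>) (push f c)"
    unfolding push_def sorted_wrt_map by (rule sorted_wrt_mono_rel[OF _ c'(2)]) auto
  moreover have "U \<subseteq> (!) f ` W \<and> (!) f ` W \<subseteq> {..q}" if "W \<in> set c" for W
  proof
    show "U \<subseteq> (!) f ` W" using f'(4) c'(3)[OF that] by (meson image_mono subset_trans)
    show "(!) f ` W \<subseteq> {..q}" using nth_le_last_Delta_f[OF f'(1)] f'(2,3) c'(3)[OF that] by (auto simp: subset_iff)
  qed
  ultimately show ?thesis using c'(1) by (auto simp: flag_chains_iff push_def)
qed

lemma push_Comp:
  assumes "\<And>W. W \<in> set c \<Longrightarrow> W \<subseteq> {..<length f}"
  shows "push (map ((!) g) f) c = push g (push f c)"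
  unfolding push_def map_map
proof (rule map_cong[OF refl])
  fix W assume "W \<in> set c"
  then have "\<And>i. i \<in> W \<Longrightarrow> i < length f" using assms by auto
  then show "(!) (map ((!) g) f) ` W = ((`) ((!) g) \<circ> (`) ((!) f)) W"
    by (auto simp: image_image intro!: image_cong)
qed

lemma nth_Idn_image: "W \<subseteq> {..p} \<Longrightarrow> (!) [0..<Suc p] ` W = W"
  by (force simp: nth_append)

lemma push_Idn: "(\<And>W. W \<in> set c \<Longrightarrow> W \<subseteq> {..p}) \<Longrightarrow> push [0..<Suc p] c = c"
  unfolding push_def by (rule map_idI) (rule nth_Idn_image)

text \<open>Surjectivity of \<open>f\<close> keeps the largest set full, and the smallest set is
  carried exactly onto the set of joints of the image necklace.\<close>

lemma push_flanked:
  assumes "((T, p), c) \<in> flanked_flags n" "f \<in> surjs p"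
  shows "(((!) f ` T, last f), push f c) \<in> flanked_flags n"
proof -
  have c: "(T, p) \<in> Obj Nec" "c \<in> flag_chains n (T, p)" "hd c = T" "last c = {..p}" "c \<noteq> []"
    using assms(1) by (auto simp: flanked_flags_iff flag_chains_iff)
  note a = surjs_Arr_Nec[OF c(1) assms(2)]
  have "{..p} = {..<length f}" using assms(2) by (auto simp: surjs_iff)
  moreover have "(!) f ` {..<length f} = set f" by (auto simp: set_conv_nth)
  moreover have "set f = {..last f}" using assms(2) by (simp add: surjs_iff)
  ultimately have "(!) f ` {..p} = {..last f}" by (simp only:)
  then show ?thesis using push_chain[OF a c(2)] a c
    by (auto simp: flanked_flags_iff push_def hd_map last_map Nec_simps(2))
qed

text \<open>Every flag on a necklace is the image of a flanked flag under an injection: restrict to the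
  vertices in the largest set of the flag, and take its smallest set as the set of joints.\<close>

definition span :: "nat set list \<Rightarrow> nat list" where
  "span c = sorted_list_of_set (last c)"

definition pull :: "nat set list \<Rightarrow> nat set list" where
  "pull c = map (\<lambda>W. {i. i < length (span c) \<and> span c ! i \<in> W}) c"

definition root :: "nat set list \<Rightarrow> necklace" where
  "root c = (hd (pull c), length (span c) - 1)"

text \<open>The vertices 0 and p lie in T, hence in the largest set of the flag. So
  \<open>span c\<close> starts at 0 and ends at p, which makes it an interval map, and its length
  determines the size of the root necklace.\<close>

lemma
  assumes T: "(T, p) \<in> Obj Nec" and c: "c \<in> flag_chains n (T, p)"
  shows set_span: "set (span c) = last c" and span_Arr: "span c \<in> Arr Delta_f" and last_span: "last (span c) = p"
    and distinct_span: "distinct (span c)"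
    and push_pull: "push (span c) (pull c) = c"
    and root_Arr: "(root c, (T, p), span c) \<in> Arr Nec"
    and pull_flanked: "(root c, pull c) \<in> flanked_flags n"
proof -
  have c': "length c = Suc n" "sorted_wrt (\<subseteq>) c" "c \<noteq> []" "\<And>W. W \<in> set c \<Longrightarrow> T \<subseteq> W \<and> W \<subseteq> {..p}"
    using c by (auto simp: flag_chains_iff)
  have W: "W \<subseteq> last c" if "W \<in> set c" for W using sorted_wrt_subset_hd_last[OF c'(2) that] by auto
  have hl: "hd c \<in> set c" "last c \<in> set c" using c'(3) by auto
  have T': "0 \<in> T" "p \<in> T" using T by (auto simp: Nec_simps)
  have L: "0 \<in> last c" "p \<in> last c" "last c \<subseteq> {0..p}" using c'(4)[OF hl(2)] T' by auto
  have fin: "finite (last c)" using L finite_subset by blast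
  show ss: "set (span c) = last c" using fin by (simp add: span_def)
  show d: "distinct (span c)" by (simp add: span_def)
  note hls = hd_last_sorted_list_of_set[OF L, folded span_def]
  show sA: "span c \<in> Arr Delta_f" using hls by (auto simp: Arr_Delta_f hd_conv_nth[symmetric]) (simp add: span_def)
  show l: "last (span c) = p" by (rule hls)
  have img: "(!) (span c) ` {i. i < length (span c) \<and> span c ! i \<in> W} = W" if "W \<in> set c" for W
    using W[OF that] unfolding ss[symmetric] by (fastforce simp: set_conv_nth)
  show pp: "push (span c) (pull c) = c"
    unfolding push_def pull_def map_map by (rule map_idI) (simp add: img)
  have hp: "hd (pull c) = {i. i < length (span c) \<and> span c ! i \<in> hd c}" "last (pull c) = {i. i < length (span c) \<and> span c ! i \<in> last c}"
    using c'(3) by (simp_all add: pull_def hd_map last_map)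
  have ln: "length (span c) = Suc (length (span c) - 1)" using hls(1) by (cases "span c") auto
  have nl: "span c ! (length (span c) - 1) = p" "span c ! 0 = 0" using l hls by (simp_all add: last_conv_nth hd_conv_nth)
  have r: "root c \<in> Obj Nec"
  proof -
    have "0 < length (span c)" "length (span c) - 1 < length (span c)" using ln by linarith+
    then show ?thesis using nl c'(4)[OF hl(1)] T' unfolding root_def hp Nec_simps by auto
  qed
  have hc: "T \<subseteq> (!) (span c) ` hd (pull c)" unfolding hp img[OF hl(1)] using c'(4)[OF hl(1)] by blast
  show "(root c, (T, p), span c) \<in> Arr Nec"
    using r T hc sA l unfolding root_def Nec_simps(2) by (simp add: hom_def)
  have "last (pull c) = {..<length (span c)}" unfolding hp ss[symmetric] by auto
  then have "last (pull c) = {..length (span c) - 1}" using ln lessThan_Suc_atMost by metis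
  moreover have "sorted_wrt (\<subseteq>) (pull c)"
    unfolding pull_def sorted_wrt_map by (rule sorted_wrt_mono_rel[OF _ c'(2)]) auto
  moreover have "hd (pull c) \<subseteq> W \<and> W \<subseteq> {..length (span c) - 1}" if "W \<in> set (pull c)" for W
    using sorted_wrt_subset_hd_last[OF calculation(2) that] calculation(1) by simp
  ultimately show "(root c, pull c) \<in> flanked_flags n"
    using r c'(1) unfolding root_def flanked_flags_iff flag_chains_iff by (auto simp: pull_def)
qed

text \<open>The reduction to flanked flags does nothing to a flag that is already flanked; hence
  \<open>full\<close> below really extends the given family.\<close>

lemma span_flanked:
  assumes "((T, p), c) \<in> flanked_flags n"
  shows "span c = [0..<Suc p]" "pull c = c" "root c = (T, p)"
proof -
  have c: "c \<in> flag_chains n (T, p)" "hd c = T" "last c = {..p}" using assms by (auto simp: flanked_flags_iff)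
  show s: "span c = [0..<Suc p]"
    unfolding span_def c(3) by (intro sorted_distinct_set_unique) (auto simp del: upt_Suc)
  show p: "pull c = c"
    unfolding pull_def s
  proof (rule map_idI)
    fix W assume "W \<in> set c"
    then have "W \<subseteq> {..<Suc p}" using c(1) unfolding flag_chains_iff lessThan_Suc_atMost by blast
    then show "{i. i < length [0..<Suc p] \<and> [0..<Suc p] ! i \<in> W} = W" by (auto simp del: upt_Suc)
  qed
  show "root c = (T, p)" using c(2) by (simp add: root_def p s)
qed

text \<open>The reduction to flanked flags is functorial. The largest set of \<open>push g c\<close>
  is the image under \<open>g\<close> of the largest set of \<open>c\<close>, so \<open>g\<close>
  restricts to a surjection between the two; \<open>g'\<close> is this surjection in the coordinates
  given by the spans, hence a map between the flanked roots.\<close>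

lemma span_natural:
  assumes g: "((T, p), (U, q), g) \<in> Arr Nec" and c: "c \<in> flag_chains n (T, p)"
  obtains g' where "g' \<in> surjs (length (span c) - 1)" "map ((!) (span (push g c))) g' = map ((!) g) (span c)"
    "push g' (pull c) = pull (push g c)" "((!) g' ` fst (root c), last g') = root (push g c)"
proof -
  have O: "(T, p) \<in> Obj Nec" "(U, q) \<in> Obj Nec" and gA: "g \<in> Arr Delta_f" "last g = q" "length g = Suc p"
    using g by (cases g; auto simp: Nec_simps hom_def Arr_Delta_f)+
  define d where "d = push g c"
  have d: "d \<in> flag_chains n (U, q)" unfolding d_def by (rule push_chain[OF g c])
  note sc = set_span[OF O(1) c] span_Arr[OF O(1) c] distinct_span[OF O(1) c] last_span[OF O(1) c]
  note sd = set_span[OF O(2) d] span_Arr[OF O(2) d] distinct_span[OF O(2) d] last_span[OF O(2) d]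
  have ne: "c \<noteq> []" using c by (auto simp: flag_chains_iff)
  have sd_img: "set (span d) = (!) g ` set (span c)"
    unfolding sc(1) sd(1) using ne by (simp add: d_def push_def last_map)
  \<comment> \<open>The position of a vertex in \<open>span d\<close>, i.e. the inverse of
    \<open>span d\<close> on its values; it is unambiguous because \<open>span d\<close> has no
    repetitions.\<close>
  define idx where "idx v = (SOME j. j < length (span d) \<and> span d ! j = v)" for v
  have idx: "idx v < length (span d)" "span d ! idx v = v" if "v \<in> set (span d)" for v
    using someI_ex[of "\<lambda>j. j < length (span d) \<and> span d ! j = v"] that unfolding idx_def by (auto simp: in_set_conv_nth)
  have idx_eq: "idx (span d ! j) = j" if "j < length (span d)" for j
    using idx[of "span d ! j"] that sd(3) nth_eq_iff_index_eq by (metis nth_mem)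
  define g' where "g' = map (\<lambda>v. idx (g ! v)) (span c)"
  have g'n: "g' ! i < length (span d)" "span d ! (g' ! i) = g ! (span c ! i)" if "i < length (span c)" for i
    using idx[of "g ! (span c ! i)"] sd_img that by (auto simp: g'_def)
  have lg: "length g' = length (span c)" by (simp add: g'_def)
  have le: "span c ! i < length g" if "i < length (span c)" for i
    using nth_le_last_Delta_f[OF sc(2) that] sc(4) gA by simp
  \<comment> \<open>\<open>span d\<close> is monotone without repetitions, so monotonicity of its
    composite with \<open>g'\<close>, which is \<open>g\<close> after \<open>span c\<close>,
    descends to \<open>g'\<close>.\<close>
  have mono: "g' ! i \<le> g' ! j" if ij: "i \<le> j" "j < length (span c)" for i j
  proof (rule ccontr)
    assume "\<not> g' ! i \<le> g' ! j"
    then have lt: "g' ! j < g' ! i" by simp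
    have "span d ! (g' ! j) \<le> span d ! (g' ! i)" by (rule nth_mono[OF sd(2)]) (use lt g'n ij in auto)
    moreover have "span d ! (g' ! i) \<le> span d ! (g' ! j)"
      using g'n ij nth_mono[OF gA(1) nth_mono[OF sc(2) ij]] le by simp
    ultimately have "span d ! (g' ! i) = span d ! (g' ! j)" by simp
    moreover have "g' ! i < length (span d)" "g' ! j < length (span d)" using g'n(1) ij by auto
    ultimately have "g' ! i = g' ! j" using nth_eq_iff_index_eq[OF sd(3)] by blast
    then show False using lt by simp
  qed
  have pos: "0 < length (span c)" "0 < length (span d)" using sc(2) sd(2) by (auto simp: Arr_Delta_f)
  have z: "g' ! 0 = 0"
  proof -
    have c0: "span c ! 0 = 0" using sc(2) by (simp only: Arr_Delta_f)
    have d0: "span d ! 0 = 0" using sd(2) by (simp only: Arr_Delta_f)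
    have "g ! 0 = 0" using gA(1) by (simp only: Arr_Delta_f)
    then have "span d ! (g' ! 0) = span d ! 0" using g'n(2)[OF pos(1)] unfolding c0 d0 by (rule trans[rotated])
    then show ?thesis using nth_eq_iff_index_eq[OF sd(3) g'n(1)[OF pos(1)] pos(2)] by simp
  qed
  have A: "g' \<in> Arr Delta_f" using pos(1) mono z lg by (auto simp: Arr_Delta_f sorted_iff_nth_mono)
  have sg: "set g' = {..<length (span d)}"
  proof
    show "set g' \<subseteq> {..<length (span d)}" using g'n(1) lg by (auto simp: in_set_conv_nth)
    show "{..<length (span d)} \<subseteq> set g'"
    proof
      fix j assume "j \<in> {..<length (span d)}"
      then have j: "j < length (span d)" by simp
      then have "span d ! j \<in> (!) g ` set (span c)" using sd_img nth_mem by blast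
      then obtain v where "v \<in> set (span c)" "span d ! j = g ! v" by blast
      then show "j \<in> set g'" using idx_eq[OF j] by (auto simp: g'_def)
    qed
  qed
  have lastg: "last g' = length (span d) - 1"
  proof -
    have "last g' \<in> set g'" using lg pos by (intro last_in_set) auto
    then have "last g' \<le> length (span d) - 1" using sg by auto
    moreover have "length (span d) - 1 \<in> set g'" using sg pos by auto
    then obtain i where i: "i < length g'" "g' ! i = length (span d) - 1" by (auto simp: in_set_conv_nth)
    have "length (span d) - 1 \<le> last g'" using nth_le_last_Delta_f[OF A i(1)] unfolding i(2) .
    ultimately show ?thesis by (intro le_antisym)
  qed
  have s: "g' \<in> surjs (length (span c) - 1)"
  proof -
    have "set g' = {..last g'}"
      unfolding sg lastg using pos(2) by (cases "length (span d)") (auto simp only: lessThan_Suc_atMost diff_Suc_1 less_irrefl)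
    moreover have "length g' = Suc (length (span c) - 1)" using lg pos(1) by simp
    ultimately show ?thesis using A unfolding surjs_iff by blast
  qed
  have m: "map ((!) (span d)) g' = map ((!) g) (span c)"
    by (rule nth_equalityI) (use g'n lg in auto)
  have pl: "(!) g' ` {i. i < length (span c) \<and> span c ! i \<in> W} = {j. j < length (span d) \<and> span d ! j \<in> (!) g ` W}"
    if W: "W \<in> set c" for W
  proof
    show "(!) g' ` {i. i < length (span c) \<and> span c ! i \<in> W} \<subseteq> {j. j < length (span d) \<and> span d ! j \<in> (!) g ` W}"
      using g'n by auto
    show "{j. j < length (span d) \<and> span d ! j \<in> (!) g ` W} \<subseteq> (!) g' ` {i. i < length (span c) \<and> span c ! i \<in> W}"
    proof clarify
      fix j w assume j: "j < length (span d)" "span d ! j = g ! w" "w \<in> W"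
      have "W \<subseteq> last c" using c W sorted_wrt_subset_hd_last(2)[of c W] by (auto simp: flag_chains_iff)
      then have "w \<in> set (span c)" using j(3) sc(1) by auto
      then obtain i where i: "i < length (span c)" "span c ! i = w" by (auto simp: in_set_conv_nth)
      then have "g' ! i = j" using idx_eq[OF j(1)] j(2) by (simp add: g'_def)
      then show "j \<in> (!) g' ` {i. i < length (span c) \<and> span c ! i \<in> W}" using i j(3) by auto
    qed
  qed
  have pp: "push g' (pull c) = pull d"
  proof -
    have "pull d = map (\<lambda>W. {j. j < length (span d) \<and> span d ! j \<in> W}) (map ((`) ((!) g)) c)"
      by (simp only: pull_def d_def push_def)
    then show ?thesis
      unfolding push_def pull_def[of c] map_map by (simp only:) (rule map_cong[OF refl], simp only: o_def pl)
  qed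
  have "(!) g' ` hd (pull c) = hd (pull d)"
  proof -
    have "pull c \<noteq> []" using ne by (simp add: pull_def)
    then show ?thesis unfolding pp[symmetric] push_def by (rule hd_map[symmetric])
  qed
  then have "((!) g' ` fst (root c), last g') = root d" unfolding root_def fst_conv lastg by (simp only:)
  from that[OF s m[unfolded d_def] pp[unfolded d_def] this[unfolded d_def]] show thesis .
qed

section \<open>Copowers and nerves\<close>

lemma functor_inverse_arrows:
  assumes F: "is_functor C D F" and fg: "inverse_arrows C f g"
  shows "inverse_arrows D (far F f) (far F g)"
proof -
  interpret C: category C by (rule is_functorD(1)[OF F])
  interpret D: category D by (rule is_functorD(2)[OF F])
  have *: "f \<in> Arr C" "g \<in> Arr C" "Dom C g = Cod C f" "Cod C g = Dom C f"
    "g \<cdot>\<^bsub>C\<^esub> f = Idn C (Dom C f)" "f \<cdot>\<^bsub>C\<^esub> g = Idn C (Cod C f)"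
    using fg by (auto simp: inverse_arrows_def hom_def)
  note h = homD[OF is_functorD(4)[OF F *(1)]] homD[OF is_functorD(4)[OF F *(2)]]
  have "far F g \<cdot>\<^bsub>D\<^esub> far F f = Idn D (Dom D (far F f))" "far F f \<cdot>\<^bsub>D\<^esub> far F g = Idn D (Cod D (far F f))"
    using is_functorD(6)[OF F *(1,2)] is_functorD(6)[OF F *(2,1)] *(3-) h
      is_functorD(5)[OF F C.Dom_Obj[OF *(1)]] is_functorD(5)[OF F C.Cod_Obj[OF *(1)]] by auto
  then show ?thesis using h *(3,4) by (intro D.inverse_arrowsI) auto
qed

lemma set_cat_simps:
  "Obj set_cat = UNIV" "(A, B, f) \<in> Arr set_cat \<longleftrightarrow> f \<in> A \<rightarrow>\<^sub>E B" "Dom set_cat (A, B, f) = A" "Cod set_cat (A, B, f) = B"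
  "Idn set_cat A = (A, A, \<lambda>x \<in> A. x)" "(B', C, g) \<cdot>\<^bsub>set_cat\<^esub> (A, B, f) = (A, C, \<lambda>x \<in> A. g (f x))"
  by (simp_all add: set_cat_def)

lemma hom_set_cat: "t \<in> hom set_cat A B \<longleftrightarrow> fst t = A \<and> fst (snd t) = B \<and> snd (snd t) \<in> A \<rightarrow>\<^sub>E B"
  by (cases t) (auto simp: hom_def[of set_cat] set_cat_simps)

locale copower_functor = symmetric_monoidal_closed_category V
  for V :: "('o, 'm, 'z) sym_mon_cat_scheme" (structure) +
  fixes F :: "('u set, 'u set \<times> 'u set \<times> ('u \<Rightarrow> 'u), 'o, 'm) functr"
  assumes F: "is_functor set_cat V F" and F_colim: "preserves_colimits TYPE('u) set_cat V F"
    and F_point: "\<And>x. isomorphic V (fob F {x}) (Unit V)"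
begin

abbreviation base :: 'u where "base \<equiv> undefined"

definition const_arr :: "'u set \<Rightarrow> 'u \<Rightarrow> 'u set \<times> 'u set \<times> ('u \<Rightarrow> 'u)" where
  "const_arr A x = ({base}, A, \<lambda>_\<in>{base}. x)"

text \<open>The isomorphisms of \<open>F {x}\<close> with the unit are assumed for each
  \<open>x\<close> separately, without naturality. One of them is fixed at the arbitrary element
  \<open>base\<close> and carried to all other points by constant maps; this makes
  \<open>point\<close> natural by construction.\<close>

definition unit_base :: 'm where
  "unit_base = inv_arr V (SOME f. f \<in> hom V (fob F {base}) (Unit V) \<and> iso V f)"

lemma unit_base: "unit_base \<in> hom V (Unit V) (fob F {base})" "iso V unit_base"
proof -
  have "\<exists>f. f \<in> hom V (fob F {base}) (Unit V) \<and> iso V f"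
    using F_point[of base] by (auto simp: isomorphic_def)
  from someI_ex[OF this] show "unit_base \<in> hom V (Unit V) (fob F {base})" "iso V unit_base"
    unfolding unit_base_def by (auto simp: hom_def)
qed

lemma F_Obj [simp]: "fob F A \<in> Obj V"
  using is_functorD(3)[OF F] by (simp add: set_cat_simps)

lemma F_Arr: "(A, B, f) \<in> Arr set_cat \<Longrightarrow> far F (A, B, f) \<in> hom V (fob F A) (fob F B)"
  using is_functorD(4)[OF F, of "(A, B, f)"] by (simp add: set_cat_simps)

lemma F_Comp: "(A, B, f) \<in> Arr set_cat \<Longrightarrow> (B, C, g) \<in> Arr set_cat \<Longrightarrow>
    far F (B, C, g) \<cdot> far F (A, B, f) = far F (A, C, \<lambda>x\<in>A. g (f x))"
  using is_functorD(6)[OF F, of "(A, B, f)" "(B, C, g)"] by (simp add: set_cat_simps)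

definition point :: "'u set \<Rightarrow> 'u \<Rightarrow> 'm" where
  "point A x = far F (const_arr A x) \<cdot> unit_base"

lemma point_hom: "x \<in> A \<Longrightarrow> point A x \<in> hom V (Unit V) (fob F A)"
  unfolding point_def const_arr_def
  by (rule Comp_hom[OF unit_base(1) F_Arr]) (auto simp: set_cat_simps)

lemma far_F_point:
  assumes "(A, B, h) \<in> Arr set_cat" "x \<in> A"
  shows "far F (A, B, h) \<cdot> point A x = point B (h x)"
proof -
  have c: "({base}, A, \<lambda>_\<in>{base}. x) \<in> Arr set_cat" using assms(2) by (auto simp: set_cat_simps)
  have e: "(\<lambda>y\<in>{base}. h ((\<lambda>_\<in>{base}. x) y)) = (\<lambda>_\<in>{base}. h x)" by (rule ext) simp
  show ?thesis
    unfolding point_def const_arr_def Comp_assoc[OF unit_base(1) F_Arr[OF c] F_Arr[OF assms(1)], symmetric]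
      F_Comp[OF c assms(1)] e ..
qed

text \<open>A set is the coproduct of its points, a colimit over a discrete category on
  \<open>'u\<close>, and \<open>F\<close> preserves it. The images of the constant maps identify
  each \<open>F {x}\<close> with \<open>F {base}\<close>, hence with the unit.\<close>

lemma point_coproduct: "is_coproduct V A (\<lambda>_. Unit V) (fob F A) (point A)"
proof -
  define D :: "('u, 'u, 'u set, 'u set \<times> 'u set \<times> ('u \<Rightarrow> 'u)) functr" where
    "D = \<lparr>fob = \<lambda>x. {x}, far = \<lambda>x. ({x}, {x}, \<lambda>y\<in>{x}. y)\<rparr>"
  let ?i = "\<lambda>x. ({x}, A, \<lambda>y\<in>{x}. y)"
  have S: "category (set_cat :: ('u set, 'u set \<times> 'u set \<times> ('u \<Rightarrow> 'u)) cat)" by (rule is_functorD(1)[OF F])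
  have D: "is_functor (discrete A) set_cat D"
    unfolding is_functor_def
  proof (intro conjI ballI impI category_discrete S)
    fix f g assume "f \<in> Arr (discrete A)" "g \<in> Arr (discrete A)" "Cod (discrete A) f = Dom (discrete A) g"
    then have [simp]: "g = f" by (simp add: discrete_def)
    show "far D (g \<cdot>\<^bsub>discrete A\<^esub> f) = far D g \<cdot>\<^bsub>set_cat\<^esub> far D f"
      by (simp add: D_def discrete_def set_cat_simps) (auto simp: restrict_def)
  qed (auto simp: discrete_def D_def set_cat_simps hom_set_cat)
  have "is_colimit (discrete A) set_cat D A ?i"
    unfolding is_colimit_def
  proof (intro conjI allI impI)
    show "is_cocone (discrete A) set_cat D A ?i"
      by (auto simp: is_cocone_def discrete_def D_def set_cat_simps hom_set_cat restrict_def split: if_splits)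
    fix B \<phi> assume c: "is_cocone (discrete A) set_cat D B \<phi>"
    have \<phi>: "fst (\<phi> x) = {x} \<and> fst (snd (\<phi> x)) = B \<and> snd (snd (\<phi> x)) \<in> {x} \<rightarrow>\<^sub>E B" if "x \<in> A" for x
      using c that by (auto simp: is_cocone_def discrete_def D_def hom_set_cat)
    define h where "h = (A, B, \<lambda>x\<in>A. snd (snd (\<phi> x)) x)"
    have h: "h \<in> hom set_cat A B" using \<phi> by (auto simp: h_def hom_set_cat)
    have comp: "t \<cdot>\<^bsub>set_cat\<^esub> ?i x = \<phi> x \<longleftrightarrow> snd (snd t) x = snd (snd (\<phi> x)) x"
      if t: "t \<in> hom set_cat A B" and x: "x \<in> A" for t x
    proof -
      obtain k where k: "t = (A, B, k)" using t by (cases t) (auto simp: hom_set_cat)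
      obtain p where p: "\<phi> x = ({x}, B, p)" using \<phi>[OF x] by (cases "\<phi> x") auto
      have "(\<lambda>y\<in>{x}. k y) = p \<longleftrightarrow> k x = p x"
      proof
        assume "k x = p x"
        then show "(\<lambda>y\<in>{x}. k y) = p" using \<phi>[OF x] p by (intro extensionalityI[of _ "{x}"]) (auto simp: PiE_def)
      qed auto
      moreover have "(\<lambda>y\<in>{x}. k ((\<lambda>y\<in>{x}. y) y)) = (\<lambda>y\<in>{x}. k y)" by (rule ext) simp
      ultimately show ?thesis unfolding k p set_cat_simps by simp
    qed
    show "\<exists>!h. h \<in> hom set_cat A B \<and> (\<forall>x\<in>Obj (discrete A). h \<cdot>\<^bsub>set_cat\<^esub> ?i x = \<phi> x)"
    proof (rule ex1I[of _ h])
      show "h \<in> hom set_cat A B \<and> (\<forall>x\<in>Obj (discrete A). h \<cdot>\<^bsub>set_cat\<^esub> ?i x = \<phi> x)"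
        using h comp[OF h] by (simp add: discrete_def) (simp add: h_def)
      fix t assume t: "t \<in> hom set_cat A B \<and> (\<forall>x\<in>Obj (discrete A). t \<cdot>\<^bsub>set_cat\<^esub> ?i x = \<phi> x)"
      then have "snd (snd t) x = snd (snd (\<phi> x)) x" if "x \<in> A" for x
        using comp[of t x] that by (simp add: discrete_def)
      then have "snd (snd t) = snd (snd h)"
        using t by (intro extensionalityI[of _ A]) (auto simp: h_def hom_set_cat PiE_def)
      then show "t = h" using t h by (simp add: hom_set_cat prod_eq_iff)
    qed
  qed
  then have "is_colimit (discrete A) V (comp_functr F D) (fob F A) (far F \<circ> ?i)"
    using F_colim D unfolding preserves_colimits_def by blast
  then have "is_coproduct V A (fob (comp_functr F D)) (fob F A) (far F \<circ> ?i)"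
  proof (rule discrete_colimit_coproduct)
    show "fob (comp_functr F D) x \<in> Obj V" "far (comp_functr F D) x = Idn V (fob (comp_functr F D) x)" for x
      using is_functorD(5)[OF F, of "{x}"] by (simp_all add: comp_functr_def D_def set_cat_simps)
  qed
  then have cp: "is_coproduct V A (\<lambda>x. fob F {x}) (fob F A) (\<lambda>x. far F (?i x))"
    by (rule coproduct_cong) (auto simp: comp_functr_def D_def)
  have "is_coproduct V A (\<lambda>_. Unit V) (fob F A) (\<lambda>x. Idn V (fob F A) \<cdot> (far F (?i x) \<cdot> point {x} x))"
  proof (rule coproduct_iso[OF cp])
    show "point {x} x \<in> hom V (Unit V) (fob F {x})" for x by (rule point_hom) simp
    show "iso V (point {x} x)" for x
    proof -
      have "inverse_arrows set_cat (const_arr {x} x) ({x}, {base}, \<lambda>_\<in>{x}. base)"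
        unfolding inverse_arrows_def const_arr_def by (auto simp: set_cat_simps hom_set_cat restrict_def)
      then have "iso V (far F (const_arr {x} x))" using functor_inverse_arrows[OF F] unfolding iso_def by blast
      moreover have "far F (const_arr {x} x) \<in> hom V (fob F {base}) (fob F {x})"
        unfolding const_arr_def by (rule F_Arr) (auto simp: set_cat_simps)
      ultimately show ?thesis unfolding point_def using unit_base homD by (intro iso_Comp) (auto simp: hom_def)
    qed
  qed (auto simp: Idn_hom)
  then show ?thesis
  proof (rule coproduct_cong)
    fix x assume x: "x \<in> A"
    then have "far F (?i x) \<cdot> point {x} x = point A x"
      using far_F_point[of "{x}" A "\<lambda>y\<in>{x}. y" x] by (auto simp: set_cat_simps)
    then show "Idn V (fob F A) \<cdot> (far F (?i x) \<cdot> point {x} x) = point A x"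
      using homD[OF point_hom[OF x]] by simp
  qed simp
qed

text \<open>The coprojection at \<open>x\<close> into the copower of \<open>v\<close> by
  \<open>A\<close>: \<open>v\<close> is identified with \<open>v \<otimes> I\<close>, and the point
  \<open>x\<close> selects the summand.\<close>

definition copow :: "'o \<Rightarrow> 'u set \<Rightarrow> 'u \<Rightarrow> 'm" where
  "copow v A x = (Idn V v \<odot> point A x) \<cdot> inv_arr V (RUnit V v)"

lemma copow_hom: "v \<in> Obj V \<Longrightarrow> x \<in> A \<Longrightarrow> copow v A x \<in> hom V v (v \<otimes> fob F A)"
  using homD[OF point_hom] by (auto simp: copow_def hom_def)

lemma copow_coproduct:
  assumes v: "v \<in> Obj V"
  shows "is_coproduct V A (\<lambda>_. v) (v \<otimes> fob F A) (copow v A)"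
proof -
  have "is_coproduct V A (\<lambda>_. v) (v \<otimes> fob F A)
      (\<lambda>x. Idn V (v \<otimes> fob F A) \<cdot> ((Idn V v \<odot> point A x) \<cdot> inv_arr V (RUnit V v)))"
    by (rule coproduct_iso[OF coproduct_TensorArr_left[OF point_coproduct v]]) (use v Idn_hom in \<open>auto simp: hom_def\<close>)
  then show ?thesis
    by (rule coproduct_cong) (use homD[OF copow_hom[OF v]] v in \<open>auto simp: copow_def\<close>)
qed

lemma copow_natural:
  assumes f: "f \<in> hom V v w" and h: "(A, B, h) \<in> Arr set_cat" and x: "x \<in> A"
  shows "(f \<odot> far F (A, B, h)) \<cdot> copow v A x = copow w B (h x) \<cdot> f"
proof -
  note f' = homD[OF f] and O = hom_Obj[OF f]
  have hx: "h x \<in> B" using h x by (auto simp: set_cat_simps)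
  note p = homD[OF point_hom[OF x]] homD[OF point_hom[OF hx]] homD[OF F_Arr[OF h]]
  have r: "(f \<odot> Idn V (Unit V)) \<cdot> inv_arr V (RUnit V v) = inv_arr V (RUnit V w) \<cdot> f"
  proof (rule iso_cancel_left[of "RUnit V w"])
    have "RUnit V w \<cdot> ((f \<odot> Idn V (Unit V)) \<cdot> inv_arr V (RUnit V v)) = (f \<cdot> RUnit V v) \<cdot> inv_arr V (RUnit V v)"
      by (rule Comp_rewrite[OF RUnit_natural[OF f]]) (use f' O in auto)
    then show "RUnit V w \<cdot> ((f \<odot> Idn V (Unit V)) \<cdot> inv_arr V (RUnit V v)) = RUnit V w \<cdot> (inv_arr V (RUnit V w) \<cdot> f)"
      using f' O by simp
  qed (use f' O in auto)
  have "(f \<odot> far F (A, B, h)) \<cdot> copow v A x = (f \<odot> point B (h x)) \<cdot> inv_arr V (RUnit V v)"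
    unfolding copow_def using f' O p by (simp add: interchange_assoc far_F_point[OF h x])
  also have "\<dots> = (Idn V w \<odot> point B (h x)) \<cdot> ((f \<odot> Idn V (Unit V)) \<cdot> inv_arr V (RUnit V v))"
    using f' O p by (simp add: interchange_assoc)
  also have "\<dots> = copow w B (h x) \<cdot> f"
    unfolding r copow_def using f' O p by simp
  finally show ?thesis .
qed

end

text \<open>There are only countably many finite lists of finite sets of naturals, so they embed
  into any infinite type.\<close>

lemma inj_code:
  assumes "infinite (UNIV :: 'u set)"
  shows "inj_on (code :: nat set list \<Rightarrow> 'u) {c. \<forall>W \<in> set c. finite W}"
proof -
  have "{c. \<forall>W \<in> set c. finite W} = lists {W :: nat set. finite W}" by (auto simp: lists_eq_set)
  then have "countable {c. \<forall>W \<in> set c. finite (W :: nat set)}"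
    using countable_lists[OF countable_Collect_finite] by simp
  then obtain e :: "nat set list \<Rightarrow> 'u" where "inj_on e {c. \<forall>W \<in> set c. finite W}"
    by (rule infinite_UNIV_inj_countable[OF assms])
  then show ?thesis unfolding code_def by (rule someI[where P = "\<lambda>e. inj_on e {c. \<forall>W \<in> set c. finite W}"])
qed

section \<open>Nerves as functors into coded sets\<close>

lemma category_Delta: "category Delta"
proof
  show "g \<cdot>\<^bsub>Delta\<^esub> f \<in> hom Delta x z" if "f \<in> hom Delta x y" "g \<in> hom Delta y z" for f g x y z
    using that by (auto simp: Delta_def hom_def sorted_iff_nth_mono subset_iff less_Suc_eq_le)
      (metis One_nat_def Suc_pred atMost_iff in_set_conv_nth le_imp_less_Suc length_greater_0_conv nth_mem order_refl)+
  show "f \<cdot>\<^bsub>Delta\<^esub> Idn Delta x = f" if f: "f \<in> hom Delta x y" for f x y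
  proof -
    obtain g where g: "f = (g, y)" "length g = Suc x" using f by (cases f; cases "fst f") (auto simp: Delta_def hom_def)
    then show ?thesis using map_nth[of g] by (simp add: Delta_def del: upt_Suc)
  qed
  show "Idn Delta y \<cdot>\<^bsub>Delta\<^esub> f = f" if f: "f \<in> hom Delta x y" for f x y
  proof -
    obtain g where g: "f = (g, y)" "set g \<subseteq> {..y}" using f by (cases f) (auto simp: Delta_def hom_def)
    have "map ((!) [0..<Suc y]) g = g" by (rule map_idI) (use g(2) in \<open>auto simp: less_Suc_eq_le simp del: upt_Suc\<close>)
    then show ?thesis using g(1) by (simp add: Delta_def del: upt_Suc)
  qed
  show "(h \<cdot>\<^bsub>Delta\<^esub> g) \<cdot>\<^bsub>Delta\<^esub> f = h \<cdot>\<^bsub>Delta\<^esub> (g \<cdot>\<^bsub>Delta\<^esub> f)"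
    if fgh: "f \<in> hom Delta w x" "g \<in> hom Delta x y" "h \<in> hom Delta y z" for f g h w x y z
  proof -
    obtain f' g' h' where e: "f = (f', x)" "g = (g', y)" "h = (h', z)" "set f' \<subseteq> {..x}" "length g' = Suc x"
      using fgh by (cases f; cases g; cases h; cases "fst g") (auto simp: Delta_def hom_def)
    have "map ((!) (map ((!) h') g')) f' = map ((!) h') (map ((!) g') f')"
      using e(4,5) by (auto simp: less_Suc_eq_le)
    then show ?thesis using e by (simp add: Delta_def)
  qed
qed (auto simp: Delta_def hom_def simp del: upt_Suc)

definition finite_chains :: "nat set list set" where
  "finite_chains = {c. \<forall>W \<in> set c. finite W}"

text \<open>\<open>code\<close> is known to be injective only on lists of finite sets, hence the
  hypothesis on \<open>A\<close>. Maps between coded sets can then be compared and composed on the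
  lists themselves.\<close>

lemma
  assumes inf: "infinite (UNIV :: 'u set)" and A: "A \<subseteq> finite_chains"
  shows inv_into_code: "c \<in> A \<Longrightarrow> inv_into A (code :: _ \<Rightarrow> 'u) (code c) = c"
    and small_map_code: "c \<in> A \<Longrightarrow> snd (snd (small_map A B h)) (code c :: 'u) = code (h c)"
    and small_map_hom: "h \<in> A \<rightarrow> B \<Longrightarrow> (small_map A B h :: 'u set \<times> 'u set \<times> ('u \<Rightarrow> 'u)) \<in> hom set_cat (code ` A) (code ` B)"
    and small_map_eqI: "t \<in> hom set_cat (code ` A) (code ` B) \<Longrightarrow> (\<And>c. c \<in> A \<Longrightarrow> snd (snd t) (code c :: 'u) = code (h c)) \<Longrightarrow>
      t = small_map A B h"
proof -
  have inj: "inj_on (code :: _ \<Rightarrow> 'u) A"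
    using inj_on_subset[OF inj_code[OF inf]] A unfolding finite_chains_def by blast
  then show i: "inv_into A (code :: _ \<Rightarrow> 'u) (code c) = c" if "c \<in> A" for c using that by simp
  then show m: "snd (snd (small_map A B h)) (code c :: 'u) = code (h c)" if "c \<in> A" for c
    using that by (simp add: small_map_def)
  show "(small_map A B h :: 'u set \<times> 'u set \<times> ('u \<Rightarrow> 'u)) \<in> hom set_cat (code ` A) (code ` B)" if "h \<in> A \<rightarrow> B"
    using that i by (auto simp: small_map_def hom_set_cat)
  show "t = small_map A B h" if t: "t \<in> hom set_cat (code ` A) (code ` B)"
    and c: "\<And>c. c \<in> A \<Longrightarrow> snd (snd t) (code c :: 'u) = code (h c)"
  proof -
    have "snd (snd t) = snd (snd (small_map A B h))"
    proof (rule extensionalityI[of _ "code ` A"])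
      show "snd (snd t) \<in> extensional (code ` A)" using t by (auto simp: hom_set_cat PiE_def)
      show "snd (snd (small_map A B h)) \<in> extensional (code ` A)" by (simp add: small_map_def)
      show "snd (snd t) x = snd (snd (small_map A B h)) x" if "x \<in> code ` A" for x using that c m by auto
    qed
    then show ?thesis using t by (simp add: hom_set_cat small_map_def prod_eq_iff)
  qed
qed

lemma small_map_Comp:
  assumes inf: "infinite (UNIV :: 'u set)" and AB: "A \<subseteq> finite_chains" "B \<subseteq> finite_chains"
    and S: "category (set_cat :: ('u set, 'u set \<times> 'u set \<times> ('u \<Rightarrow> 'u)) cat)"
    and h: "h \<in> A \<rightarrow> B" "k \<in> B \<rightarrow> C" and e: "\<And>c. c \<in> A \<Longrightarrow> k (h c) = l c"
  shows "small_map B C k \<cdot>\<^bsub>set_cat\<^esub> small_map A B h = (small_map A C l :: 'u set \<times> 'u set \<times> ('u \<Rightarrow> 'u))"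
proof (rule small_map_eqI[OF inf AB(1)])
  show "small_map B C k \<cdot>\<^bsub>set_cat\<^esub> small_map A B h \<in> hom set_cat (code ` A :: 'u set) (code ` C)"
    by (rule category.Comp_hom[OF S small_map_hom[OF inf AB(1) h(1)] small_map_hom[OF inf AB(2) h(2)]])
  fix c assume c: "c \<in> A"
  have "snd (snd (small_map B C k \<cdot>\<^bsub>set_cat\<^esub> small_map A B h)) (code c :: 'u) =
      snd (snd (small_map B C k)) (snd (snd (small_map A B h)) (code c))"
    using c by (simp add: small_map_def set_cat_simps)
  then show "snd (snd (small_map B C k \<cdot>\<^bsub>set_cat\<^esub> small_map A B h)) (code c :: 'u) = code (l c)"
    using small_map_code[OF inf AB(1) c, of B h] small_map_code[OF inf AB(2), of "h c" C k] h(1) e[OF c] c by auto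
qed

lemma chains_finite: "(\<And>W. W \<in> P \<Longrightarrow> finite W) \<Longrightarrow> chains P n \<subseteq> finite_chains"
  by (auto simp: chains_def finite_chains_def)

lemma chains_reindex:
  assumes "(f, n) \<in> Arr Delta" "c \<in> chains P n"
  shows "map ((!) c) f \<in> chains P (length f - 1)"
proof -
  have f: "f \<noteq> []" "sorted f" "set f \<subseteq> {..n}" using assms(1) by (auto simp: Delta_def)
  have c: "length c = Suc n" "sorted_wrt (\<subseteq>) c" "set c \<subseteq> P" using assms(2) by (auto simp: chains_def)
  have lt: "f ! i < length c" if "i < length f" for i using f(3) c(1) nth_mem[OF that] by auto
  have "c ! (f ! i) \<subseteq> c ! (f ! j)" if "i < j" "j < length f" for i j
  proof (cases "f ! i = f ! j")
    case False
    then have "f ! i < f ! j" using sorted_nth_mono[OF f(2), of i j] that by simp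
    then show ?thesis using sorted_wrt_nth_less[OF c(2)] lt[OF that(2)] by blast
  qed simp
  then have "sorted_wrt (\<subseteq>) (map ((!) c) f)" unfolding sorted_wrt_iff_nth_less by simp
  moreover have "set (map ((!) c) f) \<subseteq> P"
  proof
    fix W assume "W \<in> set (map ((!) c) f)"
    then obtain i where "i < length f" "W = c ! (f ! i)" by (auto simp: in_set_conv_nth)
    then show "W \<in> P" using subsetD[OF c(3) nth_mem[OF lt]] by blast
  qed
  moreover have "length (map ((!) c) f) = Suc (length f - 1)" using f(1) by (cases f) auto
  ultimately show ?thesis unfolding chains_def by blast
qed

lemma functor_nerve:
  assumes inf: "infinite (UNIV :: 'u set)" and P: "\<And>W. W \<in> P \<Longrightarrow> finite W"
    and S: "category (set_cat :: ('u set, 'u set \<times> 'u set \<times> ('u \<Rightarrow> 'u)) cat)"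
  shows "is_functor (op_cat Delta) (set_cat :: ('u set, 'u set \<times> 'u set \<times> ('u \<Rightarrow> 'u)) cat) (nerve P)"
  unfolding is_functor_def
proof (intro conjI ballI impI S category_op_cat category_Delta)
  note ch = chains_finite[OF P]
  show "fob (nerve P) x \<in> Obj (set_cat :: ('u set, _) cat)" for x by (simp add: set_cat_simps)
  show "far (nerve P) \<theta> \<in> hom set_cat (fob (nerve P) (Dom (op_cat Delta) \<theta>)) (fob (nerve P) (Cod (op_cat Delta) \<theta>) :: 'u set)"
    if "\<theta> \<in> Arr (op_cat Delta)" for \<theta>
  proof -
    obtain f n where t: "\<theta> = (f, n)" by (cases \<theta>)
    have "(small_map (chains P n) (chains P (length f - 1)) (\<lambda>c. map ((!) c) f) :: 'u set \<times> 'u set \<times> ('u \<Rightarrow> 'u)) \<in>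
        hom set_cat (code ` chains P n) (code ` chains P (length f - 1))"
      by (rule small_map_hom[OF inf ch]) (use chains_reindex[of f n] that t in auto)
    then show ?thesis by (simp add: t nerve_def Delta_def)
  qed
  show "far (nerve P) (Idn (op_cat Delta) n) = Idn set_cat (fob (nerve P) n :: 'u set)" for n
  proof -
    have I: "Idn set_cat (code ` chains P n :: 'u set) \<in> hom set_cat (code ` chains P n) (code ` chains P n)"
      by (auto simp: set_cat_simps hom_set_cat)
    have "Idn set_cat (code ` chains P n :: 'u set) = small_map (chains P n) (chains P n) (\<lambda>c. map ((!) c) [0..<Suc n])"
    proof (rule small_map_eqI[OF inf ch I])
      fix c assume c: "c \<in> chains P n"
      then have "map ((!) c) [0..<Suc n] = c" using map_nth[of c] by (simp add: chains_def del: upt_Suc)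
      then show "snd (snd (Idn set_cat (code ` chains P n :: 'u set))) (code c) = code (map ((!) c) [0..<Suc n])"
        using c by (simp add: set_cat_simps del: upt_Suc)
    qed
    then show ?thesis by (simp add: nerve_def Delta_def del: upt_Suc)
  qed
  show "far (nerve P) (\<theta>' \<cdot>\<^bsub>op_cat Delta\<^esub> \<theta>) = (far (nerve P) \<theta>' \<cdot>\<^bsub>set_cat\<^esub> far (nerve P) \<theta> :: 'u set \<times> 'u set \<times> ('u \<Rightarrow> 'u))"
    if t: "\<theta> \<in> Arr (op_cat Delta)" "\<theta>' \<in> Arr (op_cat Delta)" "Cod (op_cat Delta) \<theta> = Dom (op_cat Delta) \<theta>'" for \<theta> \<theta>'
  proof -
    obtain f n f' m where e: "\<theta> = (f, n)" "\<theta>' = (f', m)" by (cases \<theta>; cases \<theta>')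
    then have m: "m = length f - 1" "(f, n) \<in> Arr Delta" "(f', m) \<in> Arr Delta" using t by (auto simp: Delta_def)
    have "small_map (chains P m) (chains P (length f' - 1)) (\<lambda>c. map ((!) c) f') \<cdot>\<^bsub>set_cat\<^esub>
        small_map (chains P n) (chains P m) (\<lambda>c. map ((!) c) f) =
        (small_map (chains P n) (chains P (length f' - 1)) (\<lambda>c. map ((!) c) (map ((!) f) f')) :: 'u set \<times> 'u set \<times> ('u \<Rightarrow> 'u))"
    proof (rule small_map_Comp[OF inf ch ch S])
      show "(\<lambda>c. map ((!) c) f) \<in> chains P n \<rightarrow> chains P m" "(\<lambda>c. map ((!) c) f') \<in> chains P m \<rightarrow> chains P (length f' - 1)"
        using chains_reindex[OF m(2)] chains_reindex[OF m(3)] m(1) by auto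
      have "f \<noteq> []" "set f' \<subseteq> {..length f - 1}" using m by (auto simp: Delta_def)
      then have "\<forall>i \<in> set f'. i < length f" by (cases f) (auto simp: less_Suc_eq_le)
      then show "map ((!) (map ((!) c) f)) f' = map ((!) c) (map ((!) f) f')" for c :: "nat set list" by auto
    qed
    then show ?thesis using m(1) by (simp add: e nerve_def Delta_def)
  qed
qed

lemma nerve_map_eq: "nerve_map (T, U, f) n = small_map (flag_chains n T) (flag_chains n U) (push f)"
  by (simp add: nerve_map_def flag_chains_def push_def[abs_def])

lemma flag_chains_finite: "flag_chains n T \<subseteq> finite_chains"
  by (cases T) (auto simp: flag_chains_def chains_def finite_chains_def nec_poset_def intro: finite_subset[OF _ finite_atMost])

section \<open>The coend\<close>

locale categorification = nondeg_templicial V S X Xnd + copower_functor V F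
  for V :: "('o, 'm, 'z) sym_mon_cat_scheme" (structure) and S :: "'u set"
    and X :: "('u, 'o, 'm) templicial" and Xnd :: "nat \<Rightarrow> ('u, 'o) quiver"
    and F :: "('u set, 'u set \<times> 'u set \<times> ('u \<Rightarrow> 'u), 'o, 'm) functr" +
  fixes a b :: 'u
  assumes a: "a \<in> S" and b: "b \<in> S"
begin

definition N :: "necklace \<Rightarrow> 'o" where
  "N T = fob (nec_functor Q X) T (a, b)"

definition Nar :: "nec_arr \<Rightarrow> 'm" where
  "Nar f = quiv_comp (far (nec_functor Q X) f) (a, b)"

definition Nnd :: "nat set \<Rightarrow> 'o" where
  "Nnd T = nec_prod Q Xnd T (a, b)"

definition inc :: "nat set \<Rightarrow> 'm" where
  "inc T = quiv_comp (nd_arr T) (a, b)"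

lemma ab: "(a, b) \<in> S \<times> S"
  using a b by simp

lemma N_Obj: "T \<in> Obj Nec \<Longrightarrow> N T \<in> Obj V"
  unfolding N_def using is_functorD(3)[OF X.functor_nec_functor, of T] by (intro Obj_Quiv[OF _ ab]) simp

lemma Nar_hom: "f \<in> Arr Nec \<Longrightarrow> Nar f \<in> hom V (N (Cod Nec f)) (N (Dom Nec f))"
  unfolding N_def Nar_def using is_functorD(4)[OF X.functor_nec_functor, of f] by (intro quiv_comp_hom[OF _ ab]) simp

lemma Nar_Comp: "f \<in> Arr Nec \<Longrightarrow> g \<in> Arr Nec \<Longrightarrow> Cod Nec f = Dom Nec g \<Longrightarrow> Nar (g \<cdot>\<^bsub>Nec\<^esub> f) = Nar f \<cdot> Nar g"
  using is_functorD(6)[OF X.functor_nec_functor, of g f] by (simp add: Nar_def quiv_comp_Comp[OF ab])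

lemma Nar_Idn: "T \<in> Obj Nec \<Longrightarrow> Nar (Idn Nec T) = Idn V (N T)"
  using is_functorD(5)[OF X.functor_nec_functor, of T] by (simp add: Nar_def N_def quiv_comp_Idn[OF ab])

lemma inc_hom: "inc T \<in> hom V (Nnd T) (N (T, p))"
  unfolding inc_def Nnd_def N_def by (rule quiv_comp_hom[OF nd_arr_hom ab])

lemma N_coproduct:
  assumes "(T, p) \<in> Obj Nec"
  shows "is_coproduct V (surjs p) (\<lambda>f. Nnd ((!) f ` T)) (N (T, p))
    (\<lambda>f. Nar ((T, p), ((!) f ` T, last f), f) \<cdot> inc ((!) f ` T))"
  unfolding Nnd_def N_def Nar_def inc_def
  by (rule coproduct_cong[OF coproduct_Quiv_pointwise[OF necklace_coproduct[OF assms] ab]])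
    (simp_all add: quiv_comp_Comp[OF ab])

text \<open>By the co-Yoneda lemma a cowedge at level \<open>n\<close> is a compatible family of arrows out of
  the \<open>N T\<close>, one for each flag on \<open>T\<close>.\<close>

definition compatible :: "nat \<Rightarrow> 'o \<Rightarrow> (necklace \<times> nat set list \<Rightarrow> 'm) \<Rightarrow> bool" where
  "compatible n x k \<longleftrightarrow> (\<forall>T \<in> Obj Nec. \<forall>c \<in> flag_chains n T. k (T, c) \<in> hom V (N T) x) \<and>
     (\<forall>T U f. (T, U, f) \<in> Arr Nec \<longrightarrow> (\<forall>c \<in> flag_chains n T. k (U, push f c) = k (T, c) \<cdot> Nar (T, U, f)))"

lemma compatibleD:
  assumes "compatible n x k"
  shows "T \<in> Obj Nec \<Longrightarrow> c \<in> flag_chains n T \<Longrightarrow> k (T, c) \<in> hom V (N T) x"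
    "(T, U, f) \<in> Arr Nec \<Longrightarrow> c \<in> flag_chains n T \<Longrightarrow> k (U, push f c) = k (T, c) \<cdot> Nar (T, U, f)"
  using assms unfolding compatible_def by blast+

lemma compatible_eqI:
  assumes k: "compatible n x k" and k': "compatible n x k'"
    and eq: "\<And>T p c. ((T, p), c) \<in> flanked_flags n \<Longrightarrow> k ((T, p), c) \<cdot> inc T = k' ((T, p), c) \<cdot> inc T"
    and T: "T \<in> Obj Nec" and c: "c \<in> flag_chains n T"
  shows "k (T, c) = k' (T, c)"
proof -
  \<comment> \<open>On the summand of a surjection \<open>f\<close>, compatibility moves both
    families to the flanked flag \<open>push f d\<close> on the image necklace, restricted to the
    nondegenerate part there, where they agree by assumption. No induction is involved, as the
    assumption covers all flanked flags at once.\<close>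
  have flanked: "k ((R, q), d) = k' ((R, q), d)" if d: "((R, q), d) \<in> flanked_flags n" for R q d
  proof -
    have R: "(R, q) \<in> Obj Nec" "d \<in> flag_chains n (R, q)" using d by (auto simp: flanked_flags_iff)
    show ?thesis
    proof (rule coproduct_eqI[OF N_coproduct[OF R(1)] compatibleD(1)[OF k R] compatibleD(1)[OF k' R]])
      fix f assume f: "f \<in> surjs q"
      note A = surjs_Arr_Nec[OF R(1) f]
      have h: "Nar ((R, q), ((!) f ` R, last f), f) \<in> hom V (N ((!) f ` R, last f)) (N (R, q))"
        using Nar_hom[OF A] by (simp add: Nec_simps(3,4))
      have "m ((R, q), d) \<cdot> Nar ((R, q), ((!) f ` R, last f), f) \<cdot> inc ((!) f ` R) =
          m (((!) f ` R, last f), push f d) \<cdot> inc ((!) f ` R)" if m: "compatible n x m" for m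
        unfolding compatibleD(2)[OF m A R(2)]
        by (rule Comp_assoc[OF inc_hom h compatibleD(1)[OF m R], symmetric])
      from this[OF k] this[OF k'] show "k ((R, q), d) \<cdot> Nar ((R, q), ((!) f ` R, last f), f) \<cdot> inc ((!) f ` R) =
          k' ((R, q), d) \<cdot> Nar ((R, q), ((!) f ` R, last f), f) \<cdot> inc ((!) f ` R)"
        using eq[OF push_flanked[OF d f]] by simp
    qed
  qed
  obtain T' p where Tp: "T = (T', p)" by (cases T)
  note r = root_Arr[OF T[unfolded Tp] c[unfolded Tp]] pull_flanked[OF T[unfolded Tp] c[unfolded Tp]]
  obtain R q where R: "root c = (R, q)" by (cases "root c")
  have d: "pull c \<in> flag_chains n (R, q)" using r(2) unfolding R by (auto simp: flanked_flags_iff)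
  have "m (T, c) = m ((R, q), pull c) \<cdot> Nar ((R, q), T, span c)" if m: "compatible n x m" for m
    using compatibleD(2)[OF m r(1)[unfolded R] d] unfolding push_pull[OF T[unfolded Tp] c[unfolded Tp]] Tp .
  from this[OF k] this[OF k'] show ?thesis using flanked[OF r(2)[unfolded R]] by simp
qed

definition is_family :: "nat \<Rightarrow> 'o \<Rightarrow> (necklace \<times> nat set list \<Rightarrow> 'm) \<Rightarrow> bool" where
  "is_family n x h \<longleftrightarrow> x \<in> Obj V \<and> (\<forall>T p c. ((T, p), c) \<in> flanked_flags n \<longrightarrow> h ((T, p), c) \<in> hom V (Nnd T) x)"

text \<open>The value forced by compatibility: on the summand of \<open>f\<close> it must be
  \<open>h\<close> at the flag \<open>push f c\<close>, which is flanked again.\<close>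

definition ext :: "'o \<Rightarrow> (necklace \<times> nat set list \<Rightarrow> 'm) \<Rightarrow> necklace \<times> nat set list \<Rightarrow> 'm" where
  "ext x h = (\<lambda>((T, p), c). SOME e. e \<in> hom V (N (T, p)) x \<and>
     (\<forall>f \<in> surjs p. e \<cdot> Nar ((T, p), ((!) f ` T, last f), f) \<cdot> inc ((!) f ` T) = h (((!) f ` T, last f), push f c)))"

text \<open>Forced likewise, since \<open>c\<close> is the image of the flanked flag
  \<open>pull c\<close> under \<open>span c\<close>.\<close>

definition full :: "'o \<Rightarrow> (necklace \<times> nat set list \<Rightarrow> 'm) \<Rightarrow> necklace \<times> nat set list \<Rightarrow> 'm" where
  "full x h = (\<lambda>(T, c). ext x h (root c, pull c) \<cdot> Nar (root c, T, span c))"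

lemma ext:
  assumes h: "is_family n x h" and c: "((T, p), c) \<in> flanked_flags n"
  shows ext_hom: "ext x h ((T, p), c) \<in> hom V (N (T, p)) x"
    and ext_restrict: "f \<in> surjs p \<Longrightarrow> ext x h ((T, p), c) \<cdot> Nar ((T, p), ((!) f ` T, last f), f) \<cdot> inc ((!) f ` T) =
      h (((!) f ` T, last f), push f c)"
proof -
  have T: "(T, p) \<in> Obj Nec" using c by (auto simp: flanked_flags_iff)
  have x: "x \<in> Obj V" using h by (simp add: is_family_def)
  have hf: "h (((!) f ` T, last f), push f c) \<in> hom V (Nnd ((!) f ` T)) x" if "f \<in> surjs p" for f
    using h push_flanked[OF c that] by (simp add: is_family_def)
  obtain e where "e \<in> hom V (N (T, p)) x"
    "\<And>f. f \<in> surjs p \<Longrightarrow> e \<cdot> Nar ((T, p), ((!) f ` T, last f), f) \<cdot> inc ((!) f ` T) = h (((!) f ` T, last f), push f c)"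
    by (rule coproduct_ex[OF N_coproduct[OF T] x, of "\<lambda>f. h (((!) f ` T, last f), push f c)"]) (rule hf, assumption, rule that)
  then have "\<exists>e. e \<in> hom V (N (T, p)) x \<and>
     (\<forall>f \<in> surjs p. e \<cdot> Nar ((T, p), ((!) f ` T, last f), f) \<cdot> inc ((!) f ` T) = h (((!) f ` T, last f), push f c))"
    by (intro exI[of _ e] conjI ballI)
  note e = someI_ex[OF this]
  show "ext x h ((T, p), c) \<in> hom V (N (T, p)) x"
    "f \<in> surjs p \<Longrightarrow> ext x h ((T, p), c) \<cdot> Nar ((T, p), ((!) f ` T, last f), f) \<cdot> inc ((!) f ` T) =
      h (((!) f ` T, last f), push f c)"
    unfolding ext_def case_prod_conv by (rule conjunct1[OF e], rule bspec[OF conjunct2[OF e]])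
qed

text \<open>Both sides have the same components: on the summand of \<open>f\<close> they are
  \<open>h\<close> at the image of \<open>c\<close> under the composite of \<open>g\<close> and
  \<open>f\<close>.\<close>

lemma ext_push:
  assumes h: "is_family n x h" and c: "((T, p), c) \<in> flanked_flags n" and g: "g \<in> surjs p"
  shows "ext x h ((T, p), c) \<cdot> Nar ((T, p), ((!) g ` T, last g), g) = ext x h (((!) g ` T, last g), push g c)"
proof -
  let ?U = "(!) g ` T"
  have T: "(T, p) \<in> Obj Nec" "T \<subseteq> {..p}" "c \<in> flag_chains n (T, p)" using c by (auto simp: flanked_flags_iff Nec_simps)
  note d = push_flanked[OF c g] and A = surjs_Arr_Nec[OF T(1) g]
  have U: "(?U, last g) \<in> Obj Nec" using d by (auto simp: flanked_flags_iff)
  have e: "ext x h ((T, p), c) \<in> hom V (N (T, p)) x" by (rule ext_hom[OF h c])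
  have Ng: "Nar ((T, p), (?U, last g), g) \<in> hom V (N (?U, last g)) (N (T, p))" using Nar_hom[OF A] by (simp add: Nec_simps(3,4))
  show ?thesis
  proof (rule coproduct_eqI[OF N_coproduct[OF U] Comp_hom[OF Ng e] ext_hom[OF h d]])
    fix f assume f: "f \<in> surjs (last g)"
    have gf: "map ((!) f) g \<in> surjs p" "last (map ((!) f) g) = last f" using Comp_surjs[OF g f] by auto
    have lg: "length g = Suc p" using g by (simp add: surjs_iff)
    have im: "(!) (map ((!) f) g) ` T = (!) f ` ?U" using T(2) lg by (auto simp: image_image intro!: image_cong)
    have pu: "push (map ((!) f) g) c = push f (push g c)"
      by (rule push_Comp) (use T(3) lg in \<open>auto simp: flag_chains_iff subset_iff less_Suc_eq_le\<close>)
    note B = surjs_Arr_Nec[OF U f]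
    have Nf: "Nar ((?U, last g), ((!) f ` ?U, last f), f) \<in> hom V (N ((!) f ` ?U, last f)) (N (?U, last g))"
      using Nar_hom[OF B] by (simp add: Nec_simps(3,4))
    have comp: "Nar ((T, p), ((!) f ` ?U, last f), map ((!) f) g) =
        Nar ((T, p), (?U, last g), g) \<cdot> Nar ((?U, last g), ((!) f ` ?U, last f), f)"
      using Nar_Comp[OF A B] by (simp add: Nec_simps(3,4,6))
    have "(ext x h ((T, p), c) \<cdot> Nar ((T, p), (?U, last g), g)) \<cdot> Nar ((?U, last g), ((!) f ` ?U, last f), f) \<cdot> inc ((!) f ` ?U) =
        ext x h ((T, p), c) \<cdot> Nar ((T, p), ((!) f ` ?U, last f), map ((!) f) g) \<cdot> inc ((!) f ` ?U)"
      unfolding comp using homD[OF e] homD[OF Ng] homD[OF Nf] homD[OF inc_hom[of "(!) f ` ?U" "last f"]] by simp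
    also have "\<dots> = h (((!) f ` ?U, last f), push f (push g c))"
      using ext_restrict[OF h c gf(1)] unfolding gf(2) im pu .
    also have "\<dots> = ext x h ((?U, last g), push g c) \<cdot> Nar ((?U, last g), ((!) f ` ?U, last f), f) \<cdot> inc ((!) f ` ?U)"
      by (rule ext_restrict[OF h d f, symmetric])
    finally show "(ext x h ((T, p), c) \<cdot> Nar ((T, p), (?U, last g), g)) \<cdot> Nar ((?U, last g), ((!) f ` ?U, last f), f) \<cdot> inc ((!) f ` ?U) =
        ext x h ((?U, last g), push g c) \<cdot> Nar ((?U, last g), ((!) f ` ?U, last f), f) \<cdot> inc ((!) f ` ?U)" .
  qed
qed

text \<open>By \<open>span_natural\<close>, \<open>g\<close> after \<open>span c\<close> equals the
  span of the image flag after a surjection between the roots. Functoriality of N moves the action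
  along this square, and \<open>ext_push\<close> deals with the surjection.\<close>

lemma compatible_full:
  assumes h: "is_family n x h"
  shows "compatible n x (full x h)"
  unfolding compatible_def
proof (intro conjI ballI allI impI)
  fix T c assume T: "T \<in> Obj Nec" and c: "c \<in> flag_chains n T"
  obtain T' p where Tp: "T = (T', p)" by (cases T)
  note r = root_Arr[OF T[unfolded Tp] c[unfolded Tp]] pull_flanked[OF T[unfolded Tp] c[unfolded Tp]]
  obtain R q where R: "root c = (R, q)" by (cases "root c")
  have "Nar (root c, T, span c) \<in> hom V (N T) (N (R, q))" using Nar_hom[OF r(1)] by (simp add: Nec_simps(3,4) Tp R)
  from Comp_hom[OF this ext_hom[OF h r(2)[unfolded R]]]
  show "full x h (T, c) \<in> hom V (N T) x" by (simp add: full_def R)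
next
  fix T U g c assume g: "(T, U, g) \<in> Arr Nec" and c: "c \<in> flag_chains n T"
  obtain T' p U' q where TU: "T = (T', p)" "U = (U', q)" by (cases T; cases U)
  have O: "(T', p) \<in> Obj Nec" "(U', q) \<in> Obj Nec" using g by (auto simp: Nec_simps TU)
  have d: "push g c \<in> flag_chains n (U', q)" by (rule push_chain[OF g[unfolded TU] c[unfolded TU]])
  note rc = root_Arr[OF O(1) c[unfolded TU]] pull_flanked[OF O(1) c[unfolded TU]]
  note rd = root_Arr[OF O(2) d] pull_flanked[OF O(2) d]
  obtain g' where g': "g' \<in> surjs (length (span c) - 1)" "map ((!) (span (push g c))) g' = map ((!) g) (span c)"
    "push g' (pull c) = pull (push g c)" "((!) g' ` fst (root c), last g') = root (push g c)"
    by (rule span_natural[OF g[unfolded TU] c[unfolded TU]])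
  obtain R r where R: "root c = (R, r)" by (cases "root c")
  have r: "r = length (span c) - 1" using R by (simp add: root_def)
  have RO: "(R, r) \<in> Obj Nec" using rc(2) unfolding R by (auto simp: flanked_flags_iff)
  have D: "root (push g c) = ((!) g' ` R, last g')" using g'(4) by (simp add: R)
  have A: "((R, r), ((!) g' ` R, last g'), g') \<in> Arr Nec" by (rule surjs_Arr_Nec[OF RO g'(1)[folded r]])
  note rc' = rc[unfolded R] and rd' = rd[unfolded D]
  have e: "ext x h ((R, r), pull c) \<in> hom V (N (R, r)) x" by (rule ext_hom[OF h rc'(2)])
  have n1: "Nar ((R, r), (T', p), span c) \<in> hom V (N (T', p)) (N (R, r))"
    using Nar_hom[OF rc'(1)] by (simp add: Nec_simps(3,4))
  have n2: "Nar ((T', p), (U', q), g) \<in> hom V (N (U', q)) (N (T', p))"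
    using Nar_hom[OF g] by (simp add: Nec_simps(3,4) TU)
  have n3: "Nar ((R, r), ((!) g' ` R, last g'), g') \<in> hom V (N ((!) g' ` R, last g')) (N (R, r))"
    using Nar_hom[OF A] by (simp add: Nec_simps(3,4))
  have n4: "Nar (((!) g' ` R, last g'), (U', q), span (push g c)) \<in> hom V (N (U', q)) (N ((!) g' ` R, last g'))"
    using Nar_hom[OF rd'(1)] by (simp add: Nec_simps(3,4))
  have "full x h (T, c) \<cdot> Nar (T, U, g) = ext x h ((R, r), pull c) \<cdot> (Nar ((R, r), (T', p), span c) \<cdot> Nar ((T', p), (U', q), g))"
    unfolding full_def case_prod_conv R TU by (rule Comp_assoc[OF n2 n1 e])
  also have "Nar ((R, r), (T', p), span c) \<cdot> Nar ((T', p), (U', q), g) = Nar ((R, r), (U', q), map ((!) g) (span c))"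
    using Nar_Comp[OF rc'(1) g[unfolded TU]] by (simp add: Nec_simps(3,4,6))
  also have "\<dots> = Nar ((R, r), ((!) g' ` R, last g'), g') \<cdot> Nar (((!) g' ` R, last g'), (U', q), span (push g c))"
    using Nar_Comp[OF A rd'(1)] by (simp add: Nec_simps(3,4,6) g'(2))
  also have "ext x h ((R, r), pull c) \<cdot> \<dots> = (ext x h ((R, r), pull c) \<cdot> Nar ((R, r), ((!) g' ` R, last g'), g')) \<cdot>
      Nar (((!) g' ` R, last g'), (U', q), span (push g c))"
    by (rule Comp_assoc[OF n4 n3 e, symmetric])
  also have "ext x h ((R, r), pull c) \<cdot> Nar ((R, r), ((!) g' ` R, last g'), g') = ext x h (((!) g' ` R, last g'), pull (push g c))"
    using ext_push[OF h rc'(2) g'(1)[folded r]] unfolding g'(3) .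
  finally show "full x h (U, push g c) = full x h (T, c) \<cdot> Nar (T, U, g)"
    by (simp add: full_def D TU)
qed

lemma full_inc:
  assumes h: "is_family n x h" and c: "((T, p), c) \<in> flanked_flags n"
  shows "full x h ((T, p), c) \<cdot> inc T = h ((T, p), c)"
proof -
  have T: "(T, p) \<in> Obj Nec" "T \<subseteq> {..p}" "c \<in> flag_chains n (T, p)" using c by (auto simp: flanked_flags_iff Nec_simps)
  have e: "ext x h ((T, p), c) \<in> hom V (N (T, p)) x" by (rule ext_hom[OF h c])
  have im: "(!) [0..<Suc p] ` T = T" by (rule nth_Idn_image[OF T(2)])
  have pu: "push [0..<Suc p] c = c" by (rule push_Idn) (use T(3) in \<open>auto simp: flag_chains_iff\<close>)
  have l: "last [0..<Suc p] = p" by simp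
  have "full x h ((T, p), c) = ext x h ((T, p), c) \<cdot> Nar ((T, p), (T, p), [0..<Suc p])"
    unfolding full_def case_prod_conv span_flanked[OF c] ..
  moreover have "ext x h ((T, p), c) \<cdot> Nar ((T, p), (T, p), [0..<Suc p]) \<cdot> inc T = h ((T, p), c)"
    using ext_restrict[OF h c Idn_surjs] unfolding im pu l .
  moreover have N: "Nar ((T, p), (T, p), [0..<Suc p]) = Idn V (N (T, p))"
    using Nar_Idn[OF T(1)] by (simp add: Nec_simps(5) del: upt_Suc)
  ultimately show ?thesis using homD[OF e] homD[OF inc_hom[of T p]] by simp
qed

section \<open>The integrand as a functor\<close>

lemma set_category: "category (set_cat :: ('u set, 'u set \<times> 'u set \<times> ('u \<Rightarrow> 'u)) cat)"
  by (rule is_functorD(1)[OF F])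

lemma nerve_map_hom:
  assumes "(T, U, f) \<in> Arr Nec"
  shows "(nerve_map (T, U, f) n :: 'u set \<times> 'u set \<times> ('u \<Rightarrow> 'u)) \<in> hom set_cat (code ` flag_chains n T) (code ` flag_chains n U)"
proof -
  obtain T' p U' q where TU: "T = (T', p)" "U = (U', q)" by (cases T; cases U)
  show ?thesis unfolding nerve_map_eq
    by (rule small_map_hom[OF infinite_universe flag_chains_finite]) (use push_chain[OF assms[unfolded TU]] TU in auto)
qed

lemma copow_nerve_map:
  assumes f: "g \<in> hom V v w" and t: "(T, U, f) \<in> Arr Nec" and c: "c \<in> flag_chains n T"
  shows "(g \<odot> far F (nerve_map (T, U, f) n)) \<cdot> copow v (code ` flag_chains n T) (code c) =
    copow w (code ` flag_chains n U) (code (push f c)) \<cdot> g"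
proof -
  let ?A = "code ` flag_chains n T :: 'u set" and ?B = "code ` flag_chains n U :: 'u set"
  obtain h where h: "nerve_map (T, U, f) n = (?A, ?B, h)" "h \<in> ?A \<rightarrow>\<^sub>E ?B"
    using nerve_map_hom[OF t, of n] by (cases "nerve_map (T, U, f) n :: 'u set \<times> 'u set \<times> ('u \<Rightarrow> 'u)") (auto simp: hom_set_cat)
  have "h (code c) = code (push f c)"
    using small_map_code[OF infinite_universe flag_chains_finite c, of "flag_chains n U" "push f"] h(1)[unfolded nerve_map_eq] by simp
  moreover have "(?A, ?B, h) \<in> Arr set_cat" using h(2) by (simp add: set_cat_simps)
  ultimately show ?thesis unfolding h(1) using copow_natural[OF f, of ?A ?B h "code c"] c by simp
qed

abbreviation H where "H \<equiv> hom_integrand V S F X a b"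

lemma H_obj: "fob H (T, U) = act_obj V (N T) (comp_functr F (nerve (nec_poset U)))"
  by (simp add: hom_integrand_def hom_integrand_obj_def N_def)

lemma H_arr: "far H (f, g) = (fob H (Cod Nec f, Dom Nec g), fob H (Dom Nec f, Cod Nec g), \<lambda>n. Nar f \<odot> far F (nerve_map g n))"
  by (simp add: hom_integrand_def Nar_def)

lemma H_obj_at: "fob (fob H (T, U)) n = N T \<otimes> fob F (code ` flag_chains n U)"
  by (simp add: H_obj act_obj_def comp_functr_def nerve_def flag_chains_def)

lemma F_Arr': "t \<in> hom set_cat A B \<Longrightarrow> far F t \<in> hom V (fob F A) (fob F B)"
  using is_functorD(4)[OF F, of t] by (auto simp: hom_def)

lemma F_Comp': "s \<in> hom set_cat A B \<Longrightarrow> t \<in> hom set_cat B C \<Longrightarrow> far F (t \<cdot>\<^bsub>set_cat\<^esub> s) = far F t \<cdot> far F s"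
  using is_functorD(6)[OF F, of s t] by (auto simp: hom_def)

lemma functor_nerve_poset: "is_functor (op_cat Delta) set_cat (nerve (nec_poset U) :: (_, _, 'u set, _) functr)"
  by (rule functor_nerve[OF infinite_universe _ set_category])
    (auto simp: nec_poset_def intro: finite_subset[OF _ finite_atMost] split: prod.splits)

lemma functor_H_obj:
  assumes "T \<in> Obj Nec"
  shows "is_functor (op_cat Delta) V (fob H (T, U))"
  unfolding is_functor_def
proof (intro conjI ballI impI category_op_cat category_Delta category_axioms)
  let ?n = "nerve (nec_poset U) :: (_, _, 'u set, _) functr"
  note n = functor_nerve_poset[of U] and NT = N_Obj[OF assms]
  have e: "fob (fob H (T, U)) k = N T \<otimes> fob F (fob ?n k)" "far (fob H (T, U)) \<theta> = Idn V (N T) \<odot> far F (far ?n \<theta>)" for k \<theta>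
    by (simp_all add: H_obj act_obj_def comp_functr_def)
  show "fob (fob H (T, U)) k \<in> Obj V" for k using NT by (simp add: e)
  have h: "far F (far ?n \<theta>) \<in> hom V (fob F (fob ?n (Dom (op_cat Delta) \<theta>))) (fob F (fob ?n (Cod (op_cat Delta) \<theta>)))"
    if "\<theta> \<in> Arr (op_cat Delta)" for \<theta>
    by (rule F_Arr'[OF is_functorD(4)[OF n that]])
  show "far (fob H (T, U)) \<theta> \<in> hom V (fob (fob H (T, U)) (Dom (op_cat Delta) \<theta>)) (fob (fob H (T, U)) (Cod (op_cat Delta) \<theta>))"
    if "\<theta> \<in> Arr (op_cat Delta)" for \<theta>
    unfolding e by (rule TensorArr_hom[OF Idn_hom[OF NT] h[OF that]])
  show "far (fob H (T, U)) (Idn (op_cat Delta) k) = Idn V (fob (fob H (T, U)) k)" if "k \<in> Obj (op_cat Delta)" for k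
    unfolding e is_functorD(5)[OF n that] using is_functorD(5)[OF F, of "fob ?n k"] NT by (simp add: set_cat_simps(1))
  show "far (fob H (T, U)) (\<theta>' \<cdot>\<^bsub>op_cat Delta\<^esub> \<theta>) = far (fob H (T, U)) \<theta>' \<cdot> far (fob H (T, U)) \<theta>"
    if t: "\<theta> \<in> Arr (op_cat Delta)" "\<theta>' \<in> Arr (op_cat Delta)" "Cod (op_cat Delta) \<theta> = Dom (op_cat Delta) \<theta>'" for \<theta> \<theta>'
  proof -
    have "far F (far ?n (\<theta>' \<cdot>\<^bsub>op_cat Delta\<^esub> \<theta>)) = far F (far ?n \<theta>') \<cdot> far F (far ?n \<theta>)"
      unfolding is_functorD(6)[OF n t]
      by (rule F_Comp'[OF is_functorD(4)[OF n t(1)]]) (use is_functorD(4)[OF n t(2)] t(3) in simp)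
    then show ?thesis unfolding e using homD[OF h[OF t(1)]] homD[OF h[OF t(2)]] t(3) NT by (simp add: interchange)
  qed
qed

lemma nerve_map_natural:
  assumes g: "(T, U, g) \<in> Arr Nec" and \<theta>: "\<theta> \<in> Arr Delta"
  shows "far (nerve (nec_poset U)) \<theta> \<cdot>\<^bsub>set_cat\<^esub> nerve_map (T, U, g) (Cod Delta \<theta>) =
    (nerve_map (T, U, g) (Dom Delta \<theta>) \<cdot>\<^bsub>set_cat\<^esub> far (nerve (nec_poset T)) \<theta> :: 'u set \<times> 'u set \<times> ('u \<Rightarrow> 'u))"
proof -
  obtain f n where t: "\<theta> = (f, n)" by (cases \<theta>)
  obtain T' p U' q where TU: "T = (T', p)" "U = (U', q)" by (cases T; cases U)
  have pc: "push g c \<in> flag_chains k U" if "c \<in> flag_chains k T" for c k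
    using push_chain[OF g[unfolded TU]] that TU by simp
  have r: "map ((!) c) f \<in> flag_chains (length f - 1) Z" if "c \<in> flag_chains n Z" for c Z
    using chains_reindex[OF \<theta>[unfolded t]] that by (simp add: flag_chains_def)
  have f: "set f \<subseteq> {..n}" using \<theta> t by (auto simp: Delta_def)
  have "small_map (flag_chains n U) (flag_chains (length f - 1) U) (\<lambda>c. map ((!) c) f) \<cdot>\<^bsub>set_cat\<^esub> small_map (flag_chains n T) (flag_chains n U) (push g) =
      (small_map (flag_chains n T) (flag_chains (length f - 1) U) (\<lambda>c. map ((!) (push g c)) f) :: 'u set \<times> 'u set \<times> ('u \<Rightarrow> 'u))"
    by (rule small_map_Comp[OF infinite_universe flag_chains_finite flag_chains_finite set_category]) (use pc r in auto)
  also have "\<dots> = small_map (flag_chains (length f - 1) T) (flag_chains (length f - 1) U) (push g) \<cdot>\<^bsub>set_cat\<^esub> small_map (flag_chains n T) (flag_chains (length f - 1) T) (\<lambda>c. map ((!) c) f)"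
  proof (rule small_map_Comp[OF infinite_universe flag_chains_finite flag_chains_finite set_category, symmetric])
    fix c assume "c \<in> flag_chains n T"
    then have "length c = Suc n" using TU by (auto simp: flag_chains_iff)
    then have "\<forall>i \<in> set f. i < length c" using f by (auto simp: less_Suc_eq_le)
    then show "push g (map ((!) c) f) = map ((!) (push g c)) f" by (auto simp: push_def)
  qed (use pc r in auto)
  finally show ?thesis unfolding t nerve_map_eq by (simp add: nerve_def Delta_def flag_chains_def)
qed

lemma fob_nerve: "fob (nerve (nec_poset T)) n = (code ` flag_chains n T :: 'u set)"
  by (simp add: nerve_def flag_chains_def)

lemma functor_H: "is_functor (prod_cat (op_cat Nec) Nec) (Simp V) H"
proof -
  interpret Nec: category Nec by (rule category_Nec)
  have O: "Obj (op_cat Delta) = UNIV" "Obj Delta = UNIV" by (simp_all add: Delta_def)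
  have nm: "far F (nerve_map g n) \<in> hom V (fob F (code ` flag_chains n (Dom Nec g))) (fob F (code ` flag_chains n (Cod Nec g)))"
    if "g \<in> Arr Nec" for g n
    using F_Arr'[OF nerve_map_hom[of "fst g" "fst (snd g)" "snd (snd g)" n]] that by (cases g) (simp add: Nec_simps(3,4))
  have arr: "far H (f, g) \<in> hom (Simp V) (fob H (Cod Nec f, Dom Nec g)) (fob H (Dom Nec f, Cod Nec g))"
    if f: "f \<in> Arr Nec" and g: "g \<in> Arr Nec" for f g
    unfolding hom_fun_cat
  proof (intro conjI ballI)
    show "is_functor (op_cat Delta) V (fob H (Cod Nec f, Dom Nec g))" "is_functor (op_cat Delta) V (fob H (Dom Nec f, Cod Nec g))"
      using f by (auto intro: functor_H_obj)
    have c: "Nar f \<odot> far F (nerve_map g n) \<in> hom V (fob (fob H (Cod Nec f, Dom Nec g)) n) (fob (fob H (Dom Nec f, Cod Nec g)) n)" for n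
      unfolding H_obj_at by (rule TensorArr_hom[OF Nar_hom[OF f] nm[OF g]])
    then show "snd (snd (far H (f, g))) \<in> (\<Pi>\<^sub>E n \<in> Obj (op_cat Delta). hom V (fob (fob H (Cod Nec f, Dom Nec g)) n) (fob (fob H (Dom Nec f, Cod Nec g)) n))"
      unfolding O by (simp add: H_arr PiE_UNIV_domain)
    fix \<theta> assume "\<theta> \<in> Arr (op_cat Delta)"
    then have \<theta>: "\<theta> \<in> Arr Delta" by simp
    obtain T U g' where gg: "g = (T, U, g')" by (cases g)
    note n1 = is_functorD(4)[OF functor_nerve_poset[of T], of \<theta>] and n2 = is_functorD(4)[OF functor_nerve_poset[of U], of \<theta>]
    have n: "far (nerve (nec_poset T)) \<theta> \<in> hom set_cat (code ` flag_chains (Cod Delta \<theta>) T) (code ` flag_chains (Dom Delta \<theta>) T :: 'u set)"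
      "far (nerve (nec_poset U)) \<theta> \<in> hom set_cat (code ` flag_chains (Cod Delta \<theta>) U) (code ` flag_chains (Dom Delta \<theta>) U :: 'u set)"
      using n1 n2 \<theta> by (simp_all add: fob_nerve)
    note m = nerve_map_hom[OF g[unfolded gg], of "Cod Delta \<theta>"] nerve_map_hom[OF g[unfolded gg], of "Dom Delta \<theta>"]
    have "far F (far (nerve (nec_poset U)) \<theta>) \<cdot> far F (nerve_map g (Cod Delta \<theta>)) =
        far F (nerve_map g (Dom Delta \<theta>)) \<cdot> far F (far (nerve (nec_poset T)) \<theta>)"
      unfolding gg F_Comp'[OF m(1) n(2), symmetric] F_Comp'[OF n(1) m(2), symmetric] nerve_map_natural[OF g[unfolded gg] \<theta>] ..
    moreover note homD[OF F_Arr'[OF n(1)]] homD[OF F_Arr'[OF n(2)]] homD[OF F_Arr'[OF m(1)]] homD[OF F_Arr'[OF m(2)]]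
      homD[OF Nar_hom[OF f]] N_Obj[OF Nec.Dom_Obj[OF f]] N_Obj[OF Nec.Cod_Obj[OF f]]
    ultimately show "far (fob H (Dom Nec f, Cod Nec g)) \<theta> \<cdot> snd (snd (far H (f, g))) (Dom (op_cat Delta) \<theta>) =
        snd (snd (far H (f, g))) (Cod (op_cat Delta) \<theta>) \<cdot> far (fob H (Cod Nec f, Dom Nec g)) \<theta>"
      by (simp add: H_arr H_obj act_obj_def comp_functr_def interchange gg Nec_simps(3,4))
  qed (simp_all add: H_arr)
  show ?thesis
    unfolding is_functor_def
  proof (intro conjI ballI impI)
    show "category (prod_cat (op_cat Nec) Nec)" by (intro category_prod_cat category_op_cat category_Nec)
    show "category (Simp V)" by (intro category_fun_cat category_op_cat category_Delta category_axioms)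
    show "fob H x \<in> Obj (Simp V)" if "x \<in> Obj (prod_cat (op_cat Nec) Nec)" for x
      using that functor_H_obj by (cases x) (simp add: fun_cat_simps)
    show "far H x \<in> hom (Simp V) (fob H (Dom (prod_cat (op_cat Nec) Nec) x)) (fob H (Cod (prod_cat (op_cat Nec) Nec) x))"
      if "x \<in> Arr (prod_cat (op_cat Nec) Nec)" for x
      using that arr by (cases x) simp
    show "far H (Idn (prod_cat (op_cat Nec) Nec) x) = Idn (Simp V) (fob H x)" if x: "x \<in> Obj (prod_cat (op_cat Nec) Nec)" for x
    proof -
      obtain T U where TU: "x = (T, U)" by (cases x)
      have TO: "T \<in> Obj Nec" "U \<in> Obj Nec" using x TU by auto
      obtain U' q where U: "U = (U', q)" by (cases U)
      have "nerve_map (Idn Nec U) n = (Idn set_cat (code ` flag_chains n U) :: 'u set \<times> 'u set \<times> ('u \<Rightarrow> 'u))" for n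
      proof -
        have "(Idn set_cat (code ` flag_chains n U) :: 'u set \<times> 'u set \<times> ('u \<Rightarrow> 'u)) = small_map (flag_chains n U) (flag_chains n U) (push [0..<Suc q])"
        proof (rule small_map_eqI[OF infinite_universe flag_chains_finite])
          show "(Idn set_cat (code ` flag_chains n U) :: 'u set \<times> 'u set \<times> ('u \<Rightarrow> 'u)) \<in> hom set_cat (code ` flag_chains n U) (code ` flag_chains n U)"
            by (rule category.Idn_hom[OF set_category]) (simp add: set_cat_simps)
          fix c assume c: "c \<in> flag_chains n U"
          have "push [0..<Suc q] c = c" by (rule push_Idn) (use c U in \<open>auto simp: flag_chains_iff\<close>)
          then show "snd (snd (Idn set_cat (code ` flag_chains n U) :: 'u set \<times> 'u set \<times> ('u \<Rightarrow> 'u))) (code c) = code (push [0..<Suc q] c)"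
            using c by (simp add: set_cat_simps del: upt_Suc)
        qed
        then show ?thesis by (simp add: U Nec_simps(5) nerve_map_eq del: upt_Suc)
      qed
      then have "far F (nerve_map (Idn Nec U) n) = Idn V (fob F (code ` flag_chains n U))" for n
        using is_functorD(5)[OF F] by (simp add: set_cat_simps(1))
      then show ?thesis
        using TO N_Obj[OF TO(1)] Nar_Idn[OF TO(1)]
        by (simp add: TU H_arr fun_cat_simps O H_obj_at restrict_UNIV)
    qed
    show "far H (y \<cdot>\<^bsub>prod_cat (op_cat Nec) Nec\<^esub> x) = far H y \<cdot>\<^bsub>Simp V\<^esub> far H x"
      if xy: "x \<in> Arr (prod_cat (op_cat Nec) Nec)" "y \<in> Arr (prod_cat (op_cat Nec) Nec)"
        "Cod (prod_cat (op_cat Nec) Nec) x = Dom (prod_cat (op_cat Nec) Nec) y" for x y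
    proof -
      obtain f g f' g' where e: "x = (f, g)" "y = (f', g')" by (cases x; cases y)
      have A: "f \<in> Arr Nec" "g \<in> Arr Nec" "f' \<in> Arr Nec" "g' \<in> Arr Nec" "Dom Nec f = Cod Nec f'" "Cod Nec g = Dom Nec g'"
        using xy by (simp_all add: e)
      obtain T U h W k where gg: "g = (T, U, h)" "g' = (U, W, k)" using A(6) by (cases g; cases g') (auto simp: Nec_simps(3,4))
      have "nerve_map (g' \<cdot>\<^bsub>Nec\<^esub> g) n = (nerve_map g' n \<cdot>\<^bsub>set_cat\<^esub> nerve_map g n :: 'u set \<times> 'u set \<times> ('u \<Rightarrow> 'u))" for n
      proof -
        obtain T' p U' q W' r where TU: "T = (T', p)" "U = (U', q)" "W = (W', r)" by (cases T; cases U; cases W)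
        have l: "length h = Suc p" using A(2) gg TU by (cases h) (auto simp: Nec_simps hom_def Arr_Delta_f)
        have "small_map (flag_chains n U) (flag_chains n W) (push k) \<cdot>\<^bsub>set_cat\<^esub> small_map (flag_chains n T) (flag_chains n U) (push h) =
            (small_map (flag_chains n T) (flag_chains n W) (push (map ((!) k) h)) :: 'u set \<times> 'u set \<times> ('u \<Rightarrow> 'u))"
        proof (rule small_map_Comp[OF infinite_universe flag_chains_finite flag_chains_finite set_category])
          show "push h \<in> flag_chains n T \<rightarrow> flag_chains n U" "push k \<in> flag_chains n U \<rightarrow> flag_chains n W"
            using push_chain A(2,4) gg TU by blast+
          fix c assume "c \<in> flag_chains n T"
          then show "push k (push h c) = push (map ((!) k) h) c"
            by (intro push_Comp[symmetric]) (use l TU in \<open>auto simp: flag_chains_iff subset_iff less_Suc_eq_le\<close>)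
        qed
        then show ?thesis by (simp add: gg Nec_simps(6) nerve_map_eq)
      qed
      moreover have "nerve_map g n \<in> hom set_cat (code ` flag_chains n T) (code ` flag_chains n U :: 'u set)"
        "nerve_map g' n \<in> hom set_cat (code ` flag_chains n U) (code ` flag_chains n W :: 'u set)" for n
        using nerve_map_hom A(2,4) gg by blast+
      ultimately have "far F (nerve_map (g' \<cdot>\<^bsub>Nec\<^esub> g) n) = far F (nerve_map g' n) \<cdot> far F (nerve_map g n)" for n
        using F_Comp' by metis
      moreover have "Nar (f \<cdot>\<^bsub>Nec\<^esub> f') = Nar f' \<cdot> Nar f" using Nar_Comp[OF A(3,1)] A(5) by simp
      moreover note homD[OF Nar_hom[OF A(1)]] homD[OF Nar_hom[OF A(3)]] homD[OF nm[OF A(2)]] homD[OF nm[OF A(4)]]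
      ultimately show ?thesis
        using A by (simp add: e H_arr fun_cat_simps O restrict_UNIV interchange)
    qed
  qed
qed

text \<open>Coproducts in V are at hand for families that embed into the infinite type
  \<open>'u\<close>; finiteness of the joints and of the sets in a flag makes this index set
  countable, hence embeddable.\<close>

lemma countable_flanked_flags: "countable (flanked_flags n)"
proof (rule countable_subset)
  show "flanked_flags n \<subseteq> ({T. finite T} \<times> UNIV) \<times> lists {W. finite W}"
  proof
    fix x assume x: "x \<in> flanked_flags n"
    obtain T p c where e: "x = ((T, p), c)" by (cases x) auto
    have "finite T" using x e finite_subset[OF _ finite_atMost, of T p] by (auto simp: flanked_flags_iff Nec_simps)
    moreover have "c \<in> lists {W. finite W}"
      using x e flag_chains_finite[of n "(T, p)"] by (auto simp: flanked_flags_iff finite_chains_def lists_eq_set)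
    ultimately show "x \<in> ({T. finite T} \<times> UNIV) \<times> lists {W. finite W}" by (simp add: e)
  qed
  show "countable (({T :: nat set. finite T} \<times> (UNIV :: nat set)) \<times> lists {W :: nat set. finite W})"
    by (intro countable_SIGMA countable_lists countable_Collect_finite) auto
qed

section \<open>The universal cowedge at a fixed level\<close>

abbreviation E_at :: "nat \<Rightarrow> 'o" where
  "E_at n \<equiv> coprod V (flanked_flags n) (\<lambda>((T, p), c). Nnd T)"

abbreviation in_at :: "nat \<Rightarrow> necklace \<times> nat set list \<Rightarrow> 'm" where
  "in_at n \<equiv> coproj V (flanked_flags n) (\<lambda>((T, p), c). Nnd T)"

lemma E_coproduct: "is_coproduct V (flanked_flags n) (\<lambda>((T, p), c). Nnd T) (E_at n) (in_at n)"
proof (rule countable_coproduct[OF countable_flanked_flags])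
  show "(case i of (x, c) \<Rightarrow> (case x of (T, p) \<Rightarrow> \<lambda>c. Nnd T) c) \<in> Obj V" for i
    using hom_Obj(1)[OF inc_hom] by (auto split: prod.splits)
qed

lemma family_in_at: "is_family n (E_at n) (in_at n)"
  unfolding is_family_def using coproduct_Obj[OF E_coproduct] coproduct_hom[OF E_coproduct] by fastforce

text \<open>The universal cowedge at level \<open>n\<close>: on the summand of a flag \<open>c\<close> on \<open>T\<close> it is the extension of
  the coprojections along the decomposition of \<open>N T\<close>.\<close>

lemma ex_cowedge:
  assumes T: "T \<in> Obj Nec"
  shows "\<exists>h. h \<in> hom V (fob (fob H (T, T)) n) (E_at n) \<and>
    (\<forall>c \<in> flag_chains n T. h \<cdot> copow (N T) (code ` flag_chains n T) (code c) = full (E_at n) (in_at n) (T, c))"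
proof -
  let ?A = "code ` flag_chains n T :: 'u set"
  note i = inv_into_code[OF infinite_universe flag_chains_finite]
  have m: "full (E_at n) (in_at n) (T, inv_into (flag_chains n T) code x) \<in> hom V (N T) (E_at n)" if x: "x \<in> ?A" for x
  proof -
    obtain c where c: "c \<in> flag_chains n T" "x = code c" using x by blast
    have "inv_into (flag_chains n T) code x = c" using i c by (cases T) simp
    then show ?thesis using compatibleD(1)[OF compatible_full[OF family_in_at] T c(1)] by simp
  qed
  obtain h where h: "h \<in> hom V (N T \<otimes> fob F ?A) (E_at n)"
    "\<And>x. x \<in> ?A \<Longrightarrow> h \<cdot> copow (N T) ?A x = full (E_at n) (in_at n) (T, inv_into (flag_chains n T) code x)"
    using coproduct_ex[OF copow_coproduct[OF N_Obj[OF T], of ?A] coproduct_Obj[OF E_coproduct],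
      of "\<lambda>x. full (E_at n) (in_at n) (T, inv_into (flag_chains n T) code x)"] m by blast
  have "h \<cdot> copow (N T) ?A (code c) = full (E_at n) (in_at n) (T, c)" if c: "c \<in> flag_chains n T" for c
  proof -
    have "inv_into (flag_chains n T) code (code c :: 'u) = c" by (rule i[OF c])
    then show ?thesis using h(2)[of "code c"] c by simp
  qed
  then show ?thesis using h(1) unfolding H_obj_at by blast
qed

definition cow :: "nat \<Rightarrow> necklace \<Rightarrow> 'm" where
  "cow n T = (SOME h. h \<in> hom V (fob (fob H (T, T)) n) (E_at n) \<and>
    (\<forall>c \<in> flag_chains n T. h \<cdot> copow (N T) (code ` flag_chains n T) (code c) = full (E_at n) (in_at n) (T, c)))"

lemma cow:
  assumes "T \<in> Obj Nec"
  shows "cow n T \<in> hom V (fob (fob H (T, T)) n) (E_at n)"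
    "c \<in> flag_chains n T \<Longrightarrow> cow n T \<cdot> copow (N T) (code ` flag_chains n T) (code c) = full (E_at n) (in_at n) (T, c)"
  using someI_ex[OF ex_cowedge[OF assms, of n]] unfolding cow_def by blast+

text \<open>Testing the dinaturality of \<open>\<phi>\<close> at \<open>f\<close> on the copowers gives exactly the compatibility
  condition at \<open>f\<close>.\<close>

lemma cowedge_compatible:
  assumes \<phi>: "\<And>T. T \<in> Obj Nec \<Longrightarrow> \<phi> T \<in> hom V (fob (fob H (T, T)) n) x"
    and k: "\<And>T c. T \<in> Obj Nec \<Longrightarrow> c \<in> flag_chains n T \<Longrightarrow> \<phi> T \<cdot> copow (N T) (code ` flag_chains n T) (code c) = k (T, c)"
  shows "is_cowedge Nec V (eval_at H n) x \<phi> \<longleftrightarrow> x \<in> Obj V \<and> compatible n x k"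
proof -
  interpret Nec: category Nec by (rule category_Nec)
  have km: "k (T, c) \<in> hom V (N T) x" if "T \<in> Obj Nec" "c \<in> flag_chains n T" for T c
    using Comp_hom[OF copow_hom[OF N_Obj[OF that(1)], of "code c" "code ` flag_chains n T"] \<phi>[OF that(1), unfolded H_obj_at]] k[OF that] that by simp
  have dinat: "\<phi> T \<cdot> snd (snd (far H ((T, U, f), Idn Nec T))) n = \<phi> U \<cdot> snd (snd (far H (Idn Nec U, (T, U, f)))) n \<longleftrightarrow>
      (\<forall>c \<in> flag_chains n T. k (U, push f c) = k (T, c) \<cdot> Nar (T, U, f))"
    if f: "(T, U, f) \<in> Arr Nec" for T U f
  proof -
    let ?A = "code ` flag_chains n T :: 'u set" and ?B = "code ` flag_chains n U :: 'u set"
    have TU: "T \<in> Obj Nec" "U \<in> Obj Nec" using Nec.Dom_Obj[OF f] Nec.Cod_Obj[OF f] by (simp_all add: Nec_simps(3,4))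
    obtain T' p where Tp: "T = (T', p)" by (cases T)
    have Nf: "Nar (T, U, f) \<in> hom V (N U) (N T)" using Nar_hom[OF f] by (simp add: Nec_simps(3,4))
    have IT: "Idn Nec T = (T, T, [0..<Suc p])" "(T, T, [0..<Suc p]) \<in> Arr Nec"
      using Nec.Idn_Arr[OF TU(1)] by (simp_all add: Tp Nec_simps(5) del: upt_Suc)
    define l where "l = Nar (T, U, f) \<odot> far F (nerve_map (Idn Nec T) n)"
    define r where "r = Idn V (N U) \<odot> far F (nerve_map (T, U, f) n)"
    have l: "l \<in> hom V (N U \<otimes> fob F ?A) (N T \<otimes> fob F ?A)" and r: "r \<in> hom V (N U \<otimes> fob F ?A) (N U \<otimes> fob F ?B)"
      unfolding l_def r_def IT(1)
      by (rule TensorArr_hom[OF Nf F_Arr'[OF nerve_map_hom[OF IT(2)]]], rule TensorArr_hom[OF Idn_hom[OF N_Obj[OF TU(2)]] F_Arr'[OF nerve_map_hom[OF f]]])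
    have e: "snd (snd (far H ((T, U, f), Idn Nec T))) n = l" "snd (snd (far H (Idn Nec U, (T, U, f)))) n = r"
      using Nar_Idn[OF TU(2)] by (simp_all add: H_arr l_def r_def)
    note pT = \<phi>[OF TU(1), unfolded H_obj_at] and pU = \<phi>[OF TU(2), unfolded H_obj_at]
    have cl: "(\<phi> T \<cdot> l) \<cdot> copow (N U) ?A (code c) = k (T, c) \<cdot> Nar (T, U, f)"
      and cr: "(\<phi> U \<cdot> r) \<cdot> copow (N U) ?A (code c) = k (U, push f c)" if c: "c \<in> flag_chains n T" for c
    proof -
      have cA: "code c \<in> ?A" using c by simp
      note cu = copow_hom[OF N_Obj[OF TU(2)] cA] and ct = copow_hom[OF N_Obj[OF TU(1)] cA]
      have "push [0..<Suc p] c = c" by (rule push_Idn) (use c Tp in \<open>auto simp: flag_chains_iff\<close>)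
      then have "l \<cdot> copow (N U) ?A (code c) = copow (N T) ?A (code c) \<cdot> Nar (T, U, f)"
        using copow_nerve_map[OF Nf IT(2) c] by (simp add: l_def IT(1) del: upt_Suc)
      then have "(\<phi> T \<cdot> l) \<cdot> copow (N U) ?A (code c) = (\<phi> T \<cdot> copow (N T) ?A (code c)) \<cdot> Nar (T, U, f)"
        unfolding Comp_assoc[OF cu l pT] Comp_assoc[OF Nf ct pT] by simp
      then show "(\<phi> T \<cdot> l) \<cdot> copow (N U) ?A (code c) = k (T, c) \<cdot> Nar (T, U, f)" unfolding k[OF TU(1) c] .
      have pc: "push f c \<in> flag_chains n U" using push_chain[of T' p "fst U" "snd U" f c n] f c Tp by simp
      have "code (push f c) \<in> ?B" using pc by simp
      note cv = copow_hom[OF N_Obj[OF TU(2)] this]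
      have "r \<cdot> copow (N U) ?A (code c) = copow (N U) ?B (code (push f c))"
        using copow_nerve_map[OF Idn_hom[OF N_Obj[OF TU(2)]] f c] homD[OF cv] by (simp add: r_def)
      then show "(\<phi> U \<cdot> r) \<cdot> copow (N U) ?A (code c) = k (U, push f c)"
        unfolding Comp_assoc[OF cu r pU] using k[OF TU(2) pc] by simp
    qed
    have "\<phi> T \<cdot> l = \<phi> U \<cdot> r \<longleftrightarrow> (\<forall>c \<in> flag_chains n T. k (U, push f c) = k (T, c) \<cdot> Nar (T, U, f))"
    proof
      assume "\<phi> T \<cdot> l = \<phi> U \<cdot> r"
      then show "\<forall>c \<in> flag_chains n T. k (U, push f c) = k (T, c) \<cdot> Nar (T, U, f)" using cl cr by metis
    next
      assume eq: "\<forall>c \<in> flag_chains n T. k (U, push f c) = k (T, c) \<cdot> Nar (T, U, f)"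
      show "\<phi> T \<cdot> l = \<phi> U \<cdot> r"
        by (rule coproduct_eqI[OF copow_coproduct[OF N_Obj[OF TU(2)], of ?A] Comp_hom[OF l pT] Comp_hom[OF r pU]])
          (use eq cl cr in auto)
    qed
    then show ?thesis unfolding e .
  qed
  have "(\<forall>f \<in> Arr Nec. \<phi> (Dom Nec f) \<cdot> snd (snd (far H (f, Idn Nec (Dom Nec f)))) n =
      \<phi> (Cod Nec f) \<cdot> snd (snd (far H (Idn Nec (Cod Nec f), f))) n) \<longleftrightarrow>
    (\<forall>T U f. (T, U, f) \<in> Arr Nec \<longrightarrow> (\<forall>c \<in> flag_chains n T. k (U, push f c) = k (T, c) \<cdot> Nar (T, U, f)))"
    using dinat by (simp add: split_paired_Ball_Sigma Ball_def split_paired_All Nec_simps(3,4))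
  then show ?thesis unfolding is_cowedge_def compatible_def eval_at_simps using \<phi> km by blast
qed

lemma cow_cowedge: "is_cowedge Nec V (eval_at H n) (E_at n) (cow n)"
  using cowedge_compatible[of "cow n" n "E_at n" "full (E_at n) (in_at n)"] cow
    compatible_full[OF family_in_at] coproduct_Obj[OF E_coproduct] by blast

text \<open>By \<open>cowedge_compatible\<close> the cowedge is a compatible family
  \<open>k\<close>, and composing \<open>h\<close> with \<open>cow\<close> amounts to composing it
  with \<open>full\<close>. By \<open>compatible_eqI\<close> the two families agree as soon as they
  do so on the nondegenerate parts of flanked flags. So factoring through \<open>cow\<close> means
  having prescribed components on the coproduct, which exactly one arrow has.\<close>

lemma cow_universal:
  assumes \<phi>: "is_cowedge Nec V (eval_at H n) x \<phi>"
  shows "\<exists>!h. h \<in> hom V (E_at n) x \<and> (\<forall>T \<in> Obj Nec. h \<cdot> cow n T = \<phi> T)"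
proof -
  define k where "k = (\<lambda>(T, c). \<phi> T \<cdot> copow (N T) (code ` flag_chains n T) (code c))"
  have p: "\<phi> T \<in> hom V (fob (fob H (T, T)) n) x" if "T \<in> Obj Nec" for T using is_cowedgeD(2)[OF \<phi> that] unfolding eval_at_simps .
  have x: "x \<in> Obj V" by (rule is_cowedgeD(1)[OF \<phi>])
  have k: "compatible n x k"
    using cowedge_compatible[of \<phi> n x k] p \<phi> by (simp add: k_def)
  note full = compatible_full[OF family_in_at[of n]]
  have post: "compatible n x (\<lambda>y. h \<cdot> full (E_at n) (in_at n) y)" if h: "h \<in> hom V (E_at n) x" for h
    unfolding compatible_def
  proof (intro conjI ballI allI impI)
    show "h \<cdot> full (E_at n) (in_at n) (T, c) \<in> hom V (N T) x" if "T \<in> Obj Nec" "c \<in> flag_chains n T" for T c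
      by (rule Comp_hom[OF compatibleD(1)[OF full that] h])
    fix T U f c assume f: "(T, U, f) \<in> Arr Nec" and c: "c \<in> flag_chains n T"
    have T: "T \<in> Obj Nec" using category.Dom_Obj[OF category_Nec f] by (simp add: Nec_simps(3))
    have "Nar (T, U, f) \<in> hom V (N U) (N T)" using Nar_hom[OF f] by (simp add: Nec_simps(3,4))
    from Comp_assoc[OF this compatibleD(1)[OF full T c] h]
    show "h \<cdot> full (E_at n) (in_at n) (U, push f c) = (h \<cdot> full (E_at n) (in_at n) (T, c)) \<cdot> Nar (T, U, f)"
      unfolding compatibleD(2)[OF full f c] ..
  qed
  have factor: "(\<forall>T \<in> Obj Nec. h \<cdot> cow n T = \<phi> T) \<longleftrightarrow>
      (\<forall>i \<in> flanked_flags n. h \<cdot> in_at n i = (\<lambda>((T, p), c). k ((T, p), c) \<cdot> inc T) i)"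
    if h: "h \<in> hom V (E_at n) x" for h
  proof -
    have fl: "(h \<cdot> full (E_at n) (in_at n) ((T, p), c)) \<cdot> inc T = h \<cdot> in_at n ((T, p), c)" if c: "((T, p), c) \<in> flanked_flags n" for T p c
    proof -
      have "full (E_at n) (in_at n) ((T, p), c) \<in> hom V (N (T, p)) (E_at n)"
        using c compatibleD(1)[OF full] by (auto simp: flanked_flags_iff)
      from Comp_assoc[OF inc_hom this h] show ?thesis unfolding full_inc[OF family_in_at c] .
    qed
    have cp: "(h \<cdot> cow n T) \<cdot> copow (N T) (code ` flag_chains n T) (code c) = h \<cdot> full (E_at n) (in_at n) (T, c)"
      if T: "T \<in> Obj Nec" and c: "c \<in> flag_chains n T" for T c
      using Comp_assoc[OF copow_hom[OF N_Obj[OF T], of "code c" "code ` flag_chains n T"] cow(1)[OF T, of n, unfolded H_obj_at] h] c cow(2)[OF T c] by simp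
    show ?thesis
    proof
      assume eq: "\<forall>T \<in> Obj Nec. h \<cdot> cow n T = \<phi> T"
      show "\<forall>i \<in> flanked_flags n. h \<cdot> in_at n i = (\<lambda>((T, p), c). k ((T, p), c) \<cdot> inc T) i"
      proof
        fix i assume i: "i \<in> flanked_flags n"
        obtain T p c where e: "i = ((T, p), c)" by (cases i) auto
        have T: "(T, p) \<in> Obj Nec" "c \<in> flag_chains n (T, p)" using i e by (auto simp: flanked_flags_iff)
        have "k ((T, p), c) = h \<cdot> full (E_at n) (in_at n) ((T, p), c)"
          using cp[OF T] eq T(1) by (simp add: k_def)
        then show "h \<cdot> in_at n i = (\<lambda>((T, p), c). k ((T, p), c) \<cdot> inc T) i" using fl i by (simp add: e)
      qed
    next
      assume eq: "\<forall>i \<in> flanked_flags n. h \<cdot> in_at n i = (\<lambda>((T, p), c). k ((T, p), c) \<cdot> inc T) i"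
      have fk: "h \<cdot> full (E_at n) (in_at n) (T, c) = k (T, c)" if "T \<in> Obj Nec" "c \<in> flag_chains n T" for T c
      proof (rule compatible_eqI[OF post[OF h] k _ that])
        fix T p c assume "((T, p), c) \<in> flanked_flags n"
        then show "(h \<cdot> full (E_at n) (in_at n) ((T, p), c)) \<cdot> inc T = k ((T, p), c) \<cdot> inc T" using fl eq by fastforce
      qed
      show "\<forall>T \<in> Obj Nec. h \<cdot> cow n T = \<phi> T"
      proof
        fix T assume T: "T \<in> Obj Nec"
        show "h \<cdot> cow n T = \<phi> T"
          by (rule coproduct_eqI[OF copow_coproduct[OF N_Obj[OF T], of "code ` flag_chains n T"] Comp_hom[OF cow(1)[OF T, of n, unfolded H_obj_at] h] p[OF T, unfolded H_obj_at]])
            (use cp[OF T] fk[OF T] in \<open>auto simp: k_def\<close>)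
      qed
    qed
  qed
  have "\<forall>i \<in> flanked_flags n. (\<lambda>((T, p), c). k ((T, p), c) \<cdot> inc T) i \<in> hom V ((\<lambda>((T, p), c). Nnd T) i) x"
    using Comp_hom[OF inc_hom compatibleD(1)[OF k]] by (auto simp: flanked_flags_iff)
  note u = coproduct_ex1[OF E_coproduct x this]
  have "h \<in> hom V (E_at n) x \<and> (\<forall>T \<in> Obj Nec. h \<cdot> cow n T = \<phi> T) \<longleftrightarrow> h \<in> hom V (E_at n) x \<and>
      (\<forall>i \<in> flanked_flags n. h \<cdot> in_at n i = (\<lambda>((T, p), c). k ((T, p), c) \<cdot> inc T) i)" for h
    using factor by blast
  then show ?thesis using u by (simp only:)
qed

lemma categorification_level:
  "isomorphic V (fob (categorification_hom V S F X a b) n) (coprod V (flanked_flags n) (\<lambda>((T, p), Ts). nec_prod Q Xnd T (a, b)))"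
proof -
  have D: "category (op_cat Delta)" by (intro category_op_cat category_Delta)
  have "\<exists>c \<tau>. is_coend Nec (Simp V) H c \<tau> \<and> (\<forall>n. fob c n = E_at n)"
    by (rule pointwise_coend[where \<kappa> = cow, OF functor_H category_Nec D category_axioms])
      (rule cow_cowedge, rule cow_universal)
  then obtain c \<tau> where c: "is_coend Nec (Simp V) H c \<tau>" "fob c n = E_at n" by blast
  have "n \<in> Obj (op_cat Delta)" by (simp add: Delta_def)
  from coend_isomorphic_pointwise[OF c(1) D category_axioms this]
  show ?thesis unfolding c(2) categorification_hom_def Nnd_def .
qed

end

theorem proposition4p17:
  fixes V :: "('o, 'm, 'z) sym_mon_cat_scheme"
    and F :: "('u set, 'u set \<times> 'u set \<times> ('u \<Rightarrow> 'u), 'o, 'm) functr"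
    and S :: "'u set"
    and X :: "('u, 'o, 'm) templicial"
    and Xnd :: "nat \<Rightarrow> ('u, 'o) quiver"
    and n :: nat
    and a b :: 'u
  assumes "infinite (UNIV :: 'u set)"
    and "symmetric_monoidal_closed_category V"
    and "complete_cat TYPE('u) V"
    and "cocomplete TYPE('u) V"
    and "is_functor set_cat V F"
    and "preserves_colimits TYPE('u) set_cat V F"
    and "\<And>x. isomorphic V (fob F {x}) (Unit V)"
    and "is_templicial V S X"
    and "is_nondeg_choice V S X Xnd"
    and "a \<in> S" and "b \<in> S"
  shows "isomorphic V (fob (categorification_hom V S F X a b) n)
    (coprod V (flanked_flags n) (\<lambda>((T, p), Ts). nec_prod (Quiv V S) Xnd T (a, b)))"
proof -
  interpret V: symmetric_monoidal_closed_category V by fact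
  \<comment> \<open>The monoidal structure on quivers is part of what it means for X to be
    templicial.\<close>
  interpret Q: monoidal_category "Quiv V S"
    using \<open>is_templicial V S X\<close> by (simp add: is_templicial_def colax_monoidal_def)
  interpret categorification V S X Xnd F a b
    by unfold_locales (use assms in auto)
  show ?thesis by (rule categorification_level)
qed

end
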